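(* Let $\Omega\subset\mathbb{R}^d$, $d\in\{2,3\}$, be a bounded domain of class $C^{1,1}$ and let $T>0$. Let $A\in C^{1,1}(\mathbb{R}^d)$ be real-valued, positive on $\mathbb{R}^d\setminus\{\mathbf 0\}$ and positively two-homogeneous, i.e. $A(\lambda\mathbf p)=\lambda^2A(\mathbf p)$ for all $\lambda>0$, $\mathbf p\in\mathbb{R}^d$, and assume that the gradient $A':\mathbb{R}^d\to\mathbb{R}^d$ is strongly monotone, i.e. there is $a_0>0$ with $(A'(\mathbf p)-A'(\mathbf q))\cdot(\mathbf p-\mathbf q)\ge a_0|\mathbf p-\mathbf q|^2$ for all $\mathbf p,\mathbf q\in\mathbb{R}^d$. Let $M:\mathbb{R}^d\times\mathbb{R}\to\mathbb{R}$ be continuous with $0<M_0\le M(\mathbf p,s)\le M_1$ for all $\mathbf p\in\mathbb{R}^d$, $s\in\mathbb{R}$, where $M_0,M_1$ are constants. Let $\varphi_0\in H^1(\Omega)$, and let $F$ be either (a) a regular potential satisfying the growth condition (G) described in the context, or (b) the logarithmic potential (see context), in which case it is additionally assumed that $|\varphi_0|\le1$ a.e. in $\Omega$ and $|\langle\varphi_0\rangle_\Omega|<1$. Let $(\varphi,\mu)$ be a corresponding weak solution (in the sense defined in the context) of the anisotropic Cahn--Hilliard equation with potential $F$ and initial datum $\varphi_0$. Then $$\varphi\in L^2(0,T;H^2(\Omega)),\qquad A'(\nabla\varphi(t))\in H^1(\Omega)\ \text{ for almost all } t\in[0,T],$$ and $$\mu=-\nabla\cdot A'(\nabla\varphi)+F'(\varphi)\quad\text{a.e.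 in }\Omega_T .$$
   Context: Notation: $\Omega_T=(0,T)\times\Omega$; $\langle f\rangle_\Omega=\frac1{|\Omega|}\int_\Omega f\,\mathrm d\mathbf x$ is the spatial mean; $H^1(\Omega)'$ is the dual of $H^1(\Omega)$ with duality pairing $\langle\cdot,\cdot\rangle_{H^1(\Omega)}$. $A\in C^{1,1}(\mathbb{R}^d)$ means that $A$ is continuously differentiable with Lipschitz continuous gradient $A'$. For vector-valued functions, membership in $H^1(\Omega)$ is meant componentwise. Equation: with interface parameter equal to $1$, the anisotropic Cahn--Hilliard equation is $\partial_t\varphi=\nabla\cdot(M(\nabla\varphi,\varphi)\nabla\mu)$ and $\mu=-\nabla\cdot A'(\nabla\varphi)+F'(\varphi)$ in $\Omega_T$, with $A'(\nabla\varphi)\cdot\mathbf n=0$ and $\nabla\mu\cdot\mathbf n=0$ on $(0,T)\times\partial\Omega$ and $\varphi|_{t=0}=\varphi_0$ in $\Omega$, where $\mathbf n$ is the outer unit normal on $\partial\Omega$. Growth condition (G): $F:\mathbb{R}\to\mathbb{R}$ is continuously differentiable and there are an exponent $p\in[2,6)$ and constants $B_F,C_F,C_{F'}\ge0$ with $-B_F\le F(s)\le C_F(1+|s|^p)$ and $|F'(s)|\le C_{F'}(1+|s|^{p-1})$ for all $s\in\mathbb{R}$. Logarithmic potential: for constants $\theta>0$ and $\theta_c>0$, $F(s)=\frac\theta2[(1+s)\ln(1+s)+(1-s)\ln(1-s)]+\frac{\theta_c}2(1-s^2)$ for $s\in(-1,1)$, extended continuously to $[-1,1]$; $F'$ is defined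 on $(-1,1)$ only. Energy: $E(\varphi)=\int_\Omega A(\nabla\varphi)+F(\varphi)\,\mathrm d\mathbf x$. Weak solution: a pair $(\varphi,\mu)$ such that (i) $\varphi\in C([0,T];L^2(\Omega))\cap L^\infty(0,T;H^1(\Omega))\cap H^1(0,T;H^1(\Omega)')$, $\mu\in L^2(0,T;H^1(\Omega))$, $F'(\varphi)\in L^2(0,T;L^2(\Omega))$, and, in the case of the logarithmic potential, $|\varphi|<1$ a.e. in $\Omega_T$; (ii) for almost every $t\in[0,T]$ and all $\zeta,\eta\in H^1(\Omega)$: $\langle\partial_t\varphi,\zeta\rangle_{H^1(\Omega)}=-\int_\Omega M(\nabla\varphi,\varphi)\nabla\mu\cdot\nabla\zeta\,\mathrm d\mathbf x$ and $\int_\Omega\mu\eta\,\mathrm d\mathbf x=\int_\Omega A'(\nabla\varphi)\cdot\nabla\eta+F'(\varphi)\eta\,\mathrm d\mathbf x$; and $\varphi(0)=\varphi_0$ a.e. in $\Omega$; (iii) $E(\varphi(t))+\frac12\int_0^t\int_\Omega M(\nabla\varphi,\varphi)|\nabla\mu|^2\,\mathrm d\mathbf x\,\mathrm ds\le E(\varphi_0)$ for almost all $t\in[0,T]$ in the case of a regular potential, and for all $t\in[0,T]$ in the case of the logarithmic potential. *)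

theory Defs
  imports "HOL-Analysis.Analysis"
begin

section \<open>Functions of class $C^{1,1}$ and domains of class $C^{1,1}$\<close>

definition gradient :: "('a::euclidean_space \<Rightarrow> real) \<Rightarrow> 'a \<Rightarrow> 'a"
  where "gradient f x = (THE D. GDERIV f x :> D)"

definition C11 :: "('a::euclidean_space \<Rightarrow> real) \<Rightarrow> bool"
  where "C11 f \<longleftrightarrow> (\<forall>x. f differentiable (at x)) \<and> (\<exists>L. L-lipschitz_on UNIV (gradient f))"

text \<open>
  Near each boundary point the domain lies strictly above the graph of a \<open>C\<^sup>1\<^sup>,\<^sup>1\<close> function, with
  respect to a suitable unit vector \<open>e\<close> as the vertical direction; \<open>x - (x \<bullet> e) *\<^sub>R e\<close> is the
  projection of \<open>x\<close> to the hyperplane orthogonal to \<open>e\<close>, so only the values of \<open>\<gamma>\<close> on that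
  hyperplane matter.
\<close>
definition C11_boundary :: "'a::euclidean_space set \<Rightarrow> bool"
  where "C11_boundary \<Omega> \<longleftrightarrow>
    (\<forall>x0 \<in> frontier \<Omega>. \<exists>r>0. \<exists>e \<gamma>. norm e = 1 \<and> C11 \<gamma> \<and>
       \<Omega> \<inter> ball x0 r = {x \<in> ball x0 r. x \<bullet> e > \<gamma> (x - (x \<bullet> e) *\<^sub>R e)})"

definition bounded_C11_domain :: "'a::euclidean_space set \<Rightarrow> bool"
  where "bounded_C11_domain \<Omega> \<longleftrightarrow>
    open \<Omega> \<and> connected \<Omega> \<and> \<Omega> \<noteq> {} \<and> bounded \<Omega> \<and> C11_boundary \<Omega>"


section \<open>Sobolev spaces\<close>

text \<open>
  Elements of the spaces below are represented by functions on the whole type of which only the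
  values on \<open>\<Omega>\<close>, up to null sets, matter.
\<close>

primrec Ck :: "nat \<Rightarrow> ('a::euclidean_space \<Rightarrow> real) \<Rightarrow> bool"
  where
    "Ck 0 f \<longleftrightarrow> continuous_on UNIV f"
  | "Ck (Suc k) f \<longleftrightarrow>
       (\<forall>x. f differentiable (at x)) \<and> (\<forall>i\<in>Basis. Ck k (\<lambda>x. frechet_derivative f (at x) i))"

definition test_functions :: "'a::euclidean_space set \<Rightarrow> ('a \<Rightarrow> real) set"
  where "test_functions \<Omega> =
    {\<psi>. (\<forall>k. Ck k \<psi>) \<and> compact (closure {x. \<psi> x \<noteq> 0}) \<and> closure {x. \<psi> x \<noteq> 0} \<subseteq> \<Omega>}"

definition locally_integrable :: "'a::euclidean_space set \<Rightarrow> ('a \<Rightarrow> real) \<Rightarrow> bool"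
  where "locally_integrable \<Omega> u \<longleftrightarrow> (\<forall>K. compact K \<and> K \<subseteq> \<Omega> \<longrightarrow> integrable (lebesgue_on K) u)"

definition has_weak_gradient ::
    "'a::euclidean_space set \<Rightarrow> ('a \<Rightarrow> real) \<Rightarrow> ('a \<Rightarrow> 'a) \<Rightarrow> bool"
  where "has_weak_gradient \<Omega> u g \<longleftrightarrow>
    locally_integrable \<Omega> u \<and>
    (\<forall>i\<in>Basis. locally_integrable \<Omega> (\<lambda>x. g x \<bullet> i) \<and>
      (\<forall>\<psi> \<in> test_functions \<Omega>.
         (\<integral>x. u x * frechet_derivative \<psi> (at x) i \<partial>lebesgue_on \<Omega>)
           = - (\<integral>x. (g x \<bullet> i) * \<psi> x \<partial>lebesgue_on \<Omega>)))"

text \<open>The weak gradient is unique up to null sets; one representative is chosen.\<close>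
definition weak_grad :: "'a::euclidean_space set \<Rightarrow> ('a \<Rightarrow> real) \<Rightarrow> 'a \<Rightarrow> 'a"
  where "weak_grad \<Omega> u = (SOME g. has_weak_gradient \<Omega> u g)"

definition weak_div :: "'a::euclidean_space set \<Rightarrow> ('a \<Rightarrow> 'a) \<Rightarrow> 'a \<Rightarrow> real"
  where "weak_div \<Omega> v x = (\<Sum>i\<in>Basis. weak_grad \<Omega> (\<lambda>y. v y \<bullet> i) x \<bullet> i)"

definition L2_space :: "'a::euclidean_space set \<Rightarrow> ('a \<Rightarrow> real) set"
  where "L2_space \<Omega> =
    {u. u \<in> borel_measurable (lebesgue_on \<Omega>) \<and> integrable (lebesgue_on \<Omega>) (\<lambda>x. (u x)\<^sup>2)}"

definition norm_L2 :: "'a::euclidean_space set \<Rightarrow> ('a \<Rightarrow> real) \<Rightarrow> real"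
  where "norm_L2 \<Omega> u = sqrt (\<integral>x. (u x)\<^sup>2 \<partial>lebesgue_on \<Omega>)"

definition H1_space :: "'a::euclidean_space set \<Rightarrow> ('a \<Rightarrow> real) set"
  where "H1_space \<Omega> =
    {u \<in> L2_space \<Omega>. \<exists>g. has_weak_gradient \<Omega> u g \<and> (\<forall>i\<in>Basis. (\<lambda>x. g x \<bullet> i) \<in> L2_space \<Omega>)}"

definition norm_H1 :: "'a::euclidean_space set \<Rightarrow> ('a \<Rightarrow> real) \<Rightarrow> real"
  where "norm_H1 \<Omega> u =
    sqrt ((norm_L2 \<Omega> u)\<^sup>2 + (\<Sum>i\<in>Basis. (norm_L2 \<Omega> (\<lambda>x. weak_grad \<Omega> u x \<bullet> i))\<^sup>2))"

definition H2_space :: "'a::euclidean_space set \<Rightarrow> ('a \<Rightarrow> real) set"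
  where "H2_space \<Omega> =
    {u \<in> H1_space \<Omega>. \<forall>i\<in>Basis. (\<lambda>x. weak_grad \<Omega> u x \<bullet> i) \<in> H1_space \<Omega>}"

definition norm_H2 :: "'a::euclidean_space set \<Rightarrow> ('a \<Rightarrow> real) \<Rightarrow> real"
  where "norm_H2 \<Omega> u =
    sqrt ((norm_L2 \<Omega> u)\<^sup>2 + (\<Sum>i\<in>Basis. (norm_H1 \<Omega> (\<lambda>x. weak_grad \<Omega> u x \<bullet> i))\<^sup>2))"

text \<open>
  Functionals are total functions, of which only the values on \<open>H\<^sup>1\<close> matter. Boundedness forces
  them to agree on functions that are equal almost everywhere.
\<close>
definition H1_dual :: "'a::euclidean_space set \<Rightarrow> (('a \<Rightarrow> real) \<Rightarrow> real) set"
  where "H1_dual \<Omega> =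
    {l. (\<forall>u\<in>H1_space \<Omega>. \<forall>v\<in>H1_space \<Omega>. l (\<lambda>x. u x + v x) = l u + l v) \<and>
        (\<forall>c. \<forall>u\<in>H1_space \<Omega>. l (\<lambda>x. c * u x) = c * l u) \<and>
        (\<exists>C. \<forall>u\<in>H1_space \<Omega>. \<bar>l u\<bar> \<le> C * norm_H1 \<Omega> u)}"

definition norm_H1_dual :: "'a::euclidean_space set \<Rightarrow> (('a \<Rightarrow> real) \<Rightarrow> real) \<Rightarrow> real"
  where "norm_H1_dual \<Omega> l = (SUP u \<in> {u \<in> H1_space \<Omega>. norm_H1 \<Omega> u \<le> 1}. \<bar>l u\<bar>)"

definition mean :: "'a::euclidean_space set \<Rightarrow> ('a \<Rightarrow> real) \<Rightarrow> real"
  where "mean \<Omega> f = (\<integral>x. f x \<partial>lebesgue_on \<Omega>) / measure lebesgue \<Omega>"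


section \<open>Spaces of time-dependent functions\<close>

text \<open>
  Bochner spaces with values in a space \<open>X\<close> of representatives with norm \<open>N\<close>. Subtraction is the
  pointwise subtraction of functions.
\<close>
definition strongly_measurable_on ::
    "real set \<Rightarrow> 'v::minus set \<Rightarrow> ('v \<Rightarrow> real) \<Rightarrow> (real \<Rightarrow> 'v) \<Rightarrow> bool"
  where "strongly_measurable_on I X N u \<longleftrightarrow>
    (AE t in lebesgue_on I. u t \<in> X) \<and>
    (\<exists>s :: nat \<Rightarrow> real \<Rightarrow> 'v.
       (\<forall>n. finite (s n ` I) \<and> s n ` I \<subseteq> X \<and>
            (\<forall>v. {t \<in> I. s n t = v} \<in> sets lebesgue)) \<and>
       (AE t in lebesgue_on I. (\<lambda>n. N (u t - s n t)) \<longlonglongrightarrow> 0))"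

definition L2_bochner ::
    "real set \<Rightarrow> 'v::minus set \<Rightarrow> ('v \<Rightarrow> real) \<Rightarrow> (real \<Rightarrow> 'v) set"
  where "L2_bochner I X N =
    {u. strongly_measurable_on I X N u \<and> integrable (lebesgue_on I) (\<lambda>t. (N (u t))\<^sup>2)}"

definition Linf_bochner ::
    "real set \<Rightarrow> 'v::minus set \<Rightarrow> ('v \<Rightarrow> real) \<Rightarrow> (real \<Rightarrow> 'v) set"
  where "Linf_bochner I X N =
    {u. strongly_measurable_on I X N u \<and> (\<exists>C. AE t in lebesgue_on I. N (u t) \<le> C)}"

definition C_bochner ::
    "real set \<Rightarrow> 'v::minus set \<Rightarrow> ('v \<Rightarrow> real) \<Rightarrow> (real \<Rightarrow> 'v) set"
  where "C_bochner I X N =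
    {u. \<forall>t\<in>I. u t \<in> X \<and> ((\<lambda>s. N (u s - u t)) \<longlongrightarrow> 0) (at t within I)}"

abbreviation L2_L2 where "L2_L2 T \<Omega> \<equiv> L2_bochner {0<..<T} (L2_space \<Omega>) (norm_L2 \<Omega>)"
abbreviation L2_H1 where "L2_H1 T \<Omega> \<equiv> L2_bochner {0<..<T} (H1_space \<Omega>) (norm_H1 \<Omega>)"
abbreviation L2_H2 where "L2_H2 T \<Omega> \<equiv> L2_bochner {0<..<T} (H2_space \<Omega>) (norm_H2 \<Omega>)"
abbreviation L2_H1_dual where "L2_H1_dual T \<Omega> \<equiv> L2_bochner {0<..<T} (H1_dual \<Omega>) (norm_H1_dual \<Omega>)"
abbreviation Linf_H1 where "Linf_H1 T \<Omega> \<equiv> Linf_bochner {0<..<T} (H1_space \<Omega>) (norm_H1 \<Omega>)"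
abbreviation C_L2 where "C_L2 T \<Omega> \<equiv> C_bochner {0..T} (L2_space \<Omega>) (norm_L2 \<Omega>)"

definition L2_embed :: "'a::euclidean_space set \<Rightarrow> ('a \<Rightarrow> real) \<Rightarrow> ('a \<Rightarrow> real) \<Rightarrow> real"
  where "L2_embed \<Omega> u \<zeta> = (\<integral>x. u x * \<zeta> x \<partial>lebesgue_on \<Omega>)"

text \<open>
  \<open>\<phi> \<in> H\<^sup>1(0,T;H\<^sup>1(\<Omega>)')\<close> with weak time derivative \<open>w\<close>. The identity between the two Bochner
  integrals in the dual space is stated after evaluation at an arbitrary \<open>\<zeta> \<in> H\<^sup>1(\<Omega>)\<close>.
\<close>
definition H1_H1_dual_with_derivative ::
    "real \<Rightarrow> 'a::euclidean_space set \<Rightarrow> (real \<Rightarrow> 'a \<Rightarrow> real) \<Rightarrow> (real \<Rightarrow> ('a \<Rightarrow> real) \<Rightarrow> real) \<Rightarrow> bool"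
  where "H1_H1_dual_with_derivative T \<Omega> \<phi> w \<longleftrightarrow>
    (\<lambda>t. L2_embed \<Omega> (\<phi> t)) \<in> L2_H1_dual T \<Omega> \<and> w \<in> L2_H1_dual T \<Omega> \<and>
    (\<forall>\<psi> \<in> test_functions {0<..<T}. \<forall>\<zeta> \<in> H1_space \<Omega>.
       (\<integral>t. deriv \<psi> t * L2_embed \<Omega> (\<phi> t) \<zeta> \<partial>lebesgue_on {0<..<T})
         = - (\<integral>t. \<psi> t * w t \<zeta> \<partial>lebesgue_on {0<..<T}))"

abbreviation space_time :: "real \<Rightarrow> 'a::euclidean_space set \<Rightarrow> (real \<times> 'a) set"
  where "space_time T \<Omega> \<equiv> {0<..<T} \<times> \<Omega>"

definition space_time_measurable :: "real \<Rightarrow> 'a::euclidean_space set \<Rightarrow> (real \<Rightarrow> 'a \<Rightarrow> real) \<Rightarrow> bool"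
  where "space_time_measurable T \<Omega> f \<longleftrightarrow>
    (\<lambda>(t, x). f t x) \<in> borel_measurable (lebesgue_on (space_time T \<Omega>))"

text \<open>
  A family \<open>f\<close> whose members \<open>f t\<close> are defined for each time separately up to null sets (such as
  spatial weak derivatives) need not be measurable in \<open>(t, x)\<close>. A space-time representative is
  a measurable function on \<open>(0,T) \<times> \<Omega>\<close> with the same slices.
\<close>
definition space_time_representative ::
    "real \<Rightarrow> 'a::euclidean_space set \<Rightarrow> (real \<Rightarrow> 'a \<Rightarrow> real) \<Rightarrow> (real \<Rightarrow> 'a \<Rightarrow> real) \<Rightarrow> bool"
  where "space_time_representative T \<Omega> f g \<longleftrightarrow>
    space_time_measurable T \<Omega> g \<and>
    (AE t in lebesgue_on {0<..<T}. AE x in lebesgue_on \<Omega>. g t x = f t x)"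


section \<open>Potentials\<close>

datatype potential_kind = Regular | Logarithmic

definition regular_potential :: "(real \<Rightarrow> real) \<Rightarrow> bool"
  where "regular_potential F \<longleftrightarrow>
    (\<forall>s. F field_differentiable (at s)) \<and> continuous_on UNIV (deriv F) \<and>
    (\<exists>p BF CF CF'. 2 \<le> p \<and> p < 6 \<and> 0 \<le> BF \<and> 0 \<le> CF \<and> 0 \<le> CF' \<and>
       (\<forall>s. - BF \<le> F s \<and> F s \<le> CF * (1 + \<bar>s\<bar> powr p) \<and>
            \<bar>deriv F s\<bar> \<le> CF' * (1 + \<bar>s\<bar> powr (p - 1))))"

text \<open>
  At \<open>s = 1\<close> and \<open>s = -1\<close> the formula yields the continuous extension, as \<open>0 * ln 0 = 0\<close>. The
  values for \<open>\<bar>s\<bar> > 1\<close> have no meaning; they are never used, as the phase field takes its values in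
  \<open>[-1, 1]\<close>. Likewise \<open>deriv (log_potential \<theta> \<theta>c)\<close> is only meaningful on \<open>(-1, 1)\<close>.
\<close>
definition log_potential :: "real \<Rightarrow> real \<Rightarrow> real \<Rightarrow> real"
  where "log_potential \<theta> \<theta>c s =
    \<theta> / 2 * ((1 + s) * ln (1 + s) + (1 - s) * ln (1 - s)) + \<theta>c / 2 * (1 - s\<^sup>2)"


section \<open>Weak solutions of the anisotropic Cahn--Hilliard equation\<close>

definition energy ::
    "'a::euclidean_space set \<Rightarrow> ('a \<Rightarrow> real) \<Rightarrow> (real \<Rightarrow> real) \<Rightarrow> ('a \<Rightarrow> real) \<Rightarrow> real"
  where "energy \<Omega> A F u = (\<integral>x. A (weak_grad \<Omega> u x) + F (u x) \<partial>lebesgue_on \<Omega>)"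

definition energy_inequality ::
    "'a::euclidean_space set \<Rightarrow> ('a \<Rightarrow> real) \<Rightarrow> ('a \<Rightarrow> real \<Rightarrow> real) \<Rightarrow> (real \<Rightarrow> real) \<Rightarrow> ('a \<Rightarrow> real) \<Rightarrow>
     (real \<Rightarrow> 'a \<Rightarrow> real) \<Rightarrow> (real \<Rightarrow> 'a \<Rightarrow> real) \<Rightarrow> real \<Rightarrow> bool"
  where "energy_inequality \<Omega> A M F \<phi>0 \<phi> \<mu> t \<longleftrightarrow>
    energy \<Omega> A F (\<phi> t)
      + 1 / 2 * (\<integral>s. (\<integral>x. M (weak_grad \<Omega> (\<phi> s) x) (\<phi> s x) * (norm (weak_grad \<Omega> (\<mu> s) x))\<^sup>2
                   \<partial>lebesgue_on \<Omega>) \<partial>lebesgue_on {0..t})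
      \<le> energy \<Omega> A F \<phi>0"

definition weak_solution ::
    "potential_kind \<Rightarrow> real \<Rightarrow> 'a::euclidean_space set \<Rightarrow> ('a \<Rightarrow> real) \<Rightarrow> ('a \<Rightarrow> real \<Rightarrow> real) \<Rightarrow>
     (real \<Rightarrow> real) \<Rightarrow> ('a \<Rightarrow> real) \<Rightarrow> (real \<Rightarrow> 'a \<Rightarrow> real) \<Rightarrow> (real \<Rightarrow> 'a \<Rightarrow> real) \<Rightarrow> bool"
  where "weak_solution kind T \<Omega> A M F \<phi>0 \<phi> \<mu> \<longleftrightarrow>
    space_time_measurable T \<Omega> \<phi> \<and> space_time_measurable T \<Omega> \<mu> \<and>
    \<phi> \<in> C_L2 T \<Omega> \<and> \<phi> \<in> Linf_H1 T \<Omega> \<and> \<mu> \<in> L2_H1 T \<Omega> \<and>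
    (\<lambda>t x. deriv F (\<phi> t x)) \<in> L2_L2 T \<Omega> \<and>
    (kind = Logarithmic \<longrightarrow> (AE (t, x) in lebesgue_on (space_time T \<Omega>). \<bar>\<phi> t x\<bar> < 1)) \<and>
    (\<exists>dt\<phi>. H1_H1_dual_with_derivative T \<Omega> \<phi> dt\<phi> \<and>
       (AE t in lebesgue_on {0..T}. \<forall>\<zeta>\<in>H1_space \<Omega>. \<forall>\<eta>\<in>H1_space \<Omega>.
          dt\<phi> t \<zeta> = - (\<integral>x. M (weak_grad \<Omega> (\<phi> t) x) (\<phi> t x)
                        * (weak_grad \<Omega> (\<mu> t) x \<bullet> weak_grad \<Omega> \<zeta> x) \<partial>lebesgue_on \<Omega>) \<and>
          (\<integral>x. \<mu> t x * \<eta> x \<partial>lebesgue_on \<Omega>)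
            = (\<integral>x. gradient A (weak_grad \<Omega> (\<phi> t) x) \<bullet> weak_grad \<Omega> \<eta> x
                    + deriv F (\<phi> t x) * \<eta> x \<partial>lebesgue_on \<Omega>))) \<and>
    (AE x in lebesgue_on \<Omega>. \<phi> 0 x = \<phi>0 x) \<and>
    (case kind of
       Regular \<Rightarrow> (AE t in lebesgue_on {0..T}. energy_inequality \<Omega> A M F \<phi>0 \<phi> \<mu> t)
     | Logarithmic \<Rightarrow> (\<forall>t\<in>{0..T}. energy_inequality \<Omega> A M F \<phi>0 \<phi> \<mu> t))"

end

theory Submission
  imports Defs
begin

text \<open>
  At almost every time the second equation of the system is a Neumann problem: \<open>u = \<phi> t\<close> satisfies
  \<open>- div (a (grad u)) = f\<close> weakly, with natural boundary conditions, for the strongly monotone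
  Lipschitz field \<open>a = A'\<close> and \<open>f = \<mu> t - F'(\<phi> t)\<close>, which is square integrable. The theorem is therefore
  an estimate of the second derivatives of \<open>u\<close> by \<open>f\<close>, \<open>u\<close> and \<open>grad u\<close> in \<open>L\<^sup>2\<close>, combined with a
  measurability argument in time. As \<open>a\<close> is only Lipschitz continuous, the equation cannot be
  differentiated; the estimate rests on difference quotients and on the monotonicity of \<open>a\<close>.

  Near a boundary point the domain is the epigraph of a \<open>C\<^sup>1\<^sup>,\<^sup>1\<close> function \<open>\<gamma>\<close>. Instead of flattening the
  boundary, the solution is compared with its composition with the maps \<open>slide k h\<close>, which shift the
  epigraph along itself, preserve the measure and commute with gradients up to an error of order \<open>h\<close>
  (\<open>L2_weak_gradient_slide\<close>). Testing with a difference quotient of a difference quotient bounds the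
  tangential difference quotients of \<open>grad u\<close> (\<open>tangential_estimate\<close>). The remaining direction is
  obtained from the equation, which bounds the vertical derivative of the normal component of
  \<open>a (grad u)\<close>, and from \<open>grad u\<close> being curl free, which does the same for its tangential components;
  monotonicity recovers the vertical difference quotient of \<open>grad u\<close> from the two
  (\<open>monotone_normal_bound\<close>, \<open>local_estimate\<close>). All derivatives are kept in dual form, as bounds for
  \<open>\<integral> \<Theta>(grad u) \<partial>\<psi>\<close> by the \<open>L\<^sup>2\<close> norm of the test function \<open>\<psi>\<close>, with an arbitrary Lipschitz function
  \<open>\<Theta>\<close>. Such bounds are easily put together on the whole domain, and the Riesz representation theorem
  turns them into weak derivatives (\<open>lipschitz_of_gradient_regularity\<close>). Linear \<open>\<Theta>\<close> give the second
  derivatives of \<open>u\<close>, the components of \<open>a\<close> give those of \<open>a (grad u)\<close>; then the equation holds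
  almost everywhere.

  The bound for the \<open>H\<^sup>2\<close> norm is integrable in time by the assumptions on \<open>\<phi>\<close>, \<open>\<mu>\<close> and \<open>F'(\<phi>)\<close>. That \<open>\<phi>\<close>
  is strongly measurable with values in \<open>H\<^sup>2\<close> follows as in Pettis' theorem (\<open>strongly_measurable_H2\<close>):
  \<open>H\<^sup>2\<close> is separable, and the second derivatives are weakly measurable, because they are tested by
  moving one derivative to the test function.
\<close>

abbreviation (input) leb :: "'a::euclidean_space set \<Rightarrow> 'a measure" where "leb \<equiv> lebesgue_on"

abbreviation (input) dderiv :: "('a::euclidean_space \<Rightarrow> real) \<Rightarrow> 'a \<Rightarrow> 'a \<Rightarrow> real"
  where "dderiv f x \<equiv> frechet_derivative f (at x)"

section \<open>Square integrable functions\<close>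

definition L2_fun :: "'a measure \<Rightarrow> ('a \<Rightarrow> 'b::euclidean_space) \<Rightarrow> bool"
  where "L2_fun M f \<longleftrightarrow> f \<in> borel_measurable M \<and> integrable M (\<lambda>x. (norm (f x))\<^sup>2)"

definition norm2 :: "'a measure \<Rightarrow> ('a \<Rightarrow> 'b::euclidean_space) \<Rightarrow> real"
  where "norm2 M f = sqrt (LINT x|M. (norm (f x))\<^sup>2)"

lemma L2_fun_measurable [measurable_dest]:
  "L2_fun M f \<Longrightarrow> f \<in> borel_measurable M"
  by (simp add: L2_fun_def)

lemma L2_fun_integrable: "L2_fun M f \<Longrightarrow> integrable M (\<lambda>x. (norm (f x))\<^sup>2)"
  by (simp add: L2_fun_def)

lemma norm2_nonneg [simp]: "0 \<le> norm2 M f"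
  by (simp add: norm2_def)

lemma norm2_square: "(norm2 M f)\<^sup>2 = (LINT x|M. (norm (f x))\<^sup>2)"
  by (simp add: norm2_def)

lemma norm2_cong_AE:
  assumes "f \<in> borel_measurable M" "g \<in> borel_measurable M" "AE x in M. f x = g x"
  shows "norm2 M f = norm2 M g"
proof -
  have "(LINT x|M. (norm (f x))\<^sup>2) = (LINT x|M. (norm (g x))\<^sup>2)"
    by (rule integral_cong_AE) (use assms in auto)
  then show ?thesis by (simp add: norm2_def)
qed

lemma L2_fun_mono:
  assumes f: "L2_fun M f" and g: "g \<in> borel_measurable M"
    and le: "AE x in M. norm (g x) \<le> C * norm (f x)"
  shows "L2_fun M g"
proof -
  have "integrable M (\<lambda>x. (norm (g x))\<^sup>2)"
  proof (rule Bochner_Integration.integrable_bound)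
    show "integrable M (\<lambda>x. C\<^sup>2 * (norm (f x))\<^sup>2)"
      using L2_fun_integrable[OF f] by simp
    show "(\<lambda>x. (norm (g x))\<^sup>2) \<in> borel_measurable M" using g by measurable
    show "AE x in M. norm ((norm (g x))\<^sup>2) \<le> norm (C\<^sup>2 * (norm (f x))\<^sup>2)"
      using le
    proof eventually_elim
      case (elim x)
      have "(norm (g x))\<^sup>2 \<le> (C * norm (f x))\<^sup>2"
        by (rule power_mono[OF elim]) simp
      then show ?case by (simp add: power_mult_distrib)
    qed
  qed
  then show ?thesis using g by (simp add: L2_fun_def)
qed

lemma norm2_mono:
  assumes f: "L2_fun M f" and g: "g \<in> borel_measurable M"
    and le: "AE x in M. norm (g x) \<le> C * norm (f x)" and C: "0 \<le> C"
  shows "norm2 M g \<le> C * norm2 M f"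
proof -
  have "(LINT x|M. (norm (g x))\<^sup>2) \<le> (LINT x|M. C\<^sup>2 * (norm (f x))\<^sup>2)"
  proof (rule integral_mono_AE)
    show "integrable M (\<lambda>x. (norm (g x))\<^sup>2)"
      using L2_fun_mono[OF f g le] by (rule L2_fun_integrable)
    show "integrable M (\<lambda>x. C\<^sup>2 * (norm (f x))\<^sup>2)"
      using L2_fun_integrable[OF f] by simp
    show "AE x in M. (norm (g x))\<^sup>2 \<le> C\<^sup>2 * (norm (f x))\<^sup>2"
      using le
    proof eventually_elim
      case (elim x)
      have "(norm (g x))\<^sup>2 \<le> (C * norm (f x))\<^sup>2"
        by (rule power_mono[OF elim]) simp
      then show ?case by (simp add: power_mult_distrib)
    qed
  qed
  then have "(norm2 M g)\<^sup>2 \<le> (C * norm2 M f)\<^sup>2"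
    by (simp add: norm2_square power_mult_distrib)
  then show ?thesis using C by (meson norm2_nonneg mult_nonneg_nonneg power2_le_imp_le)
qed

lemma L2_fun_add:
  assumes f: "L2_fun M f" and g: "L2_fun M g"
  shows "L2_fun M (\<lambda>x. f x + g x)"
proof -
  have [measurable]: "f \<in> borel_measurable M" "g \<in> borel_measurable M"
    using f g by (auto simp: L2_fun_def)
  have "integrable M (\<lambda>x. (norm (f x + g x))\<^sup>2)"
  proof (rule Bochner_Integration.integrable_bound)
    show "integrable M (\<lambda>x. 2 * (norm (f x))\<^sup>2 + 2 * (norm (g x))\<^sup>2)"
      using L2_fun_integrable[OF f] L2_fun_integrable[OF g] by simp
    show "AE x in M. norm ((norm (f x + g x))\<^sup>2) \<le> norm (2 * (norm (f x))\<^sup>2 + 2 * (norm (g x))\<^sup>2)"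
    proof (rule AE_I2)
      fix x
      have "(norm (f x + g x))\<^sup>2 \<le> (norm (f x) + norm (g x))\<^sup>2"
        by (intro power_mono norm_triangle_ineq) simp
      also have "\<dots> \<le> 2 * (norm (f x))\<^sup>2 + 2 * (norm (g x))\<^sup>2"
        using sum_squares_bound[of "norm (f x)" "norm (g x)"] by (simp add: power2_sum)
      finally show "norm ((norm (f x + g x))\<^sup>2) \<le> norm (2 * (norm (f x))\<^sup>2 + 2 * (norm (g x))\<^sup>2)"
        by simp
    qed
  qed measurable
  then show ?thesis by (simp add: L2_fun_def)
qed

lemma L2_fun_bounded_mult:
  assumes f: "L2_fun M f" and m: "m \<in> borel_measurable M"
    and b: "\<And>x. x \<in> space M \<Longrightarrow> \<bar>m x\<bar> \<le> C"
  shows "L2_fun M (\<lambda>x. m x *\<^sub>R f x)"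
    and "0 \<le> C \<Longrightarrow> norm2 M (\<lambda>x. m x *\<^sub>R f x) \<le> C * norm2 M f"
proof -
  have [measurable]: "f \<in> borel_measurable M" using f by (rule L2_fun_measurable)
  have *: "AE x in M. norm (m x *\<^sub>R f x) \<le> C * norm (f x)"
    by (rule AE_I2) (simp add: b mult_right_mono)
  have me: "(\<lambda>x. m x *\<^sub>R f x) \<in> borel_measurable M" using m by measurable
  show "L2_fun M (\<lambda>x. m x *\<^sub>R f x)" by (rule L2_fun_mono[OF f me *])
  show "0 \<le> C \<Longrightarrow> norm2 M (\<lambda>x. m x *\<^sub>R f x) \<le> C * norm2 M f" by (rule norm2_mono[OF f me *])
qed

lemma L2_fun_scaleR:
  assumes f: "L2_fun M f"
  shows "L2_fun M (\<lambda>x. c *\<^sub>R f x)"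
  by (rule L2_fun_bounded_mult(1)[OF f, of "\<lambda>_. c" "\<bar>c\<bar>"]) auto

lemma norm2_scaleR: "norm2 M (\<lambda>x. c *\<^sub>R f x) = \<bar>c\<bar> * norm2 M f"
  by (simp add: norm2_def power_mult_distrib real_sqrt_mult)

lemma norm2_mult: "norm2 M (\<lambda>x. c * f x) = \<bar>c\<bar> * norm2 M f" for f :: "_ \<Rightarrow> real"
  using norm2_scaleR[of M c f] by simp

lemma L2_fun_mult:
  "L2_fun M f \<Longrightarrow> L2_fun M (\<lambda>x. c * f x)" for f :: "_ \<Rightarrow> real"
  using L2_fun_scaleR[of M f c] by simp

lemma L2_fun_diff:
  assumes f: "L2_fun M f" and g: "L2_fun M g"
  shows "L2_fun M (\<lambda>x. f x - g x)"
  using L2_fun_add[OF f L2_fun_scaleR[OF g, of "-1"]] by simp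

lemma L2_fun_zero [simp]: "L2_fun M (\<lambda>x. 0)"
  by (simp add: L2_fun_def)

lemma norm2_zero [simp]: "norm2 M (\<lambda>x. 0) = 0"
  by (simp add: norm2_def)

lemma L2_fun_sum:
  "finite I \<Longrightarrow> (\<And>i. i \<in> I \<Longrightarrow> L2_fun M (f i)) \<Longrightarrow> L2_fun M (\<lambda>x. \<Sum>i\<in>I. f i x)"
  by (induction I rule: finite_induct) (auto intro: L2_fun_add)

lemma integrable_inner_L2_fun:
  assumes f: "L2_fun M f" and g: "L2_fun M g"
  shows "integrable M (\<lambda>x. f x \<bullet> g x)"
proof (rule Bochner_Integration.integrable_bound)
  have [measurable]: "f \<in> borel_measurable M" "g \<in> borel_measurable M"
    using f g by (auto simp: L2_fun_def)
  show "integrable M (\<lambda>x. (norm (f x))\<^sup>2 + (norm (g x))\<^sup>2)"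
    using L2_fun_integrable[OF f] L2_fun_integrable[OF g] by simp
  show "(\<lambda>x. f x \<bullet> g x) \<in> borel_measurable M" by measurable
  show "AE x in M. norm (f x \<bullet> g x) \<le> norm ((norm (f x))\<^sup>2 + (norm (g x))\<^sup>2)"
  proof (rule AE_I2)
    fix x
    have "\<bar>f x \<bullet> g x\<bar> \<le> norm (f x) * norm (g x)" by (rule Cauchy_Schwarz_ineq2)
    also have "\<dots> \<le> (norm (f x))\<^sup>2 + (norm (g x))\<^sup>2"
      using sum_squares_bound[of "norm (f x)" "norm (g x)"]
        mult_nonneg_nonneg[OF norm_ge_zero norm_ge_zero, of "f x" "g x"] by linarith
    finally show "norm (f x \<bullet> g x) \<le> norm ((norm (f x))\<^sup>2 + (norm (g x))\<^sup>2)" by simp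
  qed
qed

lemma integrable_mult_L2_fun:
  fixes f g :: "_ \<Rightarrow> real"
  assumes "L2_fun M f" "L2_fun M g"
  shows "integrable M (\<lambda>x. f x * g x)"
  using integrable_inner_L2_fun[OF assms] by simp

lemma quadratic_nonneg_discriminant:
  fixes a b c :: real
  assumes nn: "\<And>t. 0 \<le> a + 2 * t * b + t\<^sup>2 * c" and c: "0 \<le> c"
  shows "b\<^sup>2 \<le> a * c"
proof (cases "c = 0")
  case True
  have "b = 0"
  proof (rule ccontr)
    assume "b \<noteq> 0"
    then have "\<exists>t. t * b = - (a + 1) / 2"
      by (intro exI[of _ "- (a + 1) / 2 / b"]) simp
    then obtain t where "t * b = - (a + 1) / 2" ..
    then show False using nn[of t] True by simp
  qed
  then show ?thesis using True by simp
next
  case False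
  then have pos: "c > 0" using c by simp
  have "0 \<le> a + 2 * (-b/c) * b + (-b/c)\<^sup>2 * c" by (rule nn)
  also have "\<dots> = a - b\<^sup>2 / c" using False by (simp add: power2_eq_square)
  finally have "b\<^sup>2 / c \<le> a" by simp
  then show ?thesis using pos by (simp add: pos_divide_le_eq)
qed

lemma norm2_add_scaleR_square:
  assumes f: "L2_fun M f" and g: "L2_fun M g"
  shows "(norm2 M (\<lambda>x. f x + t *\<^sub>R g x))\<^sup>2
    = (norm2 M f)\<^sup>2 + 2 * t * (LINT x|M. f x \<bullet> g x) + t\<^sup>2 * (norm2 M g)\<^sup>2"
proof -
  have "(norm (f x + t *\<^sub>R g x))\<^sup>2 = (norm (f x))\<^sup>2 + 2 * t * (f x \<bullet> g x) + t\<^sup>2 * (norm (g x))\<^sup>2" for x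
    unfolding power2_norm_eq_inner
    by (simp add: inner_add_left inner_add_right inner_commute[of "g x" "f x"] power2_eq_square algebra_simps)
  then show ?thesis
    unfolding norm2_square
    using L2_fun_integrable[OF f] L2_fun_integrable[OF g]
      integrable_inner_L2_fun[OF f g]
    by simp
qed

lemma Cauchy_Schwarz_norm2:
  assumes f: "L2_fun M f" and g: "L2_fun M g"
  shows "\<bar>LINT x|M. f x \<bullet> g x\<bar> \<le> norm2 M f * norm2 M g"
proof -
  have "(LINT x|M. f x \<bullet> g x)\<^sup>2 \<le> (norm2 M f)\<^sup>2 * (norm2 M g)\<^sup>2"
  proof (rule quadratic_nonneg_discriminant)
    fix t
    have "0 \<le> (norm2 M (\<lambda>x. f x + t *\<^sub>R g x))\<^sup>2" by simp
    then show "0 \<le> (norm2 M f)\<^sup>2 + 2 * t * (LINT x|M. f x \<bullet> g x) + t\<^sup>2 * (norm2 M g)\<^sup>2"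
      by (simp only: norm2_add_scaleR_square[OF f g])
  qed simp
  then show ?thesis
    by (metis abs_le_square_iff abs_of_nonneg norm2_nonneg mult_nonneg_nonneg power_mult_distrib)
qed

lemma Cauchy_Schwarz_norm2_real:
  fixes f g :: "_ \<Rightarrow> real"
  assumes "L2_fun M f" "L2_fun M g"
  shows "\<bar>LINT x|M. f x * g x\<bar> \<le> norm2 M f * norm2 M g"
  using Cauchy_Schwarz_norm2[OF assms] by simp

lemma norm2_triangle:
  assumes f: "L2_fun M f" and g: "L2_fun M g"
  shows "norm2 M (\<lambda>x. f x + g x) \<le> norm2 M f + norm2 M g"
proof -
  have "(norm2 M (\<lambda>x. f x + g x))\<^sup>2 \<le> (norm2 M f + norm2 M g)\<^sup>2"
    using norm2_add_scaleR_square[OF f g, of 1] Cauchy_Schwarz_norm2[OF f g]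
    by (simp add: power2_sum)
  then show ?thesis by (meson add_nonneg_nonneg norm2_nonneg power2_le_imp_le)
qed

lemma norm2_uminus [simp]: "norm2 M (\<lambda>x. - f x) = norm2 M f"
  by (simp add: norm2_def)

lemma norm2_minus_commute: "norm2 M (\<lambda>x. f x - g x) = norm2 M (\<lambda>x. g x - f x)"
  by (simp add: norm2_def norm_minus_commute)

lemma norm2_triangle_diff:
  assumes f: "L2_fun M f" and g: "L2_fun M g" and h: "L2_fun M h"
  shows "norm2 M (\<lambda>x. f x - h x) \<le> norm2 M (\<lambda>x. f x - g x) + norm2 M (\<lambda>x. g x - h x)"
  using norm2_triangle[OF L2_fun_diff[OF f g] L2_fun_diff[OF g h]] by simp

lemma norm2_sum:
  "finite I \<Longrightarrow> (\<And>i. i \<in> I \<Longrightarrow> L2_fun M (f i)) \<Longrightarrow>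
    norm2 M (\<lambda>x. \<Sum>i\<in>I. f i x) \<le> (\<Sum>i\<in>I. norm2 M (f i))"
proof (induction I rule: finite_induct)
  case (insert i I)
  then have "norm2 M (\<lambda>x. f i x + (\<Sum>i\<in>I. f i x)) \<le> norm2 M (f i) + norm2 M (\<lambda>x. \<Sum>i\<in>I. f i x)"
    by (intro norm2_triangle L2_fun_sum) auto
  with insert show ?case by force
qed simp

lemma ennreal_norm2_square:
  assumes "L2_fun M f"
  shows "ennreal ((norm2 M f)\<^sup>2) = (\<integral>\<^sup>+x. ennreal ((norm (f x))\<^sup>2) \<partial>M)"
  unfolding norm2_square
  by (rule nn_integral_eq_integral[symmetric]) (use assms in \<open>auto simp: L2_fun_def\<close>)

lemma L2_fun_if_nn_integral_le:
  assumes [measurable]: "f \<in> borel_measurable M"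
    and le: "(\<integral>\<^sup>+x. ennreal ((norm (f x))\<^sup>2) \<partial>M) \<le> ennreal (C\<^sup>2)" and C: "0 \<le> C"
  shows "L2_fun M f" "norm2 M f \<le> C"
proof -
  have "integrable M (\<lambda>x. (norm (f x))\<^sup>2)"
    by (rule integrableI_bounded) (use le in \<open>auto simp: le_less_trans\<close>)
  then show s: "L2_fun M f" by (simp add: L2_fun_def)
  have "ennreal ((norm2 M f)\<^sup>2) \<le> ennreal (C\<^sup>2)"
    using le by (simp add: ennreal_norm2_square[OF s])
  then have "(norm2 M f)\<^sup>2 \<le> C\<^sup>2" by simp
  then show "norm2 M f \<le> C" using C by (rule power2_le_imp_le)
qed

text \<open>Riesz--Fischer: along a subsequence with summable increments the pointwise sum of the
  increments is square integrable by monotone convergence, which gives a limit almost everywhere;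
  Fatou's lemma turns it into a limit in the mean.\<close>
lemma L2_fun_complete:
  fixes f :: "nat \<Rightarrow> 'a \<Rightarrow> 'b::euclidean_space"
  assumes f: "\<And>n. L2_fun M (f n)"
    and Cauchy: "\<And>e. e > 0 \<Longrightarrow> \<exists>N. \<forall>m\<ge>N. \<forall>n\<ge>N. norm2 M (\<lambda>x. f m x - f n x) < e"
  obtains g where "L2_fun M g" "(\<lambda>n. norm2 M (\<lambda>x. f n x - g x)) \<longlonglongrightarrow> 0"
proof -
  have [measurable]: "f n \<in> borel_measurable M" for n
    using f by (rule L2_fun_measurable)
  have "\<forall>k. \<exists>N. \<forall>m\<ge>N. \<forall>n\<ge>N. norm2 M (\<lambda>x. f m x - f n x) < (1/2)^k"
    by (intro allI Cauchy) simp
  then obtain N where N: "\<And>k m n. m \<ge> N k \<Longrightarrow> n \<ge> N k \<Longrightarrow> norm2 M (\<lambda>x. f m x - f n x) < (1/2)^k"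
    by metis
  define r where "r k = k + (\<Sum>j\<le>k. N j)" for k
  have rN: "N k \<le> r k" for k
    unfolding r_def using member_le_sum[of k "{..k}" N] by simp
  have r_Suc: "r k \<le> r (Suc k)" for k by (simp add: r_def)
  have r_ge: "k \<le> r k" for k by (simp add: r_def)
  define d where "d k x = f (r (Suc k)) x - f (r k) x" for k x
  have d_meas [measurable]: "d k \<in> borel_measurable M" for k
    unfolding d_def by measurable
  have d_sq: "L2_fun M (d k)" for k
    unfolding d_def by (intro L2_fun_diff f)
  have d_le: "norm2 M (d k) \<le> (1/2)^k" for k
    unfolding d_def using N[of k "r (Suc k)" "r k"] rN[of k] r_Suc[of k] by force
  define S where "S n x = (\<Sum>k<n. norm (d k x))" for n x
  have S_meas [measurable]: "S n \<in> borel_measurable M" for n unfolding S_def by measurable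
  have nd: "L2_fun M (\<lambda>x. norm (d k x))" "norm2 M (\<lambda>x. norm (d k x)) = norm2 M (d k)" for k
    using d_sq[of k] by (simp_all add: L2_fun_def norm2_def)
  have S_sq: "L2_fun M (S n)" for n
    unfolding S_def by (intro L2_fun_sum nd) auto
  have S_le: "norm2 M (S n) \<le> 2" for n
  proof -
    have "norm2 M (S n) \<le> (\<Sum>k<n. norm2 M (\<lambda>x. norm (d k x)))"
      unfolding S_def by (rule norm2_sum) (auto intro: nd)
    also have "\<dots> \<le> (\<Sum>k<n. (1/2)^k)" by (intro sum_mono) (simp add: nd d_le)
    also have "\<dots> \<le> (\<Sum>k. (1/2)^k)" by (rule sum_le_suminf) (auto intro: summable_geometric)
    also have "\<dots> = 2" by (subst suminf_geometric) auto
    finally show ?thesis .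
  qed
  have "(\<integral>\<^sup>+x. (SUP n. ennreal ((S n x)\<^sup>2)) \<partial>M) = (SUP n. \<integral>\<^sup>+x. ennreal ((S n x)\<^sup>2) \<partial>M)"
  proof (rule nn_integral_monotone_convergence_SUP)
    show "incseq (\<lambda>n x. ennreal ((S n x)\<^sup>2))"
      by (intro incseq_SucI le_funI ennreal_leI power_mono)
        (auto simp: S_def sum_nonneg)
  qed measurable
  also have "\<dots> \<le> ennreal 4"
  proof (rule SUP_least)
    fix n
    have "(\<integral>\<^sup>+x. ennreal ((S n x)\<^sup>2) \<partial>M) = ennreal ((norm2 M (S n))\<^sup>2)"
      by (subst ennreal_norm2_square[OF S_sq]) (simp)
    also have "\<dots> \<le> ennreal (2\<^sup>2)"
      by (intro ennreal_leI power_mono S_le) simp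
    finally show "(\<integral>\<^sup>+x. ennreal ((S n x)\<^sup>2) \<partial>M) \<le> ennreal 4" by simp
  qed
  finally have "(\<integral>\<^sup>+x. (SUP n. ennreal ((S n x)\<^sup>2)) \<partial>M) < \<infinity>"
    using le_less_trans by fastforce
  then have AE_fin: "AE x in M. (SUP n. ennreal ((S n x)\<^sup>2)) \<noteq> \<infinity>"
    by (intro nn_integral_PInf_AE) auto
  have AE_conv: "AE x in M. convergent (\<lambda>k. f (r k) x)"
    using AE_fin
  proof eventually_elim
    case (elim x)
    then obtain B where B: "(SUP n. ennreal ((S n x)\<^sup>2)) = ennreal B" "0 \<le> B"
      by (cases "SUP n. ennreal ((S n x)\<^sup>2)") auto
    have "(S n x)\<^sup>2 \<le> B" for n
      using SUP_upper[of n UNIV "\<lambda>n. ennreal ((S n x)\<^sup>2)"] B by simp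
    then have Sb: "S n x \<le> sqrt B" for n using real_le_rsqrt by blast
    have "summable (\<lambda>k. norm (d k x))"
      by (rule summableI_nonneg_bounded[of _ "sqrt B"]) (use Sb in \<open>auto simp: S_def\<close>)
    then have "summable (\<lambda>k. d k x)" by (rule summable_norm_cancel)
    then have "convergent (\<lambda>n. \<Sum>k<n. d k x)" by (simp add: summable_iff_convergent)
    moreover have "(\<Sum>k<n. d k x) = f (r n) x - f (r 0) x" for n
      unfolding d_def by (rule sum_lessThan_telescope)
    ultimately have "convergent (\<lambda>n. f (r n) x - f (r 0) x)" by simp
    then show ?case using convergent_add_const_right_iff[of "\<lambda>n. f (r n) x" "- f (r 0) x"] by simp
  qed
  define g where "g x = lim (\<lambda>k. f (r k) x)" for x
  have g_meas [measurable]: "g \<in> borel_measurable M"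
    unfolding g_def by (rule borel_measurable_lim_metric) measurable
  have AE_lim: "AE x in M. (\<lambda>k. f (r k) x) \<longlonglongrightarrow> g x"
    using AE_conv by eventually_elim (simp add: g_def convergent_LIMSEQ_iff)
  have key: "L2_fun M (\<lambda>x. f n x - g x) \<and> norm2 M (\<lambda>x. f n x - g x) \<le> e"
    if e: "e > 0" and n: "\<forall>m\<ge>K. norm2 M (\<lambda>x. f n x - f m x) < e" for n e K
  proof -
    have "(\<integral>\<^sup>+x. ennreal ((norm (f n x - g x))\<^sup>2) \<partial>M)
        = (\<integral>\<^sup>+x. liminf (\<lambda>k. ennreal ((norm (f n x - f (r k) x))\<^sup>2)) \<partial>M)"
    proof (rule nn_integral_cong_AE)
      show "AE x in M. ennreal ((norm (f n x - g x))\<^sup>2)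
        = liminf (\<lambda>k. ennreal ((norm (f n x - f (r k) x))\<^sup>2))"
        using AE_lim
      proof eventually_elim
        case (elim x)
        have "(\<lambda>k. ennreal ((norm (f n x - f (r k) x))\<^sup>2)) \<longlonglongrightarrow> ennreal ((norm (f n x - g x))\<^sup>2)"
          by (intro tendsto_intros elim)
        from lim_imp_Liminf[OF sequentially_bot this] show ?case by (rule sym)
      qed
    qed
    also have "\<dots> \<le> liminf (\<lambda>k. \<integral>\<^sup>+x. ennreal ((norm (f n x - f (r k) x))\<^sup>2) \<partial>M)"
      by (rule nn_integral_liminf) measurable
    also have "\<dots> \<le> ennreal (e\<^sup>2)"
    proof -
      have "eventually (\<lambda>k. (\<integral>\<^sup>+x. ennreal ((norm (f n x - f (r k) x))\<^sup>2) \<partial>M) \<le> ennreal (e\<^sup>2)) sequentially"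
        using eventually_ge_at_top[of K]
      proof eventually_elim
        case (elim k)
        then have "norm2 M (\<lambda>x. f n x - f (r k) x) < e" using n r_ge[of k] by simp
        then have "(norm2 M (\<lambda>x. f n x - f (r k) x))\<^sup>2 \<le> e\<^sup>2" by (intro power_mono) auto
        then show ?case
          by (subst ennreal_norm2_square[OF L2_fun_diff[OF f f], symmetric])
            (rule ennreal_leI)
      qed
      then have "liminf (\<lambda>k. \<integral>\<^sup>+x. ennreal ((norm (f n x - f (r k) x))\<^sup>2) \<partial>M) \<le> liminf (\<lambda>k. ennreal (e\<^sup>2))"
        by (rule Liminf_mono)
      then show ?thesis by (simp add: Liminf_const)
    qed
    finally have *: "(\<integral>\<^sup>+x. ennreal ((norm (f n x - g x))\<^sup>2) \<partial>M) \<le> ennreal (e\<^sup>2)" .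
    show ?thesis
      using L2_fun_if_nn_integral_le[OF _ *] e by auto
  qed
  show thesis
  proof
    obtain K where "\<forall>m\<ge>K. \<forall>n\<ge>K. norm2 M (\<lambda>x. f m x - f n x) < 1" using Cauchy[of 1] by auto
    then have "L2_fun M (\<lambda>x. f K x - g x)" using key[of 1 K K] by auto
    from L2_fun_diff[OF f[of K] this] show "L2_fun M g" by simp
    show "(\<lambda>n. norm2 M (\<lambda>x. f n x - g x)) \<longlonglongrightarrow> 0"
    proof (rule LIMSEQ_I)
      fix e :: real assume "e > 0"
      then obtain K where K: "\<forall>m\<ge>K. \<forall>n\<ge>K. norm2 M (\<lambda>x. f m x - f n x) < e / 2"
        using Cauchy[of "e/2"] by auto
      have "norm (norm2 M (\<lambda>x. f n x - g x) - 0) < e" if "n \<ge> K" for n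
        using key[of "e/2" K n] K that \<open>e > 0\<close> by auto
      then show "\<exists>no. \<forall>n\<ge>no. norm (norm2 M (\<lambda>x. f n x - g x) - 0) < e" by blast
    qed
  qed
qed

text \<open>The representing function is the limit of a minimising sequence of the quadratic functional
  \<open>\<parallel>\<psi>\<parallel>\<^sup>2 / 2 - l \<psi>\<close>; that sequence is Cauchy by the parallelogram law, and its
  limit lies in the closure of \<open>V\<close>.\<close>
lemma Riesz_representation_on_subspace:
  fixes l :: "('a \<Rightarrow> real) \<Rightarrow> real"
  assumes V: "\<And>\<psi>. \<psi> \<in> V \<Longrightarrow> L2_fun M \<psi>"
    and zero: "(\<lambda>x. 0) \<in> V"
    and lin: "\<And>\<psi> \<xi> t. \<psi> \<in> V \<Longrightarrow> \<xi> \<in> V \<Longrightarrow>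
        (\<lambda>x. \<psi> x + t * \<xi> x) \<in> V \<and> l (\<lambda>x. \<psi> x + t * \<xi> x) = l \<psi> + t * l \<xi>"
    and bound: "\<And>\<psi>. \<psi> \<in> V \<Longrightarrow> \<bar>l \<psi>\<bar> \<le> C * norm2 M \<psi>"
    and C: "0 \<le> C"
  obtains v where "L2_fun M v" "\<And>\<psi>. \<psi> \<in> V \<Longrightarrow> l \<psi> = (LINT x|M. v x * \<psi> x)"
    "norm2 M v \<le> C" "\<And>e. e > 0 \<Longrightarrow> \<exists>\<psi>\<in>V. norm2 M (\<lambda>x. \<psi> x - v x) < e"
proof -
  define J where "J \<psi> = (norm2 M \<psi>)\<^sup>2 / 2 - l \<psi>" for \<psi>
  have J_below: "J \<psi> \<ge> - C\<^sup>2 / 2" if "\<psi> \<in> V" for \<psi>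
  proof -
    have "l \<psi> \<le> C * norm2 M \<psi>" using bound[OF that] by simp
    moreover have "0 \<le> (C - norm2 M \<psi>)\<^sup>2" by simp
    ultimately show ?thesis by (simp add: J_def power2_diff field_simps)
  qed
  have J_add: "J (\<lambda>x. \<psi> x + t * \<xi> x)
      = J \<psi> + t * ((LINT x|M. \<psi> x * \<xi> x) - l \<xi>) + t\<^sup>2 * (norm2 M \<xi>)\<^sup>2 / 2"
    if "\<psi> \<in> V" "\<xi> \<in> V" for \<psi> \<xi> t
    using norm2_add_scaleR_square[OF V[OF that(1)] V[OF that(2)], of t] lin[OF that, of t]
    by (simp add: J_def field_simps)
  define m where "m = Inf (J ` V)"
  have bdd: "bdd_below (J ` V)" by (rule bdd_belowI2[of V "- C\<^sup>2 / 2"]) (rule J_below)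
  have m_le: "m \<le> J \<psi>" if "\<psi> \<in> V" for \<psi>
    unfolding m_def by (rule cInf_lower) (use bdd that in auto)
  have "\<exists>\<psi>\<in>V. J \<psi> < m + 1 / real (Suc n)" for n
  proof -
    have "J ` V \<noteq> {}" using zero by auto
    moreover have "Inf (J ` V) < m + 1 / real (Suc n)" by (simp add: m_def)
    ultimately show ?thesis using cInf_lessD[of "J ` V"] by blast
  qed
  then obtain p where pV: "\<And>n. p n \<in> V" and pJ: "\<And>n. J (p n) < m + 1 / real (Suc n)" by metis
  have par: "(norm2 M (\<lambda>x. p i x - p j x))\<^sup>2 \<le> 4 * (J (p i) - m) + 4 * (J (p j) - m)" for i j
  proof -
    have d: "(\<lambda>x. p i x + (-1) * p j x) \<in> V" using lin[OF pV pV] by blast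
    have "J (\<lambda>x. p j x + (1/2) * (p i x + (-1) * p j x)) \<ge> m"
      using lin[OF pV d, of j "1/2"] by (intro m_le) auto
    moreover have "J (\<lambda>x. p j x + 1 * (p i x + (-1) * p j x)) = J (p i)" by simp
    ultimately show ?thesis
      using J_add[OF pV[of j] d, of "1/2"] J_add[OF pV[of j] d, of 1]
      by (simp add: field_simps power2_eq_square)
  qed
  obtain v where v: "L2_fun M v" and lim: "(\<lambda>n. norm2 M (\<lambda>x. p n x - v x)) \<longlonglongrightarrow> 0"
  proof (rule L2_fun_complete[of M p])
    show "L2_fun M (p n)" for n by (rule V[OF pV])
    fix e :: real assume e: "e > 0"
    obtain N where N: "8 / e\<^sup>2 < real N" using reals_Archimedean2 by blast
    have "norm2 M (\<lambda>x. p i x - p j x) < e" if "i \<ge> N" "j \<ge> N" for i j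
    proof -
      have aux: "4 * (J (p i) - m) < e\<^sup>2 / 2" if "i \<ge> N" for i
      proof -
        have "8 / e\<^sup>2 < real (Suc i)" using N that by simp
        then have "8 < real (Suc i) * e\<^sup>2" using e by (simp add: pos_divide_less_eq)
        then have "4 * (1 / real (Suc i)) < e\<^sup>2 / 2" by (simp add: field_simps)
        then show ?thesis using pJ[of i] by argo
      qed
      have "(norm2 M (\<lambda>x. p i x - p j x))\<^sup>2 < e\<^sup>2"
        using par[of i j] aux[OF that(1)] aux[OF that(2)] by linarith
      then show ?thesis using e by (simp add: power_less_imp_less_base)
    qed
    then show "\<exists>N. \<forall>m\<ge>N. \<forall>n\<ge>N. norm2 M (\<lambda>x. p m x - p n x) < e" by blast
  qed
  have close: "\<exists>\<psi>\<in>V. norm2 M (\<lambda>x. \<psi> x - v x) < e" if "e > 0" for e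
    using LIMSEQ_D[OF lim that] pV by fastforce
  have rep: "l \<psi> = (LINT x|M. v x * \<psi> x)" if \<psi>: "\<psi> \<in> V" for \<psi>
  proof -
    define c where "c n = (LINT x|M. p n x * \<psi> x)" for n
    have "(c n - l \<psi>)\<^sup>2 \<le> (2 * (1 / real (Suc n))) * (norm2 M \<psi>)\<^sup>2" for n
    proof (rule quadratic_nonneg_discriminant)
      fix t
      have "m \<le> J (\<lambda>x. p n x + t * \<psi> x)" using lin[OF pV \<psi>] by (intro m_le) auto
      then have "0 \<le> 2 * (J (p n) - m) + 2 * t * (c n - l \<psi>) + t\<^sup>2 * (norm2 M \<psi>)\<^sup>2"
        unfolding J_add[OF pV \<psi>] c_def by (simp add: field_simps)
      then show "0 \<le> 2 * (1 / real (Suc n)) + 2 * t * (c n - l \<psi>) + t\<^sup>2 * (norm2 M \<psi>)\<^sup>2"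
        using pJ[of n] by argo
    qed simp
    moreover have "(\<lambda>n. (2 * (1 / real (Suc n))) * (norm2 M \<psi>)\<^sup>2) \<longlonglongrightarrow> (2 * 0) * (norm2 M \<psi>)\<^sup>2"
      using LIMSEQ_inverse_real_of_nat by (intro tendsto_intros) (simp only: inverse_eq_divide)
    ultimately have "(\<lambda>n. (c n - l \<psi>)\<^sup>2) \<longlonglongrightarrow> 0"
      by (intro tendsto_sandwich[of "\<lambda>_. 0" "\<lambda>n. (c n - l \<psi>)\<^sup>2"]) auto
    then have "(\<lambda>n. c n - l \<psi>) \<longlonglongrightarrow> 0"
      by (subst (asm) power_tendsto_0_iff) auto
    then have c1: "c \<longlonglongrightarrow> l \<psi>" by (simp add: LIM_zero_iff)
    have "(\<lambda>n. c n - (LINT x|M. v x * \<psi> x)) \<longlonglongrightarrow> 0"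
    proof (rule tendsto_rabs_zero_cancel, rule tendsto_sandwich[of "\<lambda>_. 0"])
      show "\<forall>\<^sub>F n in sequentially. \<bar>c n - (LINT x|M. v x * \<psi> x)\<bar> \<le> norm2 M (\<lambda>x. p n x - v x) * norm2 M \<psi>"
      proof (rule always_eventually, rule allI)
        fix n
        have "c n - (LINT x|M. v x * \<psi> x) = (LINT x|M. (p n x - v x) * \<psi> x)"
          unfolding c_def left_diff_distrib
          by (rule Bochner_Integration.integral_diff[symmetric])
            (intro integrable_mult_L2_fun V pV \<psi> v)+
        then show "\<bar>c n - (LINT x|M. v x * \<psi> x)\<bar> \<le> norm2 M (\<lambda>x. p n x - v x) * norm2 M \<psi>"
          using Cauchy_Schwarz_norm2_real[OF L2_fun_diff[OF V[OF pV] v] V[OF \<psi>]] by simp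
      qed
      show "(\<lambda>n. norm2 M (\<lambda>x. p n x - v x) * norm2 M \<psi>) \<longlonglongrightarrow> 0"
        using tendsto_mult[OF lim tendsto_const[of "norm2 M \<psi>"]] by simp
    qed auto
    then have "c \<longlonglongrightarrow> (LINT x|M. v x * \<psi> x)" by (simp add: LIM_zero_iff)
    with c1 show ?thesis by (rule LIMSEQ_unique)
  qed
  have "norm2 M v \<le> C"
  proof (rule ccontr)
    assume "\<not> norm2 M v \<le> C"
    then have gt: "C < norm2 M v" by simp
    define e where "e = (norm2 M v - C) / 3"
    have e: "e > 0" using gt by (simp add: e_def)
    obtain \<psi> where \<psi>: "\<psi> \<in> V" and close_\<psi>: "norm2 M (\<lambda>x. \<psi> x - v x) < e" using close[OF e] by blast
    have "norm2 M v \<le> norm2 M \<psi> + e" "norm2 M \<psi> \<le> norm2 M v + e"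
      using norm2_triangle[OF V[OF \<psi>] L2_fun_diff[OF v V[OF \<psi>]]]
        norm2_triangle[OF v L2_fun_diff[OF V[OF \<psi>] v]] close_\<psi>
        norm2_minus_commute[of M v \<psi>] by auto
    moreover have "(norm2 M \<psi>)\<^sup>2 \<le> C * norm2 M \<psi> + e * norm2 M \<psi>"
    proof -
      have "(norm2 M \<psi>)\<^sup>2 = (LINT x|M. v x * \<psi> x) + (LINT x|M. (\<psi> x - v x) * \<psi> x)"
        unfolding norm2_square
        by (subst Bochner_Integration.integral_add[symmetric])
          (auto intro!: integrable_mult_L2_fun V \<psi> v L2_fun_diff
            Bochner_Integration.integral_cong simp: power2_eq_square algebra_simps)
      also have "(LINT x|M. v x * \<psi> x) \<le> C * norm2 M \<psi>" using rep[OF \<psi>] bound[OF \<psi>] by simp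
      also have "(LINT x|M. (\<psi> x - v x) * \<psi> x) \<le> e * norm2 M \<psi>"
        using Cauchy_Schwarz_norm2_real[OF L2_fun_diff[OF V[OF \<psi>] v] V[OF \<psi>]]
          mult_right_mono[of "norm2 M (\<lambda>x. \<psi> x - v x)" e "norm2 M \<psi>"] close_\<psi> by simp
      finally show ?thesis by simp
    qed
    then have "norm2 M \<psi> * norm2 M \<psi> \<le> (C + e) * norm2 M \<psi>"
      by (simp add: power2_eq_square distrib_right)
    then have "norm2 M \<psi> \<le> C + e"
      using C e norm2_nonneg[of M \<psi>]
      by (cases "norm2 M \<psi> = 0") (auto dest: mult_right_le_imp_le)
    moreover have "norm2 M v = C + 3 * e" by (simp add: e_def field_simps)
    ultimately show False using e by linarith
  qed
  with v rep close show thesis by (intro that)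
qed

section \<open>Smooth functions and cutoffs\<close>

abbreviation smooth :: "('a::euclidean_space \<Rightarrow> real) \<Rightarrow> bool"
  where "smooth f \<equiv> \<forall>k. Ck k f"

lemma Ck_differentiable: "Ck (Suc k) f \<Longrightarrow> f differentiable (at x)"
  by simp

lemma Ck_has_derivative: "Ck (Suc k) f \<Longrightarrow> (f has_derivative dderiv f x) (at x)"
  using frechet_derivative_works by auto

lemma Ck_continuous: "Ck k f \<Longrightarrow> continuous_on UNIV f"
proof (cases k)
  case (Suc j)
  assume "Ck k f"
  then have "f differentiable (at x)" for x by (simp add: Suc)
  then show ?thesis
    by (intro continuous_at_imp_continuous_on ballI differentiable_imp_continuous_within)
qed simp

lemma Ck_Suc_imp_Ck: "Ck (Suc k) f \<Longrightarrow> Ck k f"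
proof (induction k arbitrary: f)
  case 0
  then show ?case using Ck_continuous[of "Suc 0" f] by simp
next
  case (Suc k)
  show ?case unfolding Ck.simps(2)[of k f]
  proof (intro conjI allI ballI)
    show "f differentiable (at x)" for x using Suc.prems by simp
    fix i :: 'a assume "i \<in> Basis"
    then have "Ck (Suc k) (\<lambda>x. dderiv f x i)" using Suc.prems by simp
    then show "Ck k (\<lambda>x. dderiv f x i)" by (rule Suc.IH)
  qed
qed

lemma Ck_SucI:
  assumes "\<And>x. (f has_derivative D x) (at x)" "\<And>i. i \<in> Basis \<Longrightarrow> Ck k (\<lambda>x. D x i)"
  shows "Ck (Suc k) f"
proof -
  have "dderiv f x = D x" for x
    using frechet_derivative_at[OF assms(1)] by simp
  then show ?thesis using assms by (auto simp: differentiable_def)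
qed

lemma Ck_const: "Ck k (\<lambda>x. c)"
proof (induction k arbitrary: c)
  case (Suc k)
  show ?case by (rule Ck_SucI[where D="\<lambda>x h. 0"]) (auto intro: Suc)
qed simp

lemma Ck_add: "Ck k f \<Longrightarrow> Ck k g \<Longrightarrow> Ck k (\<lambda>x. f x + g x)"
proof (induction k arbitrary: f g)
  case 0 then show ?case by (auto intro: continuous_on_add)
next
  case (Suc k)
  show ?case
    by (rule Ck_SucI[where D="\<lambda>x h. dderiv f x h + dderiv g x h"])
      (use Suc.prems in \<open>auto intro!: has_derivative_add Ck_has_derivative Suc.IH\<close>)
qed

lemma Ck_mult: "Ck k f \<Longrightarrow> Ck k g \<Longrightarrow> Ck k (\<lambda>x. f x * g x)"
proof (induction k arbitrary: f g)
  case 0 then show ?case by (auto intro: continuous_on_mult)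
next
  case (Suc k)
  note prems = Suc.prems
  show ?case
  proof (rule Ck_SucI)
    show "((\<lambda>x. f x * g x) has_derivative
        (\<lambda>h. f x * dderiv g x h + dderiv f x h * g x)) (at x)" for x
      by (intro has_derivative_mult Ck_has_derivative[OF prems(1)] Ck_has_derivative[OF prems(2)])
    fix i :: 'a assume i: "i \<in> Basis"
    show "Ck k (\<lambda>x. f x * dderiv g x i + dderiv f x i * g x)"
      using prems i Ck_Suc_imp_Ck[OF prems(1)] Ck_Suc_imp_Ck[OF prems(2)]
      by (intro Ck_add Suc.IH) auto
  qed
qed

lemma Ck_minus: "Ck k f \<Longrightarrow> Ck k g \<Longrightarrow> Ck k (\<lambda>x. f x - g x)"
  using Ck_add[of k f "\<lambda>x. (-1) * g x"] Ck_mult[OF Ck_const[of k "-1"], of g] by simp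

lemma Ck_cmult: "Ck k f \<Longrightarrow> Ck k (\<lambda>x. c * f x)"
  by (intro Ck_mult Ck_const)

lemma Ck_prod: "finite I \<Longrightarrow> (\<And>i. i \<in> I \<Longrightarrow> Ck k (f i)) \<Longrightarrow> Ck k (\<lambda>x. \<Prod>i\<in>I. f i x)"
  by (induction I rule: finite_induct) (auto intro: Ck_mult Ck_const)

lemma Ck_inverse:
  assumes nz: "\<And>x. f x \<noteq> 0"
  shows "Ck k f \<Longrightarrow> Ck k (\<lambda>x. inverse (f x))"
proof (induction k)
  case 0 then show ?case using nz by (auto intro: continuous_on_inverse)
next
  case (Suc k)
  note prems = Suc.prems
  show ?case
  proof (rule Ck_SucI)
    show "((\<lambda>x. inverse (f x)) has_derivative
        (\<lambda>h. - (inverse (f x) * dderiv f x h * inverse (f x)))) (at x)" for x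
      by (rule Deriv.has_derivative_inverse[OF nz Ck_has_derivative[OF prems]])
    fix i :: 'a assume i: "i \<in> Basis"
    have "Ck k (\<lambda>x. (-1) * (inverse (f x) * dderiv f x i * inverse (f x)))"
      using prems i Suc.IH[OF Ck_Suc_imp_Ck[OF prems]] by (intro Ck_mult Ck_const) auto
    then show "Ck k (\<lambda>x. - (inverse (f x) * dderiv f x i * inverse (f x)))" by simp
  qed
qed

lemma Ck_translate: "Ck k f \<Longrightarrow> Ck k (\<lambda>x. f (x + a))"
proof (induction k arbitrary: f)
  case 0
  then show ?case by (auto intro!: continuous_on_compose2[of UNIV f] continuous_intros)
next
  case (Suc k)
  note prems = Suc.prems
  show ?case
  proof (rule Ck_SucI)
    show "((\<lambda>x. f (x + a)) has_derivative dderiv f (x + a)) (at x)" for x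
      by (rule has_derivative_compose[OF _ Ck_has_derivative[OF prems], where f'="\<lambda>h. h"])
        (auto intro!: derivative_eq_intros)
    show "Ck k (\<lambda>x. dderiv f (x + a) i)" if "i \<in> Basis" for i
      using that prems Suc.IH[of "\<lambda>x. dderiv f x i"] by simp
  qed
qed

lemma smooth_frechet_derivative:
  assumes "smooth f" shows "smooth (\<lambda>x. dderiv f x d)"
proof (intro allI)
  fix k
  have C: "Ck (Suc k) f" using assms by blast
  have "Ck k (\<lambda>x. \<Sum>i\<in>B. (d \<bullet> i) * dderiv f x i)" if "finite B" "B \<subseteq> Basis" for B
    using that by (induction B rule: finite_induct) (use C in \<open>auto intro!: Ck_add Ck_cmult Ck_const\<close>)
  moreover have "dderiv f x d = (\<Sum>i\<in>Basis. (d \<bullet> i) * dderiv f x i)" for x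
  proof -
    have l: "linear (dderiv f x)"
      using Ck_has_derivative[OF C, of x] has_derivative_linear by blast
    have "dderiv f x d = dderiv f x (\<Sum>i\<in>Basis. (d \<bullet> i) *\<^sub>R i)"
      by (simp add: euclidean_representation)
    also have "\<dots> = (\<Sum>i\<in>Basis. (d \<bullet> i) * dderiv f x i)"
      by (simp add: linear_sum[OF l] linear_cmul[OF l])
    finally show ?thesis .
  qed
  ultimately show "Ck k (\<lambda>x. dderiv f x d)" by simp
qed

lemma smooth_has_derivative: "smooth f \<Longrightarrow> (f has_derivative dderiv f x) (at x)"
  using Ck_has_derivative by blast

lemma smooth_continuous: "smooth f \<Longrightarrow> continuous_on UNIV f"
  using Ck_continuous by blast

text \<open>The family \<open>s \<mapsto> exp (-1/s) / s\<^sup>m\<close> is closed under differentiation up to linear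
  combinations, which yields all derivatives of \<open>exp (-1/s)\<close> at once.\<close>
definition flat_exp :: "nat \<Rightarrow> real \<Rightarrow> real"
  where "flat_exp m s = (if s > 0 then exp (- inverse s) * inverse s ^ m else 0)"

lemma flat_exp_tendsto_0: "(flat_exp m \<longlongrightarrow> 0) (at 0)"
proof (rule filterlim_split_at)
  have "((\<lambda>s. inverse s ^ m / exp (inverse s)) \<longlongrightarrow> 0) (at_right (0::real))"
    by (rule filterlim_compose[OF tendsto_power_div_exp_0 filterlim_inverse_at_top_right])
  then show "(flat_exp m \<longlongrightarrow> 0) (at_right 0)"
    by (rule Lim_transform_eventually)
      (auto simp: eventually_at_right_field flat_exp_def exp_minus field_simps intro!: exI[of _ 1])
  show "(flat_exp m \<longlongrightarrow> 0) (at_left 0)"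
    by (rule Lim_transform_eventually[of "\<lambda>_. 0"])
      (auto simp: eventually_at_left_field flat_exp_def intro!: exI[of _ "-1"])
qed

lemma flat_exp_has_derivative:
  "(flat_exp m has_real_derivative (flat_exp (m + 2) s - real m * flat_exp (m + 1) s)) (at s)"
proof -
  consider "s > 0" | "s < 0" | "s = 0" by linarith
  then show ?thesis
  proof cases
    case 1
    have "((\<lambda>s. exp (- inverse s) * inverse s ^ m) has_real_derivative
        (exp (- inverse s) * (inverse s)\<^sup>2) * inverse s ^ m
        + (real m * inverse s ^ (m - 1) * (- ((inverse s)\<^sup>2))) * exp (- inverse s)) (at s)"
    proof (rule DERIV_mult)
      show "((\<lambda>s. exp (- inverse s)) has_real_derivative exp (- inverse s) * (inverse s)\<^sup>2) (at s)"
        using 1 by (auto intro!: derivative_eq_intros simp: power2_eq_square)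
      show "((\<lambda>s. inverse s ^ m) has_real_derivative real m * inverse s ^ (m - 1) * - (inverse s)\<^sup>2) (at s)"
        using 1 by (auto intro!: derivative_eq_intros simp: power2_eq_square)
    qed
    also have "(exp (- inverse s) * (inverse s)\<^sup>2) * inverse s ^ m
        + (real m * inverse s ^ (m - 1) * (- ((inverse s)\<^sup>2))) * exp (- inverse s)
        = flat_exp (m + 2) s - real m * flat_exp (m + 1) s"
      using 1 by (cases m) (auto simp: flat_exp_def power2_eq_square)
    finally have "((\<lambda>s. exp (- inverse s) * inverse s ^ m) has_real_derivative
        (flat_exp (m + 2) s - real m * flat_exp (m + 1) s)) (at s)" .
    then show ?thesis
      by (rule has_field_derivative_transform_within_open[of _ _ _ "{0<..}"])
        (use 1 in \<open>auto simp: flat_exp_def\<close>)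
  next
    case 2
    have "((\<lambda>s. 0) has_real_derivative (flat_exp (m + 2) s - real m * flat_exp (m + 1) s)) (at s)"
      using 2 by (auto simp: flat_exp_def)
    then show ?thesis
      by (rule has_field_derivative_transform_within_open[of _ _ _ "{..<0}"])
        (use 2 in \<open>auto simp: flat_exp_def\<close>)
  next
    case 3
    have "((\<lambda>h. (flat_exp m h - flat_exp m 0) / h) \<longlongrightarrow> 0) (at 0)"
    proof (rule Lim_transform_eventually[OF flat_exp_tendsto_0[of "Suc m"]])
      show "\<forall>\<^sub>F h in at 0. flat_exp (Suc m) h = (flat_exp m h - flat_exp m 0) / h"
        by (auto simp: eventually_at_filter flat_exp_def field_simps)
    qed
    then show ?thesis using 3 by (simp add: DERIV_def flat_exp_def)
  qed
qed

lemma Ck_flat_exp: "smooth q \<Longrightarrow> Ck k (\<lambda>x. flat_exp m (q x))"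
proof (induction k arbitrary: m)
  case 0
  have "continuous_on UNIV (flat_exp m)"
    using DERIV_isCont[OF flat_exp_has_derivative] by (simp add: continuous_at_imp_continuous_on)
  then show ?case using smooth_continuous[OF 0]
    by (auto intro: continuous_on_compose2)
next
  case (Suc k)
  show ?case
  proof (rule Ck_SucI)
    show "((\<lambda>x. flat_exp m (q x)) has_derivative (\<lambda>h. dderiv q x h
        * (flat_exp (m + 2) (q x) - real m * flat_exp (m + 1) (q x)))) (at x)" for x
      by (rule DERIV_compose_FDERIV[OF flat_exp_has_derivative smooth_has_derivative[OF Suc.prems]])
    fix i :: 'a
    show "Ck k (\<lambda>x. dderiv q x i * (flat_exp (m + 2) (q x) - real m * flat_exp (m + 1) (q x)))"
      using smooth_frechet_derivative[OF Suc.prems]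
      by (intro Ck_mult Ck_minus Ck_const Suc.IH[OF Suc.prems]) auto
  qed
qed

lemma Ck_inner_left: "Ck k (\<lambda>x. (x - c) \<bullet> d)"
proof (cases k)
  case 0 then show ?thesis by (auto intro!: continuous_intros)
next
  case (Suc j)
  have "Ck (Suc j) (\<lambda>x. (x - c) \<bullet> d)"
    by (rule Ck_SucI[where D="\<lambda>x h. h \<bullet> d"]) (auto intro!: derivative_eq_intros Ck_const)
  then show ?thesis by (simp add: Suc)
qed

lemma smooth_dist_square: "smooth (\<lambda>x. (norm (x - c))\<^sup>2)"
proof
  fix k
  have "Ck (Suc k) (\<lambda>x. (x - c) \<bullet> (x - c))"
  proof (rule Ck_SucI)
    show "((\<lambda>x. (x - c) \<bullet> (x - c)) has_derivative (\<lambda>h. 2 * ((x - c) \<bullet> h))) (at x)" for x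
      by (auto intro!: derivative_eq_intros simp: inner_commute)
    show "Ck k (\<lambda>x. 2 * ((x - c) \<bullet> i))" for i by (intro Ck_cmult Ck_inner_left)
  qed
  then show "Ck k (\<lambda>x. (norm (x - c))\<^sup>2)"
    unfolding power2_norm_eq_inner by (rule Ck_Suc_imp_Ck)
qed

text \<open>The quotient of two smooth functions of the distance, the second of which vanishes exactly
  on the inner ball and the first exactly outside the outer ball.\<close>
lemma cutoff_ball_exists:
  fixes c :: "'a::euclidean_space"
  assumes "0 < r" "r < R"
  obtains \<zeta> where "smooth \<zeta>" "\<And>x. 0 \<le> \<zeta> x" "\<And>x. \<zeta> x \<le> 1"
    "\<And>x. x \<in> cball c r \<Longrightarrow> \<zeta> x = 1" "\<And>x. x \<notin> ball c R \<Longrightarrow> \<zeta> x = 0"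
proof
  define p q where "p x = flat_exp 0 (R\<^sup>2 - (norm (x - c))\<^sup>2)"
    and "q x = flat_exp 0 ((norm (x - c))\<^sup>2 - r\<^sup>2)" for x
  have pq_nn: "0 \<le> p x" "0 \<le> q x" for x by (auto simp: p_def q_def flat_exp_def)
  have p0: "p x = 0" if "x \<notin> ball c R" for x
  proof -
    have "R\<^sup>2 \<le> (norm (x - c))\<^sup>2" using that assms by (intro power_mono) (auto simp: dist_norm norm_minus_commute)
    then show ?thesis by (simp add: p_def flat_exp_def)
  qed
  have p_pos: "0 < p x" if "x \<in> ball c R" for x
  proof -
    have "(norm (x - c))\<^sup>2 < R\<^sup>2" using that assms by (intro power_strict_mono) (auto simp: dist_norm norm_minus_commute)
    then show ?thesis by (simp add: p_def flat_exp_def)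
  qed
  have q0: "q x = 0" if "x \<in> cball c r" for x
  proof -
    have "(norm (x - c))\<^sup>2 \<le> r\<^sup>2" using that assms by (intro power_mono) (auto simp: dist_norm norm_minus_commute)
    then show ?thesis by (simp add: q_def flat_exp_def)
  qed
  have q_pos: "0 < q x" if "x \<notin> cball c r" for x
  proof -
    have "r\<^sup>2 < (norm (x - c))\<^sup>2" using that assms by (intro power_strict_mono) (auto simp: dist_norm norm_minus_commute)
    then show ?thesis by (simp add: q_def flat_exp_def)
  qed
  have pos: "0 < p x + q x" for x
  proof (cases "x \<in> cball c r")
    case True
    then have "x \<in> ball c R" using assms by auto
    then show ?thesis using p_pos[of x] pq_nn[of x] by linarith
  next
    case False then show ?thesis using q_pos[of x] pq_nn[of x] by linarith
  qed
  define \<zeta> where "\<zeta> x = p x * inverse (p x + q x)" for x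
  have cp: "Ck k p" "Ck k q" for k
    unfolding p_def q_def using smooth_dist_square[of c]
    by (auto intro!: Ck_flat_exp Ck_minus Ck_const)
  show "smooth \<zeta>"
    unfolding \<zeta>_def using pos by (auto intro!: Ck_mult Ck_inverse Ck_add cp simp: less_imp_neq[symmetric])
  show "0 \<le> \<zeta> x" for x using pq_nn[of x] by (simp add: \<zeta>_def)
  show "\<zeta> x \<le> 1" for x using pq_nn[of x] pos[of x] by (simp add: \<zeta>_def field_simps)
  show "\<zeta> x = 1" if "x \<in> cball c r" for x using q0[OF that] pos[of x] by (simp add: \<zeta>_def)
  show "\<zeta> x = 0" if "x \<notin> ball c R" for x using p0[OF that] by (simp add: \<zeta>_def)
qed

lemma test_functions_smooth: "\<psi> \<in> test_functions U \<Longrightarrow> smooth \<psi>"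
  by (simp add: test_functions_def)

lemma test_functionsI:
  assumes "smooth \<psi>" "compact K" "K \<subseteq> U" "\<And>x. x \<notin> K \<Longrightarrow> \<psi> x = 0"
  shows "\<psi> \<in> test_functions U"
proof -
  have "closure {x. \<psi> x \<noteq> 0} \<subseteq> K"
    using assms(2,4) by (intro closure_minimal compact_imp_closed) auto
  moreover have "compact (closure {x. \<psi> x \<noteq> 0})"
    using calculation assms(2) by (metis closed_Int_compact closed_closure inf.absorb1)
  ultimately show ?thesis using assms by (auto simp: test_functions_def)
qed

lemma test_functions_support:
  assumes "\<psi> \<in> test_functions U"
  obtains K where "compact K" "K \<subseteq> U" "\<And>x. x \<notin> K \<Longrightarrow> \<psi> x = 0"
    "\<And>x d. x \<notin> K \<Longrightarrow> dderiv \<psi> x d = 0"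
proof
  let ?K = "closure {x. \<psi> x \<noteq> 0}"
  show "compact ?K" "?K \<subseteq> U" using assms by (auto simp: test_functions_def)
  show z: "\<psi> x = 0" if "x \<notin> ?K" for x using that closure_subset[of "{x. \<psi> x \<noteq> 0}"] by blast
  show "dderiv \<psi> x d = 0" if "x \<notin> ?K" for x d
  proof -
    have "(\<psi> has_derivative (\<lambda>h. 0)) (at x)"
    proof (rule has_derivative_transform_within_open[of "\<lambda>_. 0" _ _ _ "- ?K"])
      show "0 = \<psi> y" if "y \<in> - ?K" for y by (rule z[symmetric]) (use that in \<open>simp only: Compl_iff not_False_eq_True\<close>)
    qed (use that in \<open>simp_all only: Compl_iff has_derivative_const open_Compl closed_closure not_False_eq_True\<close>)
    from frechet_derivative_at[OF this, symmetric] show ?thesis by simp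
  qed
qed

lemma test_functions_mono: "U \<subseteq> V \<Longrightarrow> test_functions U \<subseteq> test_functions V"
  by (auto simp: test_functions_def)

lemma test_functions_mult_smooth:
  assumes "smooth \<zeta>" "\<psi> \<in> test_functions U"
  shows "(\<lambda>x. \<zeta> x * \<psi> x) \<in> test_functions U"
proof -
  obtain K where "compact K" "K \<subseteq> U" "\<And>x. x \<notin> K \<Longrightarrow> \<psi> x = 0"
    using test_functions_support[OF assms(2)] by metis
  then show ?thesis
    using assms(1) test_functions_smooth[OF assms(2)]
    by (intro test_functionsI[of _ K]) (auto intro: Ck_mult)
qed

lemma test_functions_add_scale:
  assumes "\<psi> \<in> test_functions U" "\<xi> \<in> test_functions U"
  shows "(\<lambda>x. \<psi> x + t * \<xi> x) \<in> test_functions U"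
proof -
  obtain K where "compact K" "K \<subseteq> U" "\<And>x. x \<notin> K \<Longrightarrow> \<psi> x = 0"
    using test_functions_support[OF assms(1)] by metis
  moreover obtain L where "compact L" "L \<subseteq> U" "\<And>x. x \<notin> L \<Longrightarrow> \<xi> x = 0"
    using test_functions_support[OF assms(2)] by metis
  ultimately show ?thesis
    using test_functions_smooth[OF assms(1)] test_functions_smooth[OF assms(2)]
    by (intro test_functionsI[of _ "K \<union> L"]) (auto intro!: Ck_add Ck_cmult)
qed

lemma zero_test_function: "(\<lambda>x. 0) \<in> test_functions U"
  by (rule test_functionsI[of _ "{}"]) (auto intro: Ck_const)

lemma dderiv_test_function:
  assumes "\<psi> \<in> test_functions U"
  shows "(\<lambda>x. dderiv \<psi> x d) \<in> test_functions U"
proof -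
  obtain K where "compact K" "K \<subseteq> U" "\<And>x d. x \<notin> K \<Longrightarrow> dderiv \<psi> x d = 0"
    using test_functions_support[OF assms] by metis
  then show ?thesis
    using smooth_frechet_derivative[OF test_functions_smooth[OF assms]]
    by (intro test_functionsI[of _ K]) auto
qed

lemma dderiv_linear_comb:
  assumes "smooth \<psi>" "smooth \<xi>"
  shows "dderiv (\<lambda>x. \<psi> x + t * \<xi> x) x d
    = dderiv \<psi> x d + t * dderiv \<xi> x d"
proof -
  have "((\<lambda>x. \<psi> x + t * \<xi> x) has_derivative
      (\<lambda>d. dderiv \<psi> x d + t * dderiv \<xi> x d)) (at x)"
    by (intro has_derivative_add has_derivative_mult_right smooth_has_derivative assms)
  from frechet_derivative_at[OF this, symmetric] show ?thesis by simp
qed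

lemma dderiv_mult:
  assumes "smooth \<psi>" "smooth \<xi>"
  shows "dderiv (\<lambda>x. \<psi> x * \<xi> x) x d
    = \<psi> x * dderiv \<xi> x d + dderiv \<psi> x d * \<xi> x"
proof -
  have "((\<lambda>x. \<psi> x * \<xi> x) has_derivative
      (\<lambda>d. \<psi> x * dderiv \<xi> x d + dderiv \<psi> x d * \<xi> x)) (at x)"
    by (intro has_derivative_mult smooth_has_derivative assms)
  from frechet_derivative_at[OF this, symmetric] show ?thesis by simp
qed

text \<open>A smooth Urysohn function: finitely many ball cutoffs \<open>\<zeta>\<^sub>c\<close> whose inner balls cover \<open>K\<close>
  are combined to \<open>1 - \<Prod>(1 - \<zeta>\<^sub>c)\<close>.\<close>
lemma smooth_Urysohn:
  fixes K :: "'a::euclidean_space set"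
  assumes K: "compact K" and U: "open U" and KU: "K \<subseteq> U"
  obtains \<zeta> W where "\<zeta> \<in> test_functions U" "\<And>x. 0 \<le> \<zeta> x" "\<And>x. \<zeta> x \<le> 1"
    "open W" "K \<subseteq> W" "W \<subseteq> U" "\<And>x. x \<in> W \<Longrightarrow> \<zeta> x = 1"
proof -
  have "\<exists>R>0. cball c R \<subseteq> U" if "c \<in> K" for c
    using U KU that open_contains_cball by blast
  then obtain R where R: "\<And>c. c \<in> K \<Longrightarrow> 0 < R c" "\<And>c. c \<in> K \<Longrightarrow> cball c (R c) \<subseteq> U" by metis
  have "\<exists>\<zeta>. smooth \<zeta> \<and> (\<forall>x. 0 \<le> \<zeta> x \<and> \<zeta> x \<le> 1) \<and> (\<forall>x\<in>cball c (R c / 2). \<zeta> x = 1) \<and> (\<forall>x. x \<notin> ball c (R c) \<longrightarrow> \<zeta> x = 0)"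
    if "c \<in> K" for c
    by (rule cutoff_ball_exists[of "R c / 2" "R c" c]) (use R[OF that] in auto)
  then have "\<exists>\<zeta>. \<forall>c\<in>K. smooth (\<zeta> c) \<and> (\<forall>x. 0 \<le> \<zeta> c x \<and> \<zeta> c x \<le> 1)
      \<and> (\<forall>x\<in>cball c (R c / 2). \<zeta> c x = 1) \<and> (\<forall>x. x \<notin> ball c (R c) \<longrightarrow> \<zeta> c x = 0)"
    by (intro bchoice ballI)
  then obtain \<zeta> where \<zeta>: "\<And>c. c \<in> K \<Longrightarrow> smooth (\<zeta> c)" "\<And>c x. c \<in> K \<Longrightarrow> 0 \<le> \<zeta> c x" "\<And>c x. c \<in> K \<Longrightarrow> \<zeta> c x \<le> 1"
    "\<And>c x. c \<in> K \<Longrightarrow> x \<in> cball c (R c / 2) \<Longrightarrow> \<zeta> c x = 1" "\<And>c x. c \<in> K \<Longrightarrow> x \<notin> ball c (R c) \<Longrightarrow> \<zeta> c x = 0"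
    by blast
  have "\<forall>c\<in>K. open (ball c (R c / 2))" by simp
  moreover have "K \<subseteq> (\<Union>c\<in>K. ball c (R c / 2))" using R by force
  ultimately obtain C where C: "C \<subseteq> K" "finite C" "K \<subseteq> (\<Union>c\<in>C. ball c (R c / 2))"
    using compactE_image[OF K, of K "\<lambda>c. ball c (R c / 2)"] by metis
  define f where "f x = 1 - (\<Prod>c\<in>C. 1 - \<zeta> c x)" for x
  have P: "0 \<le> (\<Prod>c\<in>C. 1 - \<zeta> c x)" "(\<Prod>c\<in>C. 1 - \<zeta> c x) \<le> 1" for x
    using C(1) \<zeta>(2,3) by (auto intro!: prod_nonneg prod_le_1 simp: subset_iff)
  show thesis
  proof
    show "f \<in> test_functions U"
    proof (rule test_functionsI)
      show "smooth f" unfolding f_def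
        using C \<zeta>(1) by (auto intro!: Ck_minus Ck_const Ck_prod)
      show "compact (\<Union>c\<in>C. cball c (R c))" using C by (intro compact_UN) auto
      show "(\<Union>c\<in>C. cball c (R c)) \<subseteq> U" using C R by blast
      show "f x = 0" if "x \<notin> (\<Union>c\<in>C. cball c (R c))" for x
      proof -
        have "\<zeta> c x = 0" if c: "c \<in> C" for c
        proof -
          have "x \<notin> ball c (R c)" using \<open>x \<notin> _\<close> c ball_subset_cball by blast
          then show ?thesis using \<zeta>(5) c C(1) by blast
        qed
        then show ?thesis by (simp add: f_def)
      qed
    qed
    show "0 \<le> f x" "f x \<le> 1" for x using P[of x] by (auto simp: f_def)
    show "open (\<Union>c\<in>C. ball c (R c / 2))" by auto
    show "K \<subseteq> (\<Union>c\<in>C. ball c (R c / 2))" by (rule C(3))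
    show "(\<Union>c\<in>C. ball c (R c / 2)) \<subseteq> U"
    proof (rule UN_least)
      fix c assume "c \<in> C"
      then have "c \<in> K" using C by auto
      then have "ball c (R c / 2) \<subseteq> cball c (R c)" using R(1)[of c] by auto
      then show "ball c (R c / 2) \<subseteq> U" using R(2)[OF \<open>c \<in> K\<close>] by blast
    qed
    show "f x = 1" if "x \<in> (\<Union>c\<in>C. ball c (R c / 2))" for x
    proof -
      obtain c where c: "c \<in> C" "x \<in> ball c (R c / 2)" using \<open>x \<in> _\<close> by blast
      then have "1 - \<zeta> c x = 0" using \<zeta>(4)[of c x] C(1) by auto
      then have "(\<Prod>c\<in>C. 1 - \<zeta> c x) = 0" using c(1) C(2) by auto
      then show ?thesis by (simp add: f_def)
    qed
  qed
qed

section \<open>Integration on measurable subsets\<close>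

lemma lebesgue_on_extension_by_zero:
  fixes f g :: "'a::euclidean_space \<Rightarrow> 'b::euclidean_space"
  assumes E: "E \<in> sets lebesgue" and F: "F \<in> sets lebesgue"
    and eq: "\<And>x. x \<in> E \<Longrightarrow> x \<in> F \<Longrightarrow> f x = g x"
    and E0: "\<And>x. x \<in> E \<Longrightarrow> x \<notin> F \<Longrightarrow> f x = 0"
    and F0: "\<And>x. x \<in> F \<Longrightarrow> x \<notin> E \<Longrightarrow> g x = 0"
  shows "f \<in> borel_measurable (leb E) \<longleftrightarrow> g \<in> borel_measurable (leb F)"
    and "integrable (leb E) f \<longleftrightarrow> integrable (leb F) g"
    and "(LINT x|leb E. f x) = (LINT x|leb F. g x)"
proof -
  have *: "(\<lambda>x. indicator E x *\<^sub>R f x) = (\<lambda>x. indicator F x *\<^sub>R g x)"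
    using eq E0 F0 by (auto simp: fun_eq_iff indicator_def)
  show "f \<in> borel_measurable (leb E) \<longleftrightarrow> g \<in> borel_measurable (leb F)"
    using E F by (simp add: borel_measurable_restrict_space_iff *)
  show "integrable (leb E) f \<longleftrightarrow> integrable (leb F) g"
    using E F by (simp add: integrable_restrict_space *)
  show "(LINT x|leb E. f x) = (LINT x|leb F. g x)"
    using E F by (simp add: integral_restrict_space *)
qed

lemma L2_fun_extension_by_zero:
  fixes f g :: "'a::euclidean_space \<Rightarrow> 'b::euclidean_space"
  assumes E: "E \<in> sets lebesgue" and F: "F \<in> sets lebesgue"
    and eq: "\<And>x. x \<in> E \<Longrightarrow> x \<in> F \<Longrightarrow> f x = g x"
    and E0: "\<And>x. x \<in> E \<Longrightarrow> x \<notin> F \<Longrightarrow> f x = 0"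
    and F0: "\<And>x. x \<in> F \<Longrightarrow> x \<notin> E \<Longrightarrow> g x = 0"
  shows "L2_fun (leb E) f \<longleftrightarrow> L2_fun (leb F) g"
    and "norm2 (leb E) f = norm2 (leb F) g"
proof -
  note 1 = lebesgue_on_extension_by_zero[OF E F, of f g, OF eq E0 F0]
  note 2 = lebesgue_on_extension_by_zero[OF E F, of "\<lambda>x. (norm (f x))\<^sup>2" "\<lambda>x. (norm (g x))\<^sup>2"]
  show "L2_fun (leb E) f \<longleftrightarrow> L2_fun (leb F) g"
    unfolding L2_fun_def using 1 2 eq E0 F0 by simp
  show "norm2 (leb E) f = norm2 (leb F) g"
    unfolding norm2_def using 2(3) eq E0 F0 by simp
qed

lemma borel_measurable_lebesgue_on_AE:
  fixes f g :: "'a::euclidean_space \<Rightarrow> 'b::euclidean_space"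
  assumes E: "E \<in> sets lebesgue" and f: "f \<in> borel_measurable (leb E)"
    and ae: "AE x in leb E. f x = g x"
  shows "g \<in> borel_measurable (leb E)"
proof -
  have "(\<lambda>x. indicator E x *\<^sub>R g x) \<in> borel_measurable lebesgue"
  proof (rule borel_measurable_AE)
    show "(\<lambda>x. indicator E x *\<^sub>R f x) \<in> borel_measurable lebesgue"
      using f E by (simp add: borel_measurable_restrict_space_iff)
    have "AE x in lebesgue. x \<in> E \<longrightarrow> f x = g x" using ae E by (simp add: AE_restrict_space_iff)
    then show "AE x in lebesgue. indicator E x *\<^sub>R f x = indicator E x *\<^sub>R g x"
      by eventually_elim (auto simp: indicator_def)
  qed
  then show ?thesis using E by (simp add: borel_measurable_restrict_space_iff)
qed

lemma L2_fun_cong_AE: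
  fixes f g :: "'a::euclidean_space \<Rightarrow> 'b::euclidean_space"
  assumes E: "E \<in> sets lebesgue" and f: "L2_fun (leb E) f"
    and ae: "AE x in leb E. f x = g x"
  shows "L2_fun (leb E) g" "norm2 (leb E) g = norm2 (leb E) f"
proof -
  have g: "g \<in> borel_measurable (leb E)"
    by (rule borel_measurable_lebesgue_on_AE[OF E L2_fun_measurable[OF f] ae])
  show "L2_fun (leb E) g"
    by (rule L2_fun_mono[OF f g, of 1]) (use ae in eventually_elim, simp)
  show "norm2 (leb E) g = norm2 (leb E) f"
    by (rule norm2_cong_AE[symmetric, OF L2_fun_measurable[OF f] g ae])
qed

lemma continuous_borel_measurable_leb:
  fixes f :: "'a::euclidean_space \<Rightarrow> 'b::euclidean_space"
  shows "continuous_on UNIV f \<Longrightarrow> f \<in> borel_measurable (leb E)"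
  by (intro measurable_restrict_space1 measurable_completion)
    (simp add: borel_measurable_continuous_onI)

lemma continuous_compact_support_bounded:
  fixes f :: "'a::euclidean_space \<Rightarrow> 'b::euclidean_space"
  assumes "continuous_on UNIV f" "compact K" "\<And>x. x \<notin> K \<Longrightarrow> f x = 0"
  obtains B where "0 < B" "\<And>x. norm (f x) \<le> B"
proof -
  have "compact (f ` K)"
    using assms by (intro compact_continuous_image) (auto intro: continuous_on_subset)
  then obtain B where B: "0 < B" "\<And>x. x \<in> K \<Longrightarrow> norm (f x) \<le> B"
    using compact_imp_bounded[of "f ` K"] by (auto simp: bounded_pos)
  show thesis
    by (rule that[of B]) (use B assms(3) in \<open>force+\<close>)
qed

lemma L2_fun_indicator:
  fixes S :: "'a::euclidean_space set"
  assumes "S \<in> lmeasurable" "E \<in> sets lebesgue"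
  shows "L2_fun (leb E) (indicator S :: 'a \<Rightarrow> real)"
proof -
  have [measurable]: "S \<in> sets lebesgue" using assms by auto
  have m: "(indicator S :: 'a \<Rightarrow> real) \<in> borel_measurable (leb E)"
    by (intro measurable_restrict_space1) measurable
  have eq: "(\<lambda>x. (norm (indicator S x :: real))\<^sup>2) = (indicator S :: 'a \<Rightarrow> real)"
    by (auto simp: fun_eq_iff indicator_def)
  have "integrable lebesgue (indicator S :: 'a \<Rightarrow> real)"
    using assms(1) by (simp add: fmeasurable_def integrable_indicator_iff)
  then have "integrable lebesgue (\<lambda>x. indicator E x *\<^sub>R indicator S x :: real)"
    using assms(2) by (intro integrable_mult_indicator)
  then have "integrable (leb E) (indicator S :: 'a \<Rightarrow> real)"
    using assms(2) by (simp add: integrable_restrict_space)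
  then show ?thesis unfolding L2_fun_def eq using m by simp
qed

lemma L2_fun_continuous_compact_support:
  fixes f :: "'a::euclidean_space \<Rightarrow> 'b::euclidean_space"
  assumes c: "continuous_on UNIV f" and K: "compact K" "\<And>x. x \<notin> K \<Longrightarrow> f x = 0"
    and E: "E \<in> sets lebesgue"
  shows "L2_fun (leb E) f"
proof -
  obtain B where B: "0 < B" "\<And>x. norm (f x) \<le> B"
    using continuous_compact_support_bounded[OF c K] by metis
  show ?thesis
  proof (rule L2_fun_mono)
    show "L2_fun (leb E) (indicator K :: 'a \<Rightarrow> real)"
      by (rule L2_fun_indicator[OF lmeasurable_compact[OF K(1)] E])
    show "f \<in> borel_measurable (leb E)" by (rule continuous_borel_measurable_leb[OF c])
    have "norm (f x) \<le> B * norm (indicator K x :: real)" for x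
      using B K(2)[of x] by (cases "x \<in> K") auto
    then show "AE x in leb E. norm (f x) \<le> B * norm (indicator K x :: real)" by simp
  qed
qed

lemma L2_fun_test_function:
  assumes "\<psi> \<in> test_functions U" "E \<in> sets lebesgue"
  shows "L2_fun (leb E) \<psi>"
proof -
  obtain K where "compact K" "\<And>x. x \<notin> K \<Longrightarrow> \<psi> x = 0"
    using test_functions_support[OF assms(1)] by metis
  then show ?thesis
    using assms smooth_continuous[OF test_functions_smooth[OF assms(1)]]
    by (intro L2_fun_continuous_compact_support)
qed

lemma L2_fun_dderiv_test_function:
  assumes "\<psi> \<in> test_functions U" "E \<in> sets lebesgue"
  shows "L2_fun (leb E) (\<lambda>x. dderiv \<psi> x d)"
  using dderiv_test_function[OF assms(1)] assms(2) by (rule L2_fun_test_function)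

lemma integrable_mult_continuous_compact_support:
  fixes u f :: "'a::euclidean_space \<Rightarrow> real"
  assumes u: "integrable (leb K) u" and K: "compact K" "K \<subseteq> E"
    and f: "continuous_on UNIV f" "\<And>x. x \<notin> K \<Longrightarrow> f x = 0" and E: "E \<in> sets lebesgue"
  shows "integrable (leb E) (\<lambda>x. u x * f x)"
proof -
  obtain B where B: "0 < B" "\<And>x. norm (f x) \<le> B"
    using continuous_compact_support_bounded[OF f(1) K(1) f(2)] by metis
  have KL: "K \<in> sets lebesgue" using lmeasurable_compact[OF K(1)] by auto
  have [measurable]: "f \<in> borel_measurable (leb K)"
    by (rule continuous_borel_measurable_leb[OF f(1)])
  have [measurable]: "u \<in> borel_measurable (leb K)" using u by auto
  have "integrable (leb K) (\<lambda>x. u x * f x)"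
  proof (rule Bochner_Integration.integrable_bound)
    show "integrable (leb K) (\<lambda>x. B * u x)" using u by simp
    show "AE x in leb K. norm (u x * f x) \<le> norm (B * u x)"
      using B by (auto simp: abs_mult intro!: mult_right_mono AE_I2)
        (metis abs_ge_zero abs_of_pos mult.commute mult_left_mono)
  qed measurable
  moreover have "integrable (leb K) (\<lambda>x. u x * f x) \<longleftrightarrow> integrable (leb E) (\<lambda>x. u x * f x)"
    by (rule lebesgue_on_extension_by_zero(2)[OF KL E]) (use K(2) f(2) in auto)
  ultimately show ?thesis by blast
qed

lemma L2_fun_imp_locally_integrable:
  assumes u: "L2_fun (leb E) u" and E: "E \<in> sets lebesgue"
  shows "locally_integrable E u"
  unfolding locally_integrable_def
proof (intro allI impI)
  fix K :: "'a set" assume K: "compact K \<and> K \<subseteq> E"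
  have "integrable (leb E) (\<lambda>x. u x * indicator K x)"
    using K by (intro integrable_mult_L2_fun[OF u] L2_fun_indicator[OF _ E] lmeasurable_compact) auto
  moreover have "integrable (leb E) (\<lambda>x. u x * indicator K x) \<longleftrightarrow> integrable (leb K) u"
    by (rule lebesgue_on_extension_by_zero(2)[OF E]) (use K lmeasurable_compact[of K] in auto)
  ultimately show "integrable (leb K) u" by blast
qed

section \<open>Functions are determined by their action on test functions\<close>

text \<open>Otherwise \<open>g\<close> would be positive on a compact set of positive measure, whose indicator is a
  bounded pointwise limit of test functions with supports in a common compact set.\<close>
lemma nonpos_AE_if_test_integrals_vanish:
  fixes g :: "'a::euclidean_space \<Rightarrow> real"
  assumes E: "open E" and g: "locally_integrable E g"
    and zero: "\<And>\<psi>. \<psi> \<in> test_functions E \<Longrightarrow> (LINT x|leb E. g x * \<psi> x) = 0"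
    and B: "compact B" "B \<subseteq> E"
  shows "AE x in leb B. g x \<le> 0"
proof (rule ccontr)
  have EL: "E \<in> sets lebesgue" using E by auto
  have BL: "B \<in> sets lebesgue" using lmeasurable_compact[OF B(1)] by auto
  have gB [measurable]: "g \<in> borel_measurable (leb B)"
    using g B unfolding locally_integrable_def by blast
  define S where "S = {x\<in>B. 0 < g x}"
  have "{x \<in> space (leb B). 0 < g x} \<in> sets (leb B)" by measurable
  then have SL: "S \<in> sets lebesgue" using BL by (simp add: S_def sets_restrict_space_iff)
  assume "\<not> (AE x in leb B. g x \<le> 0)"
  then have "\<not> (AE x in lebesgue. x \<in> B \<longrightarrow> g x \<le> 0)" using BL by (simp add: AE_restrict_space_iff)
  then have "\<not> (AE x in lebesgue. x \<notin> S)" by (simp add: S_def not_less)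
  then have Spos: "emeasure lebesgue S > 0"
    using SL by (metis AE_not_in null_setsI zero_less_iff_neq_zero)
  obtain e :: real where e: "e > 0" "ennreal e < emeasure lebesgue S"
  proof -
    obtain z where z: "0 < z" "z < emeasure lebesgue S" using dense[OF Spos] by blast
    then have "z < top" using top_greatest less_le_trans by blast
    then show thesis using z by (intro that[of "enn2real z"]) (auto simp: enn2real_positive_iff)
  qed
  obtain T where T: "closed T" "T \<subseteq> S" "S - T \<in> lmeasurable" "emeasure lebesgue (S - T) < ennreal e"
    using sets_lebesgue_inner_closed[OF SL e(1)] by metis
  have TB: "T \<subseteq> B" using T(2) by (auto simp: S_def)
  then have Tc: "compact T" using T(1) B(1) by (metis closed_Int_compact inf.absorb1)
  have TL: "T \<in> sets lebesgue" using lmeasurable_compact[OF Tc] by auto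
  have Tnn: "T \<notin> null_sets lebesgue"
  proof
    assume "T \<in> null_sets lebesgue"
    then have "emeasure lebesgue (S - T) = emeasure lebesgue S" using SL by (intro emeasure_Diff_null_set)
    then show False using T(4) e(2) by simp
  qed
  then have Tne: "T \<noteq> {}" by auto
  obtain \<zeta>0 W where \<zeta>0: "\<zeta>0 \<in> test_functions E" and W: "open W" "T \<subseteq> W" "W \<subseteq> E" "\<And>x. x \<in> W \<Longrightarrow> \<zeta>0 x = 1"
    using smooth_Urysohn[OF Tc E] TB B(2) by (metis subset_trans)
  obtain K where K: "compact K" "K \<subseteq> E" "\<And>x. x \<notin> K \<Longrightarrow> \<zeta>0 x = 0"
    using test_functions_support[OF \<zeta>0] by metis
  have WK: "W \<subseteq> K" using W(4) K(3) by force
  define U where "U n = W \<inter> {x. infdist x T < 1 / real (Suc n)}" for n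
  have U_open: "open (U n)" for n
    unfolding U_def by (intro open_Int W open_Collect_less continuous_intros)
  have TU: "T \<subseteq> U n" for n using W(2) by (auto simp: U_def)
  have "\<exists>\<zeta>. \<zeta> \<in> test_functions (U n) \<and> (\<forall>x. 0 \<le> \<zeta> x \<and> \<zeta> x \<le> 1) \<and> (\<forall>x\<in>T. \<zeta> x = 1)" for n
    by (rule smooth_Urysohn[OF Tc U_open[of n] TU[of n]]) blast
  then obtain \<zeta> where \<zeta>: "\<And>n. \<zeta> n \<in> test_functions (U n)" "\<And>n x. 0 \<le> \<zeta> n x" "\<And>n x. \<zeta> n x \<le> 1"
      "\<And>n x. x \<in> T \<Longrightarrow> \<zeta> n x = 1" by metis
  have \<zeta>_out: "\<zeta> n x = 0" if "x \<notin> U n" for n x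
    using test_functions_support[OF \<zeta>(1)[of n]] that by (metis subsetD)
  have UE: "U n \<subseteq> E" for n using W(3) by (auto simp: U_def)
  have gK: "integrable (leb K) g" using g K by (auto simp: locally_integrable_def)
  have KL: "K \<in> sets lebesgue" using lmeasurable_compact[OF K(1)] by auto
  have z: "(LINT x|leb K. g x * \<zeta> n x) = 0" for n
  proof -
    have "(LINT x|leb K. g x * \<zeta> n x) = (LINT x|leb E. g x * \<zeta> n x)"
      by (rule lebesgue_on_extension_by_zero(3)[OF KL EL]) (use K(2) WK \<zeta>_out in \<open>auto simp: U_def\<close>)
    also have "\<dots> = 0" using zero test_functions_mono[OF UE] \<zeta>(1) by blast
    finally show ?thesis .
  qed
  have "(\<lambda>n. LINT x|leb K. g x * \<zeta> n x) \<longlonglongrightarrow> (LINT x|leb K. g x * indicator T x)"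
  proof (rule integral_dominated_convergence)
    have [measurable]: "g \<in> borel_measurable (leb K)" using gK by auto
    have [measurable]: "\<zeta> n \<in> borel_measurable (leb K)" for n
      using smooth_continuous[OF test_functions_smooth[OF \<zeta>(1)]]
      by (rule continuous_borel_measurable_leb)
    have [measurable]: "(indicator T :: _ \<Rightarrow> real) \<in> borel_measurable (leb K)"
      using TL by (intro measurable_restrict_space1 borel_measurable_indicator)
    show "(\<lambda>x. g x * indicator T x) \<in> borel_measurable (leb K)" by measurable
    show "(\<lambda>x. g x * \<zeta> n x) \<in> borel_measurable (leb K)" for n by measurable
    show "integrable (leb K) (\<lambda>x. norm (g x))" using gK by simp
    show "AE x in leb K. norm (g x * \<zeta> n x) \<le> norm (g x)" for n
      using \<zeta>(2,3) by (auto simp: abs_mult intro!: AE_I2 mult_left_le)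
    show "AE x in leb K. (\<lambda>n. g x * \<zeta> n x) \<longlonglongrightarrow> g x * indicator T x"
    proof (rule AE_I2)
      fix x
      have "(\<lambda>n. \<zeta> n x) \<longlonglongrightarrow> indicator T x"
      proof (cases "x \<in> T")
        case True
        then show ?thesis using \<zeta>(4) by simp
      next
        case False
        then have "0 < infdist x T" using infdist_pos_not_in_closed[OF T(1) Tne] by blast
        then obtain N where N: "1 / real (Suc N) < infdist x T"
          using nat_approx_posE by blast
        have "\<zeta> n x = 0" if "n \<ge> N" for n
        proof -
          have "1 / real (Suc n) \<le> 1 / real (Suc N)" using that by (simp add: field_simps)
          then have "x \<notin> U n" using N by (auto simp: U_def)
          then show ?thesis by (rule \<zeta>_out)
        qed
        then have "eventually (\<lambda>n. \<zeta> n x = indicator T x) sequentially"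
          using False by (auto simp: eventually_sequentially)
        then show ?thesis by (rule tendsto_eventually)
      qed
      then show "(\<lambda>n. g x * \<zeta> n x) \<longlonglongrightarrow> g x * indicator T x" by (intro tendsto_intros)
    qed
  qed
  then have "(LINT x|leb K. g x * indicator T x) = 0" by (simp add: z LIMSEQ_const_iff)
  moreover have "(LINT x|leb K. g x * indicator T x) = (LINT x|leb T. g x)"
    by (rule lebesgue_on_extension_by_zero(3)[OF KL TL]) (use W(2) WK in auto)
  moreover have gT: "integrable (leb T) g"
    using g Tc TB B(2) unfolding locally_integrable_def by blast
  moreover have g_pos: "0 < g x" if "x \<in> T" for x using that T(2) by (auto simp: S_def)
  moreover have "AE x in leb T. 0 \<le> g x"
    using g_pos by (intro AE_I2) (simp add: less_imp_le)
  ultimately have "AE x in leb T. g x = 0"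
    using integral_nonneg_eq_0_iff_AE[OF gT] by simp
  moreover have "AE x in leb T. g x \<noteq> 0" by (rule AE_I2) (auto dest: g_pos)
  ultimately have "AE x in leb T. False" by eventually_elim simp
  then have "AE x in lebesgue. x \<notin> T" using TL by (simp add: AE_restrict_space_iff)
  then show False using Tnn TL by (simp add: AE_iff_null_sets)
qed

lemma zero_AE_if_test_integrals_vanish:
  fixes g :: "'a::euclidean_space \<Rightarrow> real"
  assumes E: "open E" and g: "locally_integrable E g"
    and zero: "\<And>\<psi>. \<psi> \<in> test_functions E \<Longrightarrow> (LINT x|leb E. g x * \<psi> x) = 0"
  shows "AE x in leb E. g x = 0"
proof -
  obtain D where D: "countable D" "D \<subseteq> Pow E" "\<And>X. X \<in> D \<Longrightarrow> \<exists>a b. X = cbox a b" "\<Union>D = E"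
    using open_countable_Union_open_cbox[OF E] by metis
  have g': "locally_integrable E (\<lambda>x. - g x)" using g by (auto simp: locally_integrable_def)
  have "AE x in lebesgue. x \<in> B \<longrightarrow> g x = 0" if "B \<in> D" for B
  proof -
    have B: "compact B" "B \<subseteq> E" using D that by (force simp: compact_cbox)+
    have BL: "B \<in> sets lebesgue" using lmeasurable_compact[OF B(1)] by auto
    have "AE x in leb B. g x \<le> 0"
      by (rule nonpos_AE_if_test_integrals_vanish[OF E g zero B])
    moreover have "AE x in leb B. - g x \<le> 0"
      by (rule nonpos_AE_if_test_integrals_vanish[OF E g' _ B]) (simp add: zero)
    ultimately have "AE x in leb B. g x = 0" by eventually_elim simp
    then show ?thesis using BL by (simp add: AE_restrict_space_iff)
  qed
  then have "AE x in lebesgue. \<forall>B\<in>D. x \<in> B \<longrightarrow> g x = 0" by (rule AE_ball_countable'[OF _ D(1)])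
  then have "AE x in lebesgue. x \<in> E \<longrightarrow> g x = 0"
    by eventually_elim (use D(4) in blast)
  then show ?thesis using E by (simp add: AE_restrict_space_iff)
qed

lemma AE_eq_if_test_integrals_eq:
  fixes f g :: "'a::euclidean_space \<Rightarrow> real"
  assumes E: "open E" and f: "locally_integrable E f" and g: "locally_integrable E g"
    and eq: "\<And>\<psi>. \<psi> \<in> test_functions E \<Longrightarrow> (LINT x|leb E. f x * \<psi> x) = (LINT x|leb E. g x * \<psi> x)"
  shows "AE x in leb E. f x = g x"
proof -
  have int: "integrable (leb E) (\<lambda>x. h x * \<psi> x)" if h: "locally_integrable E h" and \<psi>: "\<psi> \<in> test_functions E" for h \<psi>
  proof -
    obtain K where K: "compact K" "K \<subseteq> E" "\<And>x. x \<notin> K \<Longrightarrow> \<psi> x = 0"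
      using test_functions_support[OF \<psi>] by metis
    show ?thesis
      by (rule integrable_mult_continuous_compact_support[OF _ K(1,2) smooth_continuous[OF test_functions_smooth[OF \<psi>]] K(3)])
        (use h K E in \<open>auto simp: locally_integrable_def\<close>)
  qed
  have "AE x in leb E. f x - g x = 0"
  proof (rule zero_AE_if_test_integrals_vanish[OF E])
    show "locally_integrable E (\<lambda>x. f x - g x)" using f g by (auto simp: locally_integrable_def)
    show "(LINT x|leb E. (f x - g x) * \<psi> x) = 0" if "\<psi> \<in> test_functions E" for \<psi>
      using int[OF f that] int[OF g that] eq[OF that] by (simp add: left_diff_distrib)
  qed
  then show ?thesis by simp
qed

text \<open>The Riesz representative of a functional that is bounded in the \<open>L\<^sup>2\<close> norm of the test
  function is the weak derivative of \<open>b\<close> in the direction \<open>d\<close>.\<close>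
lemma test_functional_representation:
  fixes b :: "'a::euclidean_space \<Rightarrow> real"
  assumes E: "open E" and b: "L2_fun (leb E) b"
    and bound: "\<And>\<psi>. \<psi> \<in> test_functions E \<Longrightarrow>
      \<bar>LINT x|leb E. b x * dderiv \<psi> x d\<bar> \<le> C * norm2 (leb E) \<psi>"
    and C: "0 \<le> C"
  obtains v where "L2_fun (leb E) v" "norm2 (leb E) v \<le> C"
    "\<And>\<psi>. \<psi> \<in> test_functions E \<Longrightarrow>
      (LINT x|leb E. b x * dderiv \<psi> x d) = - (LINT x|leb E. v x * \<psi> x)"
proof -
  have EL: "E \<in> sets lebesgue" using E by auto
  define l where "l \<psi> = - (LINT x|leb E. b x * dderiv \<psi> x d)" for \<psi>
  show thesis
  proof (rule Riesz_representation_on_subspace[of "test_functions E" "leb E" l C])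
    show "L2_fun (leb E) \<psi>" if "\<psi> \<in> test_functions E" for \<psi>
      using that EL by (rule L2_fun_test_function)
    show "(\<lambda>x. 0) \<in> test_functions E" by (rule zero_test_function)
    fix \<psi> assume \<psi>: "\<psi> \<in> test_functions E"
    show "\<bar>l \<psi>\<bar> \<le> C * norm2 (leb E) \<psi>" using bound[OF \<psi>] by (simp add: l_def)
    fix \<xi> t assume \<xi>: "\<xi> \<in> test_functions E"
    have int: "integrable (leb E) (\<lambda>x. b x * dderiv \<psi> x d)"
        "integrable (leb E) (\<lambda>x. b x * dderiv \<xi> x d)"
      using L2_fun_dderiv_test_function[OF \<psi> EL]
        L2_fun_dderiv_test_function[OF \<xi> EL]
      by (auto intro: integrable_mult_L2_fun[OF b])
    have "(LINT x|leb E. b x * dderiv (\<lambda>x. \<psi> x + t * \<xi> x) x d)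
      = (LINT x|leb E. b x * dderiv \<psi> x d + t * (b x * dderiv \<xi> x d))"
      using test_functions_smooth[OF \<psi>] test_functions_smooth[OF \<xi>]
      by (simp add: dderiv_linear_comb algebra_simps)
    also have "\<dots> = (LINT x|leb E. b x * dderiv \<psi> x d)
        + t * (LINT x|leb E. b x * dderiv \<xi> x d)"
      using int by simp
    finally show "(\<lambda>x. \<psi> x + t * \<xi> x) \<in> test_functions E \<and> l (\<lambda>x. \<psi> x + t * \<xi> x) = l \<psi> + t * l \<xi>"
      using test_functions_add_scale[OF \<psi> \<xi>] by (simp add: l_def)
  next
    fix v assume "L2_fun (leb E) v" "norm2 (leb E) v \<le> C"
      "\<And>\<psi>. \<psi> \<in> test_functions E \<Longrightarrow> l \<psi> = (LINT x|leb E. v x * \<psi> x)"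
    then show thesis by (intro that[of v]) (auto simp: l_def minus_equation_iff)
  qed (rule C)
qed

lemma norm2_le_if_test_integrals_le:
  fixes g :: "'a::euclidean_space \<Rightarrow> real"
  assumes E: "open E" and g: "L2_fun (leb E) g"
    and bound: "\<And>\<psi>. \<psi> \<in> test_functions E \<Longrightarrow>
      \<bar>LINT x|leb E. g x * \<psi> x\<bar> \<le> C * norm2 (leb E) \<psi>"
    and C: "0 \<le> C"
  shows "norm2 (leb E) g \<le> C"
proof -
  have EL: "E \<in> sets lebesgue" using E by auto
  define l where "l \<psi> = (LINT x|leb E. g x * \<psi> x)" for \<psi>
  show ?thesis
  proof (rule Riesz_representation_on_subspace[of "test_functions E" "leb E" l C])
    show sq: "L2_fun (leb E) \<psi>" if "\<psi> \<in> test_functions E" for \<psi>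
      using that EL by (rule L2_fun_test_function)
    show "(\<lambda>x. 0) \<in> test_functions E" by (rule zero_test_function)
    fix \<psi> assume \<psi>: "\<psi> \<in> test_functions E"
    show "\<bar>l \<psi>\<bar> \<le> C * norm2 (leb E) \<psi>" using bound[OF \<psi>] by (simp add: l_def)
    fix \<xi> t assume \<xi>: "\<xi> \<in> test_functions E"
    have "l (\<lambda>x. \<psi> x + t * \<xi> x) = (LINT x|leb E. g x * \<psi> x + t * (g x * \<xi> x))"
      by (simp add: l_def algebra_simps)
    also have "\<dots> = l \<psi> + t * l \<xi>"
      using integrable_mult_L2_fun[OF g sq[OF \<psi>]] integrable_mult_L2_fun[OF g sq[OF \<xi>]]
      by (simp add: l_def)
    finally show "(\<lambda>x. \<psi> x + t * \<xi> x) \<in> test_functions E \<and> l (\<lambda>x. \<psi> x + t * \<xi> x) = l \<psi> + t * l \<xi>"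
      using test_functions_add_scale[OF \<psi> \<xi>] by simp
  next
    fix v assume v: "L2_fun (leb E) v" "norm2 (leb E) v \<le> C"
      and rep: "\<And>\<psi>. \<psi> \<in> test_functions E \<Longrightarrow> l \<psi> = (LINT x|leb E. v x * \<psi> x)"
    have "AE x in leb E. g x = v x"
      using AE_eq_if_test_integrals_eq[OF E L2_fun_imp_locally_integrable[OF g EL]
        L2_fun_imp_locally_integrable[OF v(1) EL]] rep by (simp add: l_def)
    then have "norm2 (leb E) g = norm2 (leb E) v"
      using g v by (intro norm2_cong_AE L2_fun_measurable)
    then show ?thesis using v by simp
  qed (rule C)
qed

section \<open>Measure preserving shears and differentiation under the integral\<close>

definition preserves_lebesgue :: "('a::euclidean_space \<Rightarrow> 'a) \<Rightarrow> bool"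
  where "preserves_lebesgue \<tau> \<longleftrightarrow> \<tau> \<in> lebesgue \<rightarrow>\<^sub>M lebesgue \<and> distr lebesgue lebesgue \<tau> = lebesgue"

lemma preserves_lebesgueI:
  fixes \<tau> :: "'a::euclidean_space \<Rightarrow> 'a"
  assumes meas: "\<tau> \<in> borel \<rightarrow>\<^sub>M borel" and dist: "distr lborel borel \<tau> = lborel"
  shows "preserves_lebesgue \<tau>"
proof -
  have 1: "\<tau> \<in> lebesgue \<rightarrow>\<^sub>M lborel" using meas by (intro measurable_completion) simp
  have 2: "distr lebesgue lborel \<tau> = lborel"
  proof -
    have "distr lebesgue lborel \<tau> = distr lborel lborel \<tau>" by (rule distr_completion) (use meas in simp)
    also have "\<dots> = distr lborel borel \<tau>" by (rule distr_cong) auto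
    finally show ?thesis using dist by simp
  qed
  show ?thesis unfolding preserves_lebesgue_def
  proof
    show "\<tau> \<in> lebesgue \<rightarrow>\<^sub>M lebesgue"
      by (rule completion.measurable_completion2[OF 1]) (simp add: 2)
    show "distr lebesgue lebesgue \<tau> = lebesgue"
      using completion.completion_distr_eq[OF 1] by (simp add: 2)
  qed
qed

lemma nn_integral_lborel_shift:
  fixes f :: "'a::euclidean_space \<Rightarrow> ennreal"
  assumes [measurable]: "f \<in> borel_measurable borel"
  shows "(\<integral>\<^sup>+x. f (x + c) \<partial>lborel) = (\<integral>\<^sup>+x. f x \<partial>lborel)"
proof -
  have "(\<integral>\<^sup>+x. f x \<partial>lborel) = (\<integral>\<^sup>+x. f x \<partial>distr lborel borel ((+) c))" by (simp add: lborel_distr_plus)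
  also have "\<dots> = (\<integral>\<^sup>+x. f (c + x) \<partial>lborel)" by (subst nn_integral_distr) auto
  finally show ?thesis by (simp add: add.commute)
qed

text \<open>Inserting the factor \<open>1 = \<integral> \<rho> (x \<bullet> e + s) ds\<close>, exchanging the integrals and translating by
  \<open>- s e\<close> leaves an inner integral over the whole line through \<open>x\<close> in direction \<open>e\<close>; that integral
  does not see the amount \<open>g x\<close> by which the line is shifted in itself.\<close>
lemma nn_integral_shear:
  fixes e :: "'a::euclidean_space" and f :: "'a \<Rightarrow> ennreal"
  assumes e: "norm e = 1" and g [measurable]: "g \<in> borel_measurable borel"
    and inv: "\<And>x s. g (x + s *\<^sub>R e) = g x" and f [measurable]: "f \<in> borel_measurable borel"
  shows "(\<integral>\<^sup>+x. f (x + g x *\<^sub>R e) \<partial>lborel) = (\<integral>\<^sup>+x. f x \<partial>lborel)"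
proof -
  define \<rho> where "\<rho> s = (indicator {0..1::real} s :: ennreal)" for s
  have [measurable]: "\<rho> \<in> borel_measurable borel" unfolding \<rho>_def by measurable
  have \<rho>1: "(\<integral>\<^sup>+s. \<rho> (c + s) \<partial>lborel) = 1" for c
  proof -
    have "(\<integral>\<^sup>+s. \<rho> (s + c) \<partial>lborel) = (\<integral>\<^sup>+s. \<rho> s \<partial>lborel)" by (rule nn_integral_lborel_shift) measurable
    also have "\<dots> = 1" by (simp add: \<rho>_def)
    finally show ?thesis by (simp add: add.commute)
  qed
  have ee: "e \<bullet> e = 1" using e by (simp add: power2_norm_eq_inner[symmetric])
  have *: "(\<integral>\<^sup>+x. f (x + h x *\<^sub>R e) \<partial>lborel) = (\<integral>\<^sup>+x. \<rho> (x \<bullet> e) * (\<integral>\<^sup>+s. f (x - s *\<^sub>R e) \<partial>lborel) \<partial>lborel)"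
    if h [measurable]: "h \<in> borel_measurable borel" and hinv: "\<And>x s. h (x + s *\<^sub>R e) = h x" for h
  proof -
    have hinv': "h (x - s *\<^sub>R e) = h x" for x s using hinv[of x "-s"] by simp
    have "(\<integral>\<^sup>+x. f (x + h x *\<^sub>R e) \<partial>lborel) = (\<integral>\<^sup>+x. (\<integral>\<^sup>+s. \<rho> (x \<bullet> e + s) * f (x + h x *\<^sub>R e) \<partial>lborel) \<partial>lborel)"
      by (subst nn_integral_multc) (auto simp: \<rho>1)
    also have "\<dots> = (\<integral>\<^sup>+s. (\<integral>\<^sup>+x. \<rho> (x \<bullet> e + s) * f (x + h x *\<^sub>R e) \<partial>lborel) \<partial>lborel)"
      by (rule lborel_pair.Fubini') measurable
    also have "\<dots> = (\<integral>\<^sup>+s. (\<integral>\<^sup>+x. \<rho> (x \<bullet> e) * f (x + (h x - s) *\<^sub>R e) \<partial>lborel) \<partial>lborel)"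
    proof (rule nn_integral_cong)
      fix s :: real
      have "(\<integral>\<^sup>+x. \<rho> (x \<bullet> e + s) * f (x + h x *\<^sub>R e) \<partial>lborel)
        = (\<integral>\<^sup>+x. \<rho> ((x + (- s *\<^sub>R e)) \<bullet> e + s) * f ((x + (- s *\<^sub>R e)) + h (x + (- s *\<^sub>R e)) *\<^sub>R e) \<partial>lborel)"
        by (rule nn_integral_lborel_shift[symmetric]) measurable
      then show "(\<integral>\<^sup>+x. \<rho> (x \<bullet> e + s) * f (x + h x *\<^sub>R e) \<partial>lborel)
        = (\<integral>\<^sup>+x. \<rho> (x \<bullet> e) * f (x + (h x - s) *\<^sub>R e) \<partial>lborel)"
        by (simp add: hinv' inner_diff_left ee algebra_simps)
    qed
    also have "\<dots> = (\<integral>\<^sup>+x. (\<integral>\<^sup>+s. \<rho> (x \<bullet> e) * f (x + (h x - s) *\<^sub>R e) \<partial>lborel) \<partial>lborel)"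
      by (rule lborel_pair.Fubini'[symmetric]) measurable
    also have "\<dots> = (\<integral>\<^sup>+x. \<rho> (x \<bullet> e) * (\<integral>\<^sup>+s. f (x - s *\<^sub>R e) \<partial>lborel) \<partial>lborel)"
    proof (rule nn_integral_cong)
      fix x :: 'a
      have "(\<integral>\<^sup>+s. f (x - s *\<^sub>R e) \<partial>lborel) = (\<integral>\<^sup>+s. f (x - (s + (- h x)) *\<^sub>R e) \<partial>lborel)"
        by (rule nn_integral_lborel_shift[symmetric]) measurable
      then show "(\<integral>\<^sup>+s. \<rho> (x \<bullet> e) * f (x + (h x - s) *\<^sub>R e) \<partial>lborel)
        = \<rho> (x \<bullet> e) * (\<integral>\<^sup>+s. f (x - s *\<^sub>R e) \<partial>lborel)"
        by (subst nn_integral_cmult) (auto simp: algebra_simps)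
    qed
    finally show ?thesis .
  qed
  show ?thesis using *[OF g inv] *[of "\<lambda>_. 0"] by simp
qed

lemma preserves_lebesgue_shear:
  fixes e :: "'a::euclidean_space"
  assumes e: "norm e = 1" and g [measurable]: "g \<in> borel_measurable borel"
    and inv: "\<And>x s. g (x + s *\<^sub>R e) = g x"
  shows "preserves_lebesgue (\<lambda>x. x + g x *\<^sub>R e)"
proof (rule preserves_lebesgueI)
  show m [measurable]: "(\<lambda>x. x + g x *\<^sub>R e) \<in> borel \<rightarrow>\<^sub>M borel" by measurable
  show "distr lborel borel (\<lambda>x. x + g x *\<^sub>R e) = lborel"
  proof (rule measure_eqI)
    fix A :: "'a set" assume "A \<in> sets (distr lborel borel (\<lambda>x. x + g x *\<^sub>R e))"
    then have A [measurable]: "A \<in> sets borel" by simp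
    have "emeasure (distr lborel borel (\<lambda>x. x + g x *\<^sub>R e)) A = (\<integral>\<^sup>+x. indicator A x \<partial>distr lborel borel (\<lambda>x. x + g x *\<^sub>R e))"
      by simp
    also have "\<dots> = (\<integral>\<^sup>+x. indicator A (x + g x *\<^sub>R e) \<partial>lborel)"
      by (subst nn_integral_distr) auto
    also have "\<dots> = (\<integral>\<^sup>+x. indicator A x \<partial>lborel)"
      by (rule nn_integral_shear[OF e g inv]) measurable
    finally show "emeasure (distr lborel borel (\<lambda>x. x + g x *\<^sub>R e)) A = emeasure lborel A" by simp
  qed simp
qed

lemma preserves_lebesgue_translation: "preserves_lebesgue (\<lambda>x. x + c)"
proof (rule preserves_lebesgueI)
  show "distr lborel borel (\<lambda>x. x + c) = lborel"
    using lborel_distr_plus[of c] unfolding add.commute[of c, abs_def] .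
qed simp

lemma preserves_lebesgue_comp:
  assumes "preserves_lebesgue \<sigma>" "preserves_lebesgue \<tau>"
  shows "preserves_lebesgue (\<lambda>x. \<sigma> (\<tau> x))"
proof -
  have m [measurable]: "\<sigma> \<in> lebesgue \<rightarrow>\<^sub>M lebesgue" "\<tau> \<in> lebesgue \<rightarrow>\<^sub>M lebesgue"
    using assms by (auto simp: preserves_lebesgue_def)
  have "distr lebesgue lebesgue (\<lambda>x. \<sigma> (\<tau> x)) = distr (distr lebesgue lebesgue \<tau>) lebesgue \<sigma>"
    by (subst distr_distr) (auto simp: comp_def m)
  also have "\<dots> = lebesgue" using assms by (simp add: preserves_lebesgue_def)
  finally show ?thesis using measurable_compose[OF m(2) m(1)] by (simp add: preserves_lebesgue_def)
qed

lemma preserves_lebesgue_on: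
  fixes \<tau> :: "'a::euclidean_space \<Rightarrow> 'a"
  assumes \<tau>: "preserves_lebesgue \<tau>" and E: "E \<in> sets lebesgue" and F: "F \<in> sets lebesgue"
    and EF: "\<And>x. x \<in> E \<longleftrightarrow> \<tau> x \<in> F"
  shows "\<tau> \<in> leb E \<rightarrow>\<^sub>M leb F"
    and "distr (leb E) (leb F) \<tau> = leb F"
proof -
  have m: "\<tau> \<in> lebesgue \<rightarrow>\<^sub>M lebesgue" using \<tau> by (simp add: preserves_lebesgue_def)
  show m2: "\<tau> \<in> leb E \<rightarrow>\<^sub>M leb F"
    by (rule measurable_restrict_space3[OF m]) (use EF in auto)
  show "distr (leb E) (leb F) \<tau> = leb F"
  proof (rule measure_eqI)
    fix A assume "A \<in> sets (distr (leb E) (leb F) \<tau>)"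
    then have A: "A \<in> sets (leb F)" by simp
    then have AF: "A \<subseteq> F" "A \<in> sets lebesgue" using F by (auto simp: sets_restrict_space_iff)
    have "emeasure (distr (leb E) (leb F) \<tau>) A = emeasure (leb E) (\<tau> -` A \<inter> E)"
      using emeasure_distr[OF m2 A] by simp
    also have "\<tau> -` A \<inter> E = \<tau> -` A" using EF AF by auto
    also have "emeasure (leb E) (\<tau> -` A) = emeasure lebesgue (\<tau> -` A)"
      using EF AF E by (intro emeasure_restrict_space) auto
    also have "\<dots> = emeasure (distr lebesgue lebesgue \<tau>) A"
      using emeasure_distr[OF m AF(2)] by simp
    also have "\<dots> = emeasure lebesgue A" using \<tau> by (simp add: preserves_lebesgue_def)
    also have "\<dots> = emeasure (leb F) A" using AF F by (simp add: emeasure_restrict_space)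
    finally show "emeasure (distr (leb E) (leb F) \<tau>) A = emeasure (leb F) A" .
  qed simp
qed

lemma preserves_lebesgue_integral:
  fixes \<tau> :: "'a::euclidean_space \<Rightarrow> 'a" and f :: "'a \<Rightarrow> 'b::euclidean_space"
  assumes \<tau>: "preserves_lebesgue \<tau>" and E: "E \<in> sets lebesgue" and F: "F \<in> sets lebesgue"
    and EF: "\<And>x. x \<in> E \<longleftrightarrow> \<tau> x \<in> F" and f: "f \<in> borel_measurable (leb F)"
  shows "(\<lambda>x. f (\<tau> x)) \<in> borel_measurable (leb E)"
    and "integrable (leb E) (\<lambda>x. f (\<tau> x)) \<longleftrightarrow> integrable (leb F) f"
    and "(LINT x|leb E. f (\<tau> x)) = (LINT x|leb F. f x)"
proof -
  note P = preserves_lebesgue_on[OF \<tau> E F EF]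
  show "(\<lambda>x. f (\<tau> x)) \<in> borel_measurable (leb E)" by (rule measurable_compose[OF P(1) f])
  show "integrable (leb E) (\<lambda>x. f (\<tau> x)) \<longleftrightarrow> integrable (leb F) f"
    using integrable_distr_eq[OF P(1) f] by (simp add: P(2))
  show "(LINT x|leb E. f (\<tau> x)) = (LINT x|leb F. f x)"
    using integral_distr[OF P(1) f] by (simp add: P(2))
qed

lemma preserves_lebesgue_L2_fun:
  fixes \<tau> :: "'a::euclidean_space \<Rightarrow> 'a" and f :: "'a \<Rightarrow> 'b::euclidean_space"
  assumes \<tau>: "preserves_lebesgue \<tau>" and E: "E \<in> sets lebesgue" and F: "F \<in> sets lebesgue"
    and EF: "\<And>x. x \<in> E \<longleftrightarrow> \<tau> x \<in> F" and f: "L2_fun (leb F) f"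
  shows "L2_fun (leb E) (\<lambda>x. f (\<tau> x))"
    and "norm2 (leb E) (\<lambda>x. f (\<tau> x)) = norm2 (leb F) f"
proof -
  have m: "f \<in> borel_measurable (leb F)" "(\<lambda>x. (norm (f x))\<^sup>2) \<in> borel_measurable (leb F)"
    using L2_fun_measurable[OF f] by auto
  show "L2_fun (leb E) (\<lambda>x. f (\<tau> x))"
    using preserves_lebesgue_integral[OF \<tau> E F EF m(1)] preserves_lebesgue_integral[OF \<tau> E F EF m(2)] f
    by (simp add: L2_fun_def)
  show "norm2 (leb E) (\<lambda>x. f (\<tau> x)) = norm2 (leb F) f"
    using preserves_lebesgue_integral[OF \<tau> E F EF m(2)] by (simp add: norm2_def)
qed

text \<open>By the mean value theorem the difference quotients are dominated by \<open>w\<close>.\<close>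
lemma has_real_derivative_integral:
  fixes F F' :: "real \<Rightarrow> 'a \<Rightarrow> real"
  assumes e: "0 < e"
    and int: "\<And>s. \<bar>s - s0\<bar> < e \<Longrightarrow> integrable M (F s)"
    and deriv: "\<And>s x. \<bar>s - s0\<bar> < e \<Longrightarrow> x \<in> space M \<Longrightarrow> ((\<lambda>s. F s x) has_real_derivative F' s x) (at s)"
    and bound: "\<And>s x. \<bar>s - s0\<bar> < e \<Longrightarrow> x \<in> space M \<Longrightarrow> \<bar>F' s x\<bar> \<le> w x"
    and w: "integrable M w" and F': "F' s0 \<in> borel_measurable M"
  shows "((\<lambda>s. LINT x|M. F s x) has_real_derivative (LINT x|M. F' s0 x)) (at s0)"
  unfolding DERIV_def tendsto_at_iff_sequentially
proof (intro allI impI)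
  fix X :: "nat \<Rightarrow> real" assume X0: "\<forall>i. X i \<in> UNIV - {0}" and X: "X \<longlonglongrightarrow> 0"
  define Q where "Q i x = (if \<bar>X i\<bar> < e then (F (s0 + X i) x - F s0 x) / X i else F' s0 x)" for i x
  have ev: "eventually (\<lambda>i. \<bar>X i\<bar> < e) sequentially"
    using X e by (auto simp: tendsto_iff dist_real_def)
  have [measurable]: "F s \<in> borel_measurable M" if "\<bar>s - s0\<bar> < e" for s
    using int[OF that] by auto
  have Q_meas: "Q i \<in> borel_measurable M" for i
    using e F' by (cases "\<bar>X i\<bar> < e") (auto simp: Q_def[abs_def] intro!: borel_measurable_divide borel_measurable_diff)
  have "(\<lambda>i. LINT x|M. Q i x) \<longlonglongrightarrow> (LINT x|M. F' s0 x)"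
  proof (rule integral_dominated_convergence[where w=w])
    show "AE x in M. (\<lambda>i. Q i x) \<longlonglongrightarrow> F' s0 x"
    proof (rule AE_I2)
      fix x assume x: "x \<in> space M"
      have "((\<lambda>h. (F (s0 + h) x - F s0 x) / h) \<longlongrightarrow> F' s0 x) (at 0)"
        using deriv[OF _ x, of s0] e by (simp add: DERIV_def)
      then have "((\<lambda>h. (F (s0 + h) x - F s0 x) / h) \<circ> X) \<longlonglongrightarrow> F' s0 x"
        using X0 X unfolding tendsto_at_iff_sequentially by blast
      then show "(\<lambda>i. Q i x) \<longlonglongrightarrow> F' s0 x"
        by (rule Lim_transform_eventually) (use ev in eventually_elim, simp add: Q_def)
    qed
    show "AE x in M. norm (Q i x) \<le> w x" for i
    proof (rule AE_I2)
      fix x assume x: "x \<in> space M"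
      show "norm (Q i x) \<le> w x"
      proof (cases "\<bar>X i\<bar> < e")
        case True
        have "norm (F (s0 + X i) x - F s0 x) \<le> w x * norm ((s0 + X i) - s0)"
        proof (rule field_differentiable_bound[of "{s0 - e<..<s0 + e}"])
          show "((\<lambda>s. F s x) has_real_derivative F' s x) (at s within {s0 - e<..<s0 + e})"
            if "s \<in> {s0 - e<..<s0 + e}" for s
            by (rule has_field_derivative_at_within, rule deriv) (use that x in auto)
          show "norm (F' s x) \<le> w x" if "s \<in> {s0 - e<..<s0 + e}" for s
            using that x bound[of s x] by auto
        qed (use True e in auto)
        then have "\<bar>F (s0 + X i) x - F s0 x\<bar> \<le> w x * \<bar>X i\<bar>" by simp
        moreover have "0 < \<bar>X i\<bar>" using X0 by simp
        ultimately have "\<bar>F (s0 + X i) x - F s0 x\<bar> / \<bar>X i\<bar> \<le> w x" by (simp only: pos_divide_le_eq)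
        then show ?thesis using True by (simp add: Q_def)
      next
        case False then show ?thesis using bound[of s0 x] e x by (simp add: Q_def)
      qed
    qed
  qed (use w F' Q_meas in auto)
  then show "((\<lambda>h. ((LINT x|M. F (s0 + h) x) - (LINT x|M. F s0 x)) / h) \<circ> X) \<longlonglongrightarrow> (LINT x|M. F' s0 x)"
  proof (rule Lim_transform_eventually)
    show "\<forall>\<^sub>F i in sequentially. (LINT x|M. Q i x) = ((\<lambda>h. ((LINT x|M. F (s0 + h) x) - (LINT x|M. F s0 x)) / h) \<circ> X) i"
      using ev
    proof eventually_elim
      case (elim i)
      then have "integrable M (F (s0 + X i))" "integrable M (F s0)" using e by (auto intro!: int)
      then show ?case using elim by (simp add: Q_def)
    qed
  qed
qed

section \<open>Weak gradients in \<open>L\<^sup>2\<close>\<close>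

definition L2_weak_gradient :: "'a::euclidean_space set \<Rightarrow> ('a \<Rightarrow> real) \<Rightarrow> ('a \<Rightarrow> 'a) \<Rightarrow> bool"
  where "L2_weak_gradient E v G \<longleftrightarrow>
    L2_fun (leb E) v \<and> L2_fun (leb E) G \<and>
    (\<forall>\<psi>\<in>test_functions E. \<forall>d.
      (LINT x|leb E. v x * dderiv \<psi> x d) = - (LINT x|leb E. (G x \<bullet> d) * \<psi> x))"

lemma dderiv_Basis_sum:
  assumes "\<psi> differentiable (at x)"
  shows "dderiv \<psi> x d = (\<Sum>i\<in>Basis. (d \<bullet> i) *\<^sub>R dderiv \<psi> x i)"
proof -
  have l: "linear (dderiv \<psi> x)"
    using assms by (rule linear_frechet_derivative)
  have "dderiv \<psi> x d = dderiv \<psi> x (\<Sum>i\<in>Basis. (d \<bullet> i) *\<^sub>R i)"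
    by (simp add: euclidean_representation)
  also have "\<dots> = (\<Sum>i\<in>Basis. (d \<bullet> i) *\<^sub>R dderiv \<psi> x i)"
    by (simp add: linear_sum[OF l] linear_cmul[OF l])
  finally show ?thesis .
qed

lemma smooth_differentiable: "smooth \<psi> \<Longrightarrow> \<psi> differentiable (at x)"
  using Ck_differentiable by blast

lemma L2_fun_inner_const:
  assumes "L2_fun M G" shows "L2_fun M (\<lambda>x. G x \<bullet> d)"
proof (rule L2_fun_mono[OF assms, of _ "norm d"])
  have [measurable]: "G \<in> borel_measurable M" using assms by (rule L2_fun_measurable)
  show "(\<lambda>x. G x \<bullet> d) \<in> borel_measurable M" by measurable
  show "AE x in M. norm (G x \<bullet> d) \<le> norm d * norm (G x)"
    using Cauchy_Schwarz_ineq2 by (intro AE_I2) (simp add: mult.commute[of "norm d"])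
qed

lemma norm2_inner_const_le:
  assumes "L2_fun M G" shows "norm2 M (\<lambda>x. G x \<bullet> d) \<le> norm d * norm2 M G"
proof (rule norm2_mono[OF assms])
  have [measurable]: "G \<in> borel_measurable M" using assms by (rule L2_fun_measurable)
  show "(\<lambda>x. G x \<bullet> d) \<in> borel_measurable M" by measurable
  show "AE x in M. norm (G x \<bullet> d) \<le> norm d * norm (G x)"
    using Cauchy_Schwarz_ineq2 by (intro AE_I2) (simp add: mult.commute[of "norm d"])
qed simp

lemma L2_fun_componentwise:
  "L2_fun M G \<longleftrightarrow> (\<forall>i\<in>Basis. L2_fun M (\<lambda>x. G x \<bullet> i))"
proof
  assume c: "\<forall>i\<in>Basis. L2_fun M (\<lambda>x. G x \<bullet> i)"
  then have "L2_fun M (\<lambda>x. (G x \<bullet> i) *\<^sub>R i)" if "i \<in> Basis" for i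
    using that by (intro L2_fun_mono[of M "\<lambda>x. G x \<bullet> i" "\<lambda>x. (G x \<bullet> i) *\<^sub>R i" 1])
      (auto dest!: bspec L2_fun_measurable)
  then have "L2_fun M (\<lambda>x. \<Sum>i\<in>Basis. (G x \<bullet> i) *\<^sub>R i)"
    by (intro L2_fun_sum) auto
  then show "L2_fun M G" by (simp add: euclidean_representation)
qed (auto intro: L2_fun_inner_const)

lemma norm2_square_componentwise:
  assumes "L2_fun M G"
  shows "(norm2 M G)\<^sup>2 = (\<Sum>i\<in>Basis. (norm2 M (\<lambda>x. G x \<bullet> i))\<^sup>2)"
proof -
  have "(norm (G x))\<^sup>2 = (\<Sum>i\<in>Basis. (norm (G x \<bullet> i))\<^sup>2)" for x
    unfolding power2_norm_eq_inner euclidean_inner[of "G x" "G x"] by (simp add: power2_eq_square)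
  then show ?thesis
    unfolding norm2_square
    using L2_fun_integrable[OF L2_fun_inner_const[OF assms]]
    by (simp add: Bochner_Integration.integral_sum)
qed

lemma L2_space_iff: "u \<in> L2_space E \<longleftrightarrow> L2_fun (leb E) u"
  by (simp add: L2_space_def L2_fun_def)

lemma norm_L2_eq: "norm_L2 E u = norm2 (leb E) u"
  by (simp add: norm_L2_def norm2_def)

lemma L2_weak_gradientI_Basis:
  assumes E: "open E" and v: "L2_fun (leb E) v" and G: "L2_fun (leb E) G"
    and *: "\<And>\<psi> i. \<psi> \<in> test_functions E \<Longrightarrow> i \<in> Basis \<Longrightarrow>
      (LINT x|leb E. v x * dderiv \<psi> x i) = - (LINT x|leb E. (G x \<bullet> i) * \<psi> x)"
  shows "L2_weak_gradient E v G"
  unfolding L2_weak_gradient_def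
proof (intro conjI ballI allI v G)
  fix \<psi> d assume \<psi>: "\<psi> \<in> test_functions E"
  have EL: "E \<in> sets lebesgue" using E by auto
  have "(LINT x|leb E. v x * dderiv \<psi> x d)
      = (LINT x|leb E. (\<Sum>i\<in>Basis. (d \<bullet> i) * (v x * dderiv \<psi> x i)))"
    by (subst dderiv_Basis_sum[OF smooth_differentiable[OF test_functions_smooth[OF \<psi>]]])
      (simp add: sum_distrib_left algebra_simps)
  also have "\<dots> = (\<Sum>i\<in>Basis. (d \<bullet> i) * (LINT x|leb E. v x * dderiv \<psi> x i))"
    using integrable_mult_L2_fun[OF v L2_fun_dderiv_test_function[OF \<psi> EL]]
    by (subst Bochner_Integration.integral_sum) auto
  also have "\<dots> = - (\<Sum>i\<in>Basis. (d \<bullet> i) * (LINT x|leb E. (G x \<bullet> i) * \<psi> x))"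
    using *[OF \<psi>] by (simp add: sum_negf)
  also have "(\<Sum>i\<in>Basis. (d \<bullet> i) * (LINT x|leb E. (G x \<bullet> i) * \<psi> x))
      = (LINT x|leb E. (\<Sum>i\<in>Basis. (d \<bullet> i) * ((G x \<bullet> i) * \<psi> x)))"
    using integrable_mult_L2_fun[OF L2_fun_inner_const[OF G] L2_fun_test_function[OF \<psi> EL]]
    by (subst Bochner_Integration.integral_sum) auto
  also have "\<dots> = (LINT x|leb E. (G x \<bullet> d) * \<psi> x)"
    by (rule Bochner_Integration.integral_cong[OF refl])
      (simp add: euclidean_inner[of "G _" d] sum_distrib_left sum_distrib_right algebra_simps)
  finally show "(LINT x|leb E. v x * dderiv \<psi> x d) = - (LINT x|leb E. (G x \<bullet> d) * \<psi> x)" .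
qed

lemma L2_weak_gradient_has_weak_gradient:
  assumes E: "open E" and w: "L2_weak_gradient E v G"
  shows "has_weak_gradient E v G"
proof -
  have EL: "E \<in> sets lebesgue" using E by auto
  show ?thesis
    using w L2_fun_inner_const[of "leb E" G]
    unfolding has_weak_gradient_def L2_weak_gradient_def
    by (auto intro!: L2_fun_imp_locally_integrable[OF _ EL])
qed

text \<open>Two weak gradients have the same integrals against all test functions.\<close>
lemma has_weak_gradient_unique:
  assumes E: "open E" and g: "has_weak_gradient E u g" and h: "has_weak_gradient E u h"
  shows "AE x in leb E. g x = h x"
proof -
  have "AE x in leb E. g x \<bullet> i = h x \<bullet> i" if i: "i \<in> Basis" for i
  proof (rule AE_eq_if_test_integrals_eq[OF E])
    show "locally_integrable E (\<lambda>x. g x \<bullet> i)" "locally_integrable E (\<lambda>x. h x \<bullet> i)"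
      using g h i by (auto simp: has_weak_gradient_def)
    fix \<psi> assume \<psi>: "\<psi> \<in> test_functions E"
    have "- (LINT x|leb E. g x \<bullet> i * \<psi> x) = - (LINT x|leb E. h x \<bullet> i * \<psi> x)"
      using g h i \<psi> unfolding has_weak_gradient_def by (metis (no_types, lifting))
    then show "(LINT x|leb E. g x \<bullet> i * \<psi> x) = (LINT x|leb E. h x \<bullet> i * \<psi> x)" by simp
  qed
  then have "AE x in leb E. \<forall>i\<in>Basis. g x \<bullet> i = h x \<bullet> i" by (intro AE_finite_allI) auto
  then show ?thesis by eventually_elim (simp add: euclidean_eq_iff[of "g _"])
qed

lemma L2_weak_gradient_cong_AE:
  assumes E: "open E" and w: "L2_weak_gradient E v G"
    and u: "AE x in leb E. v x = u x" and H: "AE x in leb E. G x = H x"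
  shows "L2_weak_gradient E u H"
proof -
  have EL: "E \<in> sets lebesgue" using E by auto
  have v: "L2_fun (leb E) v" "L2_fun (leb E) G"
    using w by (auto simp: L2_weak_gradient_def)
  have uH: "L2_fun (leb E) u" "L2_fun (leb E) H"
    using L2_fun_cong_AE[OF EL] v u H by blast+
  have [measurable]: "v \<in> borel_measurable (leb E)" "G \<in> borel_measurable (leb E)"
    "u \<in> borel_measurable (leb E)" "H \<in> borel_measurable (leb E)"
    using v uH by (auto dest: L2_fun_measurable)
  show ?thesis unfolding L2_weak_gradient_def
  proof (intro conjI ballI allI uH)
    fix \<psi> d assume \<psi>: "\<psi> \<in> test_functions E"
    have [measurable]: "\<psi> \<in> borel_measurable (leb E)"
      "(\<lambda>x. dderiv \<psi> x d) \<in> borel_measurable (leb E)"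
      using L2_fun_test_function[OF \<psi> EL] L2_fun_dderiv_test_function[OF \<psi> EL]
      by (auto dest: L2_fun_measurable)
    have "(LINT x|leb E. u x * dderiv \<psi> x d) = (LINT x|leb E. v x * dderiv \<psi> x d)"
      by (rule integral_cong_AE) (measurable, use u in eventually_elim, simp)
    moreover have "(LINT x|leb E. (H x \<bullet> d) * \<psi> x) = (LINT x|leb E. (G x \<bullet> d) * \<psi> x)"
      by (rule integral_cong_AE) (measurable, use H in eventually_elim, simp)
    ultimately show "(LINT x|leb E. u x * dderiv \<psi> x d) = - (LINT x|leb E. (H x \<bullet> d) * \<psi> x)"
      using w \<psi> by (simp add: L2_weak_gradient_def)
  qed
qed

lemma H1_space_L2_weak_gradient:
  assumes E: "open E" and u: "u \<in> H1_space E"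
  shows "L2_weak_gradient E u (weak_grad E u)"
proof -
  obtain g where g: "has_weak_gradient E u g" and gL: "\<And>i. i \<in> Basis \<Longrightarrow> (\<lambda>x. g x \<bullet> i) \<in> L2_space E"
    and uL: "u \<in> L2_space E"
    using u by (auto simp: H1_space_def)
  have "L2_weak_gradient E u g"
  proof (rule L2_weak_gradientI_Basis[OF E])
    show "L2_fun (leb E) g"
      using gL by (subst L2_fun_componentwise) (simp add: L2_space_iff)
  qed (use g uL in \<open>auto simp: has_weak_gradient_def L2_space_iff\<close>)
  moreover have "AE x in leb E. g x = weak_grad E u x"
    unfolding weak_grad_def by (rule has_weak_gradient_unique[OF E g someI[of "has_weak_gradient E u", OF g]])
  ultimately show ?thesis using L2_weak_gradient_cong_AE[OF E, of u g u] by simp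
qed

lemma L2_weak_gradient_H1_space:
  assumes E: "open E" and w: "L2_weak_gradient E u G"
  shows "u \<in> H1_space E" "AE x in leb E. weak_grad E u x = G x"
proof -
  have h: "has_weak_gradient E u G" by (rule L2_weak_gradient_has_weak_gradient[OF E w])
  have "L2_fun (leb E) G" using w by (simp add: L2_weak_gradient_def)
  then show "u \<in> H1_space E"
    using h w by (auto simp: H1_space_def L2_space_iff L2_weak_gradient_def L2_fun_inner_const)
  show "AE x in leb E. weak_grad E u x = G x"
    unfolding weak_grad_def by (rule has_weak_gradient_unique[OF E someI[of "has_weak_gradient E u", OF h] h])
qed

lemma L2_weak_gradient_linear_comb:
  assumes E: "open E" and v: "L2_weak_gradient E v G" and w: "L2_weak_gradient E w H"
  shows "L2_weak_gradient E (\<lambda>x. v x + t * w x) (\<lambda>x. G x + t *\<^sub>R H x)"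
proof -
  have EL: "E \<in> sets lebesgue" using E by auto
  have sq: "L2_fun (leb E) v" "L2_fun (leb E) G"
      "L2_fun (leb E) w" "L2_fun (leb E) H"
    using v w by (auto simp: L2_weak_gradient_def)
  show ?thesis unfolding L2_weak_gradient_def
  proof (intro conjI ballI allI)
    show "L2_fun (leb E) (\<lambda>x. v x + t * w x)"
      by (intro L2_fun_add L2_fun_mult sq)
    show "L2_fun (leb E) (\<lambda>x. G x + t *\<^sub>R H x)"
      by (intro L2_fun_add L2_fun_scaleR sq)
    fix \<psi> d assume \<psi>: "\<psi> \<in> test_functions E"
    note i1 = integrable_mult_L2_fun[OF sq(1) L2_fun_dderiv_test_function[OF \<psi> EL, of d]]
      integrable_mult_L2_fun[OF sq(3) L2_fun_dderiv_test_function[OF \<psi> EL, of d]]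
      integrable_mult_L2_fun[OF L2_fun_inner_const[OF sq(2), of d] L2_fun_test_function[OF \<psi> EL]]
      integrable_mult_L2_fun[OF L2_fun_inner_const[OF sq(4), of d] L2_fun_test_function[OF \<psi> EL]]
    have "(LINT x|leb E. (v x + t * w x) * dderiv \<psi> x d)
      = (LINT x|leb E. v x * dderiv \<psi> x d + t * (w x * dderiv \<psi> x d))"
      by (simp add: algebra_simps)
    also have "\<dots> = - (LINT x|leb E. (G x \<bullet> d) * \<psi> x + t * ((H x \<bullet> d) * \<psi> x))"
      using i1 v w \<psi> by (simp add: L2_weak_gradient_def)
    also have "(LINT x|leb E. (G x \<bullet> d) * \<psi> x + t * ((H x \<bullet> d) * \<psi> x))
      = (LINT x|leb E. ((G x + t *\<^sub>R H x) \<bullet> d) * \<psi> x)"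
      by (simp add: algebra_simps inner_add_left)
    finally show "(LINT x|leb E. (v x + t * w x) * dderiv \<psi> x d)
      = - (LINT x|leb E. ((G x + t *\<^sub>R H x) \<bullet> d) * \<psi> x)" .
  qed
qed

text \<open>The product rule with a bounded smooth factor with bounded derivative; \<open>D\<close> is its gradient.\<close>
lemma L2_weak_gradient_mult_smooth:
  assumes E: "open E" and v: "L2_weak_gradient E v G"
    and \<zeta>: "smooth \<zeta>" and D: "\<And>x d. dderiv \<zeta> x d = D x \<bullet> d" and Dm: "continuous_on UNIV D"
    and b: "\<And>x. x \<in> E \<Longrightarrow> \<bar>\<zeta> x\<bar> \<le> B" "\<And>x. x \<in> E \<Longrightarrow> norm (D x) \<le> B"
  shows "L2_weak_gradient E (\<lambda>x. \<zeta> x * v x) (\<lambda>x. \<zeta> x *\<^sub>R G x + v x *\<^sub>R D x)"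
proof -
  have EL: "E \<in> sets lebesgue" using E by auto
  have sq: "L2_fun (leb E) v" "L2_fun (leb E) G"
    using v by (auto simp: L2_weak_gradient_def)
  have \<zeta>m: "\<zeta> \<in> borel_measurable (leb E)"
    using smooth_continuous[OF \<zeta>] by (rule continuous_borel_measurable_leb)
  have Dm': "D \<in> borel_measurable (leb E)" using Dm by (rule continuous_borel_measurable_leb)
  have s1: "L2_fun (leb E) (\<lambda>x. \<zeta> x * v x)"
    using L2_fun_bounded_mult(1)[OF sq(1) \<zeta>m, of B] b by simp
  have s2: "L2_fun (leb E) (\<lambda>x. \<zeta> x *\<^sub>R G x)"
    using L2_fun_bounded_mult(1)[OF sq(2) \<zeta>m, of B] b by simp
  have s3: "L2_fun (leb E) (\<lambda>x. v x *\<^sub>R D x)"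
  proof (rule L2_fun_mono[OF sq(1)])
    show "(\<lambda>x. v x *\<^sub>R D x) \<in> borel_measurable (leb E)"
      using L2_fun_measurable[OF sq(1)] Dm' by measurable
    have "norm (v x *\<^sub>R D x) \<le> B * norm (v x)" if "x \<in> E" for x
      using mult_left_mono[OF b(2)[OF that], of "\<bar>v x\<bar>"] by (simp add: mult.commute[of B])
    then show "AE x in leb E. norm (v x *\<^sub>R D x) \<le> B * norm (v x)"
      by (intro AE_I2) simp
  qed
  show ?thesis unfolding L2_weak_gradient_def
  proof (intro conjI ballI allI s1 L2_fun_add s2 s3)
    fix \<psi> d assume \<psi>: "\<psi> \<in> test_functions E"
    have \<zeta>\<psi>: "(\<lambda>x. \<zeta> x * \<psi> x) \<in> test_functions E" by (rule test_functions_mult_smooth[OF \<zeta> \<psi>])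
    have i1: "integrable (leb E) (\<lambda>x. (v x *\<^sub>R D x \<bullet> d) * \<psi> x)"
      by (intro integrable_mult_L2_fun L2_fun_inner_const s3 L2_fun_test_function[OF \<psi> EL])
    have i2: "integrable (leb E) (\<lambda>x. (\<zeta> x *\<^sub>R G x \<bullet> d) * \<psi> x)"
      by (intro integrable_mult_L2_fun L2_fun_inner_const s2 L2_fun_test_function[OF \<psi> EL])
    have i3: "integrable (leb E) (\<lambda>x. v x * dderiv (\<lambda>x. \<zeta> x * \<psi> x) x d)"
      by (intro integrable_mult_L2_fun sq L2_fun_dderiv_test_function[OF \<zeta>\<psi> EL])
    have "(LINT x|leb E. \<zeta> x * v x * dderiv \<psi> x d)
      = (LINT x|leb E. v x * dderiv (\<lambda>x. \<zeta> x * \<psi> x) x d - (v x *\<^sub>R D x \<bullet> d) * \<psi> x)"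
      by (rule Bochner_Integration.integral_cong[OF refl])
        (subst dderiv_mult[OF \<zeta> test_functions_smooth[OF \<psi>]], simp add: D algebra_simps)
    also have "\<dots> = - (LINT x|leb E. (G x \<bullet> d) * (\<zeta> x * \<psi> x)) - (LINT x|leb E. (v x *\<^sub>R D x \<bullet> d) * \<psi> x)"
      using i1 i3 v \<zeta>\<psi> by (simp add: L2_weak_gradient_def)
    also have "(LINT x|leb E. (G x \<bullet> d) * (\<zeta> x * \<psi> x)) = (LINT x|leb E. (\<zeta> x *\<^sub>R G x \<bullet> d) * \<psi> x)"
      by (simp add: algebra_simps)
    finally show "(LINT x|leb E. \<zeta> x * v x * dderiv \<psi> x d)
      = - (LINT x|leb E. ((\<zeta> x *\<^sub>R G x + v x *\<^sub>R D x) \<bullet> d) * \<psi> x)"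
      using i1 i2 by (simp add: inner_add_left distrib_right)
  qed
qed

section \<open>Mollification and test functions of low regularity\<close>

lemma integrable_continuous_compact_support:
  fixes f :: "'a::euclidean_space \<Rightarrow> real"
  assumes f: "continuous_on UNIV f" and K: "compact K" and z: "\<And>x. x \<notin> K \<Longrightarrow> f x = 0"
  shows "integrable lebesgue f"
proof -
  have KL: "K \<in> lmeasurable" by (rule lmeasurable_compact[OF K])
  obtain B where B: "0 < B" "\<And>x. norm (f x) \<le> B" using continuous_compact_support_bounded[OF f K z] by metis
  have f_meas: "f \<in> borel_measurable lebesgue"
    using continuous_borel_measurable_leb[OF f, of UNIV] by (simp add: lebesgue_on_UNIV_eq)
  have "integrable lebesgue (\<lambda>x. B * indicator K x)"
    using KL by (intro integrable_mult_right integrable_real_indicator) (auto simp: fmeasurable_def)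
  then show ?thesis
  proof (rule Bochner_Integration.integrable_bound)
    have "norm (f x) \<le> norm (B * indicator K x)" for x using B z[of x] by (cases "x \<in> K") auto
    then show "AE x in lebesgue. norm (f x) \<le> norm (B * indicator K x)" by simp
  qed (rule f_meas)
qed

definition mollify :: "('a::euclidean_space \<Rightarrow> real) \<Rightarrow> ('a \<Rightarrow> real) \<Rightarrow> 'a \<Rightarrow> real"
  where "mollify c f x = (LINT y|lebesgue. f y * c (y - x))"

lemma smooth_mollify:
  fixes f :: "'a::euclidean_space \<Rightarrow> real"
  assumes f: "continuous_on UNIV f" and K: "compact K" and z: "\<And>x. x \<notin> K \<Longrightarrow> f x = 0"
    and \<kappa>: "smooth \<kappa>"
  shows "smooth (mollify \<kappa> f)"
    and "((mollify \<kappa> f) has_derivative (\<lambda>d. mollify (\<lambda>z. - dderiv \<kappa> z d) f x)) (at x)"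
proof -
  obtain a b where ab: "K \<subseteq> cbox a b" using bounded_subset_cbox_symmetric compact_imp_bounded[OF K] by metis
  have cont: "continuous_on UNIV (\<lambda>y. f y * \<kappa> (y - x))" if "smooth \<kappa>" for \<kappa> x
    by (rule continuous_on_mult[OF f continuous_on_compose2[OF smooth_continuous[OF that]]])
      (auto intro!: continuous_intros)
  have eq: "mollify \<kappa> f x = integral (cbox a b) (\<lambda>y. f y * \<kappa> (y - x))" if \<kappa>: "smooth \<kappa>" for \<kappa> x
  proof -
    have int: "integrable lebesgue (\<lambda>y. f y * \<kappa> (y - x))"
      by (rule integrable_continuous_compact_support[OF cont[OF \<kappa>] K]) (simp add: z)
    have e1: "mollify \<kappa> f x = (LINT y|leb (cbox a b). f y * \<kappa> (y - x))"
    proof -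
      have "(LINT y|leb UNIV. f y * \<kappa> (y - x)) = (LINT y|leb (cbox a b). f y * \<kappa> (y - x))"
        by (rule lebesgue_on_extension_by_zero(3)) (use ab z in auto)
      then show ?thesis by (simp add: mollify_def lebesgue_on_UNIV_eq)
    qed
    have "integrable (leb UNIV) (\<lambda>y. f y * \<kappa> (y - x)) \<longleftrightarrow> integrable (leb (cbox a b)) (\<lambda>y. f y * \<kappa> (y - x))"
      by (rule lebesgue_on_extension_by_zero(2)) (use ab z in auto)
    then have "integrable (leb (cbox a b)) (\<lambda>y. f y * \<kappa> (y - x))"
      using int by (simp add: lebesgue_on_UNIV_eq)
    then show ?thesis unfolding e1 by (intro lebesgue_integral_eq_integral) auto
  qed
  have D: "((mollify \<kappa> f) has_derivative (\<lambda>d. mollify (\<lambda>z. - dderiv \<kappa> z d) f x)) (at x)"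
    if \<kappa>: "smooth \<kappa>" for \<kappa> x
  proof -
    define D where "D x y = f y *\<^sub>R Blinfun (\<lambda>d. - dderiv \<kappa> (y - x) d)" for x y
    have bl: "bounded_linear (\<lambda>d. - dderiv \<kappa> z d)" for z
      using smooth_has_derivative[OF \<kappa>, of z] by (intro bounded_linear_minus has_derivative_bounded_linear)
    have D_apply: "blinfun_apply (D x y) d = f y * (- dderiv \<kappa> (y - x) d)" for x y d
      by (simp add: D_def blinfun.scaleR_left bounded_linear_Blinfun_apply[OF bl])
    have sm: "smooth (\<lambda>z. - dderiv \<kappa> z d)" for d
      using smooth_frechet_derivative[OF \<kappa>] Ck_cmult[of _ "\<lambda>z. dderiv \<kappa> z d" "-1"] by auto
    have D_cont: "continuous_on S (\<lambda>(x, y). D x y)" for S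
    proof (rule continuous_on_blinfun_componentwise)
      fix i :: 'a
      have c: "continuous_on UNIV (\<lambda>z. - dderiv \<kappa> z i)" by (rule smooth_continuous[OF sm])
      have "continuous_on S (\<lambda>p. f (snd p) * (- dderiv \<kappa> (snd p - fst p) i))"
        by (intro continuous_on_mult continuous_on_compose2[OF f] continuous_on_compose2[OF c] continuous_intros) auto
      then show "continuous_on S (\<lambda>p. blinfun_apply (case p of (x, y) \<Rightarrow> D x y) i)"
        by (simp add: case_prod_beta D_apply)
    qed
    have "((\<lambda>x. integral (cbox a b) (\<lambda>y. f y * \<kappa> (y - x))) has_derivative integral (cbox a b) (D x)) (at x within UNIV)"
    proof (rule leibniz_rule)
      fix x t :: 'a
      have "((\<lambda>x. f t * \<kappa> (t - x)) has_derivative (\<lambda>d. f t * dderiv \<kappa> (t - x) (- d))) (at x)"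
        by (intro has_derivative_mult_right has_derivative_compose[OF _ smooth_has_derivative[OF \<kappa>]])
          (auto intro!: derivative_eq_intros)
      also have "(\<lambda>d. f t * dderiv \<kappa> (t - x) (- d)) = blinfun_apply (D x t)"
        using linear_neg[OF linear_frechet_derivative[OF smooth_differentiable[OF \<kappa>]]] by (auto simp: D_apply)
      finally show "((\<lambda>x. f t * \<kappa> (t - x)) has_derivative blinfun_apply (D x t)) (at x within UNIV)" by simp
      show "(\<lambda>y. f y * \<kappa> (y - x)) integrable_on cbox a b"
        by (rule integrable_continuous) (rule continuous_on_subset[OF cont[OF \<kappa>]], simp)
    qed (use D_cont in auto)
    moreover have "blinfun_apply (integral (cbox a b) (D x)) = (\<lambda>d. mollify (\<lambda>z. - dderiv \<kappa> z d) f x)"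
    proof
      fix d
      have "D x integrable_on cbox a b"
      proof (rule integrable_continuous)
        have "continuous_on (cbox a b) (\<lambda>y. (x, y))" by (intro continuous_intros)
        from continuous_on_compose2[OF D_cont[of UNIV] this] show "continuous_on (cbox a b) (D x)" by simp
      qed
      then have "blinfun_apply (integral (cbox a b) (D x)) d = integral (cbox a b) (\<lambda>y. blinfun_apply (D x y) d)"
        by (rule blinfun_apply_integral)
      then show "blinfun_apply (integral (cbox a b) (D x)) d = mollify (\<lambda>z. - dderiv \<kappa> z d) f x"
        by (simp add: eq[OF sm] D_apply)
    qed
    ultimately show ?thesis by (simp add: eq[OF \<kappa>, abs_def])
  qed
  show "((mollify \<kappa> f) has_derivative (\<lambda>d. mollify (\<lambda>z. - dderiv \<kappa> z d) f x)) (at x)"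
    by (rule D[OF \<kappa>])
  have "Ck k (mollify \<kappa> f)" if "smooth \<kappa>" for k \<kappa>
    using that
  proof (induction k arbitrary: \<kappa>)
    case 0
    have "continuous_on UNIV (mollify \<kappa> f)"
      using has_derivative_continuous[OF D[OF 0]] by (simp add: continuous_at_imp_continuous_on)
    then show ?case by simp
  next
    case (Suc k)
    show ?case
    proof (rule Ck_SucI[OF D[OF Suc.prems]])
      fix i :: 'a
      show "Ck k (\<lambda>x. mollify (\<lambda>z. - dderiv \<kappa> z i) f x)"
        using smooth_frechet_derivative[OF Suc.prems] Ck_cmult[of _ "\<lambda>z. dderiv \<kappa> z i" "-1"]
        by (intro Suc.IH) auto
    qed
  qed
  then show "smooth (mollify \<kappa> f)" using \<kappa> by blast
qed

lemma mollifier_exists: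
  fixes \<epsilon> :: real
  assumes "0 < \<epsilon>"
  obtains K :: "'a::euclidean_space \<Rightarrow> real" where "smooth K" "\<And>x. 0 \<le> K x" "\<And>x. x \<notin> ball 0 \<epsilon> \<Longrightarrow> K x = 0"
    "(LINT x|lebesgue. K x) = 1"
proof -
  obtain \<zeta> :: "'a \<Rightarrow> real" where \<zeta>: "smooth \<zeta>" "\<And>x. 0 \<le> \<zeta> x" "\<And>x. x \<in> cball 0 (\<epsilon>/2) \<Longrightarrow> \<zeta> x = 1" "\<And>x. x \<notin> ball 0 \<epsilon> \<Longrightarrow> \<zeta> x = 0"
    by (rule cutoff_ball_exists[of "\<epsilon>/2" \<epsilon> 0]) (use assms in auto)
  define c where "c = (LINT x|lebesgue. \<zeta> x)"
  have int: "integrable lebesgue \<zeta>"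
    by (rule integrable_continuous_compact_support[OF smooth_continuous[OF \<zeta>(1)] compact_cball[of 0 \<epsilon>]])
      (use \<zeta>(4) in auto)
  have "measure lebesgue (cball (0::'a) (\<epsilon>/2)) \<le> c"
  proof -
    have "measure lebesgue (cball (0::'a) (\<epsilon>/2)) = (LINT x|lebesgue. indicator (cball (0::'a) (\<epsilon>/2)) x)" by simp
    also have "\<dots> \<le> c" unfolding c_def
    proof (rule integral_mono[OF _ int])
      show "integrable lebesgue (indicator (cball (0::'a) (\<epsilon>/2)) :: 'a \<Rightarrow> real)"
        using lmeasurable_cball[of "0::'a" "\<epsilon>/2"] by (simp add: fmeasurable_def integrable_indicator_iff)
      show "indicator (cball (0::'a) (\<epsilon>/2)) x \<le> \<zeta> x" for x
        using \<zeta>(2,3)[of x] by (auto simp: indicator_def)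
    qed
    finally show ?thesis .
  qed
  moreover have "0 < measure lebesgue (cball (0::'a) (\<epsilon>/2))" using assms by (simp add: content_cball_pos)
  ultimately have c: "0 < c" by linarith
  show thesis
  proof (rule that[of "\<lambda>x. inverse c * \<zeta> x"])
    show "smooth (\<lambda>x. inverse c * \<zeta> x)" using \<zeta>(1) by (auto intro: Ck_cmult)
    show "(LINT x|lebesgue. inverse c * \<zeta> x) = 1" using c by (simp add: c_def[symmetric])
  qed (use \<zeta> c in auto)
qed

lemma lebesgue_integral_translation:
  fixes f :: "'a::euclidean_space \<Rightarrow> real"
  assumes "f \<in> borel_measurable lebesgue"
  shows "(LINT y|lebesgue. f (y + c)) = (LINT y|lebesgue. f y)"
  using preserves_lebesgue_integral(3)[OF preserves_lebesgue_translation[of c], of UNIV UNIV f] assms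
  by (simp add: lebesgue_on_UNIV_eq)

lemma mollify_close:
  fixes h :: "'a::euclidean_space \<Rightarrow> real"
  assumes K: "smooth K" "\<And>x. 0 \<le> K x" "\<And>x. x \<notin> ball 0 \<epsilon> \<Longrightarrow> K x = 0" "(LINT x|lebesgue. K x) = 1"
    and h: "continuous_on UNIV h" and close: "\<And>y. dist x y < \<epsilon> \<Longrightarrow> \<bar>h y - c\<bar> \<le> \<delta>"
  shows "\<bar>mollify K h x - c\<bar> \<le> \<delta>"
proof -
  have cK: "continuous_on UNIV (\<lambda>y. K (y - x))"
    by (rule continuous_on_compose2[OF smooth_continuous[OF K(1)]]) (auto intro!: continuous_intros)
  have supp: "K (y - x) = 0" if "y \<notin> cball x \<epsilon>" for y
    using that by (intro K(3)) (auto simp: dist_norm norm_minus_commute)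
  have i0: "integrable lebesgue K"
    by (rule integrable_continuous_compact_support[OF smooth_continuous[OF K(1)] compact_cball[of 0 \<epsilon>]])
      (use K(3) in auto)
  have i1: "integrable lebesgue (\<lambda>y. K (y - x))"
    by (rule integrable_continuous_compact_support[OF cK compact_cball supp])
  have i2: "integrable lebesgue (\<lambda>y. h y * K (y - x))"
    by (rule integrable_continuous_compact_support[OF continuous_on_mult[OF h cK] compact_cball[of x \<epsilon>]])
      (simp add: supp)
  have one: "(LINT y|lebesgue. K (y - x)) = 1"
    using lebesgue_integral_translation[of K "-x"] i0 K(4) by auto
  have "mollify K h x - c = (LINT y|lebesgue. h y * K (y - x) - c * K (y - x))"
    using i1 i2 one by (simp add: mollify_def)
  also have "\<bar>\<dots>\<bar> \<le> (LINT y|lebesgue. \<delta> * K (y - x))"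
  proof -
    have "norm (LINT y|lebesgue. h y * K (y - x) - c * K (y - x)) \<le> (LINT y|lebesgue. \<delta> * K (y - x))"
    proof (rule Bochner_Integration.integral_norm_bound_integral)
      fix y
      show "norm (h y * K (y - x) - c * K (y - x)) \<le> \<delta> * K (y - x)"
      proof (cases "dist x y < \<epsilon>")
        case True
        then show ?thesis using mult_right_mono[OF close K(2)[of "y - x"], of y] K(2)[of "y - x"]
          by (simp add: abs_mult left_diff_distrib[symmetric])
      next
        case False
        then have "K (y - x) = 0" by (intro K(3)) (auto simp: dist_norm norm_minus_commute)
        then show ?thesis by simp
      qed
    qed (use i1 i2 in auto)
    then show ?thesis by simp
  qed
  also have "\<dots> = \<delta>" using one by simp
  finally show ?thesis .
qed

text \<open>The derivative can be moved from the kernel to the function; only the derivative in the one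
  direction \<open>d\<close> has to exist.\<close>
lemma dderiv_mollify:
  fixes f :: "'a::euclidean_space \<Rightarrow> real"
  assumes f: "continuous_on UNIV f" and K: "compact K" and z: "\<And>x. x \<notin> K \<Longrightarrow> f x = 0"
    and df: "continuous_on UNIV df" and B: "\<And>x. \<bar>df x\<bar> \<le> B"
    and deriv: "\<And>x. ((\<lambda>t. f (x + t *\<^sub>R d)) has_real_derivative df x) (at 0)"
    and \<kappa>: "smooth \<kappa>" "\<And>x. 0 \<le> \<kappa> x" "\<And>x. x \<notin> ball 0 \<epsilon> \<Longrightarrow> \<kappa> x = 0"
  shows "dderiv (mollify \<kappa> f) x d = mollify \<kappa> df x"
proof -
  let ?g = "mollify \<kappa> f"
  have c\<kappa>: "continuous_on UNIV (\<lambda>y. \<kappa> (y - x))"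
    by (rule continuous_on_compose2[OF smooth_continuous[OF \<kappa>(1)]]) (auto intro!: continuous_intros)
  have supp: "\<kappa> (y - x) = 0" if "y \<notin> cball x \<epsilon>" for y
    using that by (intro \<kappa>(3)) (auto simp: dist_norm norm_minus_commute)
  have shift: "continuous_on UNIV (\<lambda>y. h (y + s *\<^sub>R d))" if "continuous_on UNIV h" for h :: "'a \<Rightarrow> real" and s
    by (rule continuous_on_compose2[OF that]) (auto intro!: continuous_intros)
  have cs: "continuous_on UNIV (\<lambda>y. h (y + s *\<^sub>R d) * \<kappa> (y - x))" if "continuous_on UNIV h" for h :: "'a \<Rightarrow> real" and s
    by (rule continuous_on_mult[OF shift[OF that] c\<kappa>])
  have ints: "integrable lebesgue (\<lambda>y. h (y + s *\<^sub>R d) * \<kappa> (y - x))" if "continuous_on UNIV h" for h :: "'a \<Rightarrow> real" and s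
    by (rule integrable_continuous_compact_support[OF cs[OF that] compact_cball[of x \<epsilon>]]) (simp add: supp)
  have moll: "?g (x + s *\<^sub>R d) = (LINT y|lebesgue. f (y + s *\<^sub>R d) * \<kappa> (y - x))" for s
  proof -
    have c: "continuous_on UNIV (\<lambda>y. f y * \<kappa> (y - (x + s *\<^sub>R d)))"
      by (rule continuous_on_mult[OF f continuous_on_compose2[OF smooth_continuous[OF \<kappa>(1)]]])
        (auto intro!: continuous_intros)
    then have "(\<lambda>y. f y * \<kappa> (y - (x + s *\<^sub>R d))) \<in> borel_measurable lebesgue"
      using continuous_borel_measurable_leb[of _ UNIV] by (auto simp: lebesgue_on_UNIV_eq)
    from lebesgue_integral_translation[OF this, of "s *\<^sub>R d"] show ?thesis by (simp add: mollify_def)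
  qed
  have "((\<lambda>s. LINT y|lebesgue. f (y + s *\<^sub>R d) * \<kappa> (y - x)) has_real_derivative
      (LINT y|lebesgue. df (y + 0 *\<^sub>R d) * \<kappa> (y - x))) (at 0)"
  proof (rule has_real_derivative_integral[of 1 0 lebesgue "\<lambda>s y. f (y + s *\<^sub>R d) * \<kappa> (y - x)"
        "\<lambda>s y. df (y + s *\<^sub>R d) * \<kappa> (y - x)" "\<lambda>y. B * \<kappa> (y - x)"])
    show "integrable lebesgue (\<lambda>y. f (y + s *\<^sub>R d) * \<kappa> (y - x))" for s by (rule ints[OF f])
    show "((\<lambda>s. f (y + s *\<^sub>R d) * \<kappa> (y - x)) has_real_derivative df (y + s *\<^sub>R d) * \<kappa> (y - x)) (at s)" for s y
    proof -
      have "((\<lambda>t. f (y + (t + s) *\<^sub>R d)) has_real_derivative df (y + s *\<^sub>R d)) (at 0)"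
        using deriv[of "y + s *\<^sub>R d"] by (simp add: algebra_simps)
      then have "((\<lambda>t. f (y + t *\<^sub>R d)) has_real_derivative df (y + s *\<^sub>R d)) (at (0 + s))"
        by (subst DERIV_shift)
      then show ?thesis by (intro DERIV_cmult_right) simp
    qed
    show "\<bar>df (y + s *\<^sub>R d) * \<kappa> (y - x)\<bar> \<le> B * \<kappa> (y - x)" for s y
      using mult_right_mono[OF B \<kappa>(2)] \<kappa>(2)[of "y - x"] by (simp add: abs_mult)
    show "integrable lebesgue (\<lambda>y. B * \<kappa> (y - x))"
      by (intro integrable_mult_right integrable_continuous_compact_support[OF c\<kappa> compact_cball supp])
    show "(\<lambda>y. df (y + 0 *\<^sub>R d) * \<kappa> (y - x)) \<in> borel_measurable lebesgue" using ints[OF df, of 0] by auto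
  qed simp
  moreover have "mollify \<kappa> df x = (LINT y|lebesgue. df (y + 0 *\<^sub>R d) * \<kappa> (y - x))" by (simp add: mollify_def)
  ultimately have "((\<lambda>s. ?g (x + s *\<^sub>R d)) has_real_derivative mollify \<kappa> df x) (at 0)"
    by (simp only: moll)
  moreover have "((\<lambda>s. ?g (x + s *\<^sub>R d)) has_real_derivative dderiv ?g x d) (at 0)"
  proof -
    have sm: "smooth ?g" by (rule smooth_mollify(1)[OF f K z \<kappa>(1)])
    have "((\<lambda>s. ?g (x + s *\<^sub>R d)) has_derivative (\<lambda>s. dderiv ?g (x + 0 *\<^sub>R d) (s *\<^sub>R d))) (at 0)"
      by (rule has_derivative_compose[OF _ smooth_has_derivative[OF sm]]) (auto intro!: derivative_eq_intros)
    then show ?thesis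
      using linear_cmul[OF linear_frechet_derivative[OF smooth_differentiable[OF sm], of x]]
      by (simp add: has_field_derivative_def mult_commute_abs)
  qed
  ultimately show ?thesis by (rule DERIV_unique[symmetric])
qed

text \<open>The identity defining the weak gradient in the direction \<open>d\<close> only needs the test function
  to be differentiable in that direction, since mollification approximates \<open>f\<close> and its derivative in
  the direction \<open>d\<close> simultaneously.\<close>
lemma weak_gradient_directional_test:
  fixes f :: "'a::euclidean_space \<Rightarrow> real"
  assumes E: "open E" and w: "L2_weak_gradient E v G"
    and f: "continuous_on UNIV f" and K: "compact K" "K \<subseteq> E" and z: "\<And>x. x \<notin> K \<Longrightarrow> f x = 0"
    and df: "continuous_on UNIV df"
    and deriv: "\<And>x. ((\<lambda>t. f (x + t *\<^sub>R d)) has_real_derivative df x) (at 0)"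
  shows "(LINT x|leb E. v x * df x) = - (LINT x|leb E. (G x \<bullet> d) * f x)"
proof -
  have EL: "E \<in> sets lebesgue" using E by auto
  have dz: "df x = 0" if "x \<notin> K" for x
  proof -
    have "open (- K)" using K by (simp add: compact_imp_closed open_Compl)
    then have "open ((\<lambda>t. x + t *\<^sub>R d) -` (- K))" by (rule open_vimage) (intro continuous_intros)
    then have "((\<lambda>t. f (x + t *\<^sub>R d)) has_real_derivative 0) (at 0)"
      by (rule has_field_derivative_transform_within_open[of "\<lambda>_. 0" 0 0 "(\<lambda>t. x + t *\<^sub>R d) -` (- K)", rotated])
        (use that in \<open>auto simp: z\<close>)
    then show ?thesis using deriv[of x] DERIV_unique by blast
  qed
  obtain B1 where B1: "0 < B1" "\<And>x. norm (f x) \<le> B1" using continuous_compact_support_bounded[OF f K(1) z] by metis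
  obtain B2 where B2: "0 < B2" "\<And>x. norm (df x) \<le> B2" using continuous_compact_support_bounded[OF df K(1) dz] by metis
  obtain e where e: "e > 0" and eE: "(\<Union>x\<in>K. cball x e) \<subseteq> E"
    using compact_subset_open_imp_cball_epsilon_subset[OF K(1) E K(2)] by metis
  define K' where "K' = (\<Union>x\<in>K. cball x e)"
  have K': "compact K'" "K' \<subseteq> E" using eE compact_minkowski_sum_cball[OF K(1), of e] by (auto simp: K'_def)
  define \<epsilon> where "\<epsilon> n = e * inverse (real (Suc n))" for n
  have \<epsilon>: "0 < \<epsilon> n" "\<epsilon> n \<le> e" for n using e by (auto simp: \<epsilon>_def field_simps)
  have \<epsilon>_lim: "\<epsilon> \<longlonglongrightarrow> 0" unfolding \<epsilon>_def using LIMSEQ_inverse_real_of_nat tendsto_mult_right_zero by blast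
  have "\<exists>\<kappa>. smooth \<kappa> \<and> (\<forall>x. 0 \<le> \<kappa> x) \<and> (\<forall>x. x \<notin> ball 0 (\<epsilon> n) \<longrightarrow> \<kappa> x = 0) \<and> (LINT x|lebesgue. \<kappa> x) = 1" for n
    by (rule mollifier_exists[OF \<epsilon>(1)[of n]]) blast
  then obtain \<kappa> :: "nat \<Rightarrow> 'a \<Rightarrow> real" where "\<forall>n. smooth (\<kappa> n) \<and> (\<forall>x. 0 \<le> \<kappa> n x) \<and>
      (\<forall>x. x \<notin> ball 0 (\<epsilon> n) \<longrightarrow> \<kappa> n x = 0) \<and> (LINT x|lebesgue. \<kappa> n x) = 1" by metis
  then have \<kappa>: "\<And>n. smooth (\<kappa> n)" "\<And>n x. 0 \<le> \<kappa> n x" "\<And>n x. x \<notin> ball 0 (\<epsilon> n) \<Longrightarrow> \<kappa> n x = 0"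
      "\<And>n. (LINT x|lebesgue. \<kappa> n x) = 1" by blast+
  have lim: "(\<lambda>n. mollify (\<kappa> n) h x) \<longlonglongrightarrow> h x" if h: "continuous_on UNIV h" for h x
  proof (rule LIMSEQ_I)
    fix r :: real assume r: "0 < r"
    obtain \<delta> where \<delta>: "\<delta> > 0" "\<And>y. dist x y < \<delta> \<Longrightarrow> dist (h x) (h y) < r / 2"
      using h r unfolding continuous_on_eq_continuous_at[OF open_UNIV] continuous_at_eps_delta
      by (metis UNIV_I dist_commute dist_norm half_gt_zero)
    obtain N where N: "\<And>n. n \<ge> N \<Longrightarrow> \<epsilon> n < \<delta>"
      using LIMSEQ_D[OF \<epsilon>_lim \<delta>(1)] \<epsilon>(1) by (metis abs_of_pos diff_zero real_norm_def)
    have "norm (mollify (\<kappa> n) h x - h x) < r" if "n \<ge> N" for n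
    proof -
      have "\<bar>mollify (\<kappa> n) h x - h x\<bar> \<le> r / 2"
      proof (rule mollify_close[OF \<kappa>(1,2,3,4) h])
        fix y assume "dist x y < \<epsilon> n"
        then have "dist (h x) (h y) < r / 2" using N[OF that] by (intro \<delta>(2)) simp
        then show "\<bar>h y - h x\<bar> \<le> r / 2" by (simp add: dist_real_def abs_minus_commute)
      qed
      then show ?thesis using r by simp
    qed
    then show "\<exists>N. \<forall>n\<ge>N. norm (mollify (\<kappa> n) h x - h x) < r" by blast
  qed
  have bnd: "\<bar>mollify (\<kappa> n) h x\<bar> \<le> B" if h: "continuous_on UNIV h" "\<And>x. \<bar>h x\<bar> \<le> B" for h B n x
  proof -
    have "\<bar>mollify (\<kappa> n) h x - 0\<bar> \<le> B"
    proof (rule mollify_close[where \<epsilon>="\<epsilon> n", OF \<kappa>(1) \<kappa>(2) _ \<kappa>(4) h(1)])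
      show "\<bar>h y - 0\<bar> \<le> B" for y using h(2)[of y] by simp
    qed (rule \<kappa>(3))
    then show ?thesis by simp
  qed
  have out: "mollify (\<kappa> n) h x = 0" if h: "\<And>x. x \<notin> K \<Longrightarrow> h x = 0" and x: "x \<notin> K'" for h x n
  proof -
    have "h y * \<kappa> n (y - x) = 0" for y
    proof (cases "y \<in> K")
      case True
      then have "e < dist y x" using x by (auto simp: K'_def not_le)
      then have "y - x \<notin> ball 0 (\<epsilon> n)" using \<epsilon>(2)[of n] by (auto simp: dist_norm norm_minus_commute[of x y])
      then show ?thesis using \<kappa>(3) by simp
    qed (simp add: h)
    then have "(\<lambda>y. h y * \<kappa> n (y - x)) = (\<lambda>_. 0)" by (rule ext)
    then show ?thesis by (simp only: mollify_def Bochner_Integration.integral_zero)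
  qed
  define g where "g n = mollify (\<kappa> n) f" for n
  have g_test: "g n \<in> test_functions E" for n
    unfolding g_def
    by (rule test_functionsI[OF smooth_mollify(1)[OF f K(1) z \<kappa>(1)] K']) (use out[OF z] in auto)
  have dg: "dderiv (g n) x d = mollify (\<kappa> n) df x" for n x
    unfolding g_def
    by (rule dderiv_mollify[OF f K(1) z df _ deriv \<kappa>(1,2,3)]) (use B2 in auto)
  have vsq: "L2_fun (leb E) v" "L2_fun (leb E) (\<lambda>x. G x \<bullet> d)"
    using w by (auto simp: L2_weak_gradient_def L2_fun_inner_const)
  have conv: "(\<lambda>n. LINT x|leb E. u x * mollify (\<kappa> n) h x) \<longlonglongrightarrow> (LINT x|leb E. u x * h x)"
    if u: "L2_fun (leb E) u" and h: "continuous_on UNIV h" "\<And>x. x \<notin> K \<Longrightarrow> h x = 0"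
      and B: "\<And>x. \<bar>h x\<bar> \<le> B" for u h B
  proof (rule integral_dominated_convergence)
    have [measurable]: "u \<in> borel_measurable (leb E)" using u by (rule L2_fun_measurable)
    have [measurable]: "h \<in> borel_measurable (leb E)" by (rule continuous_borel_measurable_leb[OF h(1)])
    have [measurable]: "mollify (\<kappa> n) h \<in> borel_measurable (leb E)" for n
      by (rule continuous_borel_measurable_leb[OF smooth_continuous[OF smooth_mollify(1)[OF h(1) K(1) h(2) \<kappa>(1)]]])
    show "(\<lambda>x. u x * h x) \<in> borel_measurable (leb E)" by measurable
    show "(\<lambda>x. u x * mollify (\<kappa> n) h x) \<in> borel_measurable (leb E)" for n by measurable
    show "integrable (leb E) (\<lambda>x. B * \<bar>u x * indicator K' x\<bar>)"
      using integrable_mult_L2_fun[OF u L2_fun_indicator[OF lmeasurable_compact[OF K'(1)] EL]]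
      by (intro integrable_mult_right integrable_abs)
    show "AE x in leb E. (\<lambda>n. u x * mollify (\<kappa> n) h x) \<longlonglongrightarrow> u x * h x"
      by (intro AE_I2 tendsto_mult tendsto_const lim[OF h(1)])
    show "AE x in leb E. norm (u x * mollify (\<kappa> n) h x) \<le> B * \<bar>u x * indicator K' x\<bar>" for n
    proof (rule AE_I2)
      fix x
      have "\<bar>mollify (\<kappa> n) h x\<bar> \<le> B" by (rule bnd[OF h(1) B])
      then have "\<bar>u x\<bar> * \<bar>mollify (\<kappa> n) h x\<bar> \<le> \<bar>u x\<bar> * B" by (intro mult_left_mono) auto
      moreover have "mollify (\<kappa> n) h x = 0" if "x \<notin> K'" by (rule out[OF h(2) that])
      ultimately show "norm (u x * mollify (\<kappa> n) h x) \<le> B * \<bar>u x * indicator K' x\<bar>"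
        by (cases "x \<in> K'") (auto simp: abs_mult mult.commute)
    qed
  qed
  have "(\<lambda>n. LINT x|leb E. v x * mollify (\<kappa> n) df x) \<longlonglongrightarrow> (LINT x|leb E. v x * df x)"
    by (rule conv[OF vsq(1) df dz]) (use B2 in auto)
  moreover have "(LINT x|leb E. v x * mollify (\<kappa> n) df x) = - (LINT x|leb E. (G x \<bullet> d) * g n x)" for n
    using w g_test[of n] by (simp add: L2_weak_gradient_def dg[symmetric])
  ultimately have "(\<lambda>n. - (LINT x|leb E. (G x \<bullet> d) * g n x)) \<longlonglongrightarrow> (LINT x|leb E. v x * df x)" by simp
  moreover have "(\<lambda>n. - (LINT x|leb E. (G x \<bullet> d) * g n x)) \<longlonglongrightarrow> - (LINT x|leb E. (G x \<bullet> d) * f x)"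
    unfolding g_def by (intro tendsto_minus conv[OF vsq(2) f z]) (use B1 in auto)
  ultimately show ?thesis by (rule LIMSEQ_unique)
qed

section \<open>Sliding along the boundary\<close>

lemma gradient_has_derivative:
  assumes "f differentiable (at x)"
  shows "(f has_derivative (\<lambda>d. gradient f x \<bullet> d)) (at x)"
proof -
  have "dderiv f x d = d \<bullet> (\<Sum>i\<in>Basis. dderiv f x i *\<^sub>R i)" for d
    by (subst dderiv_Basis_sum[OF assms, of d]) (simp add: inner_sum_right mult.commute)
  then obtain D where "dderiv f x = (\<lambda>d. d \<bullet> D)" by blast
  then have "GDERIV f x :> D"
    using assms frechet_derivative_works[of f "at x"] unfolding gderiv_def by simp
  moreover have "D' = D" if "GDERIV f x :> D'" for D'
  proof -
    have "(\<lambda>d. d \<bullet> D') = (\<lambda>d. d \<bullet> D)"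
      using has_derivative_unique[of f "\<lambda>d. d \<bullet> D'" x "\<lambda>d. d \<bullet> D"] that calculation by (simp add: gderiv_def)
    then show ?thesis by (metis vector_eq_ldot)
  qed
  ultimately have "GDERIV f x :> gradient f x"
    unfolding gradient_def by (rule theI)
  then show ?thesis by (simp add: gderiv_def inner_commute)
qed

lemma dderiv_eq_gradient:
  "f differentiable (at x) \<Longrightarrow> dderiv f x d = gradient f x \<bullet> d"
  using frechet_derivative_at[OF gradient_has_derivative, of f x] by metis

lemma continuous_on_gradient_smooth:
  assumes "smooth \<psi>" shows "continuous_on UNIV (gradient \<psi>)"
proof -
  have "continuous_on UNIV (\<lambda>x. \<Sum>i\<in>Basis. dderiv \<psi> x i *\<^sub>R i)"
    using smooth_continuous[OF smooth_frechet_derivative[OF assms]] by (intro continuous_intros)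
  also have "(\<lambda>x. \<Sum>i\<in>Basis. dderiv \<psi> x i *\<^sub>R i) = gradient \<psi>"
    by (auto simp: fun_eq_iff dderiv_eq_gradient[OF smooth_differentiable[OF assms]] euclidean_representation)
  finally show ?thesis .
qed

lemma continuous_on_gradient_C11: "C11 f \<Longrightarrow> continuous_on UNIV (gradient f)"
  unfolding C11_def using lipschitz_on_continuous_on by blast

text \<open>Slides along the boundary and translations are treated at once; \<open>X\<close> is the vector field that
  generates the flow.\<close>
locale measure_preserving_flow =
  fixes \<Phi> :: "real \<Rightarrow> 'a::euclidean_space \<Rightarrow> 'a" and X :: "'a \<Rightarrow> 'a" and E :: "'a set"
  assumes pres: "\<And>s. preserves_lebesgue (\<Phi> s)" and inv: "\<And>s x. \<Phi> s (\<Phi> (- s) x) = x"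
    and zero: "\<And>x. \<Phi> 0 x = x"
    and EL: "E \<in> sets lebesgue" and mem: "\<And>s x. \<Phi> s x \<in> E \<longleftrightarrow> x \<in> E"
    and cont: "continuous_on UNIV (\<lambda>(s, x). \<Phi> s x)" and X: "continuous_on UNIV X"
    and flow: "\<And>s x. ((\<lambda>s. \<Phi> s x) has_vector_derivative X (\<Phi> s x)) (at s)"
begin

text \<open>As the flow preserves the measure, it can be moved to the test function, which is differentiated
  instead of \<open>w\<close>.\<close>
lemma integral_has_derivative:
  assumes w: "L2_fun (leb E) w" and \<psi>: "\<psi> \<in> test_functions U"
  shows "((\<lambda>s. LINT x|leb E. w (\<Phi> s x) * \<psi> x) has_real_derivative
    - (LINT x|leb E. w (\<Phi> s x) * (gradient \<psi> x \<bullet> X x))) (at s)"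
proof -
  have sm: "smooth \<psi>" by (rule test_functions_smooth[OF \<psi>])
  obtain K where K: "compact K" "\<And>x. x \<notin> K \<Longrightarrow> \<psi> x = 0"
      "\<And>x d. x \<notin> K \<Longrightarrow> dderiv \<psi> x d = 0"
    using test_functions_support[OF \<psi>] by metis
  define D where "D x = gradient \<psi> x \<bullet> X x" for x
  have D_cont: "continuous_on UNIV D" unfolding D_def
    by (intro continuous_intros continuous_on_gradient_smooth[OF sm] X)
  have D0: "D x = 0" if "x \<notin> K" for x
    using K(3)[OF that, of "X x"] by (simp add: D_def dderiv_eq_gradient[OF smooth_differentiable[OF sm]])
  obtain B where B: "0 < B" "\<And>x. norm (D x) \<le> B" using continuous_compact_support_bounded[OF D_cont K(1) D0] by metis
  define K' where "K' = (\<lambda>(s, x). \<Phi> s x) ` ({s - 1..s + 1} \<times> K)"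
  have K': "compact K'" unfolding K'_def
    by (intro compact_continuous_image continuous_on_subset[OF cont] compact_Times K) auto
  have inv': "\<Phi> (- s) (\<Phi> s x) = x" for s x using inv[of "- s" x] by simp
  have w_meas [measurable]: "w \<in> borel_measurable (leb E)" using w by (rule L2_fun_measurable)
  have cont1: "continuous_on UNIV (\<Phi> t)" for t
  proof -
    have "continuous_on UNIV (\<lambda>x. (t, x))" by (intro continuous_intros)
    from continuous_on_compose2[OF cont this] show ?thesis by simp
  qed
  have comp_meas: "(\<lambda>y. f (\<Phi> t y)) \<in> borel_measurable (leb E)" if "continuous_on UNIV f" for f :: "'a \<Rightarrow> real" and t
    by (rule continuous_borel_measurable_leb[OF continuous_on_compose2[OF that cont1]]) simp
  have move: "(LINT x|leb E. w (\<Phi> t x) * f x) = (LINT y|leb E. w y * f (\<Phi> (- t) y))"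
    if f: "continuous_on UNIV f" for f :: "'a \<Rightarrow> real" and t
  proof -
    have "(\<lambda>y. w y * f (\<Phi> (- t) y)) \<in> borel_measurable (leb E)" using comp_meas[OF f] by measurable
    from preserves_lebesgue_integral(3)[OF pres EL EL mem[symmetric] this, of t] show ?thesis by (simp add: inv')
  qed
  have "((\<lambda>s. LINT y|leb E. w y * \<psi> (\<Phi> (- s) y)) has_real_derivative
    (LINT y|leb E. w y * (- D (\<Phi> (- s) y)))) (at s)"
  proof (rule has_real_derivative_integral[of 1 s "leb E" "\<lambda>s y. w y * \<psi> (\<Phi> (- s) y)"
        "\<lambda>s y. w y * (- D (\<Phi> (- s) y))" "\<lambda>y. B * \<bar>w y * indicator K' y\<bar>"])
    show "integrable (leb E) (\<lambda>y. w y * \<psi> (\<Phi> (- t) y))" for t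
      by (intro integrable_mult_L2_fun[OF w] L2_fun_test_function[OF \<psi> EL]
        preserves_lebesgue_L2_fun(1)[OF pres EL EL mem[symmetric]])
    show "integrable (leb E) (\<lambda>y. B * \<bar>w y * indicator K' y\<bar>)"
      by (intro integrable_mult_right integrable_abs integrable_mult_L2_fun[OF w]
        L2_fun_indicator[OF lmeasurable_compact[OF K'] EL])
    show "((\<lambda>s. w y * \<psi> (\<Phi> (- s) y)) has_real_derivative w y * (- D (\<Phi> (- t) y))) (at t)" for t y
    proof -
      have "((\<lambda>s. \<psi> (\<Phi> s y)) has_real_derivative D (\<Phi> (- t) y)) (at (- t))"
      proof -
        have "((\<lambda>s. \<psi> (\<Phi> s y)) has_derivative
            (\<lambda>t'. gradient \<psi> (\<Phi> (- t) y) \<bullet> (t' *\<^sub>R X (\<Phi> (- t) y)))) (at (- t))"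
          using has_derivative_compose[OF flow[unfolded has_vector_derivative_def]
              gradient_has_derivative[OF smooth_differentiable[OF sm]]] .
        then show ?thesis by (simp add: has_field_derivative_def D_def mult_commute_abs)
      qed
      then have "((\<lambda>s. \<psi> (\<Phi> (- s) y)) has_real_derivative - D (\<Phi> (- t) y)) (at t)"
        by (simp add: DERIV_mirror)
      then show ?thesis by (intro DERIV_cmult)
    qed
    show "\<bar>w y * (- D (\<Phi> (- t) y))\<bar> \<le> B * \<bar>w y * indicator K' y\<bar>" if "\<bar>t - s\<bar> < 1" for t y
    proof (cases "\<Phi> (- t) y \<in> K")
      case True
      have "y = \<Phi> t (\<Phi> (- t) y)" by (simp add: inv)
      then have "y \<in> K'" unfolding K'_def using True that by (intro image_eqI[of _ _ "(t, \<Phi> (- t) y)"]) auto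
      then show ?thesis using mult_right_mono[OF B(2), of "\<bar>w y\<bar>" "\<Phi> (- t) y"] by (simp add: abs_mult mult.commute)
    next
      case False then show ?thesis using B(1) by (simp add: D0)
    qed
    show "(\<lambda>y. w y * (- D (\<Phi> (- s) y))) \<in> borel_measurable (leb E)"
      using comp_meas[OF D_cont] by measurable
  qed simp
  then show ?thesis
    using move[OF smooth_continuous[OF sm]] move[OF D_cont] by (simp add: D_def)
qed

text \<open>A function whose difference quotients along the flow are bounded in \<open>L\<^sup>2\<close> near the support of
  the test function has a weak derivative along the flow, expressed in dual form.\<close>
lemma dual_bound:
  assumes w: "L2_fun (leb E) w" and U: "open U" and \<psi>: "\<psi> \<in> test_functions U"
    and h0: "0 < h0" and C: "\<And>h. 0 < \<bar>h\<bar> \<Longrightarrow> \<bar>h\<bar> < h0 \<Longrightarrow>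
      norm2 (leb (E \<inter> U)) (\<lambda>x. w (\<Phi> h x) - w x) \<le> \<bar>h\<bar> * C"
  shows "\<bar>LINT x|leb E. w x * (gradient \<psi> x \<bullet> X x)\<bar> \<le> C * norm2 (leb E) \<psi>"
proof -
  define g where "g s = (LINT x|leb E. w (\<Phi> s x) * \<psi> x)" for s
  obtain K where K: "K \<subseteq> U" "\<And>x. x \<notin> K \<Longrightarrow> \<psi> x = 0" using test_functions_support[OF \<psi>] by metis
  have \<psi>0: "\<psi> x = 0" if "x \<notin> U" for x using K that by blast
  have EU: "E \<inter> U \<in> sets lebesgue" using EL U by auto
  have w\<Phi>: "L2_fun (leb E) (\<lambda>x. w (\<Phi> s x))" for s
    by (rule preserves_lebesgue_L2_fun(1)[OF pres EL EL mem[symmetric] w])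
  note \<psi>sq = L2_fun_test_function[OF \<psi> EL]
  have "(g has_real_derivative - (LINT x|leb E. w x * (gradient \<psi> x \<bullet> X x))) (at 0)"
    using integral_has_derivative[OF w \<psi>, of 0] by (simp add: g_def[abs_def] zero)
  then have "((\<lambda>h. (g h - g 0) / h) \<longlongrightarrow> - (LINT x|leb E. w x * (gradient \<psi> x \<bullet> X x))) (at 0)"
    by (simp add: DERIV_def)
  then have lim: "((\<lambda>h. \<bar>(g h - g 0) / h\<bar>) \<longlongrightarrow> \<bar>- (LINT x|leb E. w x * (gradient \<psi> x \<bullet> X x))\<bar>) (at 0)"
    by (rule tendsto_rabs)
  have le: "\<bar>(g h - g 0) / h\<bar> \<le> C * norm2 (leb E) \<psi>" if h: "0 < \<bar>h\<bar>" "\<bar>h\<bar> < h0" for h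
  proof -
    have dsq: "L2_fun (leb E) (\<lambda>x. w (\<Phi> h x) - w x)"
      by (intro L2_fun_diff w\<Phi> w)
    have "g h - g 0 = (LINT x|leb E. (w (\<Phi> h x) - w x) * \<psi> x)"
      unfolding g_def left_diff_distrib zero
      by (subst Bochner_Integration.integral_diff) (auto intro!: integrable_mult_L2_fun w\<Phi> w \<psi>sq)
    also have "\<dots> = (LINT x|leb (E \<inter> U). (w (\<Phi> h x) - w x) * \<psi> x)"
      by (rule lebesgue_on_extension_by_zero(3)[OF EL EU]) (auto simp: \<psi>0)
    also have "\<bar>\<dots>\<bar> \<le> norm2 (leb (E \<inter> U)) (\<lambda>x. w (\<Phi> h x) - w x) * norm2 (leb (E \<inter> U)) \<psi>"
    proof (rule Cauchy_Schwarz_norm2_real)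
      have "L2_fun (leb E) (\<lambda>x. indicator U x *\<^sub>R (w (\<Phi> h x) - w x))"
        using U by (intro L2_fun_bounded_mult(1)[OF dsq, of _ 1] measurable_restrict_space1 borel_measurable_indicator)
          (auto simp: indicator_def)
      moreover have "L2_fun (leb E) (\<lambda>x. indicator U x *\<^sub>R (w (\<Phi> h x) - w x))
          \<longleftrightarrow> L2_fun (leb (E \<inter> U)) (\<lambda>x. w (\<Phi> h x) - w x)"
        by (rule L2_fun_extension_by_zero(1)[OF EL EU]) auto
      ultimately show "L2_fun (leb (E \<inter> U)) (\<lambda>x. w (\<Phi> h x) - w x)" by blast
      show "L2_fun (leb (E \<inter> U)) \<psi>" by (rule L2_fun_test_function[OF \<psi> EU])
    qed
    also have "norm2 (leb (E \<inter> U)) \<psi> = norm2 (leb E) \<psi>"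
      by (rule L2_fun_extension_by_zero(2)[OF EU EL]) (auto simp: \<psi>0)
    also have "norm2 (leb (E \<inter> U)) (\<lambda>x. w (\<Phi> h x) - w x) * norm2 (leb E) \<psi>
        \<le> (\<bar>h\<bar> * C) * norm2 (leb E) \<psi>"
      by (intro mult_right_mono C h) simp
    finally have "\<bar>g h - g 0\<bar> \<le> (C * norm2 (leb E) \<psi>) * \<bar>h\<bar>" by (simp add: mult_ac)
    then show ?thesis using h(1) by (simp only: abs_divide pos_divide_le_eq)
  qed
  have "\<bar>- (LINT x|leb E. w x * (gradient \<psi> x \<bullet> X x))\<bar> \<le> C * norm2 (leb E) \<psi>"
  proof (rule tendsto_upperbound[OF lim])
    show "\<forall>\<^sub>F h in at 0. \<bar>(g h - g 0) / h\<bar> \<le> C * norm2 (leb E) \<psi>"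
      unfolding eventually_at using h0 le by (intro exI[of _ h0]) (auto simp: dist_real_def)
  qed simp
  then show ?thesis by simp
qed

end

lemma translation_flow: "measure_preserving_flow (\<lambda>s x. x + s *\<^sub>R d) (\<lambda>_. d) UNIV"
  by unfold_locales
    (auto intro!: preserves_lebesgue_translation continuous_intros derivative_eq_intros simp: case_prod_beta has_vector_derivative_def)

text \<open>The maps \<open>slide k h\<close> move the point over \<open>y\<close> on the graph of \<open>\<gamma>\<close> to the one over \<open>y + h k\<close>
  and shift all vertical lines accordingly. They form a one-parameter group in \<open>h\<close> and preserve the
  Lebesgue measure and the epigraph of \<open>\<gamma>\<close>; the case of the whole space is covered as well and
  serves for interior points. The hypothesis on \<open>E\<close> abstracts from the two cases.\<close>
locale sliding =
  fixes e :: "'a::euclidean_space" and \<gamma> :: "'a \<Rightarrow> real" and E :: "'a set"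
  assumes unit: "norm e = 1" and C11_\<gamma>: "C11 \<gamma>" and open_E: "open E"
    and E_invariant: "\<And>k x. k \<bullet> e = 0 \<Longrightarrow>
      x + k + (\<gamma> (x + k - ((x + k) \<bullet> e) *\<^sub>R e) - \<gamma> (x - (x \<bullet> e) *\<^sub>R e)) *\<^sub>R e \<in> E \<longleftrightarrow> x \<in> E"
begin

definition P :: "'a \<Rightarrow> 'a" where "P x = x - (x \<bullet> e) *\<^sub>R e"

text \<open>The gradient of \<open>\<gamma> \<circ> P\<close>.\<close>
definition slope :: "'a \<Rightarrow> 'a" where "slope x = P (gradient \<gamma> (P x))"

definition slide :: "'a \<Rightarrow> real \<Rightarrow> 'a \<Rightarrow> 'a"
  where "slide k h x = x + h *\<^sub>R k + (\<gamma> (P (x + h *\<^sub>R k)) - \<gamma> (P x)) *\<^sub>R e"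

text \<open>The velocity of \<open>slide k\<close>, tangential to the translated graphs of \<open>\<gamma>\<close>.\<close>
definition tangent :: "'a \<Rightarrow> 'a \<Rightarrow> 'a" where "tangent k x = k + (slope x \<bullet> k) *\<^sub>R e"

lemma ee: "e \<bullet> e = 1" using unit by (simp add: power2_norm_eq_inner[symmetric])

lemma P_add: "P (x + y) = P x + P y" and P_scaleR: "P (c *\<^sub>R x) = c *\<^sub>R P x"
  and P_diff: "P (x - y) = P x - P y"
  and P_e: "P e = 0" and P_inner_e: "P x \<bullet> e = 0" and P_P: "P (P x) = P x"
  by (auto simp: P_def algebra_simps inner_diff_left inner_add_left ee)

lemma P_inner: "P x \<bullet> y = x \<bullet> P y"
  by (simp add: P_def inner_diff_left inner_diff_right inner_commute)

lemma P_tangential: "k \<bullet> e = 0 \<Longrightarrow> P k = k" by (simp add: P_def)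

lemma norm_P_le: "norm (P x) \<le> norm x"
proof -
  have "(norm (P x))\<^sup>2 = x \<bullet> P x" unfolding power2_norm_eq_inner by (simp add: P_inner P_P)
  also have "\<dots> \<le> norm x * norm (P x)" using norm_cauchy_schwarz by blast
  finally show ?thesis by (cases "P x = 0") (auto simp: power2_eq_square)
qed

lemma continuous_on_P [continuous_intros]: "continuous_on S f \<Longrightarrow> continuous_on S (\<lambda>x. P (f x))"
  unfolding P_def by (intro continuous_intros)

lemma P_has_derivative: "(P has_derivative P) (at x)"
  unfolding P_def by (auto intro!: derivative_eq_intros)

lemma continuous_on_gradient_\<gamma>: "continuous_on UNIV (gradient \<gamma>)"
  using C11_\<gamma> by (rule continuous_on_gradient_C11)

lemma continuous_on_\<gamma>: "continuous_on UNIV \<gamma>"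
  using C11_\<gamma> unfolding C11_def by (simp add: continuous_at_imp_continuous_on differentiable_imp_continuous_within)

lemma continuous_on_slope: "continuous_on UNIV slope"
  unfolding slope_def
  by (intro continuous_on_P continuous_on_compose2[OF continuous_on_gradient_\<gamma>] continuous_intros) auto

lemma slope_e [simp]: "slope x \<bullet> e = 0" by (simp add: slope_def P_inner_e)

lemma slope_cong: "P x = P y \<Longrightarrow> slope x = slope y" by (simp add: slope_def)

lemma slope_add_e [simp]: "slope (x + t *\<^sub>R e) = slope x" "slope (x - t *\<^sub>R e) = slope x"
  by (rule slope_cong, simp add: P_add P_diff P_scaleR P_e)+

lemma \<gamma>_P_has_derivative: "((\<lambda>x. \<gamma> (P x)) has_derivative (\<lambda>d. slope x \<bullet> d)) (at x)"
proof -
  have "(\<gamma> has_derivative (\<lambda>d. gradient \<gamma> (P x) \<bullet> d)) (at (P x))"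
    using C11_\<gamma> by (intro gradient_has_derivative) (simp add: C11_def)
  from has_derivative_compose[OF P_has_derivative this]
  show ?thesis by (simp add: slope_def P_inner)
qed

lemma P_slide: "k \<bullet> e = 0 \<Longrightarrow> P (slide k h x) = P x + h *\<^sub>R k"
  by (simp add: slide_def P_add P_scaleR P_e P_tangential)

lemma slope_slide: "k \<bullet> e = 0 \<Longrightarrow> slope (slide k h x) = slope (x + h *\<^sub>R k)"
  by (rule slope_cong) (simp add: P_slide P_add P_scaleR P_tangential)

lemma slide_0 [simp]: "slide k 0 x = x" by (simp add: slide_def)

lemma slide_add: "k \<bullet> e = 0 \<Longrightarrow> slide k s (slide k t x) = slide k (s + t) x"
proof -
  assume k: "k \<bullet> e = 0"
  have 1: "P (slide k t x + s *\<^sub>R k) = P x + (s + t) *\<^sub>R k"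
    using k by (simp add: P_add P_slide P_scaleR P_tangential algebra_simps)
  have 2: "P (slide k t x) = P x + t *\<^sub>R k" by (rule P_slide[OF k])
  have 3: "P (x + (s + t) *\<^sub>R k) = P x + (s + t) *\<^sub>R k" "P (x + t *\<^sub>R k) = P x + t *\<^sub>R k"
    using k by (simp_all add: P_add P_scaleR P_tangential)
  have "slide k s (slide k t x) = slide k t x + s *\<^sub>R k + (\<gamma> (P x + (s + t) *\<^sub>R k) - \<gamma> (P x + t *\<^sub>R k)) *\<^sub>R e"
    by (simp only: slide_def[of k s "slide k t x"] 1 2)
  also have "\<dots> = slide k (s + t) x"
    by (simp only: slide_def[of k t x] slide_def[of k "s + t" x] 3) (simp add: algebra_simps)
  finally show ?thesis .
qed

lemma slide_inverse: "k \<bullet> e = 0 \<Longrightarrow> slide k (- h) (slide k h x) = x"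
    "k \<bullet> e = 0 \<Longrightarrow> slide k h (slide k (- h) x) = x"
  by (simp_all add: slide_add)

lemma slide_mem_E: "k \<bullet> e = 0 \<Longrightarrow> slide k h x \<in> E \<longleftrightarrow> x \<in> E"
  using E_invariant[of "h *\<^sub>R k" x] by (simp add: slide_def P_def)

lemma slide_has_derivative:
  "(slide k h has_derivative (\<lambda>d. d + ((slope (x + h *\<^sub>R k) - slope x) \<bullet> d) *\<^sub>R e)) (at x)"
proof -
  have "((\<lambda>x. \<gamma> (P (x + h *\<^sub>R k))) has_derivative (\<lambda>d. slope (x + h *\<^sub>R k) \<bullet> d)) (at x)"
    by (rule has_derivative_compose[OF _ \<gamma>_P_has_derivative, where f="\<lambda>x. x + h *\<^sub>R k" and f'="\<lambda>d. d"])
      (auto intro!: derivative_eq_intros)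
  then show ?thesis
    unfolding slide_def
    by (auto intro!: derivative_eq_intros \<gamma>_P_has_derivative simp: inner_diff_left)
qed

lemma continuous_on_slide_joint: "continuous_on UNIV (\<lambda>(h, x). slide k h x)"
  unfolding slide_def case_prod_beta
  by (intro continuous_intros continuous_on_compose2[OF continuous_on_\<gamma>]) auto

lemma continuous_on_slide: "continuous_on UNIV (slide k h)"
  unfolding slide_def
  by (intro continuous_intros continuous_on_compose2[OF continuous_on_\<gamma>]) auto

lemma slide_has_vector_derivative:
  assumes k: "k \<bullet> e = 0"
  shows "((\<lambda>h. slide k h x) has_vector_derivative tangent k (slide k h x)) (at h)"
proof -
  have "((\<lambda>h. \<gamma> (P (x + h *\<^sub>R k))) has_derivative (\<lambda>t. slope (x + h *\<^sub>R k) \<bullet> (t *\<^sub>R k))) (at h)"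
    by (rule has_derivative_compose[OF _ \<gamma>_P_has_derivative, where f="\<lambda>h. x + h *\<^sub>R k" and f'="\<lambda>t. t *\<^sub>R k"])
      (auto intro!: derivative_eq_intros)
  then have "((\<lambda>h. slide k h x) has_derivative (\<lambda>t. t *\<^sub>R k + (slope (x + h *\<^sub>R k) \<bullet> (t *\<^sub>R k)) *\<^sub>R e)) (at h)"
    unfolding slide_def by (auto intro!: derivative_eq_intros)
  then show ?thesis
    by (simp add: has_vector_derivative_def tangent_def slope_slide[OF k] algebra_simps)
qed

lemma preserves_lebesgue_slide:
  assumes k: "k \<bullet> e = 0" shows "preserves_lebesgue (slide k h)"
proof -
  define g where "g y = \<gamma> (P y) - \<gamma> (P (y - h *\<^sub>R k))" for y
  have "continuous_on UNIV g" unfolding g_def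
    by (intro continuous_intros continuous_on_compose2[OF continuous_on_\<gamma>]) auto
  then have "g \<in> borel_measurable borel" by (rule borel_measurable_continuous_onI)
  moreover have "g (x + s *\<^sub>R e) = g x" for x s by (simp add: g_def P_add P_diff P_scaleR P_e)
  ultimately have "preserves_lebesgue (\<lambda>y. y + g y *\<^sub>R e)" by (rule preserves_lebesgue_shear[OF unit])
  from preserves_lebesgue_comp[OF this preserves_lebesgue_translation[of "h *\<^sub>R k"]]
  show ?thesis by (simp add: g_def slide_def[abs_def])
qed

lemma EL: "E \<in> sets lebesgue" using open_E by auto

lemma slide_L2_fun:
  fixes f :: "'a \<Rightarrow> 'b::euclidean_space"
  assumes k: "k \<bullet> e = 0" and f: "L2_fun (leb E) f"
  shows "L2_fun (leb E) (\<lambda>x. f (slide k h x))"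
    and "norm2 (leb E) (\<lambda>x. f (slide k h x)) = norm2 (leb E) f"
  using preserves_lebesgue_L2_fun[OF preserves_lebesgue_slide[OF k] EL EL _ f] slide_mem_E[OF k] by auto

lemma slide_integral:
  fixes f :: "'a \<Rightarrow> 'b::euclidean_space"
  assumes k: "k \<bullet> e = 0" and f: "f \<in> borel_measurable (leb E)"
  shows "(LINT x|leb E. f (slide k h x)) = (LINT x|leb E. f x)"
  using preserves_lebesgue_integral(3)[OF preserves_lebesgue_slide[OF k] EL EL _ f] slide_mem_E[OF k] by auto

lemma slide_integral_mult:
  fixes f g :: "'a \<Rightarrow> real"
  assumes k: "k \<bullet> e = 0" and f: "f \<in> borel_measurable (leb E)" and g: "g \<in> borel_measurable (leb E)"
  shows "(LINT x|leb E. f (slide k h x) * g x) = (LINT x|leb E. f x * g (slide k (- h) x))"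
proof -
  have [measurable]: "(\<lambda>x. g (slide k (- h) x)) \<in> borel_measurable (leb E)"
    using preserves_lebesgue_integral(1)[OF preserves_lebesgue_slide[OF k] EL EL _ g] slide_mem_E[OF k] by auto
  have "(\<lambda>x. f x * g (slide k (- h) x)) \<in> borel_measurable (leb E)" using f by measurable
  from slide_integral[OF k this, of h] show ?thesis by (simp add: slide_inverse k)
qed

lemma slide_flow:
  assumes k: "k \<bullet> e = 0" shows "measure_preserving_flow (slide k) (tangent k) E"
proof
  show "continuous_on UNIV (tangent k)" unfolding tangent_def by (intro continuous_intros continuous_on_slope)
qed (use k EL preserves_lebesgue_slide slide_inverse slide_mem_E continuous_on_slide_joint slide_has_vector_derivative in auto)

text \<open>The chain rule. The composite of a test function with the inverse slide is only continuously
  differentiable, and in the vertical direction it gets multiplied by a merely continuous factor,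
  which is constant in that direction.\<close>
lemma L2_weak_gradient_slide:
  assumes k: "k \<bullet> e = 0" and v: "L2_weak_gradient E v G"
    and s: "L2_fun (leb E) (\<lambda>x. (G (slide k h x) \<bullet> e) *\<^sub>R (slope (x + h *\<^sub>R k) - slope x))"
  shows "L2_weak_gradient E (\<lambda>x. v (slide k h x))
    (\<lambda>x. G (slide k h x) + (G (slide k h x) \<bullet> e) *\<^sub>R (slope (x + h *\<^sub>R k) - slope x))"
proof -
  have sq: "L2_fun (leb E) v" "L2_fun (leb E) G"
    using v by (auto simp: L2_weak_gradient_def)
  have m [measurable]: "v \<in> borel_measurable (leb E)" "G \<in> borel_measurable (leb E)"
    using sq by (auto dest: L2_fun_measurable)
  show ?thesis unfolding L2_weak_gradient_def
  proof (intro conjI ballI allI slide_L2_fun[OF k] L2_fun_add sq s)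
    fix \<psi> d assume \<psi>: "\<psi> \<in> test_functions E"
    have sm: "smooth \<psi>" by (rule test_functions_smooth[OF \<psi>])
    obtain K where K: "compact K" "K \<subseteq> E" "\<And>x. x \<notin> K \<Longrightarrow> \<psi> x = 0"
        "\<And>x d. x \<notin> K \<Longrightarrow> dderiv \<psi> x d = 0"
      using test_functions_support[OF \<psi>] by metis
    define K' where "K' = slide k h ` K"
    have K': "compact K'" "K' \<subseteq> E" unfolding K'_def
      using K slide_mem_E[OF k] by (auto intro!: compact_continuous_image continuous_on_subset[OF continuous_on_slide])
    define f where "f y = \<psi> (slide k (- h) y)" for y
    define b where "b y = slope y - slope (y - h *\<^sub>R k)" for y
    define g where "g y = gradient \<psi> (slide k (- h) y)" for y
    have f_cont: "continuous_on UNIV f" unfolding f_def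
      by (rule continuous_on_compose2[OF smooth_continuous[OF sm] continuous_on_slide]) simp
    have g_cont: "continuous_on UNIV g" unfolding g_def
      by (rule continuous_on_compose2[OF continuous_on_gradient_smooth[OF sm] continuous_on_slide]) simp
    have b_cont: "continuous_on UNIV b" unfolding b_def
      by (intro continuous_intros continuous_on_compose2[OF continuous_on_slope]) auto
    have f0: "f y = 0" if "y \<notin> K'" for y
    proof -
      have "slide k (- h) y \<notin> K"
      proof
        assume "slide k (- h) y \<in> K"
        then have "slide k h (slide k (- h) y) \<in> K'" unfolding K'_def by blast
        then show False using that by (simp add: slide_inverse k)
      qed
      then show ?thesis using K(3) by (simp add: f_def)
    qed
    have b_e: "b y \<bullet> e = 0" for y by (simp add: b_def inner_diff_left)
    have b_add: "b (y + t *\<^sub>R e) = b y" for y t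
      using slope_add_e(1)[of "y - h *\<^sub>R k" t] by (simp add: b_def algebra_simps)
    have f_deriv: "((\<lambda>t. f (y + t *\<^sub>R d')) has_real_derivative g y \<bullet> (d' - (b y \<bullet> d') *\<^sub>R e)) (at 0)" for y d'
    proof -
      have "(f has_derivative (\<lambda>d'. g y \<bullet> (d' + ((slope (y + (- h) *\<^sub>R k) - slope y) \<bullet> d') *\<^sub>R e))) (at y)"
        unfolding f_def g_def
        by (rule has_derivative_compose[OF slide_has_derivative gradient_has_derivative[OF smooth_differentiable[OF sm]]])
      then have "(f has_derivative (\<lambda>d'. g y \<bullet> (d' - (b y \<bullet> d') *\<^sub>R e))) (at (y + 0 *\<^sub>R d'))"
        by (simp add: b_def inner_diff_left algebra_simps)
      then have "((\<lambda>t. f (y + t *\<^sub>R d')) has_derivative (\<lambda>t. g y \<bullet> (t *\<^sub>R d' - (b y \<bullet> t *\<^sub>R d') *\<^sub>R e))) (at 0)"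
        by (rule has_derivative_compose[where f="\<lambda>t. y + t *\<^sub>R d'" and f'="\<lambda>t. t *\<^sub>R d'" and g=f, rotated])
          (auto intro!: derivative_eq_intros)
      moreover have "(\<lambda>t. g y \<bullet> (t *\<^sub>R d' - (b y \<bullet> t *\<^sub>R d') *\<^sub>R e)) = (*) (g y \<bullet> (d' - (b y \<bullet> d') *\<^sub>R e))"
        by (auto simp: fun_eq_iff inner_diff_right algebra_simps)
      ultimately show ?thesis by (simp add: has_field_derivative_def)
    qed
    have 1: "(LINT y|leb E. v y * (g y \<bullet> (d - (b y \<bullet> d) *\<^sub>R e))) = - (LINT y|leb E. (G y \<bullet> d) * f y)"
      by (rule weak_gradient_directional_test[OF open_E v f_cont K' f0 _ f_deriv])
        (assumption, intro continuous_intros g_cont b_cont)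
    have 2: "(LINT y|leb E. v y * ((b y \<bullet> d) * (g y \<bullet> e))) = - (LINT y|leb E. (G y \<bullet> e) * ((b y \<bullet> d) * f y))"
    proof (rule weak_gradient_directional_test[OF open_E v _ K'])
      show "continuous_on UNIV (\<lambda>y. b y \<bullet> d * f y)" "continuous_on UNIV (\<lambda>y. b y \<bullet> d * (g y \<bullet> e))"
        by (intro continuous_intros b_cont f_cont g_cont)+
      show "((\<lambda>t. b (y + t *\<^sub>R e) \<bullet> d * f (y + t *\<^sub>R e)) has_real_derivative b y \<bullet> d * (g y \<bullet> e)) (at 0)" for y
        unfolding b_add using f_deriv[of y e] by (intro DERIV_cmult) (simp add: b_e)
    qed (simp add: f0)
    have i: "integrable (leb E) (\<lambda>y. u y * h y)"
      if "L2_fun (leb E) u" "continuous_on UNIV h" "\<And>y. y \<notin> K' \<Longrightarrow> h y = 0" for u h :: "'a \<Rightarrow> real"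
      by (rule integrable_mult_L2_fun[OF that(1) L2_fun_continuous_compact_support[OF that(2) K'(1) that(3) EL]])
    have g0: "g y = 0" if "y \<notin> K'" for y
    proof -
      have "slide k (- h) y \<notin> K"
      proof
        assume "slide k (- h) y \<in> K"
        then have "slide k h (slide k (- h) y) \<in> K'" unfolding K'_def by blast
        then show False using that by (simp add: slide_inverse k)
      qed
      from K(4)[OF this, of "gradient \<psi> (slide k (- h) y)"]
      have "gradient \<psi> (slide k (- h) y) \<bullet> gradient \<psi> (slide k (- h) y) = 0"
        by (simp add: dderiv_eq_gradient[OF smooth_differentiable[OF sm]])
      then show ?thesis by (simp add: g_def)
    qed
    have "(LINT x|leb E. v (slide k h x) * dderiv \<psi> x d) = (LINT y|leb E. v y * (g y \<bullet> d))"
      unfolding g_def dderiv_eq_gradient[OF smooth_differentiable[OF sm]]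
      by (rule slide_integral_mult[OF k m(1)])
        (intro continuous_borel_measurable_leb continuous_intros continuous_on_gradient_smooth[OF sm])
    also have "\<dots> = (LINT y|leb E. v y * (g y \<bullet> (d - (b y \<bullet> d) *\<^sub>R e)) + v y * ((b y \<bullet> d) * (g y \<bullet> e)))"
      by (simp add: algebra_simps inner_diff_right)
    also have "\<dots> = - (LINT y|leb E. (G y \<bullet> d) * f y) - (LINT y|leb E. (G y \<bullet> e) * ((b y \<bullet> d) * f y))"
      by (subst Bochner_Integration.integral_add)
        (auto intro!: i sq continuous_intros g_cont b_cont simp: 1 2 g0)
    also have "\<dots> = - (LINT y|leb E. ((G y + (G y \<bullet> e) *\<^sub>R b y) \<bullet> d) * f y)"
    proof -
      have "(LINT y|leb E. (G y \<bullet> d) * f y + (G y \<bullet> e) * ((b y \<bullet> d) * f y))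
        = (LINT y|leb E. (G y \<bullet> d) * f y) + (LINT y|leb E. (G y \<bullet> e) * ((b y \<bullet> d) * f y))"
        by (rule Bochner_Integration.integral_add)
          (auto intro!: i L2_fun_inner_const sq continuous_intros f_cont b_cont simp: f0)
      then show ?thesis by (simp add: algebra_simps inner_add_left)
    qed
    also have "(LINT y|leb E. ((G y + (G y \<bullet> e) *\<^sub>R b y) \<bullet> d) * f y)
      = (LINT x|leb E. ((G (slide k h x) + (G (slide k h x) \<bullet> e) *\<^sub>R b (slide k h x)) \<bullet> d) * \<psi> x)"
      unfolding f_def
      by (rule slide_integral_mult[OF k, symmetric])
        (use continuous_borel_measurable_leb[OF smooth_continuous[OF sm]]
          continuous_borel_measurable_leb[OF b_cont] in measurable)
    finally have main: "(LINT x|leb E. v (slide k h x) * dderiv \<psi> x d)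
      = - (LINT x|leb E. ((G (slide k h x) + (G (slide k h x) \<bullet> e) *\<^sub>R b (slide k h x)) \<bullet> d) * \<psi> x)" .
    have bs: "b (slide k h x) = slope (x + h *\<^sub>R k) - slope x" for x
    proof -
      have "slope (slide k h x - h *\<^sub>R k) = slope x"
        by (rule slope_cong) (simp add: P_diff P_slide k P_scaleR P_tangential)
      then show ?thesis by (simp add: b_def slope_slide k)
    qed
    show "(LINT x|leb E. v (slide k h x) * dderiv \<psi> x d)
      = - (LINT x|leb E. ((G (slide k h x) + (G (slide k h x) \<bullet> e) *\<^sub>R (slope (x + h *\<^sub>R k) - slope x)) \<bullet> d) * \<psi> x)"
      using main by (simp only: bs)
  qed
qed

end

section \<open>The tangential difference quotient estimate\<close>

lemma L2_fun_norm:
  assumes "L2_fun M f"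
  shows "L2_fun M (\<lambda>x. norm (f x))" "norm2 M (\<lambda>x. norm (f x)) = norm2 M f"
  using assms by (auto simp: L2_fun_def norm2_def intro: borel_measurable_norm)

context sliding
begin

lemma slope_lipschitz:
  obtains L where "0 \<le> L" "\<And>x h k. k \<bullet> e = 0 \<Longrightarrow> norm (slope (x + h *\<^sub>R k) - slope x) \<le> L * \<bar>h\<bar> * norm k"
proof -
  obtain L where L: "L-lipschitz_on UNIV (gradient \<gamma>)" using C11_\<gamma> by (auto simp: C11_def)
  have "norm (slope (x + h *\<^sub>R k) - slope x) \<le> L * \<bar>h\<bar> * norm k" if k: "k \<bullet> e = 0" for x h k
  proof -
    have "norm (slope (x + h *\<^sub>R k) - slope x) \<le> norm (gradient \<gamma> (P (x + h *\<^sub>R k)) - gradient \<gamma> (P x))"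
      unfolding slope_def P_diff[symmetric] by (rule norm_P_le)
    also have "\<dots> \<le> L * norm (P (x + h *\<^sub>R k) - P x)"
      using lipschitz_onD[OF L] by (simp add: dist_norm)
    also have "\<dots> = L * \<bar>h\<bar> * norm k" by (simp add: P_add P_scaleR P_tangential[OF k])
    finally show ?thesis .
  qed
  moreover have "0 \<le> L" using L by (rule lipschitz_on_nonneg)
  ultimately show thesis using that by blast
qed

text \<open>The term by which the gradient of \<open>v \<circ> slide k h\<close> differs from \<open>G \<circ> slide k h\<close> is of order \<open>h\<close>.\<close>
lemma slide_remainder:
  assumes k: "k \<bullet> e = 0" and G: "L2_fun (leb E) G"
    and L: "0 \<le> L" "\<And>x h k. k \<bullet> e = 0 \<Longrightarrow> norm (slope (x + h *\<^sub>R k) - slope x) \<le> L * \<bar>h\<bar> * norm k"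
  shows "L2_fun (leb E) (\<lambda>x. (G (slide k h x) \<bullet> e) *\<^sub>R (slope (x + h *\<^sub>R k) - slope x))"
    and "norm ((G (slide k h x) \<bullet> e) *\<^sub>R (slope (x + h *\<^sub>R k) - slope x)) \<le> L * \<bar>h\<bar> * norm k * norm (G (slide k h x))"
proof -
  have le: "norm ((G (slide k h x) \<bullet> e) *\<^sub>R (slope (x + h *\<^sub>R k) - slope x)) \<le> L * \<bar>h\<bar> * norm k * norm (G (slide k h x))" for x
  proof -
    have "\<bar>G (slide k h x) \<bullet> e\<bar> \<le> norm (G (slide k h x))" using Cauchy_Schwarz_ineq2[of _ e] by (simp add: unit)
    then have "\<bar>G (slide k h x) \<bullet> e\<bar> * norm (slope (x + h *\<^sub>R k) - slope x) \<le> norm (G (slide k h x)) * (L * \<bar>h\<bar> * norm k)"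
      using L(2)[OF k] by (intro mult_mono) auto
    then show ?thesis by (simp add: mult.commute)
  qed
  show "norm ((G (slide k h x) \<bullet> e) *\<^sub>R (slope (x + h *\<^sub>R k) - slope x)) \<le> L * \<bar>h\<bar> * norm k * norm (G (slide k h x))"
    by (rule le)
  show "L2_fun (leb E) (\<lambda>x. (G (slide k h x) \<bullet> e) *\<^sub>R (slope (x + h *\<^sub>R k) - slope x))"
  proof (rule L2_fun_mono[OF slide_L2_fun(1)[OF k G]])
    have [measurable]: "(\<lambda>x. G (slide k h x)) \<in> borel_measurable (leb E)"
      by (rule L2_fun_measurable[OF slide_L2_fun(1)[OF k G]])
    have [measurable]: "(\<lambda>x. slope (x + h *\<^sub>R k) - slope x) \<in> borel_measurable (leb E)"
      by (intro continuous_borel_measurable_leb continuous_intros continuous_on_compose2[OF continuous_on_slope]) auto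
    show "(\<lambda>x. (G (slide k h x) \<bullet> e) *\<^sub>R (slope (x + h *\<^sub>R k) - slope x)) \<in> borel_measurable (leb E)" by measurable
  qed (use le in auto)
qed

lemma L2_weak_gradient_slide':
  assumes k: "k \<bullet> e = 0" and v: "L2_weak_gradient E v G"
  shows "L2_weak_gradient E (\<lambda>x. v (slide k h x))
    (\<lambda>x. G (slide k h x) + (G (slide k h x) \<bullet> e) *\<^sub>R (slope (x + h *\<^sub>R k) - slope x))"
proof -
  obtain L where L: "0 \<le> L" "\<And>x h k. k \<bullet> e = 0 \<Longrightarrow> norm (slope (x + h *\<^sub>R k) - slope x) \<le> L * \<bar>h\<bar> * norm k"
    by (rule slope_lipschitz) blast
  have "L2_fun (leb E) G" using v by (simp add: L2_weak_gradient_def)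
  from slide_remainder(1)[OF k this L] show ?thesis by (rule L2_weak_gradient_slide[OF k v])
qed

text \<open>The tangent field is divergence free, so that it can be moved from the test function to
  \<open>v\<close>; along the flow it is transported into itself.\<close>
lemma slide_integral_has_derivative_weak:
  assumes k: "k \<bullet> e = 0" and v: "L2_weak_gradient E v G" and \<psi>: "\<psi> \<in> test_functions E"
  shows "(LINT x|leb E. v (slide k s x) * (gradient \<psi> x \<bullet> tangent k x))
    = - (LINT x|leb E. (G (slide k s x) \<bullet> tangent k (slide k s x)) * \<psi> x)"
proof -
  have sm: "smooth \<psi>" by (rule test_functions_smooth[OF \<psi>])
  obtain K where K: "compact K" "K \<subseteq> E" "\<And>x. x \<notin> K \<Longrightarrow> \<psi> x = 0"
    "\<And>x d. x \<notin> K \<Longrightarrow> dderiv \<psi> x d = 0" using test_functions_support[OF \<psi>] by metis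
  have gr: "gradient \<psi> x \<bullet> d = dderiv \<psi> x d" for x d
    by (simp add: dderiv_eq_gradient[OF smooth_differentiable[OF sm]])
  have g0: "gradient \<psi> x \<bullet> d = 0" if "x \<notin> K" for x d using K(4)[OF that] by (simp add: gr)
  have gr_cont: "continuous_on UNIV (\<lambda>x. gradient \<psi> x \<bullet> d)" for d
    by (intro continuous_intros continuous_on_gradient_smooth[OF sm])
  define H where "H x = G (slide k s x) + (G (slide k s x) \<bullet> e) *\<^sub>R (slope (x + s *\<^sub>R k) - slope x)" for x
  have u: "L2_weak_gradient E (\<lambda>x. v (slide k s x)) H"
    unfolding H_def by (rule L2_weak_gradient_slide'[OF k v])
  have sq: "L2_fun (leb E) (\<lambda>x. v (slide k s x))" "L2_fun (leb E) H"
    using u by (auto simp: L2_weak_gradient_def)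
  have i: "integrable (leb E) (\<lambda>y. u y * h y)"
    if "L2_fun (leb E) u" "continuous_on UNIV h" "\<And>y. y \<notin> K \<Longrightarrow> h y = 0" for u h :: "'a \<Rightarrow> real"
    by (rule integrable_mult_L2_fun[OF that(1) L2_fun_continuous_compact_support[OF that(2) K(1) that(3) EL]])
  have 1: "(LINT x|leb E. v (slide k s x) * (gradient \<psi> x \<bullet> k)) = - (LINT x|leb E. (H x \<bullet> k) * \<psi> x)"
    using u \<psi> unfolding L2_weak_gradient_def gr by blast
  have 2: "(LINT x|leb E. v (slide k s x) * ((slope x \<bullet> k) * (gradient \<psi> x \<bullet> e)))
      = - (LINT x|leb E. (H x \<bullet> e) * ((slope x \<bullet> k) * \<psi> x))"
  proof (rule weak_gradient_directional_test[OF open_E u _ K(1,2)])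
    show "continuous_on UNIV (\<lambda>x. slope x \<bullet> k * \<psi> x)" "continuous_on UNIV (\<lambda>x. slope x \<bullet> k * (gradient \<psi> x \<bullet> e))"
      by (intro continuous_intros continuous_on_slope smooth_continuous[OF sm] gr_cont)+
    show "((\<lambda>t. slope (x + t *\<^sub>R e) \<bullet> k * \<psi> (x + t *\<^sub>R e)) has_real_derivative slope x \<bullet> k * (gradient \<psi> x \<bullet> e)) (at 0)" for x
    proof -
      have "((\<lambda>t. \<psi> (x + t *\<^sub>R e)) has_derivative (\<lambda>t. gradient \<psi> (x + 0 *\<^sub>R e) \<bullet> (t *\<^sub>R e))) (at 0)"
        by (rule has_derivative_compose[OF _ gradient_has_derivative[OF smooth_differentiable[OF sm]]])
          (auto intro!: derivative_eq_intros)
      then have "((\<lambda>t. \<psi> (x + t *\<^sub>R e)) has_real_derivative gradient \<psi> x \<bullet> e) (at 0)"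
        by (simp add: has_field_derivative_def mult_commute_abs)
      then show ?thesis unfolding slope_add_e by (rule DERIV_cmult)
    qed
  qed (simp add: K(3))
  have "(LINT x|leb E. v (slide k s x) * (gradient \<psi> x \<bullet> tangent k x))
    = (LINT x|leb E. v (slide k s x) * (gradient \<psi> x \<bullet> k) + v (slide k s x) * ((slope x \<bullet> k) * (gradient \<psi> x \<bullet> e)))"
    by (simp add: tangent_def inner_add_right algebra_simps)
  also have "\<dots> = - (LINT x|leb E. (H x \<bullet> k) * \<psi> x) - (LINT x|leb E. (H x \<bullet> e) * ((slope x \<bullet> k) * \<psi> x))"
    by (subst Bochner_Integration.integral_add)
      (auto intro!: i sq continuous_intros gr_cont continuous_on_slope simp: 1 2 g0)
  also have "\<dots> = - (LINT x|leb E. (H x \<bullet> k) * \<psi> x + (H x \<bullet> e) * ((slope x \<bullet> k) * \<psi> x))"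
    by (subst Bochner_Integration.integral_add)
      (auto intro!: i sq L2_fun_inner_const continuous_intros smooth_continuous[OF sm] continuous_on_slope simp: K(3))
  also have "(\<lambda>x. (H x \<bullet> k) * \<psi> x + (H x \<bullet> e) * ((slope x \<bullet> k) * \<psi> x))
      = (\<lambda>x. (G (slide k s x) \<bullet> tangent k (slide k s x)) * \<psi> x)"
    by (auto simp: fun_eq_iff H_def tangent_def slope_slide[OF k] inner_add_left inner_add_right inner_diff_left algebra_simps)
  finally show ?thesis .
qed

text \<open>The derivative of \<open>v\<close> along the flow is \<open>G \<bullet> tangent k\<close>, whose norm is invariant under slides.
  Integration in \<open>h\<close> is carried out after testing.\<close>
lemma norm2_slide_difference_le:
  assumes k: "k \<bullet> e = 0" and v: "L2_weak_gradient E v G"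
    and T: "L2_fun (leb E) (\<lambda>x. G x \<bullet> tangent k x)"
  shows "norm2 (leb E) (\<lambda>x. v (slide k h x) - v x) \<le> \<bar>h\<bar> * norm2 (leb E) (\<lambda>x. G x \<bullet> tangent k x)"
proof (rule norm2_le_if_test_integrals_le[OF open_E])
  have sq: "L2_fun (leb E) v" using v by (simp add: L2_weak_gradient_def)
  show "L2_fun (leb E) (\<lambda>x. v (slide k h x) - v x)"
    by (intro L2_fun_diff slide_L2_fun[OF k] sq)
  fix \<psi> assume \<psi>: "\<psi> \<in> test_functions E"
  note \<psi>sq = L2_fun_test_function[OF \<psi> EL]
  define g where "g s = (LINT x|leb E. v (slide k s x) * \<psi> x)" for s
  define g' where "g' s = (LINT x|leb E. (G (slide k s x) \<bullet> tangent k (slide k s x)) * \<psi> x)" for s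
  have g: "(g has_real_derivative g' s) (at s)" for s
    using measure_preserving_flow.integral_has_derivative[OF slide_flow[OF k] sq \<psi>, of s]
    by (simp add: g_def[abs_def] g'_def slide_integral_has_derivative_weak[OF k v \<psi>])
  have g'_le: "\<bar>g' s\<bar> \<le> norm2 (leb E) (\<lambda>x. G x \<bullet> tangent k x) * norm2 (leb E) \<psi>" for s
    unfolding g'_def
    using Cauchy_Schwarz_norm2_real[OF slide_L2_fun(1)[OF k T] \<psi>sq] slide_L2_fun(2)[OF k T] by simp
  have "norm (g h - g 0) \<le> (norm2 (leb E) (\<lambda>x. G x \<bullet> tangent k x) * norm2 (leb E) \<psi>) * norm (h - 0)"
    by (rule field_differentiable_bound[of UNIV]) (use g g'_le in auto)
  moreover have "g h - g 0 = (LINT x|leb E. (v (slide k h x) - v x) * \<psi> x)"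
    unfolding g_def left_diff_distrib
    by (subst Bochner_Integration.integral_diff)
      (auto intro!: integrable_mult_L2_fun slide_L2_fun[OF k] sq \<psi>sq)
  ultimately show "\<bar>LINT x|leb E. (v (slide k h x) - v x) * \<psi> x\<bar>
      \<le> \<bar>h\<bar> * norm2 (leb E) (\<lambda>x. G x \<bullet> tangent k x) * norm2 (leb E) \<psi>"
    by (simp add: algebra_simps)
qed simp

lemma norm2_slide_difference_bounded_support:
  assumes k: "k \<bullet> e = 0" and v: "L2_weak_gradient E v G"
    and C: "\<And>x. G x \<noteq> 0 \<Longrightarrow> norm (tangent k x) \<le> C" "0 \<le> C"
  shows "norm2 (leb E) (\<lambda>x. v (slide k h x) - v x) \<le> \<bar>h\<bar> * (C * norm2 (leb E) G)"
proof -
  have G: "L2_fun (leb E) G" using v by (simp add: L2_weak_gradient_def)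
  have le: "norm (G x \<bullet> tangent k x) \<le> C * norm (G x)" for x
  proof (cases "G x = 0")
    case False
    have "norm (G x \<bullet> tangent k x) \<le> norm (G x) * norm (tangent k x)" using Cauchy_Schwarz_ineq2 by simp
    also have "\<dots> \<le> norm (G x) * C" using C(1)[OF False] by (intro mult_left_mono) auto
    finally show ?thesis by (simp add: mult.commute)
  qed simp
  have [measurable]: "G \<in> borel_measurable (leb E)" using G by (rule L2_fun_measurable)
  have [measurable]: "tangent k \<in> borel_measurable (leb E)"
    unfolding tangent_def by (intro continuous_borel_measurable_leb continuous_intros continuous_on_slope)
  have m: "(\<lambda>x. G x \<bullet> tangent k x) \<in> borel_measurable (leb E)" by measurable
  have "norm2 (leb E) (\<lambda>x. v (slide k h x) - v x) \<le> \<bar>h\<bar> * norm2 (leb E) (\<lambda>x. G x \<bullet> tangent k x)"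
    using le by (intro norm2_slide_difference_le[OF k v] L2_fun_mono[OF G m]) auto
  also have "\<dots> \<le> \<bar>h\<bar> * (C * norm2 (leb E) G)"
    using le C(2) by (intro mult_left_mono norm2_mono[OF G m]) auto
  finally show ?thesis .
qed

end

text \<open>The absorption argument: \<open>p\<close> stands for the difference quotient of the gradient, \<open>q\<close> for that of
  its image under the strongly monotone field, and \<open>W\<close> for the gradient of the test function, which
  is \<open>\<zeta>\<^sup>2 p\<close> up to terms of lower order.\<close>
lemma monotone_absorption:
  fixes p q W :: "'a \<Rightarrow> 'b::euclidean_space" and \<zeta> y :: "'a \<Rightarrow> real"
  assumes p: "L2_fun M p" and q: "L2_fun M q" and W: "L2_fun M W"
    and y: "L2_fun M y" and \<zeta>: "\<zeta> \<in> borel_measurable M" "\<And>x. 0 \<le> \<zeta> x" "\<And>x. \<zeta> x \<le> 1"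
    and qp: "\<And>x. norm (q x) \<le> \<Lambda> * norm (p x)" "\<And>x. a0 * (norm (p x))\<^sup>2 \<le> q x \<bullet> p x"
    and Wp: "\<And>x. norm (W x - (\<zeta> x)\<^sup>2 *\<^sub>R p x) \<le> \<zeta> x * y x"
    and le: "(LINT x|M. q x \<bullet> W x) \<le> C1 * N * norm2 M W" and yN: "norm2 M y \<le> C2 * N"
    and nn: "0 < a0" "0 \<le> \<Lambda>" "0 \<le> C1" "0 \<le> C2" "0 \<le> N"
  shows "norm2 M (\<lambda>x. \<zeta> x *\<^sub>R p x) \<le> (1 + (\<Lambda> * C2 + C1 * (1 + C2)) / a0) * N"
proof -
  define Z where "Z x = \<zeta> x *\<^sub>R p x" for x
  have Z: "L2_fun M Z" unfolding Z_def
    using \<zeta>(2,3) by (intro L2_fun_bounded_mult(1)[OF p \<zeta>(1), of 1]) simp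
  have Zn: "L2_fun M (\<lambda>x. norm (Z x))" "norm2 M (\<lambda>x. norm (Z x)) = norm2 M Z"
    using L2_fun_norm[OF Z] by auto
  have y0: "0 \<le> \<zeta> x * y x" for x using Wp[of x] norm_ge_zero order_trans by blast
  have "(LINT x|M. a0 * (norm (Z x))\<^sup>2 - \<Lambda> * (norm (Z x) * y x)) \<le> (LINT x|M. q x \<bullet> W x)"
  proof (rule integral_mono)
    show "integrable M (\<lambda>x. a0 * (norm (Z x))\<^sup>2 - \<Lambda> * (norm (Z x) * y x))"
      using L2_fun_integrable[OF Z] integrable_mult_L2_fun[OF Zn(1) y] by simp
    show "integrable M (\<lambda>x. q x \<bullet> W x)" by (rule integrable_inner_L2_fun[OF q W])
    fix x
    have "a0 * (norm (Z x))\<^sup>2 = (\<zeta> x)\<^sup>2 * (a0 * (norm (p x))\<^sup>2)"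
      by (simp add: Z_def power_mult_distrib)
    also have "\<dots> \<le> (\<zeta> x)\<^sup>2 * (q x \<bullet> p x)" by (intro mult_left_mono qp) simp
    also have "\<dots> = q x \<bullet> W x + (- (q x \<bullet> (W x - (\<zeta> x)\<^sup>2 *\<^sub>R p x)))" by (simp add: inner_diff_right)
    also have "- (q x \<bullet> (W x - (\<zeta> x)\<^sup>2 *\<^sub>R p x)) \<le> norm (q x) * norm (W x - (\<zeta> x)\<^sup>2 *\<^sub>R p x)"
      using Cauchy_Schwarz_ineq2[of "q x" "W x - (\<zeta> x)\<^sup>2 *\<^sub>R p x"] by simp
    also have "norm (q x) * norm (W x - (\<zeta> x)\<^sup>2 *\<^sub>R p x) \<le> (\<Lambda> * norm (p x)) * (\<zeta> x * y x)"
      using nn by (intro mult_mono qp Wp) auto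
    also have "\<dots> = \<Lambda> * (norm (Z x) * y x)" using \<zeta>(2)[of x] by (simp add: Z_def)
    finally show "a0 * (norm (Z x))\<^sup>2 - \<Lambda> * (norm (Z x) * y x) \<le> q x \<bullet> W x" by simp
  qed
  moreover have "(LINT x|M. a0 * (norm (Z x))\<^sup>2 - \<Lambda> * (norm (Z x) * y x))
      = a0 * (norm2 M Z)\<^sup>2 - \<Lambda> * (LINT x|M. norm (Z x) * y x)"
    using L2_fun_integrable[OF Z] integrable_mult_L2_fun[OF Zn(1) y] by (simp add: norm2_square)
  moreover have "\<Lambda> * (LINT x|M. norm (Z x) * y x) \<le> \<Lambda> * (norm2 M Z * (C2 * N))"
  proof -
    have "(LINT x|M. norm (Z x) * y x) \<le> norm2 M Z * norm2 M y"
      using Cauchy_Schwarz_norm2_real[OF Zn(1) y] Zn(2) by simp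
    also have "\<dots> \<le> norm2 M Z * (C2 * N)" using yN by (intro mult_left_mono) auto
    finally show ?thesis using nn by (intro mult_left_mono) auto
  qed
  moreover have "C1 * N * norm2 M W \<le> C1 * N * (norm2 M Z + C2 * N)"
  proof -
    have yabs: "L2_fun M (\<lambda>x. \<bar>y x\<bar>)" "norm2 M (\<lambda>x. \<bar>y x\<bar>) = norm2 M y"
      using L2_fun_norm[OF y] by auto
    have "norm2 M W \<le> 1 * norm2 M (\<lambda>x. norm (Z x) + \<bar>y x\<bar>)"
    proof (rule norm2_mono[OF L2_fun_add[OF Zn(1) yabs(1)] L2_fun_measurable[OF W]])
      show "AE x in M. norm (W x) \<le> 1 * norm (norm (Z x) + \<bar>y x\<bar>)"
      proof (rule AE_I2)
        fix x
        have "norm (W x) \<le> norm (W x - (\<zeta> x)\<^sup>2 *\<^sub>R p x) + norm ((\<zeta> x)\<^sup>2 *\<^sub>R p x)"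
          using norm_triangle_ineq[of "W x - (\<zeta> x)\<^sup>2 *\<^sub>R p x" "(\<zeta> x)\<^sup>2 *\<^sub>R p x"] by simp
        also have "norm (W x - (\<zeta> x)\<^sup>2 *\<^sub>R p x) \<le> \<bar>y x\<bar>"
        proof -
          have "\<zeta> x * y x \<le> \<zeta> x * \<bar>y x\<bar>" using \<zeta>(2) by (intro mult_left_mono) auto
          also have "\<dots> \<le> 1 * \<bar>y x\<bar>" using \<zeta>(3) by (intro mult_right_mono) auto
          finally show ?thesis using Wp[of x] by simp
        qed
        also have "norm ((\<zeta> x)\<^sup>2 *\<^sub>R p x) \<le> norm (Z x)"
        proof -
          have "(\<zeta> x)\<^sup>2 \<le> \<zeta> x" using \<zeta>(2,3)[of x] by (simp add: power2_eq_square mult_left_le)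
          then have "(\<zeta> x)\<^sup>2 * norm (p x) \<le> \<zeta> x * norm (p x)" by (intro mult_right_mono) auto
          then show ?thesis using \<zeta>(2)[of x] by (simp add: Z_def)
        qed
        finally show "norm (W x) \<le> 1 * norm (norm (Z x) + \<bar>y x\<bar>)" by simp
      qed
    qed simp
    also have "\<dots> \<le> norm2 M Z + norm2 M y" using norm2_triangle[OF Zn(1) yabs(1)] by (simp add: Zn(2) yabs(2))
    finally have "norm2 M W \<le> norm2 M Z + C2 * N" using yN by simp
    then show ?thesis using nn by (intro mult_left_mono) auto
  qed
  ultimately have main: "a0 * (norm2 M Z)\<^sup>2 \<le> \<Lambda> * (norm2 M Z * (C2 * N)) + C1 * N * (norm2 M Z + C2 * N)"
    using le by linarith
  have "norm2 M Z \<le> (1 + (\<Lambda> * C2 + C1 * (1 + C2)) / a0) * N"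
  proof (cases "norm2 M Z \<le> N")
    case True
    have "1 * N \<le> (1 + (\<Lambda> * C2 + C1 * (1 + C2)) / a0) * N" using nn by (intro mult_right_mono) auto
    then show ?thesis using True by simp
  next
    case False
    then have pos: "0 < norm2 M Z" using nn by linarith
    have "C1 * N * (norm2 M Z + C2 * N) \<le> C1 * N * (norm2 M Z + C2 * norm2 M Z)"
      using False nn by (intro mult_left_mono add_left_mono) auto
    then have "a0 * (norm2 M Z)\<^sup>2 \<le> \<Lambda> * (norm2 M Z * (C2 * N)) + C1 * N * (norm2 M Z + C2 * norm2 M Z)"
      using main by linarith
    also have "\<dots> = (\<Lambda> * C2 + C1 * (1 + C2)) * N * norm2 M Z" by (simp add: algebra_simps)
    finally have "(a0 * norm2 M Z) * norm2 M Z \<le> ((\<Lambda> * C2 + C1 * (1 + C2)) * N) * norm2 M Z"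
      by (simp add: power2_eq_square mult.assoc)
    then have "a0 * norm2 M Z \<le> (\<Lambda> * C2 + C1 * (1 + C2)) * N" using pos by (rule mult_right_le_imp_le)
    then have "norm2 M Z \<le> (\<Lambda> * C2 + C1 * (1 + C2)) * N / a0" using nn by (simp add: pos_le_divide_eq mult.commute)
    then show ?thesis using nn by (simp add: distrib_right)
  qed
  then show ?thesis by (simp add: Z_def[abs_def])
qed

lemma L2_weak_gradient_scale:
  assumes "open E" "L2_weak_gradient E v G"
  shows "L2_weak_gradient E (\<lambda>x. t * v x) (\<lambda>x. t *\<^sub>R G x)"
  using L2_weak_gradient_linear_comb[of E "\<lambda>_. 0" "\<lambda>_. 0" v G t] assms
  by (simp add: L2_weak_gradient_def)

lemma abs_inverse_mult_le:
  fixes h X Y :: real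
  assumes "X \<le> \<bar>h\<bar> * Y" "0 < \<bar>h\<bar>" shows "\<bar>1 / h\<bar> * X \<le> Y"
proof -
  have "X / \<bar>h\<bar> \<le> Y" using assms by (simp add: pos_divide_le_eq mult.commute)
  then show ?thesis by simp
qed

context sliding
begin

text \<open>A solution of the equation in \<open>E\<close> that has been cut off outside a ball of radius \<open>4 r\<close>, so
  that the equation only holds for test functions living in the ball of radius \<open>3 r\<close>.\<close>
definition local_solution ::
    "('a \<Rightarrow> 'a) \<Rightarrow> 'a \<Rightarrow> real \<Rightarrow> ('a \<Rightarrow> real) \<Rightarrow> ('a \<Rightarrow> 'a) \<Rightarrow> ('a \<Rightarrow> real) \<Rightarrow> bool"
  where "local_solution a x0 r v G f \<longleftrightarrow> L2_weak_gradient E v G \<and>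
    (\<forall>x. x \<notin> cball x0 (4 * r) \<longrightarrow> G x = 0) \<and> L2_fun (leb E) f \<and>
    (\<forall>\<eta> H. L2_weak_gradient E \<eta> H \<longrightarrow> (\<forall>x. x \<notin> cball x0 (3 * r) \<longrightarrow> \<eta> x = 0 \<and> H x = 0) \<longrightarrow>
      (LINT x|leb E. a (G x) \<bullet> H x) = (LINT x|leb E. f x * \<eta> x))"

text \<open>The weak equation is tested with \<open>(w \<circ> slide k (-h) - w) / h\<close>, where \<open>w\<close> is the product of
  \<open>\<zeta>\<^sup>2\<close> and the difference quotient of \<open>v\<close>. Since slides preserve the measure, the quotient moves over
  to \<open>a \<circ> G\<close>, where strong monotonicity controls the difference quotient of \<open>G\<close>; the derivatives of the
  slides contribute terms of order \<open>h\<close> since the slope of \<open>\<gamma>\<close> is Lipschitz continuous. The constant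
  does not depend on the solution.\<close>
lemma tangential_estimate:
  fixes a :: "'a \<Rightarrow> 'a"
  assumes k: "k \<bullet> e = 0" "norm k \<le> 1" and r: "0 < r"
    and a: "\<And>p q. norm (a p - a q) \<le> \<Lambda> * norm (p - q)" "a 0 = 0"
      "\<And>p q. a0 * (norm (p - q))\<^sup>2 \<le> (a p - a q) \<bullet> (p - q)" and a0: "0 < a0" and \<Lambda>: "0 \<le> \<Lambda>"
  obtains K h0 where "0 \<le> K" "0 < h0"
    "\<And>v G f h. local_solution a x0 r v G f \<Longrightarrow>
      0 < \<bar>h\<bar> \<Longrightarrow> \<bar>h\<bar> < h0 \<Longrightarrow>
      norm2 (leb (E \<inter> ball x0 r)) (\<lambda>x. G (slide k h x) - G x)
        \<le> \<bar>h\<bar> * (K * (norm2 (leb E) f + norm2 (leb E) G))"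
proof -
  let ?M = "leb E"
  obtain \<zeta> where \<zeta>: "smooth \<zeta>" "\<And>x. 0 \<le> \<zeta> x" "\<And>x. \<zeta> x \<le> 1"
    "\<And>x. x \<in> cball x0 r \<Longrightarrow> \<zeta> x = 1" "\<And>x. x \<notin> ball x0 (2 * r) \<Longrightarrow> \<zeta> x = 0"
    by (rule cutoff_ball_exists[of r "2 * r" x0]) (use r in auto)
  have "compact (gradient \<zeta> ` cball x0 (2 * r))"
    by (intro compact_continuous_image continuous_on_subset[OF continuous_on_gradient_smooth[OF \<zeta>(1)]]) auto
  then obtain B where B: "0 < B" "\<And>x. x \<in> cball x0 (2 * r) \<Longrightarrow> norm (gradient \<zeta> x) \<le> B"
    using compact_imp_bounded[of "gradient \<zeta> ` cball x0 (2 * r)"] by (auto simp: bounded_pos)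
  have "continuous_on UNIV (tangent k)" unfolding tangent_def
    by (intro continuous_intros continuous_on_slope)
  then have "compact (tangent k ` cball x0 (4 * r))"
    by (intro compact_continuous_image) (auto intro: continuous_on_subset)
  then obtain C where C: "0 < C" "\<And>x. x \<in> cball x0 (4 * r) \<Longrightarrow> norm (tangent k x) \<le> C"
    using compact_imp_bounded[of "tangent k ` cball x0 (4 * r)"] by (auto simp: bounded_pos)
  obtain L where L: "0 \<le> L" "\<And>x h k. k \<bullet> e = 0 \<Longrightarrow> norm (slope (x + h *\<^sub>R k) - slope x) \<le> L * \<bar>h\<bar> * norm k"
    by (rule slope_lipschitz) blast
  have Lk: "L * \<bar>h\<bar> * norm k \<le> L * \<bar>h\<bar>" for h using k(2) L(1) by (simp add: mult_left_le)
  define D where "D x = (2 * \<zeta> x) *\<^sub>R gradient \<zeta> x" for x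
  have \<zeta>2: "smooth (\<lambda>x. \<zeta> x * \<zeta> x)" using \<zeta>(1) by (auto intro: Ck_mult)
  have D: "dderiv (\<lambda>x. \<zeta> x * \<zeta> x) x d = D x \<bullet> d" for x d
    by (simp add: dderiv_mult[OF \<zeta>(1) \<zeta>(1)] D_def
      dderiv_eq_gradient[OF smooth_differentiable[OF \<zeta>(1)]])
  have D_cont: "continuous_on UNIV D" unfolding D_def
    by (intro continuous_intros smooth_continuous[OF \<zeta>(1)] continuous_on_gradient_smooth[OF \<zeta>(1)])
  have D_le: "norm (D x) \<le> 2 * B * \<zeta> x" for x
  proof (cases "x \<in> ball x0 (2 * r)")
    case True
    then have "norm (gradient \<zeta> x) * \<zeta> x \<le> B * \<zeta> x" using \<zeta>(2) by (intro mult_right_mono B) auto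
    then show ?thesis using \<zeta>(2)[of x] by (simp add: D_def mult.commute)
  next
    case False then show ?thesis by (simp add: D_def \<zeta>(5))
  qed
  have D_le': "norm (D x) \<le> 2 * B" for x
  proof -
    have "2 * B * \<zeta> x \<le> 2 * B * 1" using B(1) by (intro mult_left_mono \<zeta>(3)) simp
    then show ?thesis using D_le[of x] by linarith
  qed
  \<comment> \<open>For small \<open>h\<close> a slide moves points of the support of \<open>\<zeta>\<close> by less than \<open>r\<close>, so that the test
    function lives in the ball of radius \<open>3 r\<close>, where the equation is available.\<close>
  have "uniformly_continuous_on ({-1..1} \<times> cball x0 (2 * r)) (\<lambda>(h, x). slide k h x)"
    by (intro compact_uniformly_continuous continuous_on_subset[OF continuous_on_slide_joint] compact_Times) auto
  then obtain \<delta> where \<delta>: "\<delta> > 0" "\<And>p q. p \<in> {-1..1} \<times> cball x0 (2 * r) \<Longrightarrow> q \<in> {-1..1} \<times> cball x0 (2 * r) \<Longrightarrow>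
      dist q p < \<delta> \<Longrightarrow> dist ((\<lambda>(h, x). slide k h x) q) ((\<lambda>(h, x). slide k h x) p) < r"
    using r unfolding uniformly_continuous_on_def by meson
  define h0 where "h0 = min 1 \<delta>"
  have h0: "0 < h0" using \<delta>(1) by (simp add: h0_def)
  have near: "dist (slide k h y) y < r" if "\<bar>h\<bar> < h0" "y \<in> cball x0 (2 * r)" for h y
  proof -
    have "- 1 \<le> h" "h \<le> 1" "\<bar>h\<bar> < \<delta>" using that(1) by (auto simp: h0_def)
    then show ?thesis using \<delta>(2)[of "(0, y)" "(h, y)"] that(2) by (simp add: dist_Pair_Pair)
  qed
  have a_le: "norm (a p) \<le> \<Lambda> * norm p" for p using a(1)[of p 0] a(2) by simp
  have "\<Lambda>-lipschitz_on UNIV a" using a(1) \<Lambda> by (auto simp: lipschitz_on_def dist_norm)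
  then have a_cont: "continuous_on UNIV a" by (rule lipschitz_on_continuous_on)
  then have [measurable]: "a \<in> borel_measurable borel" by (rule borel_measurable_continuous_onI)
  define C1 where "C1 = C + \<Lambda> * L"
  define C2 where "C2 = L + 2 * B * C"
  define K where "K = 1 + (\<Lambda> * C2 + C1 * (1 + C2)) / a0"
  have C12: "0 \<le> C1" "0 \<le> C2" using C(1) B(1) L(1) \<Lambda> by (auto simp: C1_def C2_def)
  show thesis
  proof (rule that[of K h0])
    show "0 \<le> K" using C12 a0 \<Lambda> by (simp add: K_def)
    fix v G f h
    assume sol: "local_solution a x0 r v G f" and h: "0 < \<bar>h\<bar>" "\<bar>h\<bar> < h0"
    have v: "L2_weak_gradient E v G" and G0: "\<And>x. x \<notin> cball x0 (4 * r) \<Longrightarrow> G x = 0"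
      and f: "L2_fun ?M f"
      and eqn: "\<And>\<eta> H. L2_weak_gradient E \<eta> H \<Longrightarrow> (\<And>x. x \<notin> cball x0 (3 * r) \<Longrightarrow> \<eta> x = 0 \<and> H x = 0) \<Longrightarrow>
        (LINT x|?M. a (G x) \<bullet> H x) = (LINT x|?M. f x * \<eta> x)"
      using sol unfolding local_solution_def by blast+
    \<comment> \<open>\<open>V\<close> is the difference quotient of \<open>v\<close>, \<open>w\<close> its product with \<open>\<zeta>\<^sup>2\<close>, and \<open>\<eta>\<close> the backward difference
      quotient of \<open>w\<close>, which is the test function; \<open>HV\<close>, \<open>W\<close> and \<open>H\<close> are their gradients, in which \<open>R\<close> and
      \<open>S\<close> account for the derivatives of the slides.\<close>
    define N where "N = norm2 ?M f + norm2 ?M G"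
    define R where "R x = (G (slide k h x) \<bullet> e) *\<^sub>R (slope (x + h *\<^sub>R k) - slope x)" for x
    define V where "V x = (1/h) * (v (slide k h x) + (-1) * v x)" for x
    define HV where "HV x = (1/h) *\<^sub>R ((G (slide k h x) + R x) + (-1) *\<^sub>R G x)" for x
    define w where "w x = \<zeta> x * \<zeta> x * V x" for x
    define W where "W x = (\<zeta> x * \<zeta> x) *\<^sub>R HV x + V x *\<^sub>R D x" for x
    define S where "S x = (W (slide k (- h) x) \<bullet> e) *\<^sub>R (slope (x + (- h) *\<^sub>R k) - slope x)" for x
    define \<eta> where "\<eta> x = (1/h) * (w (slide k (- h) x) + (-1) * w x)" for x
    define H where "H x = (1/h) *\<^sub>R ((W (slide k (- h) x) + S x) + (-1) *\<^sub>R W x)" for x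
    define p where "p x = (1/h) *\<^sub>R (G (slide k h x) - G x)" for x
    define q where "q x = (1/h) *\<^sub>R (a (G (slide k h x)) - a (G x))" for x
    define y where "y x = L * norm (G (slide k h x)) + 2 * B * \<bar>V x\<bar>" for x
    have V: "L2_weak_gradient E V HV" unfolding V_def HV_def R_def
      by (intro L2_weak_gradient_scale L2_weak_gradient_linear_comb L2_weak_gradient_slide' open_E v k)
    have w: "L2_weak_gradient E w W" unfolding w_def W_def
    proof (rule L2_weak_gradient_mult_smooth[OF open_E V \<zeta>2 D D_cont])
      fix x
      have "\<zeta> x * \<zeta> x \<le> 1 * 1" using \<zeta>(2,3) by (intro mult_mono) auto
      then show "\<bar>\<zeta> x * \<zeta> x\<bar> \<le> 1 + 2 * B" using \<zeta>(2)[of x] B(1) by simp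
      show "norm (D x) \<le> 1 + 2 * B" using D_le'[of x] by simp
    qed
    have \<eta>: "L2_weak_gradient E \<eta> H" unfolding \<eta>_def H_def S_def
      by (intro L2_weak_gradient_scale L2_weak_gradient_linear_comb L2_weak_gradient_slide' open_E w k)
    have W0: "w x = 0" "W x = 0" if "x \<notin> cball x0 (2 * r)" for x
    proof -
      have "\<zeta> x = 0" using that by (intro \<zeta>(5)) auto
      then show "w x = 0" "W x = 0" by (auto simp: w_def W_def D_def)
    qed
    have W\<sigma>0: "w (slide k (- h) x) = 0" "W (slide k (- h) x) = 0" if "x \<notin> cball x0 (3 * r)" for x
    proof -
      have "slide k (- h) x \<notin> cball x0 (2 * r)"
      proof
        assume c: "slide k (- h) x \<in> cball x0 (2 * r)"
        from near[OF h(2) c] have "dist x (slide k (- h) x) < r" by (simp add: slide_inverse k)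
        then have "dist x0 x \<le> 3 * r"
          using c dist_triangle[of x0 x "slide k (- h) x"] by (simp add: dist_commute)
        then show False using that by simp
      qed
      then show "w (slide k (- h) x) = 0" "W (slide k (- h) x) = 0" by (auto intro: W0)
    qed
    have W00: "w x = 0" "W x = 0" if "x \<notin> cball x0 (3 * r)" for x
    proof -
      have "x \<notin> cball x0 (2 * r)" using that r by auto
      then show "w x = 0" "W x = 0" by (rule W0)+
    qed
    have G: "L2_fun ?M G" using v by (simp add: L2_weak_gradient_def)
    have Wsq: "L2_fun ?M W" using w by (simp add: L2_weak_gradient_def)
    have Vsq: "L2_fun ?M V" using V by (simp add: L2_weak_gradient_def)
    have wsq: "L2_fun ?M w" using w by (simp add: L2_weak_gradient_def)
    have \<eta>sq: "L2_fun ?M \<eta>" using \<eta> by (simp add: L2_weak_gradient_def)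
    have G\<tau>: "L2_fun ?M (\<lambda>x. G (slide k h x))" "norm2 ?M (\<lambda>x. G (slide k h x)) = norm2 ?M G"
      by (rule slide_L2_fun[OF k(1) G])+
    have W\<sigma>: "L2_fun ?M (\<lambda>x. W (slide k (- h) x))" "norm2 ?M (\<lambda>x. W (slide k (- h) x)) = norm2 ?M W"
      by (rule slide_L2_fun[OF k(1) Wsq])+
    have S: "L2_fun ?M S" unfolding S_def by (rule slide_remainder(1)[OF k(1) Wsq L])
    have aG: "L2_fun ?M (\<lambda>x. a (G x))" "norm2 ?M (\<lambda>x. a (G x)) \<le> \<Lambda> * norm2 ?M G"
    proof -
      have m: "(\<lambda>x. a (G x)) \<in> borel_measurable ?M" using L2_fun_measurable[OF G] by measurable
      show "L2_fun ?M (\<lambda>x. a (G x))" "norm2 ?M (\<lambda>x. a (G x)) \<le> \<Lambda> * norm2 ?M G"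
        using a_le \<Lambda> by (auto intro!: L2_fun_mono[OF G m] norm2_mono[OF G m])
    qed
    have aG\<tau>: "L2_fun ?M (\<lambda>x. a (G (slide k h x)))"
      by (rule slide_L2_fun[OF k(1) aG(1)])
    have psq: "L2_fun ?M p" unfolding p_def by (intro L2_fun_scaleR L2_fun_diff G G\<tau>)
    have qsq: "L2_fun ?M q" unfolding q_def by (intro L2_fun_scaleR L2_fun_diff aG aG\<tau>)
    have NG: "norm2 ?M G \<le> N" "norm2 ?M f \<le> N" "0 \<le> N" by (auto simp: N_def)
    have V_le: "norm2 ?M V \<le> C * norm2 ?M G"
    proof -
      have "norm2 ?M (\<lambda>x. v (slide k h x) - v x) \<le> \<bar>h\<bar> * (C * norm2 ?M G)"
        by (rule norm2_slide_difference_bounded_support[OF k(1) v]) (use C G0 in force)+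
      moreover have "norm2 ?M V = \<bar>1/h\<bar> * norm2 ?M (\<lambda>x. v (slide k h x) - v x)"
        unfolding V_def by (subst norm2_mult) simp
      ultimately show ?thesis using abs_inverse_mult_le[OF _ h(1)] by simp
    qed
    have \<eta>_le: "norm2 ?M \<eta> \<le> C * norm2 ?M W"
    proof -
      have "norm (tangent k x) \<le> C" if "W x \<noteq> 0" for x
      proof -
        have "x \<in> cball x0 (2 * r)" using W0(2) that by blast
        then show ?thesis using r by (intro C(2)) auto
      qed
      then have "norm2 ?M (\<lambda>x. w (slide k (- h) x) - w x) \<le> \<bar>- h\<bar> * (C * norm2 ?M W)"
        using C(1) by (intro norm2_slide_difference_bounded_support[OF k(1) w]) auto
      moreover have "norm2 ?M \<eta> = \<bar>1/h\<bar> * norm2 ?M (\<lambda>x. w (slide k (- h) x) - w x)"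
        unfolding \<eta>_def by (subst norm2_mult) simp
      ultimately show ?thesis using abs_inverse_mult_le[OF _ h(1)] by simp
    qed
    have S_le: "norm2 ?M S \<le> \<bar>h\<bar> * (L * norm2 ?M W)"
    proof -
      have "norm2 ?M S \<le> (L * \<bar>h\<bar>) * norm2 ?M (\<lambda>x. W (slide k (- h) x))"
      proof (rule norm2_mono[OF W\<sigma>(1) L2_fun_measurable[OF S]])
        have "norm (S x) \<le> L * \<bar>h\<bar> * norm (W (slide k (- h) x))" for x
        proof -
          have "norm (S x) \<le> L * \<bar>- h\<bar> * norm k * norm (W (slide k (- h) x))"
            unfolding S_def by (rule slide_remainder(2)[OF k(1) Wsq L])
          also have "\<dots> \<le> L * \<bar>h\<bar> * norm (W (slide k (- h) x))"
            using Lk[of h] by (intro mult_right_mono) auto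
          finally show ?thesis .
        qed
        then show "AE x in ?M. norm (S x) \<le> L * \<bar>h\<bar> * norm (W (slide k (- h) x))" by simp
      qed (use L in simp)
      then show ?thesis by (simp add: W\<sigma>(2) mult_ac)
    qed
    \<comment> \<open>The discrete integration by parts moves the backward difference from \<open>W\<close> to \<open>a \<circ> G\<close>.\<close>
    have qW: "(LINT x|?M. q x \<bullet> W x) = (LINT x|?M. f x * \<eta> x) - (1/h) * (LINT x|?M. a (G x) \<bullet> S x)"
    proof -
      have i: "integrable ?M (\<lambda>x. a (G x) \<bullet> W (slide k (- h) x))" "integrable ?M (\<lambda>x. a (G x) \<bullet> S x)"
          "integrable ?M (\<lambda>x. a (G x) \<bullet> W x)" "integrable ?M (\<lambda>x. a (G (slide k h x)) \<bullet> W x)"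
        by (intro integrable_inner_L2_fun aG aG\<tau> W\<sigma> S Wsq)+
      have "(LINT x|?M. f x * \<eta> x) = (LINT x|?M. a (G x) \<bullet> H x)"
        by (rule eqn[OF \<eta>, symmetric]) (auto simp: \<eta>_def H_def S_def W\<sigma>0 W00)
      also have "\<dots> = (LINT x|?M. (1/h) * ((a (G x) \<bullet> W (slide k (- h) x) + a (G x) \<bullet> S x) - a (G x) \<bullet> W x))"
        by (simp add: H_def inner_add_right inner_diff_right algebra_simps)
      also have "\<dots> = (1/h) * (((LINT x|?M. a (G x) \<bullet> W (slide k (- h) x)) + (LINT x|?M. a (G x) \<bullet> S x)) - (LINT x|?M. a (G x) \<bullet> W x))"
        using i by simp
      also have "(LINT x|?M. a (G x) \<bullet> W (slide k (- h) x)) = (LINT x|?M. a (G (slide k h x)) \<bullet> W x)"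
        using slide_integral[OF k(1) borel_measurable_integrable[OF i(4)], of "- h"] by (simp add: slide_inverse k)
      finally have "(LINT x|?M. f x * \<eta> x) - (1/h) * (LINT x|?M. a (G x) \<bullet> S x)
        = (1/h) * ((LINT x|?M. a (G (slide k h x)) \<bullet> W x) - (LINT x|?M. a (G x) \<bullet> W x))"
        by (simp add: algebra_simps)
      also have "\<dots> = (LINT x|?M. (1/h) * (a (G (slide k h x)) \<bullet> W x - a (G x) \<bullet> W x))"
        using i by simp
      also have "\<dots> = (LINT x|?M. q x \<bullet> W x)" by (simp add: q_def inner_diff_left)
      finally show ?thesis by simp
    qed
    have "norm2 ?M (\<lambda>x. \<zeta> x *\<^sub>R p x) \<le> K * N" unfolding K_def
    proof (rule monotone_absorption[OF psq qsq Wsq, of y])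
      show ysq: "L2_fun ?M y" unfolding y_def
        by (intro L2_fun_add L2_fun_mult L2_fun_norm G\<tau>)
          (use L2_fun_norm(1)[OF Vsq] in simp)
      show "\<zeta> \<in> borel_measurable ?M" by (rule continuous_borel_measurable_leb[OF smooth_continuous[OF \<zeta>(1)]])
      show "norm (q x) \<le> \<Lambda> * norm (p x)" for x
      proof -
        have "\<bar>1/h\<bar> * norm (a (G (slide k h x)) - a (G x)) \<le> \<bar>1/h\<bar> * (\<Lambda> * norm (G (slide k h x) - G x))"
          by (intro mult_left_mono a) simp
        then show ?thesis by (simp add: q_def p_def mult.left_commute)
      qed
      show "a0 * (norm (p x))\<^sup>2 \<le> q x \<bullet> p x" for x
      proof -
        have "(1/h)\<^sup>2 * (a0 * (norm (G (slide k h x) - G x))\<^sup>2) \<le> (1/h)\<^sup>2 * ((a (G (slide k h x)) - a (G x)) \<bullet> (G (slide k h x) - G x))"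
          by (intro mult_left_mono a) simp
        then show ?thesis by (simp add: q_def p_def power_mult_distrib power2_eq_square mult_ac)
      qed
      show "norm (W x - (\<zeta> x)\<^sup>2 *\<^sub>R p x) \<le> \<zeta> x * y x" for x
      proof -
        have "W x - (\<zeta> x)\<^sup>2 *\<^sub>R p x = (\<zeta> x * \<zeta> x) *\<^sub>R ((1/h) *\<^sub>R R x) + V x *\<^sub>R D x"
          by (simp add: W_def HV_def p_def power2_eq_square scaleR_add_right scaleR_diff_right algebra_simps)
        also have "norm \<dots> \<le> norm ((\<zeta> x * \<zeta> x) *\<^sub>R ((1/h) *\<^sub>R R x)) + norm (V x *\<^sub>R D x)" by (rule norm_triangle_ineq)
        also have "norm ((\<zeta> x * \<zeta> x) *\<^sub>R ((1/h) *\<^sub>R R x)) \<le> \<zeta> x * (L * norm (G (slide k h x)))"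
        proof -
          have "norm (R x) \<le> L * \<bar>h\<bar> * norm k * norm (G (slide k h x))"
            unfolding R_def by (rule slide_remainder(2)[OF k(1) G L])
          also have "\<dots> \<le> L * \<bar>h\<bar> * norm (G (slide k h x))" using Lk[of h] by (intro mult_right_mono) auto
          finally have "norm ((1/h) *\<^sub>R R x) \<le> L * norm (G (slide k h x))"
            using h(1) by (simp add: divide_simps mult_ac)
          moreover have "\<zeta> x * \<zeta> x \<le> \<zeta> x" using \<zeta>(2,3)[of x] by (simp add: mult_left_le)
          ultimately have "(\<zeta> x * \<zeta> x) * norm ((1/h) *\<^sub>R R x) \<le> \<zeta> x * (L * norm (G (slide k h x)))"
            using \<zeta>(2)[of x] by (intro mult_mono) auto
          then show ?thesis using \<zeta>(2)[of x] by (simp add: abs_mult)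
        qed
        also have "norm (V x *\<^sub>R D x) \<le> \<zeta> x * (2 * B * \<bar>V x\<bar>)"
          using mult_left_mono[OF D_le[of x], of "\<bar>V x\<bar>"] by (simp add: mult_ac)
        finally show ?thesis by (simp add: y_def distrib_left)
      qed
      show "(LINT x|?M. q x \<bullet> W x) \<le> C1 * N * norm2 ?M W"
      proof -
        have "(LINT x|?M. f x * \<eta> x) \<le> N * (C * norm2 ?M W)"
        proof -
          have "(LINT x|?M. f x * \<eta> x) \<le> norm2 ?M f * norm2 ?M \<eta>"
            using Cauchy_Schwarz_norm2_real[OF f \<eta>sq] by simp
          also have "\<dots> \<le> N * (C * norm2 ?M W)" using NG \<eta>_le by (intro mult_mono) auto
          finally show ?thesis .
        qed
        moreover have "- ((1/h) * (LINT x|?M. a (G x) \<bullet> S x)) \<le> (\<Lambda> * N) * (L * norm2 ?M W)"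
        proof -
          have "\<bar>LINT x|?M. a (G x) \<bullet> S x\<bar> \<le> norm2 ?M (\<lambda>x. a (G x)) * norm2 ?M S"
            by (rule Cauchy_Schwarz_norm2[OF aG(1) S])
          also have "\<dots> \<le> (\<Lambda> * N) * (\<bar>h\<bar> * (L * norm2 ?M W))"
          proof (intro mult_mono S_le)
            show "norm2 ?M (\<lambda>x. a (G x)) \<le> \<Lambda> * N"
              using aG(2) mult_left_mono[OF NG(1) \<Lambda>] by linarith
          qed (use \<Lambda> NG in auto)
          finally have "\<bar>1/h\<bar> * \<bar>LINT x|?M. a (G x) \<bullet> S x\<bar> \<le> \<bar>1/h\<bar> * ((\<Lambda> * N) * (\<bar>h\<bar> * (L * norm2 ?M W)))"
            by (intro mult_left_mono) auto
          also have "\<dots> = (\<Lambda> * N) * (L * norm2 ?M W)" using h(1) by simp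
          finally have "\<bar>(1/h) * (LINT x|?M. a (G x) \<bullet> S x)\<bar> \<le> (\<Lambda> * N) * (L * norm2 ?M W)"
            by (simp only: abs_mult)
          then show ?thesis by linarith
        qed
        ultimately show ?thesis unfolding qW by (simp add: C1_def algebra_simps)
      qed
      show "norm2 ?M y \<le> C2 * N"
      proof -
        have s1: "L2_fun ?M (\<lambda>x. L * norm (G (slide k h x)))"
          by (intro L2_fun_mult L2_fun_norm G\<tau>)
        have s2: "L2_fun ?M (\<lambda>x. 2 * B * \<bar>V x\<bar>)"
          using L2_fun_mult[OF L2_fun_norm(1)[OF Vsq], of "2 * B"] by simp
        have "norm2 ?M y \<le> norm2 ?M (\<lambda>x. L * norm (G (slide k h x))) + norm2 ?M (\<lambda>x. 2 * B * \<bar>V x\<bar>)"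
          unfolding y_def by (rule norm2_triangle[OF s1 s2])
        also have "norm2 ?M (\<lambda>x. L * norm (G (slide k h x))) = L * norm2 ?M G"
          using L(1) by (simp add: norm2_mult L2_fun_norm(2)[OF G\<tau>(1)] G\<tau>(2))
        also have "norm2 ?M (\<lambda>x. 2 * B * \<bar>V x\<bar>) = 2 * B * norm2 ?M V"
          using B(1) L2_fun_norm(2)[OF Vsq] by (simp add: norm2_mult)
        also have "L * norm2 ?M G + 2 * B * norm2 ?M V \<le> L * N + 2 * B * (C * N)"
        proof (intro add_mono mult_left_mono)
          have "C * norm2 ?M G \<le> C * N" using C(1) NG(1) by (intro mult_left_mono) auto
          with V_le show "norm2 ?M V \<le> C * N" by (rule order_trans)
        qed (use L B NG in auto)
        finally show ?thesis by (simp add: C2_def algebra_simps)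
      qed
    qed (use \<zeta> a0 \<Lambda> C12 NG in auto)
    moreover have "norm2 (leb (E \<inter> ball x0 r)) (\<lambda>x. G (slide k h x) - G x) \<le> \<bar>h\<bar> * norm2 ?M (\<lambda>x. \<zeta> x *\<^sub>R p x)"
    proof -
      let ?g = "\<lambda>x. indicator (ball x0 r) x *\<^sub>R (G (slide k h x) - G x)"
      have gsq: "?g \<in> borel_measurable ?M"
        using L2_fun_measurable[OF G] L2_fun_measurable[OF G\<tau>(1)]
        by (intro borel_measurable_scaleR borel_measurable_diff measurable_restrict_space1[OF borel_measurable_indicator]) auto
      have "norm2 (leb (E \<inter> ball x0 r)) (\<lambda>x. G (slide k h x) - G x) = norm2 ?M ?g"
        by (rule L2_fun_extension_by_zero(2)) (use EL in auto)
      also have "\<dots> \<le> \<bar>h\<bar> * norm2 ?M (\<lambda>x. \<zeta> x *\<^sub>R p x)"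
      proof (rule norm2_mono[OF _ gsq])
        show "L2_fun ?M (\<lambda>x. \<zeta> x *\<^sub>R p x)"
          using \<zeta>(2,3) by (intro L2_fun_bounded_mult(1)[OF psq, of _ 1]
            continuous_borel_measurable_leb[OF smooth_continuous[OF \<zeta>(1)]]) auto
        have "norm (?g x) \<le> \<bar>h\<bar> * norm (\<zeta> x *\<^sub>R p x)" for x
          using h(1) \<zeta>(4)[of x] by (auto simp: p_def indicator_def)
        then show "AE x in ?M. norm (?g x) \<le> \<bar>h\<bar> * norm (\<zeta> x *\<^sub>R p x)" by simp
      qed simp
      finally show ?thesis .
    qed
    ultimately show "norm2 (leb (E \<inter> ball x0 r)) (\<lambda>x. G (slide k h x) - G x)
        \<le> \<bar>h\<bar> * (K * (norm2 ?M f + norm2 ?M G))"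
      using mult_left_mono[of "norm2 ?M (\<lambda>x. \<zeta> x *\<^sub>R p x)" "K * N" "\<bar>h\<bar>"] by (simp add: N_def)
  qed (rule h0)
qed

end

section \<open>From tangential to full regularity\<close>

lemma dderiv_translate:
  assumes "smooth \<psi>"
  shows "dderiv (\<lambda>x. \<psi> (x + a)) x d = dderiv \<psi> (x + a) d"
proof -
  have "((\<lambda>x. \<psi> (x + a)) has_derivative dderiv \<psi> (x + a)) (at x)"
    by (rule has_derivative_compose[OF _ smooth_has_derivative[OF assms], where f'="\<lambda>h. h"])
      (auto intro!: derivative_eq_intros)
  from frechet_derivative_at[OF this, symmetric] show ?thesis by simp
qed

lemma test_functions_translate:
  assumes \<psi>: "\<psi> \<in> test_functions V" and sub: "\<And>x. x \<in> V \<Longrightarrow> x - a \<in> U"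
  shows "(\<lambda>x. \<psi> (x + a)) \<in> test_functions U"
proof -
  obtain K where K: "compact K" "K \<subseteq> V" "\<And>x. x \<notin> K \<Longrightarrow> \<psi> x = 0" using test_functions_support[OF \<psi>] by metis
  show ?thesis
  proof (rule test_functionsI)
    show "smooth (\<lambda>x. \<psi> (x + a))" using test_functions_smooth[OF \<psi>] by (auto intro: Ck_translate)
    show "compact ((\<lambda>x. x - a) ` K)" by (intro compact_continuous_image continuous_intros K)
    show "(\<lambda>x. x - a) ` K \<subseteq> U" using K(2) sub by auto
    show "\<psi> (x + a) = 0" if "x \<notin> (\<lambda>x. x - a) ` K" for x
    proof (rule K(3))
      show "x + a \<notin> K" using that by (metis add_diff_cancel_right' image_eqI)
    qed
  qed
qed

text \<open>The support keeps a positive distance from the complement of \<open>U\<close>, which leaves room for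
  translations.\<close>
lemma test_function_neighbourhood:
  assumes \<psi>: "\<psi> \<in> test_functions U" and U: "open U"
  obtains V \<epsilon> where "open V" "0 < \<epsilon>" "\<psi> \<in> test_functions V" "\<And>x a. x \<in> V \<Longrightarrow> norm a < \<epsilon> \<Longrightarrow> x + a \<in> U"
proof -
  obtain K where K: "compact K" "K \<subseteq> U" "\<And>x. x \<notin> K \<Longrightarrow> \<psi> x = 0" using test_functions_support[OF \<psi>] by metis
  obtain \<delta> where \<delta>: "\<delta> > 0" "(\<Union>x\<in>K. cball x \<delta>) \<subseteq> U"
    using compact_subset_open_imp_cball_epsilon_subset[OF K(1) U K(2)] by metis
  show thesis
  proof (rule that[of "\<Union>x\<in>K. ball x (\<delta>/2)" "\<delta>/2"])
    show "\<psi> \<in> test_functions (\<Union>x\<in>K. ball x (\<delta>/2))"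
      using \<delta>(1) by (intro test_functionsI[OF test_functions_smooth[OF \<psi>] K(1) _ K(3)]) force+
    fix x a :: 'a assume "x \<in> (\<Union>x\<in>K. ball x (\<delta>/2))" "norm a < \<delta>/2"
    then obtain y where y: "y \<in> K" "dist y x < \<delta>/2" "dist x (x + a) < \<delta>/2" by (auto simp: dist_norm)
    then have "dist y (x + a) \<le> \<delta>" using dist_triangle[of y "x + a" x] by linarith
    then have "x + a \<in> cball y \<delta>" by simp
    then show "x + a \<in> U" using \<delta>(2) y(1) by blast
  qed (use \<delta>(1) in auto)
qed

lemma lebesgue_on_UNIV_indicator:
  fixes b :: "'a::euclidean_space \<Rightarrow> real"
  assumes U: "U \<in> sets lebesgue"
  shows "L2_fun (leb UNIV) (\<lambda>x. indicator U x * b x) \<longleftrightarrow> L2_fun (leb U) b"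
    and "(LINT x|leb UNIV. indicator U x * b x * f x) = (LINT x|leb U. b x * f x)"
  by (rule L2_fun_extension_by_zero(1) lebesgue_on_extension_by_zero(3); use U in auto)+

lemma norm2_test_function:
  assumes "\<psi> \<in> test_functions U" "U \<in> sets lebesgue" "V \<in> sets lebesgue" "U \<subseteq> V"
  shows "norm2 (leb V) \<psi> = norm2 (leb U) \<psi>"
proof -
  obtain K where K: "K \<subseteq> U" "\<And>x. x \<notin> K \<Longrightarrow> \<psi> x = 0" using test_functions_support[OF assms(1)] by metis
  have "\<psi> x = 0" if "x \<notin> U" for x using K that by blast
  then show ?thesis using assms by (intro L2_fun_extension_by_zero(2)) auto
qed

lemma integral_translation_UNIV:
  fixes f g :: "'a::euclidean_space \<Rightarrow> real"
  assumes "f \<in> borel_measurable (leb UNIV)" "g \<in> borel_measurable (leb UNIV)"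
  shows "(LINT x|leb UNIV. f (x + a) * g x) = (LINT x|leb UNIV. f x * g (x + (- a)))"
proof -
  have [measurable]: "(\<lambda>x. g (x + (- a))) \<in> borel_measurable (leb UNIV)"
    using preserves_lebesgue_integral(1)[OF preserves_lebesgue_translation[of "- a"] _ _ _ assms(2), of UNIV] by simp
  have "(\<lambda>x. f x * g (x + (- a))) \<in> borel_measurable (leb UNIV)" using assms(1) by measurable
  from preserves_lebesgue_integral(3)[OF preserves_lebesgue_translation[of a] _ _ _ this, of UNIV] show ?thesis by simp
qed

lemma L2_weak_gradient_test_function:
  assumes \<psi>: "\<psi> \<in> test_functions U" and E: "open E"
  shows "L2_weak_gradient E \<psi> (gradient \<psi>)"
proof (rule L2_weak_gradientI_Basis[OF E])
  have EL: "E \<in> sets lebesgue" using E by auto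
  have sm: "smooth \<psi>" by (rule test_functions_smooth[OF \<psi>])
  obtain K where K: "compact K" "\<And>x d. x \<notin> K \<Longrightarrow> dderiv \<psi> x d = 0"
    using test_functions_support[OF \<psi>] by metis
  show "L2_fun (leb E) \<psi>" by (rule L2_fun_test_function[OF \<psi> EL])
  have "gradient \<psi> x = 0" if "x \<notin> K" for x
    using K(2)[OF that, of "gradient \<psi> x"] by (simp add: dderiv_eq_gradient[OF smooth_differentiable[OF sm]])
  then show "L2_fun (leb E) (gradient \<psi>)"
    by (rule L2_fun_continuous_compact_support[OF continuous_on_gradient_smooth[OF sm] K(1) _ EL])
  fix \<xi> and d :: 'a assume \<xi>: "\<xi> \<in> test_functions E"
  have sm\<xi>: "smooth \<xi>" by (rule test_functions_smooth[OF \<xi>])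
  obtain K where K: "K \<subseteq> E" "\<And>x. x \<notin> K \<Longrightarrow> \<xi> x = 0" "\<And>x d. x \<notin> K \<Longrightarrow> dderiv \<xi> x d = 0"
    using test_functions_support[OF \<xi>] by metis
  have \<xi>0: "\<xi> x = 0" "dderiv \<xi> x d = 0" if "x \<notin> E" for x d using K that by blast+
  let ?U = "leb (UNIV :: 'a set)"
  have m: "\<psi> \<in> borel_measurable ?U" "\<xi> \<in> borel_measurable ?U"
    by (auto intro!: continuous_borel_measurable_leb smooth_continuous sm sm\<xi>)
  note der = measure_preserving_flow.integral_has_derivative[OF translation_flow[of d] L2_fun_test_function]
  have 1: "((\<lambda>s. LINT x|?U. \<psi> (x + s *\<^sub>R d) * \<xi> x) has_real_derivative - (LINT x|?U. \<psi> x * (gradient \<xi> x \<bullet> d))) (at 0)"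
    using der[OF \<psi> _ \<xi>, of 0] by simp
  have 2: "((\<lambda>s. LINT x|?U. \<xi> (x + s *\<^sub>R d) * \<psi> x) has_real_derivative - (LINT x|?U. \<xi> x * (gradient \<psi> x \<bullet> d))) (at (- 0))"
    using der[OF \<xi> _ \<psi>, of 0] by simp
  have "(LINT x|?U. \<psi> (x + s *\<^sub>R d) * \<xi> x) = (LINT x|?U. \<xi> (x + (- s) *\<^sub>R d) * \<psi> x)" for s
    using integral_translation_UNIV[OF m, of "s *\<^sub>R d"] by (simp add: mult.commute)
  then have "((\<lambda>s. LINT x|?U. \<psi> (x + s *\<^sub>R d) * \<xi> x) has_real_derivative (LINT x|?U. \<xi> x * (gradient \<psi> x \<bullet> d))) (at 0)"
    using 2 DERIV_mirror[of "\<lambda>s. LINT x|?U. \<xi> (x + s *\<^sub>R d) * \<psi> x" "- (LINT x|?U. \<xi> x * (gradient \<psi> x \<bullet> d))" 0] by simp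
  then have "- (LINT x|?U. \<psi> x * (gradient \<xi> x \<bullet> d)) = (LINT x|?U. \<xi> x * (gradient \<psi> x \<bullet> d))"
    using 1 DERIV_unique by blast
  moreover have "(LINT x|?U. \<psi> x * (gradient \<xi> x \<bullet> d)) = (LINT x|leb E. \<psi> x * dderiv \<xi> x d)"
    by (rule lebesgue_on_extension_by_zero(3))
      (use EL \<xi>0(2) in \<open>auto simp: dderiv_eq_gradient[OF smooth_differentiable[OF sm\<xi>]]\<close>)
  moreover have "(LINT x|?U. \<xi> x * (gradient \<psi> x \<bullet> d)) = (LINT x|leb E. gradient \<psi> x \<bullet> d * \<xi> x)"
    by (rule lebesgue_on_extension_by_zero(3)) (use EL \<xi>0(1) in auto)
  ultimately show "(LINT x|leb E. \<psi> x * dderiv \<xi> x d) = - (LINT x|leb E. gradient \<psi> x \<bullet> d * \<xi> x)"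
    by simp
qed

text \<open>Weak gradients are curl free. The symmetry of the second derivatives of the test function is
  avoided by differentiating a translation in the direction \<open>d\<close> instead.\<close>
lemma L2_weak_gradient_curl_free:
  assumes E: "open E" and v: "L2_weak_gradient E v G" and \<psi>: "\<psi> \<in> test_functions E"
  shows "(LINT x|leb E. (G x \<bullet> c) * dderiv \<psi> x d)
    = (LINT x|leb E. (G x \<bullet> d) * dderiv \<psi> x c)"
proof -
  let ?U = "leb (UNIV :: 'a set)"
  have EL: "E \<in> sets lebesgue" using E by auto
  have sm: "smooth \<psi>" by (rule test_functions_smooth[OF \<psi>])
  define \<psi>c where "\<psi>c x = dderiv \<psi> x c" for x
  have \<psi>c: "\<psi>c \<in> test_functions E" unfolding \<psi>c_def by (rule dderiv_test_function[OF \<psi>])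
  have smc: "smooth \<psi>c" by (rule test_functions_smooth[OF \<psi>c])
  have sq: "L2_fun (leb E) v" "L2_fun (leb E) (\<lambda>x. G x \<bullet> c)"
    using v by (auto simp: L2_weak_gradient_def L2_fun_inner_const)
  define v' where "v' x = indicator E x * v x" for x
  define g' where "g' x = indicator E x * (G x \<bullet> c)" for x
  have sq': "L2_fun ?U v'" "L2_fun ?U g'"
    unfolding v'_def g'_def using sq by (simp_all add: lebesgue_on_UNIV_indicator[OF EL])
  have m: "\<psi> \<in> borel_measurable ?U" "\<psi>c \<in> borel_measurable ?U"
    by (auto intro!: continuous_borel_measurable_leb smooth_continuous sm smc)
  obtain V \<epsilon> where V: "open V" "0 < \<epsilon>" "\<psi> \<in> test_functions V" "\<And>x a. x \<in> V \<Longrightarrow> norm a < \<epsilon> \<Longrightarrow> x + a \<in> E"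
    using test_function_neighbourhood[OF \<psi> E] by metis
  note der = measure_preserving_flow.integral_has_derivative[OF translation_flow[of d]]
  have 1: "((\<lambda>s. LINT x|?U. g' (x + s *\<^sub>R d) * \<psi> x) has_real_derivative - (LINT x|?U. g' x * (gradient \<psi> x \<bullet> d))) (at 0)"
    using der[OF sq'(2) \<psi>, of 0] by simp
  have 2: "((\<lambda>s. - (LINT x|?U. v' (x + s *\<^sub>R d) * \<psi>c x)) has_real_derivative - (- (LINT x|?U. v' x * (gradient \<psi>c x \<bullet> d)))) (at 0)"
    using der[OF sq'(1) \<psi>c, of 0] by (intro DERIV_minus) simp
  have "((\<lambda>s. LINT x|?U. g' (x + s *\<^sub>R d) * \<psi> x) has_real_derivative - (- (LINT x|?U. v' x * (gradient \<psi>c x \<bullet> d)))) (at 0)"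
  proof (rule has_field_derivative_transform_within_open[OF 2])
    let ?S = "{s. norm (s *\<^sub>R d) < \<epsilon>}"
    show "open ?S" by (intro open_Collect_less continuous_intros)
    show "0 \<in> ?S" using V(2) by simp
    fix s assume s: "s \<in> ?S"
    have t: "(\<lambda>x. \<psi> (x + (- (s *\<^sub>R d)))) \<in> test_functions E"
      using s V(4) by (intro test_functions_translate[OF V(3)]) auto
    have "(LINT x|?U. g' (x + s *\<^sub>R d) * \<psi> x) = (LINT x|?U. g' x * \<psi> (x + (- (s *\<^sub>R d))))"
      by (rule integral_translation_UNIV[OF L2_fun_measurable[OF sq'(2)] m(1)])
    also have "\<dots> = (LINT x|leb E. (G x \<bullet> c) * \<psi> (x + (- (s *\<^sub>R d))))"
      unfolding g'_def by (rule lebesgue_on_UNIV_indicator(2)[OF EL])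
    also have "\<dots> = - (LINT x|leb E. v x * \<psi>c (x + (- (s *\<^sub>R d))))"
    proof -
      have "(LINT x|leb E. v x * frechet_derivative (\<lambda>x. \<psi> (x + (- (s *\<^sub>R d)))) (at x) c)
        = - (LINT x|leb E. (G x \<bullet> c) * \<psi> (x + (- (s *\<^sub>R d))))"
        using v t unfolding L2_weak_gradient_def by blast
      then show ?thesis unfolding dderiv_translate[OF sm] \<psi>c_def by linarith
    qed
    also have "(LINT x|leb E. v x * \<psi>c (x + (- (s *\<^sub>R d)))) = (LINT x|?U. v' x * \<psi>c (x + (- (s *\<^sub>R d))))"
      unfolding v'_def by (rule lebesgue_on_UNIV_indicator(2)[OF EL, symmetric])
    also have "\<dots> = (LINT x|?U. v' (x + s *\<^sub>R d) * \<psi>c x)"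
      by (rule integral_translation_UNIV[OF L2_fun_measurable[OF sq'(1)] m(2), symmetric])
    finally show "- (LINT x|?U. v' (x + s *\<^sub>R d) * \<psi>c x) = (LINT x|?U. g' (x + s *\<^sub>R d) * \<psi> x)" by simp
  qed
  then have "- (LINT x|?U. g' x * (gradient \<psi> x \<bullet> d)) = (LINT x|?U. v' x * (gradient \<psi>c x \<bullet> d))"
    using DERIV_unique[OF 1] by simp
  also have "(LINT x|?U. v' x * (gradient \<psi>c x \<bullet> d)) = (LINT x|leb E. v x * dderiv \<psi>c x d)"
    unfolding v'_def lebesgue_on_UNIV_indicator(2)[OF EL] by (simp add: dderiv_eq_gradient[OF smooth_differentiable[OF smc]])
  also have "\<dots> = - (LINT x|leb E. (G x \<bullet> d) * \<psi>c x)"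
    using v \<psi>c by (simp add: L2_weak_gradient_def)
  also have "(LINT x|?U. g' x * (gradient \<psi> x \<bullet> d)) = (LINT x|leb E. (G x \<bullet> c) * dderiv \<psi> x d)"
    unfolding g'_def lebesgue_on_UNIV_indicator(2)[OF EL] by (simp add: dderiv_eq_gradient[OF smooth_differentiable[OF sm]])
  finally show ?thesis by (simp add: \<psi>c_def)
qed

text \<open>A dual bound for the derivative in a direction bounds the difference quotients in that direction.\<close>
lemma norm2_translation_difference_le:
  fixes b :: "'a::euclidean_space \<Rightarrow> real"
  assumes U: "open U" and V: "open V" and b: "L2_fun (leb U) b" and C: "0 \<le> C"
    and bound: "\<And>\<psi>. \<psi> \<in> test_functions U \<Longrightarrow>
      \<bar>LINT x|leb U. b x * dderiv \<psi> x d\<bar> \<le> C * norm2 (leb U) \<psi>"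
    and VU: "\<And>x s. x \<in> V \<Longrightarrow> \<bar>s\<bar> < h0 \<Longrightarrow> x + s *\<^sub>R d \<in> U" and h: "\<bar>h\<bar> < h0"
  shows "L2_fun (leb V) (\<lambda>x. b (x + h *\<^sub>R d) - b x)"
    and "norm2 (leb V) (\<lambda>x. b (x + h *\<^sub>R d) - b x) \<le> \<bar>h\<bar> * C"
proof -
  let ?U = "leb (UNIV :: 'a set)"
  have UL: "U \<in> sets lebesgue" and VL: "V \<in> sets lebesgue" using U V by auto
  have V_sub: "V \<subseteq> U" using VU[of _ 0] h by auto
  define b' where "b' x = indicator U x * b x" for x
  have sq': "L2_fun ?U b'" unfolding b'_def using b by (simp add: lebesgue_on_UNIV_indicator[OF UL])
  have sqt: "L2_fun ?U (\<lambda>x. b' (x + h *\<^sub>R d))"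
    using preserves_lebesgue_L2_fun(1)[OF preserves_lebesgue_translation[of "h *\<^sub>R d"] _ _ _ sq', of UNIV] by simp
  have "L2_fun ?U (\<lambda>x. indicator V x *\<^sub>R (b' (x + h *\<^sub>R d) - b' x))"
    using V by (intro L2_fun_bounded_mult(1)[OF L2_fun_diff[OF sqt sq'], of _ 1]
      measurable_restrict_space1 borel_measurable_indicator) (auto simp: indicator_def)
  moreover have "L2_fun ?U (\<lambda>x. indicator V x *\<^sub>R (b' (x + h *\<^sub>R d) - b' x))
      \<longleftrightarrow> L2_fun (leb V) (\<lambda>x. b (x + h *\<^sub>R d) - b x)"
    using VU[OF _ h] V_sub VL by (intro L2_fun_extension_by_zero(1)) (auto simp: b'_def)
  ultimately show sq: "L2_fun (leb V) (\<lambda>x. b (x + h *\<^sub>R d) - b x)" by blast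
  show "norm2 (leb V) (\<lambda>x. b (x + h *\<^sub>R d) - b x) \<le> \<bar>h\<bar> * C"
  proof (rule norm2_le_if_test_integrals_le[OF V sq])
    fix \<psi> assume \<psi>: "\<psi> \<in> test_functions V"
    have sm: "smooth \<psi>" by (rule test_functions_smooth[OF \<psi>])
    obtain K where K: "K \<subseteq> V" "\<And>x. x \<notin> K \<Longrightarrow> \<psi> x = 0" using test_functions_support[OF \<psi>] by metis
    have \<psi>0: "\<psi> x = 0" if "x \<notin> V" for x using K that by blast
    define g where "g s = (LINT x|?U. b' (x + s *\<^sub>R d) * \<psi> x)" for s
    define g' where "g' s = - (LINT x|?U. b' (x + s *\<^sub>R d) * (gradient \<psi> x \<bullet> d))" for s
    have der: "(g has_real_derivative g' s) (at s)" for s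
      unfolding g_def[abs_def] g'_def
      by (rule measure_preserving_flow.integral_has_derivative[OF translation_flow[of d] sq' \<psi>])
    have g'_le: "\<bar>g' s\<bar> \<le> C * norm2 (leb V) \<psi>" if s: "\<bar>s\<bar> < h0" for s
    proof -
      let ?\<psi>s = "\<lambda>x. \<psi> (x + (- (s *\<^sub>R d)))"
      have t: "?\<psi>s \<in> test_functions U"
        using VU[OF _ s] by (intro test_functions_translate[OF \<psi>]) auto
      have gm: "(\<lambda>x. gradient \<psi> x \<bullet> d) \<in> borel_measurable ?U"
        by (intro continuous_borel_measurable_leb continuous_intros continuous_on_gradient_smooth[OF sm])
      have "g' s = - (LINT x|?U. b' x * (gradient \<psi> (x + (- (s *\<^sub>R d))) \<bullet> d))"
        unfolding g'_def by (subst integral_translation_UNIV[OF L2_fun_measurable[OF sq'] gm]) simp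
      also have "\<dots> = - (LINT x|leb U. b x * frechet_derivative ?\<psi>s (at x) d)"
        unfolding b'_def lebesgue_on_UNIV_indicator(2)[OF UL] dderiv_translate[OF sm]
        by (simp add: dderiv_eq_gradient[OF smooth_differentiable[OF sm]])
      finally have "\<bar>g' s\<bar> \<le> C * norm2 (leb U) ?\<psi>s" using bound[OF t] by simp
      also have "norm2 (leb U) ?\<psi>s = norm2 ?U ?\<psi>s" by (rule norm2_test_function[OF t UL, symmetric]) auto
      also have "\<dots> = norm2 ?U \<psi>"
        using preserves_lebesgue_L2_fun(2)[OF preserves_lebesgue_translation[of "- (s *\<^sub>R d)"] _ _ _
          L2_fun_test_function[OF \<psi>], of UNIV UNIV] by simp
      also have "\<dots> = norm2 (leb V) \<psi>" by (rule norm2_test_function[OF \<psi> VL]) auto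
      finally show ?thesis .
    qed
    have "norm (g h - g 0) \<le> (C * norm2 (leb V) \<psi>) * norm (h - 0)"
    proof (rule field_differentiable_bound[of "{- h0<..<h0}"])
      show "(g has_real_derivative g' s) (at s within {- h0<..<h0})" for s
        by (rule has_field_derivative_at_within[OF der])
      show "norm (g' s) \<le> C * norm2 (leb V) \<psi>" if "s \<in> {- h0<..<h0}" for s
        using g'_le[of s] that by (auto simp: abs_less_iff)
    qed (use h in auto)
    moreover have "g h - g 0 = (LINT x|leb V. (b (x + h *\<^sub>R d) - b x) * \<psi> x)"
    proof -
      note \<psi>sq = L2_fun_test_function[OF \<psi>, of UNIV]
      have "g h - g 0 = (LINT x|?U. (b' (x + h *\<^sub>R d) - b' x) * \<psi> x)"
        unfolding g_def left_diff_distrib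
        by (subst Bochner_Integration.integral_diff) (auto intro!: integrable_mult_L2_fun sqt sq' \<psi>sq)
      also have "\<dots> = (LINT x|leb V. (b (x + h *\<^sub>R d) - b x) * \<psi> x)"
        by (rule lebesgue_on_extension_by_zero(3)) (use VL VU[OF _ h] V_sub \<psi>0 in \<open>auto simp: b'_def\<close>)
      finally show ?thesis .
    qed
    ultimately show "\<bar>LINT x|leb V. (b (x + h *\<^sub>R d) - b x) * \<psi> x\<bar> \<le> \<bar>h\<bar> * C * norm2 (leb V) \<psi>"
      by (simp add: mult_ac)
  qed (use C in simp)
qed

context sliding
begin

lemma tangent_P: "tangent (P i) x = P i + (slope x \<bullet> i) *\<^sub>R e"
  by (simp add: tangent_def slope_def P_inner[symmetric] P_P)

text \<open>The vectors \<open>tangent (P i) x\<close> and \<open>e\<close> on the one hand and \<open>i\<close> and \<open>e - slope x\<close> on the other are dual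
  frames. The test functions are differentiated along the former.\<close>
lemma tangent_expansion:
  "p \<bullet> q = (\<Sum>i\<in>Basis. (p \<bullet> i) * (q \<bullet> tangent (P i) x)) + (p \<bullet> (e - slope x)) * (q \<bullet> e)"
proof -
  have "(\<Sum>i\<in>Basis. (p \<bullet> i) * (q \<bullet> tangent (P i) x))
      = (\<Sum>i\<in>Basis. (p \<bullet> i) * (P q \<bullet> i)) + (\<Sum>i\<in>Basis. (p \<bullet> i) * (slope x \<bullet> i)) * (q \<bullet> e)"
    by (simp add: tangent_P inner_add_right P_inner distrib_left sum.distrib sum_distrib_left mult_ac)
  also have "\<dots> = p \<bullet> P q + (p \<bullet> slope x) * (q \<bullet> e)"
    by (simp add: euclidean_inner[of p "P q"] euclidean_inner[of p "slope x"])
  finally show ?thesis by (simp add: P_def[of q] inner_diff_right inner_commute algebra_simps)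
qed

text \<open>The pointwise heart of the estimate in the direction across the boundary: \<open>e - slope x\<close> is a
  normal vector and \<open>p\<close> is recovered from its tangential components and its component along \<open>e\<close>.
  Monotonicity bounds \<open>p\<close> by those tangential components and by the normal component of \<open>q\<close>.\<close>
lemma monotone_normal_bound:
  assumes "a0 * (norm p)\<^sup>2 \<le> q \<bullet> p" "norm q \<le> \<Lambda> * norm p" "0 < a0" "0 \<le> \<Lambda>"
  shows "norm p \<le> (\<Lambda> * (\<Sum>i\<in>Basis. \<bar>p \<bullet> tangent (P i) x\<bar>) + \<bar>q \<bullet> (e - slope x)\<bar>) / a0"
proof -
  let ?S = "\<Sum>i\<in>Basis. \<bar>p \<bullet> tangent (P i) x\<bar>"
  have "(\<Sum>i\<in>Basis. (q \<bullet> i) * (p \<bullet> tangent (P i) x)) \<le> (\<Sum>i\<in>Basis. norm q * \<bar>p \<bullet> tangent (P i) x\<bar>)"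
  proof (rule sum_mono)
    fix i :: 'a assume i: "i \<in> Basis"
    have "(q \<bullet> i) * (p \<bullet> tangent (P i) x) \<le> \<bar>q \<bullet> i\<bar> * \<bar>p \<bullet> tangent (P i) x\<bar>"
      by (metis abs_ge_self abs_mult)
    also have "\<dots> \<le> norm q * \<bar>p \<bullet> tangent (P i) x\<bar>" by (intro mult_right_mono Basis_le_norm i) simp
    finally show "(q \<bullet> i) * (p \<bullet> tangent (P i) x) \<le> norm q * \<bar>p \<bullet> tangent (P i) x\<bar>" .
  qed
  also have "\<dots> = norm q * ?S" by (simp add: sum_distrib_left)
  also have "\<dots> \<le> (\<Lambda> * norm p) * ?S" by (intro mult_right_mono assms sum_nonneg) auto
  finally have 1: "(\<Sum>i\<in>Basis. (q \<bullet> i) * (p \<bullet> tangent (P i) x)) \<le> (\<Lambda> * norm p) * ?S" .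
  have "(q \<bullet> (e - slope x)) * (p \<bullet> e) \<le> \<bar>q \<bullet> (e - slope x)\<bar> * \<bar>p \<bullet> e\<bar>" by (metis abs_ge_self abs_mult)
  also have "\<dots> \<le> \<bar>q \<bullet> (e - slope x)\<bar> * norm p"
    using Cauchy_Schwarz_ineq2[of p e] by (intro mult_left_mono) (auto simp: unit)
  finally have "a0 * (norm p)\<^sup>2 \<le> (\<Lambda> * norm p) * ?S + \<bar>q \<bullet> (e - slope x)\<bar> * norm p"
    using assms(1) 1 tangent_expansion[of q p x] by linarith
  then have le: "(a0 * norm p) * norm p \<le> (\<Lambda> * ?S + \<bar>q \<bullet> (e - slope x)\<bar>) * norm p"
    by (simp add: power2_eq_square algebra_simps)
  have nn: "0 \<le> \<Lambda> * ?S + \<bar>q \<bullet> (e - slope x)\<bar>"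
    using assms(4) by (intro add_nonneg_nonneg mult_nonneg_nonneg sum_nonneg) auto
  have "a0 * norm p \<le> \<Lambda> * ?S + \<bar>q \<bullet> (e - slope x)\<bar>"
  proof (cases "p = 0")
    case False then show ?thesis using le by (simp add: mult_le_cancel_right)
  qed (use nn in simp)
  then show ?thesis using assms(3) by (simp add: pos_le_divide_eq mult.commute)
qed

text \<open>The equation bounds the derivative along \<open>e\<close> of the normal component of \<open>a \<circ> G\<close> by the
  tangential derivatives. Being curl free, \<open>G\<close> has tangential components whose derivative along \<open>e\<close>
  is bounded likewise. All coefficients are constant along \<open>e\<close>, so that difference quotients in that
  direction can be used.\<close>
lemma local_estimate:
  fixes a :: "'a \<Rightarrow> 'a"
  assumes r: "0 < r"
    and a: "\<And>p q. norm (a p - a q) \<le> \<Lambda> * norm (p - q)" "a 0 = 0"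
      "\<And>p q. a0 * (norm (p - q))\<^sup>2 \<le> (a p - a q) \<bullet> (p - q)" and a0: "0 < a0" and \<Lambda>: "0 \<le> \<Lambda>"
  obtains K where "0 \<le> K"
    "\<And>v G f \<Theta> \<kappa> \<psi> j. local_solution a x0 r v G f \<Longrightarrow>
      (\<And>p q. \<bar>\<Theta> p - \<Theta> q\<bar> \<le> \<kappa> * norm (p - q)) \<Longrightarrow> \<Theta> 0 = 0 \<Longrightarrow> 0 \<le> \<kappa> \<Longrightarrow>
      \<psi> \<in> test_functions (E \<inter> ball x0 r) \<Longrightarrow> j \<in> Basis \<Longrightarrow>
      \<bar>LINT x|leb E. \<Theta> (G x) * dderiv \<psi> x j\<bar>
        \<le> \<kappa> * (K * (norm2 (leb E) f + norm2 (leb E) G)) * norm2 (leb E) \<psi>"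
proof -
  let ?M = "leb E" and ?O = "E \<inter> ball x0 r"
  have O: "open ?O" using open_E by auto
  have OL: "?O \<in> sets lebesgue" using O by auto
  have Pk: "P i \<bullet> e = 0" "norm (P i) \<le> 1" if "i \<in> Basis" for i
    using norm_P_le[of i] that by (auto simp: P_inner_e)
  define Q where "Q i K h0 \<longleftrightarrow> 0 \<le> K \<and> 0 < h0 \<and>
      (\<forall>v G f h. local_solution a x0 r v G f \<longrightarrow> 0 < \<bar>h\<bar> \<longrightarrow> \<bar>h\<bar> < h0 \<longrightarrow>
      norm2 (leb ?O) (\<lambda>x. G (slide (P i) h x) - G x) \<le> \<bar>h\<bar> * (K * (norm2 ?M f + norm2 ?M G)))" for i K h0
  have "\<exists>K h0. Q i K h0" if i: "i \<in> Basis" for i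
    unfolding Q_def by (rule tangential_estimate[OF Pk[OF i] r a a0 \<Lambda>, of x0]) blast
  then obtain Ki hi where KQ: "\<And>i. i \<in> Basis \<Longrightarrow> Q i (Ki i) (hi i)" by metis
  have Ki: "0 \<le> Ki i" and hi: "0 < hi i" if "i \<in> Basis" for i using KQ[OF that] by (simp_all add: Q_def)
  have est: "norm2 (leb ?O) (\<lambda>x. G (slide (P i) h x) - G x) \<le> \<bar>h\<bar> * (Ki i * (norm2 ?M f + norm2 ?M G))"
    if "i \<in> Basis" "local_solution a x0 r v G f" "0 < \<bar>h\<bar>" "\<bar>h\<bar> < hi i" for i v G f h
    using KQ[OF that(1)] that(2-) unfolding Q_def by blast
  define KT where "KT = (\<Sum>i\<in>Basis. Ki i)"
  have KT: "0 \<le> KT" "\<And>i. i \<in> Basis \<Longrightarrow> Ki i \<le> KT"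
    unfolding KT_def using Ki by (auto intro!: sum_nonneg member_le_sum)
  have "compact (slope ` cball x0 r)"
    by (intro compact_continuous_image continuous_on_subset[OF continuous_on_slope]) auto
  then obtain m where m: "0 < m" "\<And>x. x \<in> cball x0 r \<Longrightarrow> norm (slope x) \<le> m"
    using compact_imp_bounded[of "slope ` cball x0 r"] by (auto simp: bounded_pos)
  have a_le: "norm (a p) \<le> \<Lambda> * norm p" for p using a(1)[of p 0] a(2) by simp
  have "\<Lambda>-lipschitz_on UNIV a" using a(1) \<Lambda> by (auto simp: lipschitz_on_def dist_norm)
  then have a_cont: "continuous_on UNIV a" by (rule lipschitz_on_continuous_on)
  then have [measurable]: "a \<in> borel_measurable borel" by (rule borel_measurable_continuous_onI)
  define n where "n = real (card (Basis :: 'a set))"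
  define Kb where "Kb = 1 + n * (\<Lambda> * KT)"
  define Kp where "Kp = (\<Lambda> * (n * KT) + Kb) / a0"
  have n: "0 \<le> n" by (simp add: n_def)
  have Kbp: "0 \<le> Kb" "0 \<le> Kp" using n \<Lambda> KT a0 by (auto simp: Kb_def Kp_def)
  show thesis
  proof (rule that[of "KT + (1 + m) * Kp"])
    show "0 \<le> KT + (1 + m) * Kp" using KT Kbp m by auto
    fix v G f \<kappa> \<psi> and \<Theta> :: "'a \<Rightarrow> real" and j :: 'a
    assume sol: "local_solution a x0 r v G f"
      and \<Theta>: "\<And>p q. \<bar>\<Theta> p - \<Theta> q\<bar> \<le> \<kappa> * norm (p - q)" "\<Theta> 0 = 0" "0 \<le> \<kappa>"
      and \<psi>: "\<psi> \<in> test_functions ?O" and j: "j \<in> Basis"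
    have v: "L2_weak_gradient E v G" and f: "L2_fun ?M f"
      and eqn: "\<And>\<eta> H. L2_weak_gradient E \<eta> H \<Longrightarrow> (\<And>x. x \<notin> cball x0 (3 * r) \<Longrightarrow> \<eta> x = 0 \<and> H x = 0) \<Longrightarrow>
        (LINT x|?M. a (G x) \<bullet> H x) = (LINT x|?M. f x * \<eta> x)"
      using sol unfolding local_solution_def by blast+
    define N where "N = norm2 ?M f + norm2 ?M G"
    have N: "0 \<le> N" "norm2 ?M f \<le> N" by (auto simp: N_def)
    have G: "L2_fun ?M G" using v by (simp add: L2_weak_gradient_def)
    have Gm [measurable]: "G \<in> borel_measurable ?M" by (rule L2_fun_measurable[OF G])
    have lip_sq: "L2_fun ?M (\<lambda>x. \<Phi> (G x))" and lip_cont: "continuous_on UNIV \<Phi>"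
      if \<Phi>: "\<And>p q. \<bar>\<Phi> p - \<Phi> q\<bar> \<le> l * norm (p - q)" "\<Phi> 0 = 0" "0 \<le> l" for \<Phi> :: "'a \<Rightarrow> real" and l
    proof -
      have "l-lipschitz_on UNIV \<Phi>" using \<Phi> by (auto simp: lipschitz_on_def dist_norm)
      then show c: "continuous_on UNIV \<Phi>" by (rule lipschitz_on_continuous_on)
      then have [measurable]: "\<Phi> \<in> borel_measurable borel" by (rule borel_measurable_continuous_onI)
      have "norm (\<Phi> (G x)) \<le> l * norm (G x)" for x using \<Phi>(1)[of "G x" 0] \<Phi>(2) by simp
      then show "L2_fun ?M (\<lambda>x. \<Phi> (G x))" by (intro L2_fun_mono[OF G]) auto
    qed
    have test_ball: "\<xi> \<in> test_functions (ball x0 r)" "\<xi> \<in> test_functions E" if "\<xi> \<in> test_functions ?O" for \<xi>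
      using that test_functions_mono[of ?O "ball x0 r"] test_functions_mono[of ?O E] by auto
    have slope_tan: "continuous_on UNIV (\<lambda>x. tangent k x)" for k
      unfolding tangent_def by (intro continuous_intros continuous_on_slope)
    have tang: "\<bar>LINT x|?M. \<Phi> (G x) * (gradient \<xi> x \<bullet> tangent (P i) x)\<bar> \<le> l * (KT * N) * norm2 ?M \<xi>"
      if \<Phi>: "\<And>p q. \<bar>\<Phi> p - \<Phi> q\<bar> \<le> l * norm (p - q)" "\<Phi> 0 = 0" "0 \<le> l" and \<xi>: "\<xi> \<in> test_functions ?O" and i: "i \<in> Basis"
      for \<Phi> :: "'a \<Rightarrow> real" and l \<xi> i
    proof (rule measure_preserving_flow.dual_bound[OF slide_flow[OF Pk(1)[OF i]] lip_sq[OF \<Phi>] open_ball test_ball(1)[OF \<xi>] hi[OF i]])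
      fix h assume h: "0 < \<bar>h\<bar>" "\<bar>h\<bar> < hi i"
      have G\<tau>: "L2_fun ?M (\<lambda>x. G (slide (P i) h x))" by (rule slide_L2_fun[OF Pk(1)[OF i] G])
      have restr: "L2_fun (leb ?O) u" if "L2_fun ?M u" for u :: "'a \<Rightarrow> 'a"
      proof -
        have "L2_fun ?M (\<lambda>x. indicator (ball x0 r) x *\<^sub>R u x)"
          by (intro L2_fun_bounded_mult(1)[OF that, of _ 1] measurable_restrict_space1 borel_measurable_indicator)
            (auto simp: indicator_def)
        moreover have "L2_fun ?M (\<lambda>x. indicator (ball x0 r) x *\<^sub>R u x) \<longleftrightarrow> L2_fun (leb ?O) u"
          by (rule L2_fun_extension_by_zero(1)[OF EL OL]) auto
        ultimately show ?thesis by blast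
      qed
      have "norm2 (leb ?O) (\<lambda>x. \<Phi> (G (slide (P i) h x)) - \<Phi> (G x))
        \<le> l * norm2 (leb ?O) (\<lambda>x. G (slide (P i) h x) - G x)"
      proof (rule norm2_mono)
        show "L2_fun (leb ?O) (\<lambda>x. G (slide (P i) h x) - G x)"
          by (intro restr L2_fun_diff G\<tau> G)
        have "(\<lambda>x. \<Phi> (G (slide (P i) h x)) - \<Phi> (G x)) \<in> borel_measurable ?M"
          by (intro borel_measurable_diff L2_fun_measurable lip_sq[OF \<Phi>]
            L2_fun_measurable[OF slide_L2_fun(1)[OF Pk(1)[OF i] lip_sq[OF \<Phi>]]])
        then show "(\<lambda>x. \<Phi> (G (slide (P i) h x)) - \<Phi> (G x)) \<in> borel_measurable (leb ?O)"
          by (rule measurable_restrict_mono) auto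
      qed (use \<Phi> in auto)
      also have "\<dots> \<le> l * (\<bar>h\<bar> * (KT * N))"
      proof (intro mult_left_mono \<Phi>(3))
        have "norm2 (leb ?O) (\<lambda>x. G (slide (P i) h x) - G x) \<le> \<bar>h\<bar> * (Ki i * N)"
          unfolding N_def by (rule est[OF i sol h])
        also have "\<dots> \<le> \<bar>h\<bar> * (KT * N)" using KT(2)[OF i] N by (intro mult_left_mono mult_right_mono) auto
        finally show "norm2 (leb ?O) (\<lambda>x. G (slide (P i) h x) - G x) \<le> \<bar>h\<bar> * (KT * N)" .
      qed
      finally show "norm2 (leb ?O) (\<lambda>x. \<Phi> (G (slide (P i) h x)) - \<Phi> (G x)) \<le> \<bar>h\<bar> * (l * (KT * N))"
        by (simp add: mult_ac)
    qed
    \<comment> \<open>The normal component of \<open>a \<circ> G\<close> and the tangential components of \<open>G\<close>.\<close>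
    define b where "b x = a (G x) \<bullet> (e - slope x)" for x
    define z where "z i x = G x \<bullet> tangent (P i) x" for i x
    have coeff_sq: "L2_fun (leb ?O) (\<lambda>x. u x \<bullet> c x)"
      if u: "L2_fun ?M u" and c: "continuous_on UNIV c" for u c :: "'a \<Rightarrow> 'a"
    proof -
      have "compact (c ` cball x0 r)" by (intro compact_continuous_image continuous_on_subset[OF c]) auto
      then obtain B where B0: "0 < B" and B: "\<And>x. x \<in> cball x0 r \<Longrightarrow> norm (c x) \<le> B"
        using compact_imp_bounded[of "c ` cball x0 r"] by (auto simp: bounded_pos)
      have [measurable]: "u \<in> borel_measurable ?M" "c \<in> borel_measurable ?M"
        using L2_fun_measurable[OF u] continuous_borel_measurable_leb[OF c] by auto
      have [measurable]: "(indicator (ball x0 r) :: 'a \<Rightarrow> real) \<in> borel_measurable ?M"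
        by (rule measurable_restrict_space1[OF borel_measurable_indicator]) simp
      have "L2_fun ?M (\<lambda>x. indicator (ball x0 r) x *\<^sub>R (u x \<bullet> c x))"
      proof (rule L2_fun_mono[OF u])
        have "norm (indicator (ball x0 r) x *\<^sub>R (u x \<bullet> c x)) \<le> B * norm (u x)" for x
        proof (cases "x \<in> ball x0 r")
          case True
          have "\<bar>u x \<bullet> c x\<bar> \<le> norm (u x) * norm (c x)" by (rule Cauchy_Schwarz_ineq2)
          also have "\<dots> \<le> norm (u x) * B" using True by (intro mult_left_mono B) auto
          finally show ?thesis using True by (simp add: mult.commute)
        next
          case False
          then show ?thesis using B0 by simp
        qed
        then show "AE x in ?M. norm (indicator (ball x0 r) x *\<^sub>R (u x \<bullet> c x)) \<le> B * norm (u x)" by simp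
      qed measurable
      moreover have "L2_fun ?M (\<lambda>x. indicator (ball x0 r) x *\<^sub>R (u x \<bullet> c x))
          \<longleftrightarrow> L2_fun (leb ?O) (\<lambda>x. u x \<bullet> c x)"
        by (rule L2_fun_extension_by_zero(1)[OF EL OL]) auto
      ultimately show ?thesis by blast
    qed
    have aG: "L2_fun ?M (\<lambda>x. a (G x))"
      using a_le by (intro L2_fun_mono[OF G]) auto
    have bsq: "L2_fun (leb ?O) b" unfolding b_def
      by (intro coeff_sq aG continuous_intros continuous_on_slope)
    have zsq: "L2_fun (leb ?O) (z i)" for i unfolding z_def by (intro coeff_sq G slope_tan)
    have norm_O: "norm2 (leb ?O) \<xi> = norm2 ?M \<xi>" if "\<xi> \<in> test_functions ?O" for \<xi>
      using norm2_test_function[OF that OL EL] by simp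
    have supp: "gradient \<xi> x = 0" "\<xi> x = 0" if \<xi>: "\<xi> \<in> test_functions ?O" and x: "x \<notin> ?O" for \<xi> x
    proof -
      obtain K where "K \<subseteq> ?O" "\<And>x. x \<notin> K \<Longrightarrow> \<xi> x = 0" "\<And>x d. x \<notin> K \<Longrightarrow> dderiv \<xi> x d = 0"
        using test_functions_support[OF \<xi>] by metis
      then have "\<xi> x = 0" "dderiv \<xi> x (gradient \<xi> x) = 0" using x by blast+
      then show "gradient \<xi> x = 0" "\<xi> x = 0"
        by (auto simp: dderiv_eq_gradient[OF smooth_differentiable[OF test_functions_smooth[OF \<xi>]]])
    qed
    have fd: "dderiv \<xi> x d = gradient \<xi> x \<bullet> d" if "\<xi> \<in> test_functions ?O" for \<xi> x d
      by (rule dderiv_eq_gradient[OF smooth_differentiable[OF test_functions_smooth[OF that]]])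
    have int: "integrable ?M (\<lambda>x. u x * (gradient \<xi> x \<bullet> c x))"
      if u: "L2_fun ?M u" and \<xi>: "\<xi> \<in> test_functions ?O" and c: "continuous_on UNIV c" for u :: "'a \<Rightarrow> real" and \<xi> c
    proof -
      obtain K where K: "compact K" "\<And>x d. x \<notin> K \<Longrightarrow> dderiv \<xi> x d = 0"
        using test_functions_support[OF \<xi>] by metis
      have "L2_fun ?M (\<lambda>x. gradient \<xi> x \<bullet> c x)"
      proof (rule L2_fun_continuous_compact_support[OF _ K(1) _ EL])
        show "continuous_on UNIV (\<lambda>x. gradient \<xi> x \<bullet> c x)"
          by (intro continuous_on_inner continuous_on_gradient_smooth test_functions_smooth[OF \<xi>] c)
        show "gradient \<xi> x \<bullet> c x = 0" if "x \<notin> K" for x using K(2)[OF that, of "c x"] by (simp add: fd[OF \<xi>])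
      qed
      then show ?thesis by (rule integrable_mult_L2_fun[OF u])
    qed
    have b_bound: "\<bar>LINT x|leb ?O. b x * dderiv \<xi> x e\<bar> \<le> (Kb * N) * norm2 (leb ?O) \<xi>"
      if \<xi>: "\<xi> \<in> test_functions ?O" for \<xi>
    proof -
      have "(LINT x|leb ?O. b x * dderiv \<xi> x e) = (LINT x|?M. b x * (gradient \<xi> x \<bullet> e))"
        by (rule lebesgue_on_extension_by_zero(3)[OF OL EL]) (auto simp: fd[OF \<xi>] supp(1)[OF \<xi>])
      also have "\<dots> = (LINT x|?M. a (G x) \<bullet> gradient \<xi> x - (\<Sum>i\<in>Basis. (a (G x) \<bullet> i) * (gradient \<xi> x \<bullet> tangent (P i) x)))"
      proof (rule Bochner_Integration.integral_cong[OF refl])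
        fix x
        show "b x * (gradient \<xi> x \<bullet> e)
          = a (G x) \<bullet> gradient \<xi> x - (\<Sum>i\<in>Basis. (a (G x) \<bullet> i) * (gradient \<xi> x \<bullet> tangent (P i) x))"
          using tangent_expansion[of "a (G x)" "gradient \<xi> x" x] by (simp add: b_def)
      qed
      also have "\<dots> = (LINT x|?M. a (G x) \<bullet> gradient \<xi> x) - (\<Sum>i\<in>Basis. LINT x|?M. (a (G x) \<bullet> i) * (gradient \<xi> x \<bullet> tangent (P i) x))"
      proof -
        have "integrable ?M (\<lambda>x. a (G x) \<bullet> gradient \<xi> x)"
          using L2_weak_gradient_test_function[OF \<xi> open_E]
          by (intro integrable_inner_L2_fun[OF aG]) (simp add: L2_weak_gradient_def)
        moreover have i: "integrable ?M (\<lambda>x. (a (G x) \<bullet> i) * (gradient \<xi> x \<bullet> tangent (P i) x))" for i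
          by (intro int \<xi> L2_fun_inner_const aG slope_tan)
        ultimately show ?thesis by (simp add: Bochner_Integration.integral_sum[OF i])
      qed
      also have "(LINT x|?M. a (G x) \<bullet> gradient \<xi> x) = (LINT x|?M. f x * \<xi> x)"
        by (rule eqn[OF L2_weak_gradient_test_function[OF \<xi> open_E]]) (use r in \<open>auto intro!: supp[OF \<xi>]\<close>)
      finally have "\<bar>LINT x|leb ?O. b x * dderiv \<xi> x e\<bar>
        \<le> \<bar>LINT x|?M. f x * \<xi> x\<bar> + \<bar>\<Sum>i\<in>Basis. LINT x|?M. (a (G x) \<bullet> i) * (gradient \<xi> x \<bullet> tangent (P i) x)\<bar>" by linarith
      also have "\<bar>LINT x|?M. f x * \<xi> x\<bar> \<le> N * norm2 ?M \<xi>"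
      proof -
        have "\<bar>LINT x|?M. f x * \<xi> x\<bar> \<le> norm2 ?M f * norm2 ?M \<xi>"
          by (rule Cauchy_Schwarz_norm2_real[OF f L2_fun_test_function[OF \<xi> EL]])
        also have "\<dots> \<le> N * norm2 ?M \<xi>" using N by (intro mult_right_mono) auto
        finally show ?thesis .
      qed
      also have "\<bar>\<Sum>i\<in>Basis. LINT x|?M. (a (G x) \<bullet> i) * (gradient \<xi> x \<bullet> tangent (P i) x)\<bar> \<le> (\<Sum>i\<in>(Basis :: 'a set). \<Lambda> * (KT * N) * norm2 ?M \<xi>)"
      proof (rule order_trans[OF sum_abs sum_mono])
        fix i :: 'a assume i: "i \<in> Basis"
        show "\<bar>LINT x|?M. (a (G x) \<bullet> i) * (gradient \<xi> x \<bullet> tangent (P i) x)\<bar> \<le> \<Lambda> * (KT * N) * norm2 ?M \<xi>"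
        proof (rule tang[OF _ _ \<Lambda> \<xi> i])
          show "\<bar>a p \<bullet> i - a q \<bullet> i\<bar> \<le> \<Lambda> * norm (p - q)" for p q
            using Basis_le_norm[OF i, of "a p - a q"] a(1)[of p q] by (simp add: inner_diff_left)
        qed (simp add: a(2))
      qed
      also have "N * norm2 ?M \<xi> + (\<Sum>i\<in>(Basis :: 'a set). \<Lambda> * (KT * N) * norm2 ?M \<xi>) = (Kb * N) * norm2 ?M \<xi>"
        by (simp add: Kb_def n_def algebra_simps)
      finally show ?thesis by (simp add: norm_O[OF \<xi>])
    qed
    have z_bound: "\<bar>LINT x|leb ?O. z i x * dderiv \<xi> x e\<bar> \<le> (KT * N) * norm2 (leb ?O) \<xi>"
      if \<xi>: "\<xi> \<in> test_functions ?O" and i: "i \<in> Basis" for \<xi> i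
    proof -
      have gc: "continuous_on UNIV (\<lambda>x. (slope x \<bullet> P i) *\<^sub>R e)"
        by (intro continuous_intros continuous_on_slope)
      have "(LINT x|leb ?O. z i x * dderiv \<xi> x e) = (LINT x|?M. z i x * (gradient \<xi> x \<bullet> e))"
        by (rule lebesgue_on_extension_by_zero(3)[OF OL EL]) (auto simp: fd[OF \<xi>] supp(1)[OF \<xi>])
      also have "\<dots> = (LINT x|?M. (G x \<bullet> P i) * (gradient \<xi> x \<bullet> e) + (G x \<bullet> e) * (gradient \<xi> x \<bullet> ((slope x \<bullet> P i) *\<^sub>R e)))"
        by (simp add: z_def tangent_def inner_add_right algebra_simps)
      also have "\<dots> = (LINT x|?M. (G x \<bullet> P i) * (gradient \<xi> x \<bullet> e)) + (LINT x|?M. (G x \<bullet> e) * (gradient \<xi> x \<bullet> ((slope x \<bullet> P i) *\<^sub>R e)))"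
        by (rule Bochner_Integration.integral_add) (intro int \<xi> L2_fun_inner_const G continuous_intros gc)+
      also have "(LINT x|?M. (G x \<bullet> P i) * (gradient \<xi> x \<bullet> e)) = (LINT x|?M. (G x \<bullet> e) * (gradient \<xi> x \<bullet> P i))"
        using L2_weak_gradient_curl_free[OF open_E v test_ball(2)[OF \<xi>], of "P i" e] by (simp add: fd[OF \<xi>])
      also have "(LINT x|?M. (G x \<bullet> e) * (gradient \<xi> x \<bullet> P i)) + (LINT x|?M. (G x \<bullet> e) * (gradient \<xi> x \<bullet> ((slope x \<bullet> P i) *\<^sub>R e)))
        = (LINT x|?M. (G x \<bullet> e) * (gradient \<xi> x \<bullet> P i) + (G x \<bullet> e) * (gradient \<xi> x \<bullet> ((slope x \<bullet> P i) *\<^sub>R e)))"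
        by (rule Bochner_Integration.integral_add[symmetric]) (intro int \<xi> L2_fun_inner_const G continuous_intros gc)+
      also have "\<dots> = (LINT x|?M. (G x \<bullet> e) * (gradient \<xi> x \<bullet> tangent (P i) x))"
        by (simp add: tangent_def inner_add_right algebra_simps)
      also have "\<bar>\<dots>\<bar> \<le> 1 * (KT * N) * norm2 ?M \<xi>"
      proof (rule tang[OF _ _ _ \<xi> i])
        show "\<bar>p \<bullet> e - q \<bullet> e\<bar> \<le> 1 * norm (p - q)" for p q
          using Cauchy_Schwarz_ineq2[of "p - q" e] by (simp add: inner_diff_left unit)
      qed auto
      finally show ?thesis by (simp add: norm_O[OF \<xi>])
    qed
    \<comment> \<open>The direction \<open>j\<close> is the sum of \<open>tangent (P j) x\<close> and \<open>c x\<close> times \<open>e\<close>; \<open>c\<close> is constant along \<open>e\<close>. The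
      truncation in \<open>w\<close> is invisible near the support of the test function and allows translations
      of the whole space.\<close>
    define c where "c x = (j \<bullet> e) - slope x \<bullet> P j" for x
    have c_le: "\<bar>c x\<bar> \<le> 1 + m" if "x \<in> cball x0 r" for x
    proof -
      have "\<bar>j \<bullet> e\<bar> \<le> 1" using Cauchy_Schwarz_ineq2[of j e] j by (simp add: unit)
      moreover have "\<bar>slope x \<bullet> P j\<bar> \<le> norm (slope x) * norm (P j)" by (rule Cauchy_Schwarz_ineq2)
      moreover have "norm (slope x) * norm (P j) \<le> m * 1" using m(1) Pk(2)[OF j] m(2)[OF that] by (intro mult_mono) auto
      ultimately show ?thesis by (simp add: c_def)
    qed
    have c_cont: "continuous_on UNIV c" unfolding c_def by (intro continuous_intros continuous_on_slope)
    define w where "w x = indicator ?O x * (c x * \<Theta> (G x))" for x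
    have \<Theta>G: "L2_fun ?M (\<lambda>x. \<Theta> (G x))" by (rule lip_sq[OF \<Theta>])
    have wO: "L2_fun (leb ?O) (\<lambda>x. c x * \<Theta> (G x))"
    proof -
      have "L2_fun (leb ?O) (\<lambda>x. (\<Theta> (G x) *\<^sub>R e) \<bullet> (c x *\<^sub>R e))"
      proof (rule coeff_sq)
        show "L2_fun ?M (\<lambda>x. \<Theta> (G x) *\<^sub>R e)"
          by (rule L2_fun_mono[OF \<Theta>G, of _ 1]) (use L2_fun_measurable[OF \<Theta>G] in \<open>auto simp: unit\<close>)
      qed (intro continuous_intros c_cont)
      then show ?thesis by (simp add: ee mult.commute)
    qed
    have wsq: "L2_fun (leb UNIV) w"
      unfolding w_def using wO by (simp add: lebesgue_on_UNIV_indicator(1)[OF OL])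
    obtain V \<epsilon> where V: "open V" "0 < \<epsilon>" "\<psi> \<in> test_functions V" "\<And>x y. x \<in> V \<Longrightarrow> norm y < \<epsilon> \<Longrightarrow> x + y \<in> ?O"
      using test_function_neighbourhood[OF \<psi> O] by metis
    have VO: "x \<in> ?O" if "x \<in> V" for x using V(4)[OF that, of 0] V(2) by simp
    have VOs: "x + s *\<^sub>R e \<in> ?O" if "x \<in> V" "\<bar>s\<bar> < \<epsilon>" for x s using V(4)[OF that(1), of "s *\<^sub>R e"] that(2) by (simp add: unit)
    have VL: "V \<in> sets lebesgue" using V(1) by auto
    have normal: "\<bar>LINT x|leb UNIV. w x * (gradient \<psi> x \<bullet> e)\<bar> \<le> ((1 + m) * (\<kappa> * (Kp * N))) * norm2 (leb UNIV) \<psi>"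
    proof (rule measure_preserving_flow.dual_bound[OF translation_flow wsq V(1) V(3) V(2)])
      fix h assume h: "0 < \<bar>h\<bar>" "\<bar>h\<bar> < \<epsilon>"
      note bt = norm2_translation_difference_le[OF O V(1) bsq _ b_bound VOs h(2)]
      note zt = norm2_translation_difference_le[OF O V(1) zsq _ z_bound VOs h(2)]
      have nn: "0 \<le> Kb * N" "0 \<le> KT * N" using Kbp KT N by auto
      define y where "y x = (\<Lambda> * (\<Sum>i\<in>Basis. \<bar>z i (x + h *\<^sub>R e) - z i x\<bar>) + \<bar>b (x + h *\<^sub>R e) - b x\<bar>) / a0" for x
      have pw: "norm (G (x + h *\<^sub>R e) - G x) \<le> y x" for x
      proof -
        have "z i (x + h *\<^sub>R e) - z i x = (G (x + h *\<^sub>R e) - G x) \<bullet> tangent (P i) x" for i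
          by (simp add: z_def tangent_def inner_diff_left)
        moreover have "b (x + h *\<^sub>R e) - b x = (a (G (x + h *\<^sub>R e)) - a (G x)) \<bullet> (e - slope x)"
          by (simp add: b_def inner_diff_left)
        ultimately show ?thesis unfolding y_def
          using monotone_normal_bound[OF a(3) a(1) a0 \<Lambda>, of "G (x + h *\<^sub>R e)" "G x" x] by simp
      qed
      have zabs: "L2_fun (leb V) (\<lambda>x. \<bar>z i (x + h *\<^sub>R e) - z i x\<bar>)"
          "norm2 (leb V) (\<lambda>x. \<bar>z i (x + h *\<^sub>R e) - z i x\<bar>) \<le> \<bar>h\<bar> * (KT * N)" if i: "i \<in> Basis" for i
        using L2_fun_norm[OF zt(1)[OF nn(2) _ i]] zt(2)[OF nn(2) _ i] i by auto
      have babs: "L2_fun (leb V) (\<lambda>x. \<bar>b (x + h *\<^sub>R e) - b x\<bar>)"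
          "norm2 (leb V) (\<lambda>x. \<bar>b (x + h *\<^sub>R e) - b x\<bar>) \<le> \<bar>h\<bar> * (Kb * N)"
        using L2_fun_norm[OF bt(1)[OF nn(1)]] bt(2)[OF nn(1)] by auto
      have Ssq: "L2_fun (leb V) (\<lambda>x. \<Sum>i\<in>Basis. \<bar>z i (x + h *\<^sub>R e) - z i x\<bar>)"
        by (intro L2_fun_sum zabs) auto
      have y_eq: "y = (\<lambda>x. (1/a0) * (\<Lambda> * (\<Sum>i\<in>Basis. \<bar>z i (x + h *\<^sub>R e) - z i x\<bar>) + \<bar>b (x + h *\<^sub>R e) - b x\<bar>))"
        by (simp add: y_def fun_eq_iff)
      have ysq: "L2_fun (leb V) y"
        unfolding y_eq by (intro L2_fun_mult L2_fun_add Ssq babs)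
      have "norm2 (leb V) y \<le> (1/a0) * (\<Lambda> * (n * (\<bar>h\<bar> * (KT * N))) + \<bar>h\<bar> * (Kb * N))"
      proof -
        have "norm2 (leb V) y = (1/a0) * norm2 (leb V)
            (\<lambda>x. \<Lambda> * (\<Sum>i\<in>Basis. \<bar>z i (x + h *\<^sub>R e) - z i x\<bar>) + \<bar>b (x + h *\<^sub>R e) - b x\<bar>)"
          unfolding y_eq using a0 by (subst norm2_mult) simp
        also have "\<dots> \<le> (1/a0) * (\<Lambda> * (n * (\<bar>h\<bar> * (KT * N))) + \<bar>h\<bar> * (Kb * N))"
        proof (intro mult_left_mono order_trans[OF norm2_triangle[OF L2_fun_mult[OF Ssq] babs(1)]] add_mono babs(2))
          have "norm2 (leb V) (\<lambda>x. \<Sum>i\<in>Basis. \<bar>z i (x + h *\<^sub>R e) - z i x\<bar>)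
              \<le> (\<Sum>i\<in>Basis. norm2 (leb V) (\<lambda>x. \<bar>z i (x + h *\<^sub>R e) - z i x\<bar>))"
            by (intro norm2_sum zabs) auto
          also have "\<dots> \<le> (\<Sum>i\<in>(Basis :: 'a set). \<bar>h\<bar> * (KT * N))" by (intro sum_mono zabs)
          also have "\<dots> = n * (\<bar>h\<bar> * (KT * N))" by (simp add: n_def)
          finally show "norm2 (leb V) (\<lambda>x. \<Lambda> * (\<Sum>i\<in>Basis. \<bar>z i (x + h *\<^sub>R e) - z i x\<bar>)) \<le> \<Lambda> * (n * (\<bar>h\<bar> * (KT * N)))"
            using \<Lambda> by (simp only: norm2_mult abs_of_nonneg) (intro mult_left_mono)
        qed (use a0 in auto)
        finally show ?thesis .
      qed
      also have "\<dots> = \<bar>h\<bar> * (Kp * N)" using a0 by (simp add: Kp_def field_simps)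
      finally have y_le: "norm2 (leb V) y \<le> \<bar>h\<bar> * (Kp * N)" .
      have "norm2 (leb V) (\<lambda>x. w (x + h *\<^sub>R e) - w x) \<le> ((1 + m) * \<kappa>) * norm2 (leb V) y"
      proof (rule norm2_mono[OF ysq])
        have "(\<lambda>x. w (x + h *\<^sub>R e) - w x) \<in> borel_measurable (leb UNIV)"
          using preserves_lebesgue_integral(1)[OF preserves_lebesgue_translation[of "h *\<^sub>R e"] _ _ _ L2_fun_measurable[OF wsq], of UNIV]
          by (intro borel_measurable_diff L2_fun_measurable[OF wsq]) simp
        then show "(\<lambda>x. w (x + h *\<^sub>R e) - w x) \<in> borel_measurable (leb V)"
          by (rule measurable_restrict_mono) auto
        have "norm (w (x + h *\<^sub>R e) - w x) \<le> ((1 + m) * \<kappa>) * norm (y x)" if x: "x \<in> V" for x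
        proof -
          have "c (x + h *\<^sub>R e) = c x" by (simp add: c_def)
          then have "w (x + h *\<^sub>R e) - w x = c x * (\<Theta> (G (x + h *\<^sub>R e)) - \<Theta> (G x))"
            using VO[OF x] VOs[OF x h(2)] by (simp add: w_def right_diff_distrib del: mem_ball IntE Int_iff)
          then have "norm (w (x + h *\<^sub>R e) - w x) = \<bar>c x\<bar> * \<bar>\<Theta> (G (x + h *\<^sub>R e)) - \<Theta> (G x)\<bar>" by (simp add: abs_mult)
          also have "\<dots> \<le> (1 + m) * (\<kappa> * y x)"
          proof (intro mult_mono c_le)
            show "x \<in> cball x0 r" using VO[OF x] by auto
            show "\<bar>\<Theta> (G (x + h *\<^sub>R e)) - \<Theta> (G x)\<bar> \<le> \<kappa> * y x"
              using \<Theta>(1)[of "G (x + h *\<^sub>R e)" "G x"] mult_left_mono[OF pw[of x] \<Theta>(3)] by linarith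
          qed (use m in auto)
          also have "y x \<le> norm (y x)" by simp
          finally show ?thesis using m \<Theta>(3) by (simp add: mult.assoc mult_left_mono)
        qed
        then show "AE x in leb V. norm (w (x + h *\<^sub>R e) - w x) \<le> ((1 + m) * \<kappa>) * norm (y x)"
          by (intro AE_I2) simp
      qed (use m \<Theta> in simp)
      also have "\<dots> \<le> ((1 + m) * \<kappa>) * (\<bar>h\<bar> * (Kp * N))" using y_le m \<Theta>(3) by (intro mult_left_mono) auto
      finally show "norm2 (leb (UNIV \<inter> V)) (\<lambda>x. w (x + h *\<^sub>R e) - w x) \<le> \<bar>h\<bar> * ((1 + m) * (\<kappa> * (Kp * N)))"
        by (simp add: mult_ac)
    qed
    have wint: "(LINT x|leb UNIV. w x * (gradient \<psi> x \<bullet> e)) = (LINT x|?M. \<Theta> (G x) * (gradient \<psi> x \<bullet> (c x *\<^sub>R e)))"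
      by (rule lebesgue_on_extension_by_zero(3)) (use EL supp(1)[OF \<psi>] in \<open>auto simp: w_def indicator_def\<close>)
    have decomp: "dderiv \<psi> x j = gradient \<psi> x \<bullet> tangent (P j) x + gradient \<psi> x \<bullet> (c x *\<^sub>R e)" for x
      unfolding fd[OF \<psi>] by (simp add: c_def tangent_def P_def[of j] inner_add_right inner_diff_right algebra_simps)
    have "(LINT x|?M. \<Theta> (G x) * dderiv \<psi> x j)
      = (LINT x|?M. \<Theta> (G x) * (gradient \<psi> x \<bullet> tangent (P j) x)) + (LINT x|?M. \<Theta> (G x) * (gradient \<psi> x \<bullet> (c x *\<^sub>R e)))"
      unfolding decomp distrib_left
      by (rule Bochner_Integration.integral_add) (intro int \<Theta>G \<psi> slope_tan continuous_intros c_cont)+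
    also have "\<bar>\<dots>\<bar> \<le> \<kappa> * (KT * N) * norm2 ?M \<psi> + ((1 + m) * (\<kappa> * (Kp * N))) * norm2 ?M \<psi>"
    proof (rule order_trans[OF abs_triangle_ineq add_mono])
      show "\<bar>LINT x|?M. \<Theta> (G x) * (gradient \<psi> x \<bullet> tangent (P j) x)\<bar> \<le> \<kappa> * (KT * N) * norm2 ?M \<psi>"
        by (rule tang[OF \<Theta> \<psi> j])
      have "norm2 (leb UNIV) \<psi> = norm2 ?M \<psi>"
        using norm2_test_function[OF \<psi> OL, of UNIV] norm_O[OF \<psi>] by simp
      then show "\<bar>LINT x|?M. \<Theta> (G x) * (gradient \<psi> x \<bullet> (c x *\<^sub>R e))\<bar> \<le> ((1 + m) * (\<kappa> * (Kp * N))) * norm2 ?M \<psi>"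
        using normal by (simp only: wint)
    qed
    also have "\<dots> = \<kappa> * ((KT + (1 + m) * Kp) * N) * norm2 ?M \<psi>" by (simp add: algebra_simps)
    finally show "\<bar>LINT x|?M. \<Theta> (G x) * dderiv \<psi> x j\<bar>
        \<le> \<kappa> * ((KT + (1 + m) * Kp) * (norm2 ?M f + norm2 ?M G)) * norm2 ?M \<psi>" by (simp only: N_def)
  qed
qed

end

section \<open>Regularity up to the boundary\<close>

lemma test_function_gradient_zero:
  assumes "\<zeta> \<in> test_functions U" "x \<notin> U" shows "\<zeta> x = 0" "gradient \<zeta> x = 0"
proof -
  obtain K where "K \<subseteq> U" "\<And>x. x \<notin> K \<Longrightarrow> \<zeta> x = 0" "\<And>x d. x \<notin> K \<Longrightarrow> dderiv \<zeta> x d = 0"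
    using test_functions_support[OF assms(1)] by metis
  then have "\<zeta> x = 0" "dderiv \<zeta> x (gradient \<zeta> x) = 0" using assms(2) by blast+
  then show "\<zeta> x = 0" "gradient \<zeta> x = 0"
    by (auto simp: dderiv_eq_gradient[OF smooth_differentiable[OF test_functions_smooth[OF assms(1)]]])
qed

lemma gradient_zero_if_locally_constant:
  assumes "open W" "x \<in> W" "\<And>y. y \<in> W \<Longrightarrow> \<zeta> y = c" and \<zeta>: "smooth \<zeta>"
  shows "gradient \<zeta> x = 0"
proof -
  have "(\<zeta> has_derivative (\<lambda>_. 0)) (at x)"
    by (rule has_derivative_transform_within_open[of "\<lambda>_. c" _ _ _ W]) (use assms in auto)
  then have "(\<lambda>d. gradient \<zeta> x \<bullet> d) = (\<lambda>_. 0)"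
    using gradient_has_derivative[OF smooth_differentiable[OF \<zeta>]] has_derivative_unique by blast
  then have "gradient \<zeta> x \<bullet> gradient \<zeta> x = 0" by metis
  then show ?thesis by simp
qed

text \<open>A function supported in a ball in which two open sets agree can be moved from one of them to
  the other, since test functions can be cut off outside a smaller ball.\<close>
lemma L2_weak_gradient_transfer:
  assumes U: "open U" and V: "open V" and w: "L2_weak_gradient U w G" and \<rho>: "0 < \<rho>" "\<rho> < R"
    and UV: "U \<inter> ball x0 R = V \<inter> ball x0 R"
    and z: "\<And>x. x \<notin> cball x0 \<rho> \<Longrightarrow> w x = 0" "\<And>x. x \<notin> cball x0 \<rho> \<Longrightarrow> G x = 0"
  shows "L2_weak_gradient V w G"
  unfolding L2_weak_gradient_def
proof (intro conjI ballI allI)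
  have UL: "U \<in> sets lebesgue" and VL: "V \<in> sets lebesgue" using U V by auto
  have out': "x \<notin> cball x0 \<rho>" if "x \<in> U \<and> x \<notin> V \<or> x \<in> V \<and> x \<notin> U" for x
  proof -
    have "x \<notin> ball x0 R" using that UV by blast
    then show ?thesis using \<rho>(2) by auto
  qed
  have "L2_fun (leb U) w \<longleftrightarrow> L2_fun (leb V) w"
    by (rule L2_fun_extension_by_zero(1)[OF UL VL]) (use out' z(1) in blast)+
  then show "L2_fun (leb V) w" using w by (simp add: L2_weak_gradient_def)
  have "L2_fun (leb U) G \<longleftrightarrow> L2_fun (leb V) G"
    by (rule L2_fun_extension_by_zero(1)[OF UL VL]) (use out' z(2) in blast)+
  then show "L2_fun (leb V) G" using w by (simp add: L2_weak_gradient_def)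
  fix \<psi> d assume \<psi>: "\<psi> \<in> test_functions V"
  have sm: "smooth \<psi>" by (rule test_functions_smooth[OF \<psi>])
  have sub: "cball x0 \<rho> \<subseteq> ball x0 R" using \<rho>(2) by auto
  obtain \<zeta> W where \<zeta>: "\<zeta> \<in> test_functions (ball x0 R)" and W: "open W" "cball x0 \<rho> \<subseteq> W" "\<And>x. x \<in> W \<Longrightarrow> \<zeta> x = 1"
    using smooth_Urysohn[OF compact_cball open_ball sub] by metis
  have sm\<zeta>: "smooth \<zeta>" by (rule test_functions_smooth[OF \<zeta>])
  obtain K1 where K1: "compact K1" "K1 \<subseteq> ball x0 R" "\<And>x. x \<notin> K1 \<Longrightarrow> \<zeta> x = 0" using test_functions_support[OF \<zeta>] by metis
  obtain K2 where K2: "compact K2" "K2 \<subseteq> V" "\<And>x. x \<notin> K2 \<Longrightarrow> \<psi> x = 0" using test_functions_support[OF \<psi>] by metis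
  have \<zeta>\<psi>: "(\<lambda>x. \<zeta> x * \<psi> x) \<in> test_functions U"
  proof (rule test_functionsI)
    show "smooth (\<lambda>x. \<zeta> x * \<psi> x)" using sm sm\<zeta> by (auto intro: Ck_mult)
    show "compact (K1 \<inter> K2)" using K1 K2 by (intro compact_Int)
    show "K1 \<inter> K2 \<subseteq> U" using K1(2) K2(2) UV by blast
    show "\<zeta> x * \<psi> x = 0" if "x \<notin> K1 \<inter> K2" for x using K1(3)[of x] K2(3)[of x] that by auto
  qed
  have fd: "dderiv (\<lambda>x. \<zeta> x * \<psi> x) x d = dderiv \<psi> x d" "\<zeta> x = 1" if "x \<in> cball x0 \<rho>" for x
  proof -
    have x: "x \<in> W" using W(2) that by blast
    have "gradient \<zeta> x = 0" by (rule gradient_zero_if_locally_constant[OF W(1) x W(3) sm\<zeta>])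
    then show "dderiv (\<lambda>x. \<zeta> x * \<psi> x) x d = dderiv \<psi> x d" "\<zeta> x = 1"
      using W(3)[OF x] by (simp_all add: dderiv_mult[OF sm\<zeta> sm] dderiv_eq_gradient[OF smooth_differentiable[OF sm\<zeta>]])
  qed
  have "(LINT x|leb V. w x * dderiv \<psi> x d) = (LINT x|leb U. w x * dderiv (\<lambda>x. \<zeta> x * \<psi> x) x d)"
  proof (rule lebesgue_on_extension_by_zero(3)[OF VL UL])
    show "w x * dderiv \<psi> x d = w x * dderiv (\<lambda>x. \<zeta> x * \<psi> x) x d" for x
      using fd(1)[of x] z(1)[of x] by (cases "x \<in> cball x0 \<rho>") simp_all
  qed (use out' z(1) in \<open>simp_all del: mem_cball\<close>)
  also have "\<dots> = - (LINT x|leb U. (G x \<bullet> d) * (\<zeta> x * \<psi> x))"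
    using w \<zeta>\<psi> unfolding L2_weak_gradient_def by blast
  also have "(LINT x|leb U. (G x \<bullet> d) * (\<zeta> x * \<psi> x)) = (LINT x|leb V. (G x \<bullet> d) * \<psi> x)"
  proof (rule lebesgue_on_extension_by_zero(3)[OF UL VL])
    show "(G x \<bullet> d) * (\<zeta> x * \<psi> x) = (G x \<bullet> d) * \<psi> x" for x
      using fd(2)[of x] z(2)[of x] by (cases "x \<in> cball x0 \<rho>") simp_all
  qed (use out' z(2) in \<open>simp_all del: mem_cball\<close>)
  finally show "(LINT x|leb V. w x * dderiv \<psi> x d) = - (LINT x|leb V. (G x \<bullet> d) * \<psi> x)" .
qed

lemma C11_const: "C11 (\<lambda>x. 0 :: real)"
proof -
  have d: "(\<lambda>x :: 'a. 0 :: real) differentiable (at x)" for x by simp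
  have "gradient (\<lambda>x :: 'a. 0 :: real) x = 0" for x
  proof -
    have "(\<lambda>d. gradient (\<lambda>x. 0 :: real) x \<bullet> d) = (\<lambda>d. 0)"
      using gradient_has_derivative[OF d, of x] has_derivative_unique has_derivative_const by blast
    then have "gradient (\<lambda>x. 0 :: real) x \<bullet> gradient (\<lambda>x. 0 :: real) x = 0" by metis
    then show ?thesis by simp
  qed
  then have "gradient (\<lambda>x :: 'a. 0 :: real) = (\<lambda>x. 0)" by (rule ext)
  moreover have "0-lipschitz_on UNIV (\<lambda>x :: 'a. 0 :: 'a)" by (rule lipschitz_on_constant)
  ultimately show ?thesis unfolding C11_def using d by metis
qed

text \<open>An interior point gets the flat chart of the whole space. The factor 5 leaves room for nested
  balls: for test functions, two cutoffs and the solution.\<close>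
lemma boundary_chart_exists:
  fixes \<Omega> :: "'a::euclidean_space set"
  assumes \<Omega>: "bounded_C11_domain \<Omega>" and x0: "x0 \<in> closure \<Omega>"
  obtains r e \<gamma> E where "0 < r" "sliding e \<gamma> E" "\<Omega> \<inter> ball x0 (5 * r) = E \<inter> ball x0 (5 * r)"
proof (cases "x0 \<in> \<Omega>")
  case True
  have "open \<Omega>" using \<Omega> by (simp add: bounded_C11_domain_def)
  then obtain R where R: "0 < R" "ball x0 R \<subseteq> \<Omega>" using True open_contains_ball by blast
  obtain e :: 'a where e: "e \<in> Basis" using nonempty_Basis by blast
  have "sliding e (\<lambda>x. 0) UNIV"
    by unfold_locales (use e C11_const in auto)
  then show thesis using R by (intro that[of "R / 5" e "\<lambda>x. 0" UNIV]) auto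
next
  case False
  then have "x0 \<in> frontier \<Omega>" using x0 \<Omega> by (simp add: frontier_def bounded_C11_domain_def interior_open)
  then obtain R e \<gamma> where R: "R > 0" "norm e = 1" "C11 \<gamma>"
      "\<Omega> \<inter> ball x0 R = {x \<in> ball x0 R. x \<bullet> e > \<gamma> (x - (x \<bullet> e) *\<^sub>R e)}"
    using \<Omega> unfolding bounded_C11_domain_def C11_boundary_def by blast
  define E where "E = {x. \<gamma> (x - (x \<bullet> e) *\<^sub>R e) < x \<bullet> e}"
  have ee: "e \<bullet> e = 1" using R(2) by (simp add: power2_norm_eq_inner[symmetric])
  have "continuous_on UNIV \<gamma>"
    using R(3) unfolding C11_def by (simp add: continuous_at_imp_continuous_on differentiable_imp_continuous_within)
  then have "continuous_on UNIV (\<lambda>x. \<gamma> (x - (x \<bullet> e) *\<^sub>R e))"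
    by (rule continuous_on_compose2) (auto intro!: continuous_intros)
  then have "open E" unfolding E_def by (rule open_Collect_less) (intro continuous_intros)
  have "sliding e \<gamma> E"
  proof
    fix k x assume k: "k \<bullet> e = 0"
    define t where "t = \<gamma> (x + k - ((x + k) \<bullet> e) *\<^sub>R e) - \<gamma> (x - (x \<bullet> e) *\<^sub>R e)"
    have "(x + k + t *\<^sub>R e) \<bullet> e = x \<bullet> e + t" using k by (simp add: inner_add_left ee)
    moreover have "x + k + t *\<^sub>R e - (x \<bullet> e + t) *\<^sub>R e = x + k - ((x + k) \<bullet> e) *\<^sub>R e"
      using k by (simp add: inner_add_left algebra_simps)
    ultimately have "(x + k + t *\<^sub>R e \<in> E) = (\<gamma> (x + k - ((x + k) \<bullet> e) *\<^sub>R e) < x \<bullet> e + t)"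
      unfolding E_def mem_Collect_eq by (simp only:)
    also have "\<dots> = (x \<in> E)" by (auto simp: E_def t_def)
    finally show "(x + k + (\<gamma> (x + k - ((x + k) \<bullet> e) *\<^sub>R e) - \<gamma> (x - (x \<bullet> e) *\<^sub>R e)) *\<^sub>R e \<in> E) = (x \<in> E)"
      by (simp only: t_def)
  qed (use R(2,3) \<open>open E\<close> in simp_all)
  then show thesis using R(1,4) by (intro that[of "R / 5" e \<gamma> E]) (simp_all add: E_def set_eq_iff conj_commute)
qed

text \<open>The weak form of \<open>- div (a (grad u)) = f\<close> with natural boundary conditions.\<close>
definition neumann_solution ::
    "('a::euclidean_space \<Rightarrow> 'a) \<Rightarrow> 'a set \<Rightarrow> ('a \<Rightarrow> real) \<Rightarrow> ('a \<Rightarrow> 'a) \<Rightarrow> ('a \<Rightarrow> real) \<Rightarrow> bool"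
  where "neumann_solution a U u G f \<longleftrightarrow> L2_weak_gradient U u G \<and> L2_fun (leb U) f \<and>
    (\<forall>\<eta> H. L2_weak_gradient U \<eta> H \<longrightarrow>
      (LINT x|leb U. a (G x) \<bullet> H x) = (LINT x|leb U. f x * \<eta> x))"

text \<open>A bound for the weak derivatives of Lipschitz functions of the gradient on a class of test
  functions, with a constant that only depends on the domain and the vector field.\<close>
definition derivative_bound ::
    "('a::euclidean_space \<Rightarrow> 'a) \<Rightarrow> 'a set \<Rightarrow> ('a \<Rightarrow> real) set \<Rightarrow> real \<Rightarrow> bool"
  where "derivative_bound a U \<Psi> K \<longleftrightarrow> (\<forall>u G f \<Theta> c. \<forall>\<psi>\<in>\<Psi>. \<forall>j\<in>Basis. neumann_solution a U u G f \<longrightarrow>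
    (\<forall>p q. \<bar>\<Theta> p - \<Theta> q\<bar> \<le> c * norm (p - q)) \<longrightarrow> \<Theta> 0 = 0 \<longrightarrow> 0 \<le> c \<longrightarrow>
    \<bar>LINT x|leb U. \<Theta> (G x) * dderiv \<psi> x j\<bar>
      \<le> c * (K * (norm2 (leb U) f + norm2 (leb U) u + norm2 (leb U) G)) * norm2 (leb U) \<psi>)"

text \<open>Multiplied by a cutoff that equals one in the ball of radius \<open>3 r\<close> and vanishes outside that of
  radius \<open>4 r\<close>, a solution in the domain becomes a local solution in the chart with the same
  gradient near the test functions; the lower order norm of \<open>u\<close> is due to the cutoff.\<close>
lemma derivative_bound_local:
  fixes U :: "'a::euclidean_space set"
  assumes U: "bounded_C11_domain U" and x0: "x0 \<in> closure U"
    and a: "\<And>p q. norm (a p - a q) \<le> \<Lambda> * norm (p - q)" "a 0 = 0"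
      "\<And>p q. a0 * (norm (p - q))\<^sup>2 \<le> (a p - a q) \<bullet> (p - q)" and a0: "0 < a0" and \<Lambda>: "0 \<le> \<Lambda>"
  obtains r K where "0 < r" "0 \<le> K" "derivative_bound a U (test_functions (U \<inter> ball x0 r)) K"
proof -
  have Uo: "open U" using U by (simp add: bounded_C11_domain_def)
  then have UL: "U \<in> sets lebesgue" by auto
  obtain r e \<gamma> E where r: "0 < r" and sl: "sliding e \<gamma> E" and eq5: "U \<inter> ball x0 (5 * r) = E \<inter> ball x0 (5 * r)"
    using boundary_chart_exists[OF U x0] by metis
  interpret sliding e \<gamma> E by (rule sl)
  obtain K where K: "0 \<le> K" and est: "\<And>v G f \<Theta> \<kappa> \<psi> j. local_solution a x0 r v G f \<Longrightarrow>
      (\<And>p q. \<bar>\<Theta> p - \<Theta> q\<bar> \<le> \<kappa> * norm (p - q)) \<Longrightarrow> \<Theta> 0 = 0 \<Longrightarrow> 0 \<le> \<kappa> \<Longrightarrow>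
      \<psi> \<in> test_functions (E \<inter> ball x0 r) \<Longrightarrow> j \<in> Basis \<Longrightarrow>
      \<bar>LINT x|leb E. \<Theta> (G x) * dderiv \<psi> x j\<bar>
        \<le> \<kappa> * (K * (norm2 (leb E) f + norm2 (leb E) G)) * norm2 (leb E) \<psi>"
    by (rule local_estimate[OF r a a0 \<Lambda>, of x0]) blast
  have sub: "cball x0 (3 * r) \<subseteq> ball x0 (4 * r)" using r by auto
  obtain \<zeta> W where \<zeta>: "\<zeta> \<in> test_functions (ball x0 (4 * r))" "\<And>x. 0 \<le> \<zeta> x" "\<And>x. \<zeta> x \<le> 1"
      and W: "open W" "cball x0 (3 * r) \<subseteq> W" "\<And>x. x \<in> W \<Longrightarrow> \<zeta> x = 1"
    using smooth_Urysohn[OF compact_cball open_ball sub] by metis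
  have sm\<zeta>: "smooth \<zeta>" by (rule test_functions_smooth[OF \<zeta>(1)])
  have \<zeta>1: "\<zeta> x = 1" "gradient \<zeta> x = 0" if "x \<in> cball x0 (3 * r)" for x
  proof -
    have x: "x \<in> W" using W(2) that by blast
    show "\<zeta> x = 1" "gradient \<zeta> x = 0"
      using W(3)[OF x] gradient_zero_if_locally_constant[OF W(1) x W(3) sm\<zeta>] by auto
  qed
  have \<zeta>0: "\<zeta> x = 0" "gradient \<zeta> x = 0" if "x \<notin> cball x0 (4 * r)" for x
  proof -
    have "x \<notin> ball x0 (4 * r)" using that by auto
    then show "\<zeta> x = 0" "gradient \<zeta> x = 0" using test_function_gradient_zero[OF \<zeta>(1)] by blast+
  qed
  obtain B where B: "0 < B" "\<And>x. norm (gradient \<zeta> x) \<le> B"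
    using continuous_compact_support_bounded[OF continuous_on_gradient_smooth[OF sm\<zeta>] compact_cball[of x0 "4 * r"] \<zeta>0(2)] by metis
  have in45: "x \<in> U \<longleftrightarrow> x \<in> E" if "x \<in> cball x0 (4 * r)" for x
  proof -
    have "x \<in> ball x0 (5 * r)" using that r by auto
    then show ?thesis using eq5 by blast
  qed
  have OO: "U \<inter> ball x0 r = E \<inter> ball x0 r"
  proof -
    have "ball x0 r \<subseteq> cball x0 (4 * r)" using r by auto
    then show ?thesis using in45 by blast
  qed
  have bound: "derivative_bound a U (test_functions (U \<inter> ball x0 r)) (K * (1 + B))"
    unfolding derivative_bound_def
  proof (intro allI ballI impI)
    fix u G f \<kappa> \<psi> and \<Theta> :: "'a \<Rightarrow> real" and j :: 'a
    assume \<psi>: "\<psi> \<in> test_functions (U \<inter> ball x0 r)" and j: "j \<in> Basis" and sol: "neumann_solution a U u G f"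
      and \<Theta>: "\<forall>p q. \<bar>\<Theta> p - \<Theta> q\<bar> \<le> \<kappa> * norm (p - q)" "\<Theta> 0 = 0" "0 \<le> \<kappa>"
    have u: "L2_weak_gradient U u G" and f: "L2_fun (leb U) f"
      and eqn: "\<And>\<eta> H. L2_weak_gradient U \<eta> H \<Longrightarrow>
        (LINT x|leb U. a (G x) \<bullet> H x) = (LINT x|leb U. f x * \<eta> x)"
      using sol by (auto simp: neumann_solution_def)
    have usq: "L2_fun (leb U) u" "L2_fun (leb U) G"
      using u by (auto simp: L2_weak_gradient_def)
    define v where "v x = \<zeta> x * u x" for x
    define Gv where "Gv x = \<zeta> x *\<^sub>R G x + u x *\<^sub>R gradient \<zeta> x" for x
    define f' where "f' x = indicator (cball x0 (4 * r)) x *\<^sub>R f x" for x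
    have vU: "L2_weak_gradient U v Gv" unfolding v_def Gv_def
    proof (rule L2_weak_gradient_mult_smooth[OF Uo u sm\<zeta> _ continuous_on_gradient_smooth[OF sm\<zeta>]])
      show "dderiv \<zeta> x d = gradient \<zeta> x \<bullet> d" for x d
        by (rule dderiv_eq_gradient[OF smooth_differentiable[OF sm\<zeta>]])
      show "\<bar>\<zeta> x\<bar> \<le> 1 + B" for x using \<zeta>(2,3)[of x] B(1) by simp
      show "norm (gradient \<zeta> x) \<le> 1 + B" for x using B(2)[of x] by simp
    qed
    have v0: "v x = 0" "Gv x = 0" if "x \<notin> cball x0 (4 * r)" for x
      using \<zeta>0[OF that] by (simp_all add: v_def Gv_def)
    have vE: "L2_weak_gradient E v Gv"
      by (rule L2_weak_gradient_transfer[OF Uo open_E vU _ _ eq5 v0]) (use r in auto)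
    have f'sq: "L2_fun (leb U) f'" "norm2 (leb U) f' \<le> 1 * norm2 (leb U) f"
    proof -
      have m: "(indicator (cball x0 (4 * r)) :: 'a \<Rightarrow> real) \<in> borel_measurable (leb U)"
        by (rule measurable_restrict_space1[OF borel_measurable_indicator]) simp
      show "L2_fun (leb U) f'" "norm2 (leb U) f' \<le> 1 * norm2 (leb U) f"
        unfolding f'_def
        by (rule L2_fun_bounded_mult[OF f m]; auto simp: indicator_def)+
    qed
    have f'0: "f' x = 0" if "x \<notin> cball x0 (4 * r)" for x using that by (simp add: f'_def)
    have f'E: "L2_fun (leb E) f'" "norm2 (leb E) f' = norm2 (leb U) f'"
    proof -
      have *: "f' x = 0" if "x \<in> U \<and> x \<notin> E \<or> x \<in> E \<and> x \<notin> U" for x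
        by (rule f'0) (use in45[of x] that in blast)
      show "L2_fun (leb E) f'"
        by (subst L2_fun_extension_by_zero(1)[OF EL UL, of _ f']) (use * f'sq(1) in simp_all)
      show "norm2 (leb E) f' = norm2 (leb U) f'"
        by (rule L2_fun_extension_by_zero(2)[OF EL UL]) (use * in simp_all)
    qed
    have sol': "local_solution a x0 r v Gv f'"
      unfolding local_solution_def
    proof (intro conjI allI impI vE f'E(1))
      show "Gv x = 0" if "x \<notin> cball x0 (4 * r)" for x by (rule v0(2)[OF that])
      fix \<eta> H assume \<eta>: "L2_weak_gradient E \<eta> H" and z: "\<forall>x. x \<notin> cball x0 (3 * r) \<longrightarrow> \<eta> x = 0 \<and> H x = 0"
      have zE: "\<eta> x = 0 \<and> H x = 0" if "x \<in> U \<and> x \<notin> E \<or> x \<in> E \<and> x \<notin> U" for x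
      proof -
        have "x \<notin> cball x0 (4 * r)" using in45[of x] that by blast
        then have "x \<notin> cball x0 (3 * r)" using r by auto
        then show ?thesis using z by blast
      qed
      have "L2_weak_gradient U \<eta> H"
        by (rule L2_weak_gradient_transfer[OF open_E Uo \<eta> _ _ eq5[symmetric], of "3 * r"]) (use r z in auto)
      then have "(LINT x|leb U. a (G x) \<bullet> H x) = (LINT x|leb U. f x * \<eta> x)" by (rule eqn)
      moreover have c34: "x \<in> cball x0 (4 * r)" if "x \<in> cball x0 (3 * r)" for x using that r by auto
      have "(LINT x|leb U. a (G x) \<bullet> H x) = (LINT x|leb E. a (Gv x) \<bullet> H x)"
      proof (rule lebesgue_on_extension_by_zero(3)[OF UL EL])
        show "a (G x) \<bullet> H x = a (Gv x) \<bullet> H x" for x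
          using \<zeta>1[of x] z by (cases "x \<in> cball x0 (3 * r)") (simp_all add: Gv_def)
      qed (use zE in simp_all)
      moreover have "(LINT x|leb U. f x * \<eta> x) = (LINT x|leb E. f' x * \<eta> x)"
      proof (rule lebesgue_on_extension_by_zero(3)[OF UL EL])
        show "f x * \<eta> x = f' x * \<eta> x" for x
          using c34[of x] z by (cases "x \<in> cball x0 (3 * r)") (simp_all add: f'_def)
      qed (use zE in simp_all)
      ultimately show "(LINT x|leb E. a (Gv x) \<bullet> H x) = (LINT x|leb E. f' x * \<eta> x)" by simp
    qed
    have \<psi>E: "\<psi> \<in> test_functions (E \<inter> ball x0 r)" using \<psi> by (simp add: OO)
    have \<psi>0: "dderiv \<psi> x j = 0" if "x \<notin> U \<inter> ball x0 r" for x
    proof -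
      obtain K where "K \<subseteq> U \<inter> ball x0 r" "\<And>x d. x \<notin> K \<Longrightarrow> dderiv \<psi> x d = 0"
        using test_functions_support[OF \<psi>] by metis
      then show ?thesis using that by blast
    qed
    have r3: "x \<in> cball x0 (3 * r)" if "x \<in> ball x0 r" for x using that r by auto
    have "(LINT x|leb U. \<Theta> (G x) * dderiv \<psi> x j) = (LINT x|leb E. \<Theta> (Gv x) * dderiv \<psi> x j)"
    proof (rule lebesgue_on_extension_by_zero(3)[OF UL EL])
      show "\<Theta> (G x) * dderiv \<psi> x j = \<Theta> (Gv x) * dderiv \<psi> x j" for x
        using \<zeta>1[OF r3, of x] \<psi>0[of x] by (cases "x \<in> U \<inter> ball x0 r") (simp_all add: Gv_def)
      show "\<Theta> (G x) * dderiv \<psi> x j = 0" if "x \<in> U" "x \<notin> E" for x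
        using \<psi>0[of x] OO that by auto
      show "\<Theta> (Gv x) * dderiv \<psi> x j = 0" if "x \<in> E" "x \<notin> U" for x
        using \<psi>0[of x] that by auto
    qed
    also have "\<bar>\<dots>\<bar> \<le> \<kappa> * (K * (norm2 (leb E) f' + norm2 (leb E) Gv)) * norm2 (leb E) \<psi>"
      by (rule est[of v Gv f' \<Theta>, OF sol' \<Theta>(1)[rule_format] \<Theta>(2,3) \<psi>E j])
    also have "norm2 (leb E) \<psi> = norm2 (leb U) \<psi>"
    proof (rule L2_fun_extension_by_zero(2)[OF EL UL])
      have "x \<in> E \<inter> ball x0 r" "x \<in> U \<inter> ball x0 r" if "\<psi> x \<noteq> 0" for x
        using test_function_gradient_zero(1)[OF \<psi>E] test_function_gradient_zero(1)[OF \<psi>] that by blast+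
      then show "\<psi> x = 0" if "x \<in> E" "x \<notin> U" for x using that by blast
      have "x \<in> E \<inter> ball x0 r" if "\<psi> x \<noteq> 0" for x
        using test_function_gradient_zero(1)[OF \<psi>E] that by blast
      then show "\<psi> x = 0" if "x \<in> U" "x \<notin> E" for x using that by blast
    qed simp
    also have "\<kappa> * (K * (norm2 (leb E) f' + norm2 (leb E) Gv)) * norm2 (leb U) \<psi>
      \<le> \<kappa> * (K * (1 + B) * (norm2 (leb U) f + norm2 (leb U) u + norm2 (leb U) G)) * norm2 (leb U) \<psi>"
    proof -
      have "norm2 (leb E) Gv = norm2 (leb U) Gv"
      proof (rule L2_fun_extension_by_zero(2)[OF EL UL])
        show "Gv x = 0" if "x \<in> E" "x \<notin> U" for x by (rule v0(2)) (use in45[of x] that in blast)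
        show "Gv x = 0" if "x \<in> U" "x \<notin> E" for x by (rule v0(2)) (use in45[of x] that in blast)
      qed simp
      also have "\<dots> \<le> norm2 (leb U) G + B * norm2 (leb U) u"
      proof -
        have gm: "gradient \<zeta> \<in> borel_measurable (leb U)" "\<zeta> \<in> borel_measurable (leb U)"
          by (auto intro!: continuous_borel_measurable_leb continuous_on_gradient_smooth smooth_continuous sm\<zeta>)
        have 1: "L2_fun (leb U) (\<lambda>x. \<zeta> x *\<^sub>R G x)" "norm2 (leb U) (\<lambda>x. \<zeta> x *\<^sub>R G x) \<le> 1 * norm2 (leb U) G"
        proof -
          have *: "\<bar>\<zeta> x\<bar> \<le> 1" for x using \<zeta>(2,3)[of x] by simp
          show "L2_fun (leb U) (\<lambda>x. \<zeta> x *\<^sub>R G x)" "norm2 (leb U) (\<lambda>x. \<zeta> x *\<^sub>R G x) \<le> 1 * norm2 (leb U) G"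
            using L2_fun_bounded_mult[OF usq(2) gm(2) *] by simp_all
        qed
        have m2: "(\<lambda>x. u x *\<^sub>R gradient \<zeta> x) \<in> borel_measurable (leb U)"
          using L2_fun_measurable[OF usq(1)] gm by measurable
        have le: "AE x in leb U. norm (u x *\<^sub>R gradient \<zeta> x) \<le> B * norm (u x)"
          using mult_right_mono[OF B(2) abs_ge_zero] by (intro AE_I2) (simp add: mult.commute)
        have 2: "L2_fun (leb U) (\<lambda>x. u x *\<^sub>R gradient \<zeta> x)"
            "norm2 (leb U) (\<lambda>x. u x *\<^sub>R gradient \<zeta> x) \<le> B * norm2 (leb U) u"
          using B(1) L2_fun_mono[OF usq(1) m2 le] norm2_mono[OF usq(1) m2 le] by auto
        show ?thesis unfolding Gv_def using norm2_triangle[OF 1(1) 2(1)] 1(2) 2(2) by linarith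
      qed
      finally have "norm2 (leb E) f' + norm2 (leb E) Gv
          \<le> norm2 (leb U) f + (norm2 (leb U) G + B * norm2 (leb U) u)"
        using f'E(2) f'sq(2) by linarith
      also have "\<dots> \<le> (1 + B) * (norm2 (leb U) f + norm2 (leb U) u + norm2 (leb U) G)"
        using B(1) by (simp add: algebra_simps)
      finally have "K * (norm2 (leb E) f' + norm2 (leb E) Gv)
          \<le> K * ((1 + B) * (norm2 (leb U) f + norm2 (leb U) u + norm2 (leb U) G))"
        using K by (intro mult_left_mono)
      then show ?thesis using \<Theta>(3) by (intro mult_right_mono mult_left_mono) (auto simp: mult.assoc)
    qed
    finally show "\<bar>LINT x|leb U. \<Theta> (G x) * dderiv \<psi> x j\<bar>
      \<le> \<kappa> * (K * (1 + B) * (norm2 (leb U) f + norm2 (leb U) u + norm2 (leb U) G)) * norm2 (leb U) \<psi>" .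
  qed
  show thesis by (rule that[OF r _ bound]) (use K B in auto)
qed

text \<open>Local bounds are put together one ball at a time: a test function is split into its product
  with a cutoff and the remainder, which vanishes in the corresponding smaller ball. The \<open>L\<^sup>2\<close> norm of
  both parts is bounded by that of the whole, so that the derivatives of the cutoff do not enter.\<close>
lemma derivative_bound_cover:
  fixes E :: "'a::euclidean_space set"
  assumes E: "open E" and fin: "finite C"
    and loc: "\<And>c. c \<in> C \<Longrightarrow> 0 < r c \<and> 0 \<le> K c \<and> derivative_bound a E (test_functions (E \<inter> ball c (r c))) (K c)"
  shows "derivative_bound a E {\<psi> \<in> test_functions E. \<forall>x. \<psi> x \<noteq> 0 \<longrightarrow> x \<in> (\<Union>c\<in>C. cball c (r c / 2))} (\<Sum>c\<in>C. K c)"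
  using fin loc
proof (induction C rule: finite_induct)
  case empty
  show ?case unfolding derivative_bound_def
  proof (intro allI ballI impI)
    fix u G f \<kappa> \<psi> and \<Theta> :: "'a \<Rightarrow> real" and j :: 'a
    assume "\<psi> \<in> {\<psi> \<in> test_functions E. \<forall>x. \<psi> x \<noteq> 0 \<longrightarrow> x \<in> (\<Union>c\<in>{}. cball c (r c / 2))}"
    then have "\<psi> = (\<lambda>x. 0)" by auto
    then show "\<bar>LINT x|leb E. \<Theta> (G x) * dderiv \<psi> x j\<bar>
      \<le> \<kappa> * ((\<Sum>c\<in>{}. K c) * (norm2 (leb E) f + norm2 (leb E) u + norm2 (leb E) G)) * norm2 (leb E) \<psi>"
      by (simp add: frechet_derivative_const)
  qed
next
  case (insert c C)
  have EL: "E \<in> sets lebesgue" using E by auto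
  have rc: "0 < r c" and Kc: "0 \<le> K c" and bc: "derivative_bound a E (test_functions (E \<inter> ball c (r c))) (K c)"
    using insert.prems by auto
  have bC: "derivative_bound a E {\<psi> \<in> test_functions E. \<forall>x. \<psi> x \<noteq> 0 \<longrightarrow> x \<in> (\<Union>c\<in>C. cball c (r c / 2))} (\<Sum>c\<in>C. K c)"
    using insert by blast
  have sub: "cball c (r c / 2) \<subseteq> ball c (r c)" using rc by auto
  obtain \<zeta> W where \<zeta>: "\<zeta> \<in> test_functions (ball c (r c))" "\<And>x. 0 \<le> \<zeta> x" "\<And>x. \<zeta> x \<le> 1"
      and W: "cball c (r c / 2) \<subseteq> W" "\<And>x. x \<in> W \<Longrightarrow> \<zeta> x = 1"
    using smooth_Urysohn[OF compact_cball open_ball sub] by metis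
  have sm\<zeta>: "smooth \<zeta>" by (rule test_functions_smooth[OF \<zeta>(1)])
  show ?case unfolding derivative_bound_def
  proof (intro allI ballI impI)
    fix u G f \<kappa> \<psi> and \<Theta> :: "'a \<Rightarrow> real" and j :: 'a
    assume \<psi>': "\<psi> \<in> {\<psi> \<in> test_functions E. \<forall>x. \<psi> x \<noteq> 0 \<longrightarrow> x \<in> (\<Union>c\<in>insert c C. cball c (r c / 2))}"
      and j: "j \<in> Basis" and sol: "neumann_solution a E u G f"
      and \<Theta>: "\<forall>p q. \<bar>\<Theta> p - \<Theta> q\<bar> \<le> \<kappa> * norm (p - q)" "\<Theta> 0 = 0" "0 \<le> \<kappa>"
    let ?N = "norm2 (leb E) f + norm2 (leb E) u + norm2 (leb E) G"
    have \<psi>: "\<psi> \<in> test_functions E" using \<psi>' by simp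
    have sm: "smooth \<psi>" by (rule test_functions_smooth[OF \<psi>])
    define \<psi>1 where "\<psi>1 x = \<zeta> x * \<psi> x" for x
    define \<psi>2 where "\<psi>2 x = \<psi> x + (-1) * \<psi>1 x" for x
    have 1: "\<psi>1 \<in> test_functions (E \<inter> ball c (r c))"
    proof -
      obtain K1 where K1: "compact K1" "K1 \<subseteq> ball c (r c)" "\<And>x. x \<notin> K1 \<Longrightarrow> \<zeta> x = 0" using test_functions_support[OF \<zeta>(1)] by metis
      obtain K2 where K2: "compact K2" "K2 \<subseteq> E" "\<And>x. x \<notin> K2 \<Longrightarrow> \<psi> x = 0" using test_functions_support[OF \<psi>] by metis
      have "smooth \<psi>1" unfolding \<psi>1_def using sm sm\<zeta> by (auto intro: Ck_mult)
      then show ?thesis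
        by (rule test_functionsI[of _ "K1 \<inter> K2"]) (use K1 K2 in \<open>auto simp: \<psi>1_def\<close>)
    qed
    then have \<psi>1: "\<psi>1 \<in> test_functions E" using test_functions_mono[of "E \<inter> ball c (r c)" E] by auto
    have 2: "\<psi>2 \<in> {\<psi> \<in> test_functions E. \<forall>x. \<psi> x \<noteq> 0 \<longrightarrow> x \<in> (\<Union>c\<in>C. cball c (r c / 2))}"
    proof (intro CollectI conjI allI impI)
      show "\<psi>2 \<in> test_functions E" unfolding \<psi>2_def by (rule test_functions_add_scale[OF \<psi> \<psi>1])
      fix x assume x: "\<psi>2 x \<noteq> 0"
      then have "\<zeta> x \<noteq> 1" "\<psi> x \<noteq> 0" by (auto simp: \<psi>2_def \<psi>1_def)
      then have "x \<notin> cball c (r c / 2)" using W by blast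
      then show "x \<in> (\<Union>c\<in>C. cball c (r c / 2))" using \<psi>' \<open>\<psi> x \<noteq> 0\<close> by blast
    qed
    have \<psi>sq: "L2_fun (leb E) \<psi>" by (rule L2_fun_test_function[OF \<psi> EL])
    have n1: "norm2 (leb E) \<psi>1 \<le> 1 * norm2 (leb E) \<psi>"
    proof (rule norm2_mono[OF \<psi>sq])
      show "\<psi>1 \<in> borel_measurable (leb E)"
        by (rule L2_fun_measurable[OF L2_fun_test_function[OF 1 EL]])
      show "AE x in leb E. norm (\<psi>1 x) \<le> 1 * norm (\<psi> x)"
        using \<zeta>(2,3) by (intro AE_I2) (simp add: \<psi>1_def abs_mult mult_left_le_one_le)
    qed simp
    have n2: "norm2 (leb E) \<psi>2 \<le> 1 * norm2 (leb E) \<psi>"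
    proof (rule norm2_mono[OF \<psi>sq])
      show "\<psi>2 \<in> borel_measurable (leb E)"
        using 2 by (intro L2_fun_measurable[OF L2_fun_test_function[OF _ EL]]) auto
      have "norm (\<psi>2 x) \<le> 1 * norm (\<psi> x)" for x
      proof -
        have "\<psi>2 x = (1 - \<zeta> x) * \<psi> x" by (simp add: \<psi>2_def \<psi>1_def algebra_simps)
        then show ?thesis using \<zeta>(2,3)[of x] by (simp add: abs_mult mult_left_le_one_le)
      qed
      then show "AE x in leb E. norm (\<psi>2 x) \<le> 1 * norm (\<psi> x)" by simp
    qed simp
    have fd: "dderiv \<psi> x j = dderiv \<psi>1 x j + dderiv \<psi>2 x j" for x
      unfolding \<psi>2_def by (subst dderiv_linear_comb[OF sm test_functions_smooth[OF 1]]) simp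
    have \<Theta>G: "L2_fun (leb E) (\<lambda>x. \<Theta> (G x))"
    proof -
      have G: "L2_fun (leb E) G" using sol by (simp add: neumann_solution_def L2_weak_gradient_def)
      have "\<kappa>-lipschitz_on UNIV \<Theta>" using \<Theta> by (auto simp: lipschitz_on_def dist_norm)
      then have [measurable]: "\<Theta> \<in> borel_measurable borel"
        by (intro borel_measurable_continuous_onI lipschitz_on_continuous_on)
      have "norm (\<Theta> (G x)) \<le> \<kappa> * norm (G x)" for x using \<Theta>(1)[rule_format, of "G x" 0] \<Theta>(2) by simp
      moreover have "(\<lambda>x. \<Theta> (G x)) \<in> borel_measurable (leb E)"
        using L2_fun_measurable[OF G] by measurable
      ultimately show ?thesis by (intro L2_fun_mono[OF G]) auto
    qed
    have "(LINT x|leb E. \<Theta> (G x) * dderiv \<psi> x j)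
      = (LINT x|leb E. \<Theta> (G x) * dderiv \<psi>1 x j) + (LINT x|leb E. \<Theta> (G x) * dderiv \<psi>2 x j)"
      unfolding fd distrib_left
      using 1 2 by (intro Bochner_Integration.integral_add integrable_mult_L2_fun[OF \<Theta>G]
        L2_fun_dderiv_test_function[OF _ EL]) auto
    moreover have "\<bar>LINT x|leb E. \<Theta> (G x) * dderiv \<psi>1 x j\<bar> \<le> \<kappa> * (K c * ?N) * norm2 (leb E) \<psi>1"
      using bc 1 j sol \<Theta> unfolding derivative_bound_def by blast
    moreover have "\<kappa> * (K c * ?N) * norm2 (leb E) \<psi>1 \<le> \<kappa> * (K c * ?N) * norm2 (leb E) \<psi>"
      using n1 \<Theta>(3) Kc by (intro mult_left_mono) auto
    moreover have "\<bar>LINT x|leb E. \<Theta> (G x) * dderiv \<psi>2 x j\<bar> \<le> \<kappa> * ((\<Sum>c\<in>C. K c) * ?N) * norm2 (leb E) \<psi>2"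
      using bC 2 j sol \<Theta> unfolding derivative_bound_def by blast
    moreover have "\<kappa> * ((\<Sum>c\<in>C. K c) * ?N) * norm2 (leb E) \<psi>2 \<le> \<kappa> * ((\<Sum>c\<in>C. K c) * ?N) * norm2 (leb E) \<psi>"
    proof -
      have "0 \<le> (\<Sum>c\<in>C. K c)" using insert.prems by (intro sum_nonneg) auto
      then show ?thesis using n2 \<Theta>(3) by (intro mult_left_mono) auto
    qed
    ultimately have "\<bar>LINT x|leb E. \<Theta> (G x) * dderiv \<psi> x j\<bar>
      \<le> \<kappa> * (K c * ?N) * norm2 (leb E) \<psi> + \<kappa> * ((\<Sum>c\<in>C. K c) * ?N) * norm2 (leb E) \<psi>" by linarith
    also have "\<dots> = \<kappa> * ((\<Sum>c\<in>insert c C. K c) * ?N) * norm2 (leb E) \<psi>"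
      using insert.hyps by (simp add: algebra_simps)
    finally show "\<bar>LINT x|leb E. \<Theta> (G x) * dderiv \<psi> x j\<bar>
      \<le> \<kappa> * ((\<Sum>c\<in>insert c C. K c) * ?N) * norm2 (leb E) \<psi>" .
  qed
qed

text \<open>Finitely many balls with local bounds cover the closure of the domain, and a functional that is
  bounded in the \<open>L\<^sup>2\<close> norm of the test function is represented by a weak derivative. Admitting all
  Lipschitz functions \<open>\<Theta>\<close> makes a chain rule for weakly differentiable functions superfluous.\<close>
proposition lipschitz_of_gradient_regularity:
  fixes E :: "'a::euclidean_space set"
  assumes E: "bounded_C11_domain E"
    and a: "\<And>p q. norm (a p - a q) \<le> \<Lambda> * norm (p - q)" "a 0 = 0"
      "\<And>p q. a0 * (norm (p - q))\<^sup>2 \<le> (a p - a q) \<bullet> (p - q)" and a0: "0 < a0" and \<Lambda>: "0 \<le> \<Lambda>"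
  obtains K where "0 \<le> K" "\<And>u G f \<Theta> \<kappa>. neumann_solution a E u G f \<Longrightarrow>
    (\<And>p q. \<bar>\<Theta> p - \<Theta> q\<bar> \<le> \<kappa> * norm (p - q)) \<Longrightarrow> \<Theta> 0 = 0 \<Longrightarrow> 0 \<le> \<kappa> \<Longrightarrow>
    \<exists>D. L2_weak_gradient E (\<lambda>x. \<Theta> (G x)) D \<and> norm2 (leb E) D
      \<le> \<kappa> * (K * (norm2 (leb E) f + norm2 (leb E) u + norm2 (leb E) G))"
proof -
  have Eo: "open E" and "bounded E" using E by (auto simp: bounded_C11_domain_def)
  then have cpt: "compact (closure E)" and EL: "E \<in> sets lebesgue" by auto
  have "\<exists>r K. 0 < r \<and> 0 \<le> K \<and> derivative_bound a E (test_functions (E \<inter> ball c r)) K" if "c \<in> closure E" for c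
    by (rule derivative_bound_local[OF E that a a0 \<Lambda>]) blast
  then obtain r K where rK: "\<And>c. c \<in> closure E \<Longrightarrow> 0 < r c \<and> 0 \<le> K c \<and> derivative_bound a E (test_functions (E \<inter> ball c (r c))) (K c)"
    by metis
  have "\<forall>c\<in>closure E. open (ball c (r c / 2))" by simp
  moreover have "closure E \<subseteq> (\<Union>c\<in>closure E. ball c (r c / 2))" using rK by force
  ultimately obtain C where C: "C \<subseteq> closure E" "finite C" "closure E \<subseteq> (\<Union>c\<in>C. ball c (r c / 2))"
    using compactE_image[OF cpt, of "closure E" "\<lambda>c. ball c (r c / 2)"] by metis
  define K1 where "K1 = (\<Sum>c\<in>C. K c)"
  have K1: "0 \<le> K1" unfolding K1_def using rK C by (intro sum_nonneg) auto
  have bnd: "derivative_bound a E {\<psi> \<in> test_functions E. \<forall>x. \<psi> x \<noteq> 0 \<longrightarrow> x \<in> (\<Union>c\<in>C. cball c (r c / 2))} K1"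
    unfolding K1_def using rK C by (intro derivative_bound_cover[OF Eo C(2)]) auto
  have all: "{\<psi> \<in> test_functions E. \<forall>x. \<psi> x \<noteq> 0 \<longrightarrow> x \<in> (\<Union>c\<in>C. cball c (r c / 2))} = test_functions E"
  proof -
    have "x \<in> (\<Union>c\<in>C. cball c (r c / 2))" if "\<psi> \<in> test_functions E" "\<psi> x \<noteq> 0" for \<psi> x
    proof -
      have "x \<in> E" using test_function_gradient_zero(1)[OF that(1)] that(2) by blast
      then have "x \<in> (\<Union>c\<in>C. ball c (r c / 2))" using C(3) closure_subset by blast
      then show ?thesis using ball_subset_cball by blast
    qed
    then show ?thesis by blast
  qed
  define n where "n = real (card (Basis :: 'a set))"
  show thesis
  proof (rule that[of "n * K1"])
    show "0 \<le> n * K1" using K1 by (simp add: n_def)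
    fix u G f \<kappa> and \<Theta> :: "'a \<Rightarrow> real"
    assume sol: "neumann_solution a E u G f" and \<Theta>: "\<And>p q. \<bar>\<Theta> p - \<Theta> q\<bar> \<le> \<kappa> * norm (p - q)" "\<Theta> 0 = 0" "0 \<le> \<kappa>"
    let ?N = "norm2 (leb E) f + norm2 (leb E) u + norm2 (leb E) G"
    have G: "L2_fun (leb E) G" using sol by (simp add: neumann_solution_def L2_weak_gradient_def)
    have "\<kappa>-lipschitz_on UNIV \<Theta>" using \<Theta> by (auto simp: lipschitz_on_def dist_norm)
    then have [measurable]: "\<Theta> \<in> borel_measurable borel"
      by (intro borel_measurable_continuous_onI lipschitz_on_continuous_on)
    have m: "(\<lambda>x. \<Theta> (G x)) \<in> borel_measurable (leb E)"
      using L2_fun_measurable[OF G] by measurable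
    have "norm (\<Theta> (G x)) \<le> \<kappa> * norm (G x)" for x using \<Theta>(1)[of "G x" 0] \<Theta>(2) by simp
    then have \<Theta>G: "L2_fun (leb E) (\<lambda>x. \<Theta> (G x))" by (intro L2_fun_mono[OF G m]) auto
    have "\<forall>j\<in>Basis. \<exists>v. L2_fun (leb E) v \<and> norm2 (leb E) v \<le> \<kappa> * (K1 * ?N) \<and>
        (\<forall>\<psi>\<in>test_functions E. (LINT x|leb E. \<Theta> (G x) * dderiv \<psi> x j) = - (LINT x|leb E. v x * \<psi> x))"
    proof
      fix j :: 'a assume j: "j \<in> Basis"
      show "\<exists>v. L2_fun (leb E) v \<and> norm2 (leb E) v \<le> \<kappa> * (K1 * ?N) \<and>
        (\<forall>\<psi>\<in>test_functions E. (LINT x|leb E. \<Theta> (G x) * dderiv \<psi> x j) = - (LINT x|leb E. v x * \<psi> x))"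
    proof (rule test_functional_representation[OF Eo \<Theta>G])
      show "\<bar>LINT x|leb E. \<Theta> (G x) * dderiv \<psi> x j\<bar> \<le> \<kappa> * (K1 * ?N) * norm2 (leb E) \<psi>"
        if "\<psi> \<in> test_functions E" for \<psi>
        using bnd j sol \<Theta> that unfolding all derivative_bound_def by blast
      show "0 \<le> \<kappa> * (K1 * ?N)" using \<Theta>(3) K1 by simp
    qed blast
    qed
    from bchoice[OF this] obtain V where V: "\<forall>j\<in>Basis. L2_fun (leb E) (V j) \<and> norm2 (leb E) (V j) \<le> \<kappa> * (K1 * ?N) \<and>
        (\<forall>\<psi>\<in>test_functions E. (LINT x|leb E. \<Theta> (G x) * dderiv \<psi> x j) = - (LINT x|leb E. V j x * \<psi> x))" by blast
    define D where "D x = (\<Sum>j\<in>Basis. V j x *\<^sub>R j)" for x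
    have Dj: "D x \<bullet> j = V j x" if "j \<in> Basis" for x j unfolding D_def using that by simp
    have Dsq: "L2_fun (leb E) D"
      by (subst L2_fun_componentwise) (use V in \<open>simp add: Dj\<close>)
    have "L2_weak_gradient E (\<lambda>x. \<Theta> (G x)) D"
      by (rule L2_weak_gradientI_Basis[OF Eo \<Theta>G Dsq]) (use V in \<open>simp add: Dj\<close>)
    moreover have "norm2 (leb E) D \<le> \<kappa> * (n * K1 * ?N)"
    proof -
      have Vj: "L2_fun (leb E) (\<lambda>x. V j x *\<^sub>R j)" "norm2 (leb E) (\<lambda>x. V j x *\<^sub>R j) = norm2 (leb E) (V j)"
        if "j \<in> Basis" for j
      proof -
        have "L2_fun (leb E) (V j)" using V that by blast
        then show "L2_fun (leb E) (\<lambda>x. V j x *\<^sub>R j)" "norm2 (leb E) (\<lambda>x. V j x *\<^sub>R j) = norm2 (leb E) (V j)"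
          using that by (auto simp: L2_fun_def norm2_def)
      qed
      have "norm2 (leb E) D \<le> (\<Sum>j\<in>Basis. norm2 (leb E) (\<lambda>x. V j x *\<^sub>R j))"
        unfolding D_def by (intro norm2_sum Vj) auto
      also have "\<dots> \<le> (\<Sum>j\<in>(Basis :: 'a set). \<kappa> * (K1 * ?N))" using V by (intro sum_mono) (simp add: Vj)
      also have "\<dots> = \<kappa> * (n * K1 * ?N)" by (simp add: n_def mult_ac)
      finally show ?thesis .
    qed
    ultimately show "\<exists>D. L2_weak_gradient E (\<lambda>x. \<Theta> (G x)) D \<and> norm2 (leb E) D \<le> \<kappa> * (n * K1 * ?N)" by blast
  qed
qed

section \<open>Separability and measurable families\<close>

text \<open>The Riesz representative of the pairing with \<open>g\<close> lies in the closure of \<open>V\<close> and differs from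
  \<open>g\<close> by a vector that is orthogonal to \<open>V\<close>.\<close>
lemma dense_if_orthogonal_trivial:
  fixes g :: "'a \<Rightarrow> real"
  assumes V: "\<And>\<psi>. \<psi> \<in> V \<Longrightarrow> L2_fun M \<psi>" and zero: "(\<lambda>x. 0) \<in> V"
    and lin: "\<And>\<psi> \<xi> t. \<psi> \<in> V \<Longrightarrow> \<xi> \<in> V \<Longrightarrow> (\<lambda>x. \<psi> x + t * \<xi> x) \<in> V"
    and orth: "\<And>h :: 'a \<Rightarrow> real. L2_fun M h \<Longrightarrow> (\<And>\<psi>. \<psi> \<in> V \<Longrightarrow> (LINT x|M. h x * \<psi> x) = 0) \<Longrightarrow> AE x in M. h x = 0"
    and g: "L2_fun M g" and e: "0 < e"
  shows "\<exists>\<psi>\<in>V. norm2 M (\<lambda>x. g x - \<psi> x) < e"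
proof -
  define l where "l \<psi> = (LINT x|M. g x * \<psi> x)" for \<psi>
  have int: "integrable M (\<lambda>x. g x * \<psi> x)" if "\<psi> \<in> V" for \<psi>
    by (rule integrable_mult_L2_fun[OF g V[OF that]])
  have ll: "l (\<lambda>x. \<psi> x + t * \<xi> x) = l \<psi> + t * l \<xi>" if "\<psi> \<in> V" "\<xi> \<in> V" for \<psi> \<xi> t
  proof -
    have "l (\<lambda>x. \<psi> x + t * \<xi> x) = (LINT x|M. g x * \<psi> x + t * (g x * \<xi> x))" by (simp add: l_def algebra_simps)
    then show ?thesis using int that by (simp add: l_def)
  qed
  obtain v where v: "L2_fun M v" "\<And>\<psi>. \<psi> \<in> V \<Longrightarrow> l \<psi> = (LINT x|M. v x * \<psi> x)"
      "\<And>e. e > 0 \<Longrightarrow> \<exists>\<psi>\<in>V. norm2 M (\<lambda>x. \<psi> x - v x) < e"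
  proof (rule Riesz_representation_on_subspace[of V M l "norm2 M g"])
    show "\<bar>l \<psi>\<bar> \<le> norm2 M g * norm2 M \<psi>" if "\<psi> \<in> V" for \<psi>
      unfolding l_def by (rule Cauchy_Schwarz_norm2_real[OF g V[OF that]])
  qed (use V zero lin ll in auto)
  have "AE x in M. g x - v x = 0"
  proof (rule orth[OF L2_fun_diff[OF g v(1)]])
    fix \<psi> assume \<psi>: "\<psi> \<in> V"
    have "(LINT x|M. (g x - v x) * \<psi> x) = l \<psi> - (LINT x|M. v x * \<psi> x)"
      unfolding l_def left_diff_distrib
      by (rule Bochner_Integration.integral_diff[OF int[OF \<psi>] integrable_mult_L2_fun[OF v(1) V[OF \<psi>]]])
    then show "(LINT x|M. (g x - v x) * \<psi> x) = 0" using v(2)[OF \<psi>] by simp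
  qed
  then have ae: "AE x in M. g x = v x" by eventually_elim simp
  obtain \<psi> where \<psi>: "\<psi> \<in> V" "norm2 M (\<lambda>x. \<psi> x - v x) < e" using v(3)[OF e] by blast
  have "norm2 M (\<lambda>x. \<psi> x - g x) = norm2 M (\<lambda>x. \<psi> x - v x)"
  proof (rule norm2_cong_AE)
    show "(\<lambda>x. \<psi> x - g x) \<in> borel_measurable M" "(\<lambda>x. \<psi> x - v x) \<in> borel_measurable M"
      using V[OF \<psi>(1)] g v(1) by (auto intro!: L2_fun_measurable L2_fun_diff)
    show "AE x in M. \<psi> x - g x = \<psi> x - v x" using ae by eventually_elim simp
  qed
  with \<psi> norm2_minus_commute[of M g \<psi>] show ?thesis by (intro bexI[of _ \<psi>]) simp_all
qed

lemma test_functions_dense: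
  fixes g :: "'a::euclidean_space \<Rightarrow> real"
  assumes E: "open E" and g: "L2_fun (leb E) g" and e: "0 < e"
  shows "\<exists>\<psi>\<in>test_functions E. norm2 (leb E) (\<lambda>x. g x - \<psi> x) < e"
proof (rule dense_if_orthogonal_trivial[OF _ zero_test_function test_functions_add_scale _ g e])
  have EL: "E \<in> sets lebesgue" using E by auto
  show "L2_fun (leb E) \<psi>" if "\<psi> \<in> test_functions E" for \<psi>
    using that EL by (rule L2_fun_test_function)
  show "AE x in leb E. h x = 0"
    if "L2_fun (leb E) h" "\<And>\<psi>. \<psi> \<in> test_functions E \<Longrightarrow> (LINT x|leb E. h x * \<psi> x) = 0"
    for h :: "'a \<Rightarrow> real"
    using zero_AE_if_test_integrals_vanish[OF E L2_fun_imp_locally_integrable[OF that(1) EL]] that(2) by blast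
qed

lemma sigma_finite_lebesgue: "sigma_finite_measure (lebesgue :: 'a::euclidean_space measure)"
proof
  obtain \<A> where \<A>: "countable \<A>" "\<A> \<subseteq> sets (lborel :: 'a measure)" "\<Union>\<A> = space (lborel :: 'a measure)"
      "\<forall>A\<in>\<A>. emeasure lborel A \<noteq> \<infinity>"
    using lborel.sigma_finite_countable by blast
  then show "\<exists>\<A>. countable \<A> \<and> \<A> \<subseteq> sets (lebesgue :: 'a measure) \<and> \<Union>\<A> = space (lebesgue :: 'a measure) \<and>
      (\<forall>A\<in>\<A>. emeasure lebesgue A \<noteq> \<infinity>)"
    by (intro exI[of _ \<A>]) (auto simp: subset_iff)
qed

text \<open>By the \<open>\<pi>\<close>-\<open>\<lambda>\<close> theorem a function is determined by its integrals over the members of a generator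
  of the Borel sets that is closed under intersections.\<close>
lemma zero_AE_if_integrals_over_generator_vanish:
  fixes h :: "'a::euclidean_space \<Rightarrow> real"
  assumes h: "integrable lebesgue h" and G: "Int_stable G" "UNIV \<in> G" "sigma_sets UNIV G = sets borel"
    and zero: "\<And>X. X \<in> G \<Longrightarrow> (LINT x:X|lebesgue. h x) = 0"
  shows "AE x in lebesgue. h x = 0"
proof (rule sigma_finite_measure.density_zero[OF sigma_finite_lebesgue h])
  have si: "set_integrable lebesgue A h" if "A \<in> sets lebesgue" for A
    unfolding set_integrable_def by (rule integrable_mult_indicator[OF that h])
  have sb: "A \<in> sets lebesgue" if "A \<in> sigma_sets UNIV G" for A
    using that unfolding G(3) by simp
  have cl: "G \<subseteq> Pow UNIV" by simp
  have borel: "(LINT x:A|lebesgue. h x) = 0" if "A \<in> sigma_sets UNIV G" for A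
    using G(1) cl that
  proof (induction rule: sigma_sets_induct_disjoint)
    case (compl A)
    have "(LINT x:UNIV|lebesgue. h x) = (LINT x:A \<union> (UNIV - A)|lebesgue. h x)" by simp
    also have "\<dots> = (LINT x:A|lebesgue. h x) + (LINT x:UNIV - A|lebesgue. h x)"
    proof (rule set_integral_Un)
      show "set_integrable lebesgue (UNIV - A) h" using sets.compl_sets[OF sb[OF compl.hyps]] by (intro si) simp
    qed (use si[OF sb[OF compl.hyps]] in auto)
    finally show ?case using compl.IH zero[OF G(2)] by simp
  next
    case (union A)
    have "(LINT x:(\<Union>i. A i)|lebesgue. h x) = (\<Sum>i. (LINT x:(A i)|lebesgue. h x))"
    proof (rule lebesgue_integral_countable_add)
      show "A i \<in> sets lebesgue" for i using sb union by blast
      then show "set_integrable lebesgue (\<Union>i. A i) h" by (intro si sets.countable_UN) auto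
      show "A i \<inter> A j = {}" if "i \<noteq> j" for i j using union.hyps(1) that by (auto simp: disjoint_family_on_def)
    qed
    then show ?case using union.IH by simp
  qed (use zero in \<open>auto simp: set_lebesgue_integral_def\<close>)
  fix A :: "'a set" assume A: "A \<in> sets lebesgue"
  have mp: "main_part lborel A \<in> sets lborel" using A by (rule main_part_sets)
  have "AE x in lborel. x \<notin> null_part lborel A" using A by (rule AE_notin_null_part)
  then have "AE x in lebesgue. x \<notin> null_part lborel A" by (rule AE_completion)
  then have ae: "AE x in lebesgue. x \<in> main_part lborel A \<longleftrightarrow> x \<in> A"
    by eventually_elim (use main_part_null_part_Un[OF A] in blast)
  have bm: "set_borel_measurable lebesgue B h" if "B \<in> sets lebesgue" for B
    using si[OF that] unfolding set_integrable_def set_borel_measurable_def by (rule borel_measurable_integrable)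
  have "(LINT x:A|lebesgue. h x) = (LINT x:main_part lborel A|lebesgue. h x)"
    by (rule set_integral_cong_set[OF bm bm ae]) (use A mp in auto)
  also have "\<dots> = 0" by (rule borel) (use mp G(3) in simp)
  finally show "(LINT x:A|lebesgue. h x) = 0" .
qed

text \<open>The finite intersections of members of a countable basis of the topology.\<close>
lemma countable_Int_stable_generator:
  obtains G :: "'a::second_countable_topology set set"
  where "countable G" "Int_stable G" "UNIV \<in> G" "sigma_sets UNIV G = sets borel"
proof -
  obtain B :: "'a set set" where B: "countable B" "topological_basis B" using ex_countable_basis by blast
  define G where "G = Inter ` {F. finite F \<and> F \<subseteq> B}"
  have "countable G" unfolding G_def by (intro countable_image countable_Collect_finite_subset B)
  moreover have "Int_stable G"
  proof (rule Int_stableI)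
    fix X Y assume "X \<in> G" "Y \<in> G"
    then obtain F F' where "finite F" "F \<subseteq> B" "X = \<Inter>F" "finite F'" "F' \<subseteq> B" "Y = \<Inter>F'" by (auto simp: G_def)
    then have "X \<inter> Y = \<Inter>(F \<union> F')" "finite (F \<union> F')" "F \<union> F' \<subseteq> B" by auto
    then show "X \<inter> Y \<in> G" unfolding G_def by blast
  qed
  moreover have "UNIV \<in> G" unfolding G_def by (rule image_eqI[of _ _ "{}"]) auto
  moreover have "sigma_sets UNIV G = sets borel"
  proof
    have sB: "sets borel = sigma_sets UNIV B" using borel_eq_countable_basis[OF B] by (metis Pow_UNIV sets_measure_of top_greatest)
    have "B \<subseteq> G" unfolding G_def by (auto intro!: image_eqI[of _ Inter "{_}"])
    then show "sets borel \<subseteq> sigma_sets UNIV G" unfolding sB by (rule sigma_sets_mono')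
    have "\<Inter>F \<in> sets borel" if "finite F" "F \<subseteq> B" for F
      using that topological_basis_open[OF B(2)] by (intro borel_open open_Inter) auto
    then have "G \<subseteq> sets borel" by (auto simp: G_def)
    then show "sigma_sets UNIV G \<subseteq> sets borel" using sets.sigma_sets_subset[of G borel] by simp
  qed
  ultimately show thesis by (rule that)
qed

text \<open>Rational linear combinations of the indicators of a countable generator are dense, as only the
  zero function is orthogonal to all of these indicators.\<close>
proposition L2_fun_separable:
  fixes E :: "'a::euclidean_space set"
  assumes E: "E \<in> lmeasurable"
  obtains D :: "nat \<Rightarrow> 'a \<Rightarrow> real" where "\<And>n. L2_fun (leb E) (D n)"
    "\<And>g e. L2_fun (leb E) g \<Longrightarrow> 0 < e \<Longrightarrow> \<exists>n. norm2 (leb E) (\<lambda>x. g x - D n x) < e"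
proof -
  let ?M = "leb E"
  have EL: "E \<in> sets lebesgue" using E by auto
  obtain G :: "'a set set" where G: "countable G" "Int_stable G" "UNIV \<in> G" "sigma_sets UNIV G = sets borel"
    by (rule countable_Int_stable_generator)
  have GB: "X \<in> sets borel" if "X \<in> G" for X using that G(4) by (metis sigma_sets.Basic)
  define comb :: "(rat \<times> 'a set) list \<Rightarrow> 'a \<Rightarrow> real"
    where "comb l x = (\<Sum>(q, X)\<leftarrow>l. of_rat q * indicator X x)" for l x
  define L where "L = lists ((UNIV :: rat set) \<times> G)"
  have one: "L2_fun ?M (indicator E :: 'a \<Rightarrow> real)" by (rule L2_fun_indicator[OF E EL])
  have ind: "L2_fun ?M (indicator X :: 'a \<Rightarrow> real)" if "X \<in> G" for X
  proof (rule L2_fun_mono[OF one])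
    show "(indicator X :: 'a \<Rightarrow> real) \<in> borel_measurable ?M"
      by (rule measurable_restrict_space1[OF borel_measurable_indicator]) (use GB[OF that] in simp)
    show "AE x in ?M. norm (indicator X x :: real) \<le> 1 * norm (indicator E x :: real)"
      using EL by (intro AE_I2) (auto simp: indicator_def)
  qed
  have comb_Cons: "comb ((q, X) # l) = (\<lambda>x. of_rat q * indicator X x + comb l x)" for q X l
    by (auto simp: comb_def)
  have sq: "L2_fun ?M (comb l)" if "l \<in> L" for l
    using that
  proof (induction l)
    case Nil
    show ?case using L2_fun_zero by (simp add: comb_def[abs_def])
  next
    case (Cons p l)
    obtain q X where p: "p = (q, X)" by (cases p)
    show ?case unfolding p comb_Cons
      using Cons by (intro L2_fun_add L2_fun_mult ind) (auto simp: p L_def)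
  qed
  \<comment> \<open>The closure of the countable set is a subspace over the real numbers, to which the density
    criterion applies.\<close>
  define V where "V = {g :: 'a \<Rightarrow> real. L2_fun ?M g \<and> (\<forall>e>0. \<exists>l\<in>L. norm2 ?M (\<lambda>x. g x - comb l x) < e)}"
  have VI: "g \<in> V" if sg: "L2_fun ?M g" and ap: "\<And>e. e > 0 \<Longrightarrow> \<exists>h\<in>V. norm2 ?M (\<lambda>x. g x - h x) < e" for g
    unfolding V_def
  proof (intro CollectI conjI sg allI impI)
    fix e :: real assume e: "e > 0"
    obtain h where h: "h \<in> V" "norm2 ?M (\<lambda>x. g x - h x) < e / 2" using ap[of "e / 2"] e by auto
    obtain l where l: "l \<in> L" "norm2 ?M (\<lambda>x. h x - comb l x) < e / 2" using h(1) e unfolding V_def by (auto dest: spec[of _ "e / 2"])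
    have "L2_fun ?M h" using h(1) by (simp add: V_def)
    from norm2_triangle_diff[OF sg this sq[OF l(1)]] h(2) l(2)
    show "\<exists>l\<in>L. norm2 ?M (\<lambda>x. g x - comb l x) < e" by (intro bexI[OF _ l(1)]) linarith
  qed
  have Vsq: "L2_fun ?M g" if "g \<in> V" for g using that by (simp add: V_def)
  have comb_V: "comb l \<in> V" if "l \<in> L" for l
    unfolding V_def using sq[OF that] that by (auto intro!: bexI[of _ l])
  have V_add: "(\<lambda>x. g x + h x) \<in> V" if g: "g \<in> V" and h: "h \<in> V" for g h
  proof (rule VI)
    show "L2_fun ?M (\<lambda>x. g x + h x)" by (intro L2_fun_add Vsq that)
    fix e :: real assume e: "e > 0"
    obtain l where l: "l \<in> L" "norm2 ?M (\<lambda>x. g x - comb l x) < e / 2" using g e unfolding V_def by (auto dest: spec[of _ "e / 2"])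
    obtain k where k: "k \<in> L" "norm2 ?M (\<lambda>x. h x - comb k x) < e / 2" using h e unfolding V_def by (auto dest: spec[of _ "e / 2"])
    have "comb (l @ k) = (\<lambda>x. comb l x + comb k x)" by (auto simp: comb_def)
    then have "norm2 ?M (\<lambda>x. (g x + h x) - comb (l @ k) x) = norm2 ?M (\<lambda>x. (g x - comb l x) + (h x - comb k x))"
      by (simp add: algebra_simps)
    also have "\<dots> \<le> norm2 ?M (\<lambda>x. g x - comb l x) + norm2 ?M (\<lambda>x. h x - comb k x)"
      by (intro norm2_triangle L2_fun_diff Vsq g h sq l k)
    finally show "\<exists>f\<in>V. norm2 ?M (\<lambda>x. (g x + h x) - f x) < e"
      using l k by (intro bexI[of _ "comb (l @ k)"] comb_V) (auto simp: L_def)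
  qed
  have ind_V: "(\<lambda>x. c * indicator X x) \<in> V" if X: "X \<in> G" for c :: real and X
  proof (rule VI)
    show "L2_fun ?M (\<lambda>x. c * indicator X x)" by (intro L2_fun_mult ind X)
    fix e :: real assume e: "e > 0"
    define n where "n = norm2 ?M (indicator X :: 'a \<Rightarrow> real)"
    have "0 \<le> n" by (simp add: n_def)
    obtain q where q: "\<bar>c - of_rat q\<bar> < e / (n + 1)"
    proof -
      have "c - e / (n + 1) < c + e / (n + 1)" using e \<open>0 \<le> n\<close> by (simp add: add_pos_nonneg)
      then obtain q where "c - e / (n + 1) < of_rat q" "of_rat q < c + e / (n + 1)" using of_rat_dense by blast
      then show thesis by (intro that[of q]) (simp add: abs_less_iff)
    qed
    have "norm2 ?M (\<lambda>x. c * indicator X x - comb [(q, X)] x) = norm2 ?M (\<lambda>x. (c - of_rat q) * indicator X x)"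
      by (simp add: comb_def left_diff_distrib)
    also have "\<dots> = \<bar>c - of_rat q\<bar> * n" unfolding norm2_mult n_def ..
    also have "\<dots> \<le> e / (n + 1) * n" using q \<open>0 \<le> n\<close> by (intro mult_right_mono) auto
    also have "\<dots> < e" using e \<open>0 \<le> n\<close> by (simp add: field_simps)
    finally show "\<exists>f\<in>V. norm2 ?M (\<lambda>x. c * indicator X x - f x) < e"
      using X by (intro bexI[of _ "comb [(q, X)]"] comb_V) (auto simp: L_def)
  qed
  have scale_comb: "(\<lambda>x. t * comb l x) \<in> V" if "l \<in> L" for t l
    using that
  proof (induction l)
    case Nil
    have "(\<lambda>x. t * comb [] x) = comb []" by (auto simp: comb_def)
    then show ?case using comb_V Nil by simp
  next
    case (Cons p l)
    obtain q X where p: "p = (q, X)" by (cases p)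
    have "(\<lambda>x. t * of_rat q * indicator X x + t * comb l x) \<in> V"
      using Cons by (intro V_add ind_V) (auto simp: p L_def)
    then show ?case by (simp add: p comb_Cons algebra_simps)
  qed
  have V_scale: "(\<lambda>x. t * g x) \<in> V" if g: "g \<in> V" for t g
  proof (rule VI)
    show "L2_fun ?M (\<lambda>x. t * g x)" by (intro L2_fun_mult Vsq g)
    fix e :: real assume e: "e > 0"
    have "e / (\<bar>t\<bar> + 1) > 0" using e by simp
    then obtain l where l: "l \<in> L" "norm2 ?M (\<lambda>x. g x - comb l x) < e / (\<bar>t\<bar> + 1)" using g unfolding V_def by blast
    have "norm2 ?M (\<lambda>x. t * g x - t * comb l x) = \<bar>t\<bar> * norm2 ?M (\<lambda>x. g x - comb l x)"
      unfolding norm2_mult[symmetric] by (simp add: right_diff_distrib)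
    also have "\<dots> \<le> \<bar>t\<bar> * (e / (\<bar>t\<bar> + 1))" using l(2) by (intro mult_left_mono) auto
    also have "\<dots> < e" using e by (simp add: field_simps)
    finally show "\<exists>f\<in>V. norm2 ?M (\<lambda>x. t * g x - f x) < e" using scale_comb[OF l(1), of t] by (intro bexI)
  qed
  have zero: "(\<lambda>x. 0) \<in> V" using comb_V[of "[]"] by (simp add: comb_def[abs_def] L_def)
  have orth: "AE x in ?M. h x = 0" if h: "L2_fun ?M h" and z: "\<And>\<psi>. \<psi> \<in> V \<Longrightarrow> (LINT x|?M. h x * \<psi> x) = 0"
    for h :: "'a \<Rightarrow> real"
  proof -
    have "integrable ?M (\<lambda>x. h x * indicator UNIV x)"
      by (rule integrable_mult_L2_fun[OF h ind[OF G(3)]])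
    then have int: "integrable lebesgue (\<lambda>x. indicator E x * h x)"
      using EL by (simp add: integrable_restrict_space)
    have "AE x in lebesgue. indicator E x * h x = 0"
    proof (rule zero_AE_if_integrals_over_generator_vanish[OF int G(2,3,4)])
      fix X assume X: "X \<in> G"
      have "(LINT x|?M. h x * (1 * indicator X x)) = 0" by (rule z[OF ind_V[OF X]])
      then show "(LINT x:X|lebesgue. indicator E x * h x) = 0"
        using EL by (simp add: integral_restrict_space set_lebesgue_integral_def mult_ac)
    qed
    then show ?thesis using EL by (auto simp: AE_restrict_space_iff elim: eventually_mono)
  qed
  have "countable L" unfolding L_def using G(1) by (intro countable_lists countable_SIGMA) auto
  moreover have "L \<noteq> {}" by (auto simp: L_def)
  ultimately have rng: "range (from_nat_into L) = L" by (intro range_from_nat_into)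
  show thesis
  proof (rule that[of "\<lambda>n. comb (from_nat_into L n)"])
    show "L2_fun ?M (comb (from_nat_into L n))" for n using sq rng by blast
    fix g :: "'a \<Rightarrow> real" and e :: real assume g: "L2_fun ?M g" and e: "0 < e"
    have "\<exists>\<psi>\<in>V. norm2 ?M (\<lambda>x. g x - \<psi> x) < d" if "d > 0" for d
      by (rule dense_if_orthogonal_trivial[OF Vsq zero V_add[OF _ V_scale] orth g that])
    then have "g \<in> V" by (intro VI g)
    then obtain l where "l \<in> L" "norm2 ?M (\<lambda>x. g x - comb l x) < e" using e unfolding V_def by blast
    then show "\<exists>n. norm2 ?M (\<lambda>x. g x - comb (from_nat_into L n) x) < e" using rng by (metis imageE)
  qed
qed

lemma borel_measurable_cong_on_space:
  "f \<in> borel_measurable M \<Longrightarrow> (\<And>t. t \<in> space M \<Longrightarrow> g t = f t) \<Longrightarrow> g \<in> borel_measurable M"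
  using measurable_cong[of M g f borel] by blast

lemma AE_lebesgue_on_good_set:
  assumes I: "I \<in> sets lebesgue" and P: "AE t in leb I. P t"
  obtains J where "J \<in> sets lebesgue" "J \<subseteq> I" "I - J \<in> null_sets lebesgue" "\<And>t. t \<in> J \<Longrightarrow> P t"
proof -
  obtain N where N: "\<And>t. t \<in> space (leb I) - N \<Longrightarrow> P t" "N \<in> null_sets (leb I)"
    using AE_E3[OF P] by blast
  have N': "N \<in> null_sets lebesgue" "N \<subseteq> I" using N(2) I by (auto simp: null_sets_restrict_space)
  show thesis
  proof (rule that[of "I - N"])
    have "I - (I - N) = N" using N'(2) by blast
    then show "I - (I - N) \<in> null_sets lebesgue" using N'(1) by simp
    show "I - N \<in> sets lebesgue" using I N'(1) by auto
  qed (use N(1) in auto)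
qed

lemma AE_lebesgue_on_if_good_set:
  assumes I: "I \<in> sets lebesgue" and J: "I - J \<in> null_sets lebesgue" "\<And>t. t \<in> J \<Longrightarrow> P t"
  shows "AE t in leb I. P t"
proof -
  have "AE t in lebesgue. t \<notin> I - J" by (rule AE_not_in[OF J(1)])
  then have "AE t in lebesgue. t \<in> I \<longrightarrow> P t" by eventually_elim (use J(2) in blast)
  then show ?thesis using I by (simp add: AE_restrict_space_iff)
qed

text \<open>The functional turns the approximating simple functions into real simple functions.\<close>
lemma borel_measurable_functional_of_strongly_measurable:
  fixes I :: "real set" and l :: "'v::minus \<Rightarrow> real"
  assumes u: "strongly_measurable_on I X N u" and I: "I \<in> sets lebesgue"
    and J: "J \<in> sets lebesgue" "J \<subseteq> I" "\<And>t. t \<in> J \<Longrightarrow> u t \<in> X"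
    and l: "\<And>v w. v \<in> X \<Longrightarrow> w \<in> X \<Longrightarrow> \<bar>l v - l w\<bar> \<le> C * N (v - w)"
  shows "(\<lambda>t. l (u t)) \<in> borel_measurable (leb J)"
proof -
  obtain s where s: "\<And>n. finite (s n ` I)" "\<And>n. s n ` I \<subseteq> X" "\<And>n v. {t \<in> I. s n t = v} \<in> sets lebesgue"
      and lim: "AE t in leb I. (\<lambda>n. N (u t - s n t)) \<longlonglongrightarrow> 0"
    using u unfolding strongly_measurable_on_def by blast
  have m: "(\<lambda>t. l (s n t)) \<in> borel_measurable (leb J)" for n
  proof (rule borel_measurable_simple_function, rule simple_function_compose1[of _ "s n" l])
    show "simple_function (leb J) (s n)"
      unfolding simple_function_def
    proof (intro conjI ballI)
      show "finite (s n ` space (leb J))"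
        by (rule finite_subset[OF image_mono s(1)[of n]]) (use J in simp)
      fix v
      have "s n -` {v} \<inter> space (leb J) = {t \<in> I. s n t = v} \<inter> J" using J(2) by auto
      then show "s n -` {v} \<inter> space (leb J) \<in> sets (leb J)"
        using s(3)[of n v] J(1) by (auto simp: sets_restrict_space_iff)
    qed
  qed
  have "AE t in leb J. (\<lambda>n. N (u t - s n t)) \<longlonglongrightarrow> 0"
    using lim I J(1,2) by (auto simp: AE_restrict_space_iff elim!: eventually_mono)
  then have "AE t in leb J. t \<in> J \<and> (\<lambda>n. N (u t - s n t)) \<longlonglongrightarrow> 0"
    using J(1) by (simp add: AE_restrict_space_iff)
  then have "AE t in leb J. lim (\<lambda>n. l (s n t)) = l (u t)"
  proof eventually_elim
    case (elim t)
    have le: "norm (l (u t) - l (s n t)) \<le> C * N (u t - s n t)" for n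
      using l[of "u t" "s n t"] J(2,3) s(2)[of n] elim by auto
    have "(\<lambda>n. C * N (u t - s n t)) \<longlonglongrightarrow> 0" using tendsto_mult_left[OF conjunct2[OF elim], of C] by simp
    then have "(\<lambda>n. l (u t) - l (s n t)) \<longlonglongrightarrow> 0" by (rule Lim_null_comparison[rotated]) (use le in auto)
    then have "(\<lambda>n. l (s n t)) \<longlonglongrightarrow> l (u t)"
      using tendsto_diff[OF tendsto_const[of "l (u t)"], of "\<lambda>n. l (u t) - l (s n t)" 0] by simp
    then show ?case by (rule limI)
  qed
  then show ?thesis
    by (rule borel_measurable_lebesgue_on_AE[OF J(1), rotated]) (intro borel_measurable_lim_metric m)
qed

text \<open>A function with values near a countable set is approximated by mapping each time to the first
  best approximation among finitely many members of that set.\<close>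
lemma strongly_measurable_if_separably_valued:
  fixes u :: "real \<Rightarrow> 'v::minus"
  assumes I: "I \<in> sets lebesgue" and J: "J \<in> sets lebesgue" "J \<subseteq> I" "I - J \<in> null_sets lebesgue"
    and u: "\<And>t. t \<in> J \<Longrightarrow> u t \<in> X" and v: "\<And>n :: nat. v n \<in> X" and N: "\<And>w. 0 \<le> N w"
    and dense: "\<And>t e. t \<in> J \<Longrightarrow> 0 < e \<Longrightarrow> \<exists>n. N (u t - v n) < e"
    and meas: "\<And>n. (\<lambda>t. N (u t - v n)) \<in> borel_measurable (leb J)"
  shows "strongly_measurable_on I X N u"
proof -
  define k where "k n t = (LEAST i. \<forall>j\<in>{..n}. N (u t - v i) \<le> N (u t - v j))" for n t
  have ex: "\<exists>i\<le>n. \<forall>j\<in>{..n}. N (u t - v i) \<le> N (u t - v j)" for n t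
  proof -
    have "Min ((\<lambda>i. N (u t - v i)) ` {..n}) \<in> (\<lambda>i. N (u t - v i)) ` {..n}" by (rule Min_in) auto
    then obtain i where i: "i \<le> n" "Min ((\<lambda>i. N (u t - v i)) ` {..n}) = N (u t - v i)"
      unfolding image_iff by blast
    have "N (u t - v i) \<le> N (u t - v j)" if "j \<in> {..n}" for j
      unfolding i(2)[symmetric] by (rule Min_le) (use that in auto)
    then show ?thesis using i(1) by blast
  qed
  have k1: "N (u t - v (k n t)) \<le> N (u t - v j)" if "j \<le> n" for n t j
    using LeastI_ex[of "\<lambda>i. \<forall>j\<in>{..n}. N (u t - v i) \<le> N (u t - v j)"] ex[of n t] that unfolding k_def by auto
  have k2: "k n t \<le> n" for n t
  proof -
    obtain i where i: "i \<le> n" "\<forall>j\<in>{..n}. N (u t - v i) \<le> N (u t - v j)" using ex[of n t] by blast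
    then have "k n t \<le> i" unfolding k_def by (intro Least_le)
    then show ?thesis using i(1) by simp
  qed
  have km: "k n \<in> measurable (leb J) (count_space UNIV)" for n
  proof -
    note [measurable] = meas
    have "Measurable.pred (leb J) (\<lambda>t. \<forall>j\<in>{..n}. N (u t - v i) \<le> N (u t - v j))" for i
      using borel_measurable_le[OF meas[of i] meas] by (intro pred_intros_finite) (auto simp: pred_def)
    then show ?thesis unfolding k_def by (rule measurable_Least)
  qed
  define s where "s n t = (if t \<in> J then v (k n t) else v 0)" for n t
  have lev: "{t \<in> J. k n t = i} \<in> sets lebesgue" for n i
  proof -
    have "k n -` {i} \<inter> space (leb J) \<in> sets (leb J)" by (rule measurable_sets[OF km]) simp
    moreover have "k n -` {i} \<inter> space (leb J) = {t \<in> J. k n t = i}" by auto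
    ultimately show ?thesis using J(1) by (simp add: sets_restrict_space_iff)
  qed
  show ?thesis unfolding strongly_measurable_on_def
  proof (intro conjI exI[of _ s] allI)
    show "AE t in leb I. u t \<in> X" by (rule AE_lebesgue_on_if_good_set[OF I J(3) u])
    fix n
    have "s n t \<in> v ` {..n}" for t using k2[of n t] by (simp add: s_def)
    then have sub: "s n ` I \<subseteq> v ` {..n}" by blast
    then show "finite (s n ` I)" by (rule finite_subset) simp
    show "s n ` I \<subseteq> X" by (rule subset_trans[OF sub]) (use v in auto)
    fix w
    have "{t \<in> I. s n t = w} = (\<Union>i\<in>{i. i \<le> n \<and> v i = w}. {t \<in> J. k n t = i}) \<union> (if v 0 = w then I - J else {})"
    proof (intro set_eqI iffI)
      fix t assume t: "t \<in> {t \<in> I. s n t = w}"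
      show "t \<in> (\<Union>i\<in>{i. i \<le> n \<and> v i = w}. {t \<in> J. k n t = i}) \<union> (if v 0 = w then I - J else {})"
        using t k2[of n t] by (cases "t \<in> J") (simp_all add: s_def)
    next
      fix t assume t: "t \<in> (\<Union>i\<in>{i. i \<le> n \<and> v i = w}. {t \<in> J. k n t = i}) \<union> (if v 0 = w then I - J else {})"
      show "t \<in> {t \<in> I. s n t = w}"
        using t J(2) by (cases "t \<in> J") (auto simp: s_def split: if_splits)
    qed
    also have "\<dots> \<in> sets lebesgue" using lev I J(1) by (intro sets.Un sets.finite_UN) auto
    finally show "{t \<in> I. s n t = w} \<in> sets lebesgue" .
  next
    show "AE t in leb I. (\<lambda>n. N (u t - s n t)) \<longlonglongrightarrow> 0"
    proof (rule AE_lebesgue_on_if_good_set[OF I J(3)])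
      fix t assume t: "t \<in> J"
      show "(\<lambda>n. N (u t - s n t)) \<longlonglongrightarrow> 0"
      proof (rule LIMSEQ_I)
        fix e :: real assume "0 < e"
        then obtain n0 where n0: "N (u t - v n0) < e" using dense[OF t] by blast
        have "norm (N (u t - s n t) - 0) < e" if "n \<ge> n0" for n
          using k1[OF that, of t] n0 N[of "u t - v (k n t)"] t by (simp add: s_def)
        then show "\<exists>n0. \<forall>n\<ge>n0. norm (N (u t - s n t) - 0) < e" by blast
      qed
    qed
  qed
qed

text \<open>The square of the norm of \<open>h\<close> is the supremum of \<open>2 \<langle>h, \<psi>\<rangle> - \<parallel>\<psi>\<parallel>\<^sup>2\<close>, which differs from
  \<open>\<parallel>h\<parallel>\<^sup>2\<close> by \<open>\<parallel>h - \<psi>\<parallel>\<^sup>2\<close>, over a dense sequence of functions \<open>\<psi>\<close>. So weak measurability suffices.\<close>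
lemma borel_measurable_norm2_square:
  fixes h :: "'t \<Rightarrow> 'a \<Rightarrow> real" and \<psi> :: "nat \<Rightarrow> 'a \<Rightarrow> real"
  assumes \<psi>: "\<And>n. L2_fun M (\<psi> n)" and h: "\<And>t. t \<in> space N \<Longrightarrow> L2_fun M (h t)"
    and dense: "\<And>t e. t \<in> space N \<Longrightarrow> 0 < e \<Longrightarrow> \<exists>n. norm2 M (\<lambda>x. h t x - \<psi> n x) < e"
    and meas: "\<And>n. (\<lambda>t. LINT x|M. h t x * \<psi> n x) \<in> borel_measurable N"
  shows "(\<lambda>t. (norm2 M (h t))\<^sup>2) \<in> borel_measurable N"
proof -
  define f where "f n t = 2 * (LINT x|M. h t x * \<psi> n x) - (norm2 M (\<psi> n))\<^sup>2" for n t
  have fm: "f n \<in> borel_measurable N" for n using meas unfolding f_def by measurable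
  have f: "f n t = (norm2 M (h t))\<^sup>2 - (norm2 M (\<lambda>x. h t x - \<psi> n x))\<^sup>2" if "t \<in> space N" for n t
    using norm2_add_scaleR_square[OF h[OF that] \<psi>, of "-1" n] by (simp add: f_def)
  have bdd: "bdd_above (range (\<lambda>n. f n t))" if "t \<in> space N" for t
    using f[OF that] by (intro bdd_aboveI[of _ "(norm2 M (h t))\<^sup>2"]) auto
  have "(norm2 M (h t))\<^sup>2 = (SUP n. f n t)" if t: "t \<in> space N" for t
  proof (rule antisym)
    show "(SUP n. f n t) \<le> (norm2 M (h t))\<^sup>2" using f[OF t] by (intro cSUP_least) auto
    show "(norm2 M (h t))\<^sup>2 \<le> (SUP n. f n t)"
    proof (rule field_le_epsilon)
      fix e :: real assume e: "0 < e"
      then obtain n where n: "norm2 M (\<lambda>x. h t x - \<psi> n x) < sqrt e" using dense[OF t, of "sqrt e"] by auto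
      have "(norm2 M (\<lambda>x. h t x - \<psi> n x))\<^sup>2 \<le> (sqrt e)\<^sup>2" using n by (intro power_mono) auto
      then have "(norm2 M (h t))\<^sup>2 \<le> f n t + e" using f[OF t, of n] e by simp
      moreover have "f n t \<le> (SUP n. f n t)" by (rule cSUP_upper[OF _ bdd[OF t]]) simp
      ultimately show "(norm2 M (h t))\<^sup>2 \<le> (SUP n. f n t) + e" by linarith
    qed
  qed
  then have "(\<lambda>t. (norm2 M (h t))\<^sup>2) \<in> borel_measurable N \<longleftrightarrow> (\<lambda>t. SUP n. f n t) \<in> borel_measurable N"
    by (intro measurable_cong)
  also have "\<dots>" by (rule borel_measurable_cSUP[OF _ fm bdd]) auto
  finally show ?thesis .
qed

text \<open>Subsets of finite products of \<open>L\<^sup>2(\<Omega>)\<close> are separable: for each tuple of members of a dense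
  sequence and each precision one close element is picked, if there is any.\<close>
lemma separable_family:
  fixes E :: "'a::euclidean_space set" and c :: "'v \<Rightarrow> 'k \<Rightarrow> 'a \<Rightarrow> real"
  assumes E: "E \<in> lmeasurable" and K: "finite K" and X: "X \<noteq> {}"
    and c: "\<And>v k. v \<in> X \<Longrightarrow> k \<in> K \<Longrightarrow> L2_fun (leb E) (c v k)"
  obtains v :: "nat \<Rightarrow> 'v" where "\<And>n. v n \<in> X"
    "\<And>w e. w \<in> X \<Longrightarrow> 0 < e \<Longrightarrow> \<exists>n. \<forall>k\<in>K. norm2 (leb E) (\<lambda>x. c w k x - c (v n) k x) < e"
proof -
  obtain D :: "nat \<Rightarrow> 'a \<Rightarrow> real" where D: "\<And>n. L2_fun (leb E) (D n)"
    "\<And>g e. L2_fun (leb E) g \<Longrightarrow> 0 < e \<Longrightarrow> \<exists>n. norm2 (leb E) (\<lambda>x. g x - D n x) < e"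
    using L2_fun_separable[OF E] by metis
  define near where "near f m v \<longleftrightarrow> v \<in> X \<and> (\<forall>k\<in>K. norm2 (leb E) (\<lambda>x. c v k x - D (f k) x) < 1 / Suc m)" for f m v
  define pick where "pick = (\<lambda>(f, m). if \<exists>v. near f m v then SOME v. near f m v else SOME v. v \<in> X)"
  define Z where "Z = (PiE K (\<lambda>_. UNIV :: nat set)) \<times> (UNIV :: nat set)"
  have "countable Z" unfolding Z_def using K by (intro countable_SIGMA countable_PiE) auto
  moreover have "Z \<noteq> {}" by (auto simp: Z_def PiE_eq_empty_iff)
  ultimately have rng: "range (from_nat_into Z) = Z" by (intro range_from_nat_into)
  show thesis
  proof (rule that[of "\<lambda>n. pick (from_nat_into Z n)"])
    have "pick z \<in> X" for z
    proof (cases z)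
      case (Pair f m)
      show ?thesis
      proof (cases "\<exists>v. near f m v")
        case True
        then have "near f m (SOME v. near f m v)" by (rule someI_ex)
        moreover have "pick z = (SOME v. near f m v)" using True by (simp add: pick_def Pair)
        ultimately show ?thesis unfolding near_def by simp
      next
        case False
        then have "pick z = (SOME v. v \<in> X)" by (auto simp: pick_def Pair)
        then show ?thesis using X by (simp add: some_in_eq)
      qed
    qed
    then show "pick (from_nat_into Z n) \<in> X" for n .
    fix w and e :: real assume w: "w \<in> X" and e: "0 < e"
    obtain m where m: "1 / Suc m < e / 2" using e nat_approx_posE[of "e / 2"] by auto
    have "\<forall>k\<in>K. \<exists>n. norm2 (leb E) (\<lambda>x. c w k x - D n x) < 1 / Suc m"
      using D(2)[OF c[OF w]] by simp
    from bchoice[OF this] obtain f0 where f0: "\<forall>k\<in>K. norm2 (leb E) (\<lambda>x. c w k x - D (f0 k) x) < 1 / Suc m" by blast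
    define f where "f = restrict f0 K"
    have "near f m w" using w f0 by (simp add: near_def f_def)
    then have nr: "near f m (pick (f, m))"
      using someI[of "near f m" w] by (auto simp: pick_def)
    have "(f, m) \<in> Z" by (auto simp: Z_def f_def)
    then obtain n where n: "from_nat_into Z n = (f, m)" using rng by (metis imageE)
    have "norm2 (leb E) (\<lambda>x. c w k x - c (pick (f, m)) k x) < e" if k: "k \<in> K" for k
    proof -
      have "norm2 (leb E) (\<lambda>x. c w k x - D (f k) x) < 1 / Suc m" using \<open>near f m w\<close> k by (simp add: near_def)
      moreover have "norm2 (leb E) (\<lambda>x. D (f k) x - c (pick (f, m)) k x) < 1 / Suc m"
        using nr k by (subst norm2_minus_commute) (simp add: near_def)
      moreover have "pick (f, m) \<in> X" using nr by (simp add: near_def)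
      ultimately show ?thesis
        using norm2_triangle_diff[OF c[OF w k] D(1) c[OF _ k], of "pick (f, m)" "f k"] m by linarith
    qed
    then show "\<exists>n. \<forall>k\<in>K. norm2 (leb E) (\<lambda>x. c w k x - c (pick (from_nat_into Z n)) k x) < e"
      using n by (intro exI[of _ n]) simp
  qed
qed

section \<open>Measurability of functions with values in the second-order Sobolev space\<close>

lemma norm2_le_norm_H1:
  assumes E: "open E" and u: "u \<in> H1_space E"
  shows "(norm_H1 E u)\<^sup>2 = (norm2 (leb E) u)\<^sup>2 + (norm2 (leb E) (weak_grad E u))\<^sup>2"
    and "norm2 (leb E) u \<le> norm_H1 E u" "norm2 (leb E) (weak_grad E u) \<le> norm_H1 E u"
proof -
  have "L2_fun (leb E) (weak_grad E u)"
    using H1_space_L2_weak_gradient[OF E u] by (simp add: L2_weak_gradient_def)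
  then show 1: "(norm_H1 E u)\<^sup>2 = (norm2 (leb E) u)\<^sup>2 + (norm2 (leb E) (weak_grad E u))\<^sup>2"
    by (simp add: norm_H1_def norm2_square_componentwise norm_L2_eq sum_nonneg)
  have 0: "0 \<le> norm_H1 E u" by (simp add: norm_H1_def sum_nonneg)
  show "norm2 (leb E) u \<le> norm_H1 E u" "norm2 (leb E) (weak_grad E u) \<le> norm_H1 E u"
    by (rule power2_le_imp_le[OF _ 0]; simp add: 1)+
qed

lemma H1_space_diff:
  assumes E: "open E" and u: "u \<in> H1_space E" and v: "v \<in> H1_space E"
  shows "(\<lambda>x. u x - v x) \<in> H1_space E"
    and "AE x in leb E. weak_grad E (\<lambda>x. u x - v x) x = weak_grad E u x - weak_grad E v x"
proof -
  have "L2_weak_gradient E (\<lambda>x. u x - v x) (\<lambda>x. weak_grad E u x - weak_grad E v x)"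
    using L2_weak_gradient_linear_comb[OF E H1_space_L2_weak_gradient[OF E u] H1_space_L2_weak_gradient[OF E v], of "-1"] by simp
  from L2_weak_gradient_H1_space[OF E this]
  show "(\<lambda>x. u x - v x) \<in> H1_space E"
    "AE x in leb E. weak_grad E (\<lambda>x. u x - v x) x = weak_grad E u x - weak_grad E v x" by auto
qed

lemma H1_space_cong_AE:
  assumes E: "open E" and u: "u \<in> H1_space E" and ae: "AE x in leb E. u x = v x"
  shows "v \<in> H1_space E" "AE x in leb E. weak_grad E v x = weak_grad E u x"
  using L2_weak_gradient_H1_space[OF E L2_weak_gradient_cong_AE[OF E H1_space_L2_weak_gradient[OF E u] ae]] by auto

text \<open>The partial derivatives are taken from right to left along the list of directions.\<close>
primrec weak_partial :: "'a::euclidean_space set \<Rightarrow> ('a \<Rightarrow> real) \<Rightarrow> 'a list \<Rightarrow> 'a \<Rightarrow> real"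
  where
    "weak_partial E w [] = w"
  | "weak_partial E w (j # js) = (\<lambda>x. weak_grad E (weak_partial E w js) x \<bullet> j)"

definition multi_indices :: "'a::euclidean_space list set"
  where "multi_indices = {[]} \<union> (\<lambda>i. [i]) ` Basis \<union> (\<lambda>(j, i). [j, i]) ` (Basis \<times> Basis)"

lemma finite_multi_indices: "finite multi_indices" by (simp add: multi_indices_def)

lemma norm_H2_square:
  "(norm_H2 E w)\<^sup>2 = (norm2 (leb E) (weak_partial E w []))\<^sup>2
    + (\<Sum>i\<in>Basis. (norm2 (leb E) (weak_partial E w [i]))\<^sup>2
      + (\<Sum>j\<in>Basis. (norm2 (leb E) (weak_partial E w [j, i]))\<^sup>2))"
  by (simp add: norm_H2_def norm_H1_def norm_L2_eq sum_nonneg add_nonneg_nonneg)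

lemma weak_partial_diff:
  assumes E: "open E" and w: "w \<in> H2_space E" and v: "v \<in> H2_space E"
  shows "(\<lambda>x. w x - v x) \<in> H2_space E"
    and "l \<in> multi_indices \<Longrightarrow> L2_fun (leb E) (weak_partial E w l)"
    and "l \<in> multi_indices \<Longrightarrow> norm2 (leb E) (weak_partial E (\<lambda>x. w x - v x) l)
      = norm2 (leb E) (\<lambda>x. weak_partial E w l x - weak_partial E v l x)"
proof -
  have EL: "E \<in> sets lebesgue" using E by auto
  have H1: "u \<in> H1_space E" "\<And>i. i \<in> Basis \<Longrightarrow> (\<lambda>x. weak_grad E u x \<bullet> i) \<in> H1_space E" if "u \<in> H2_space E" for u
    using that by (auto simp: H2_space_def)
  have d1: "(\<lambda>x. w x - v x) \<in> H1_space E"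
      "AE x in leb E. weak_grad E (\<lambda>x. w x - v x) x = weak_grad E w x - weak_grad E v x"
    using H1_space_diff[OF E H1(1)[OF w] H1(1)[OF v]] by auto
  have ae1: "AE x in leb E. weak_grad E w x \<bullet> i - weak_grad E v x \<bullet> i = weak_grad E (\<lambda>x. w x - v x) x \<bullet> i" for i
    using d1(2) by eventually_elim (simp add: inner_diff_left)
  have d2: "(\<lambda>x. weak_grad E (\<lambda>x. w x - v x) x \<bullet> i) \<in> H1_space E"
      "AE x in leb E. weak_grad E (\<lambda>x. weak_grad E (\<lambda>x. w x - v x) x \<bullet> i) x
        = weak_grad E (\<lambda>x. weak_grad E w x \<bullet> i) x - weak_grad E (\<lambda>x. weak_grad E v x \<bullet> i) x" if i: "i \<in> Basis" for i
  proof -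
    note d = H1_space_diff[OF E H1(2)[OF w i] H1(2)[OF v i]]
    show "(\<lambda>x. weak_grad E (\<lambda>x. w x - v x) x \<bullet> i) \<in> H1_space E" by (rule H1_space_cong_AE(1)[OF E d(1) ae1])
    from H1_space_cong_AE(2)[OF E d(1) ae1] d(2)
    show "AE x in leb E. weak_grad E (\<lambda>x. weak_grad E (\<lambda>x. w x - v x) x \<bullet> i) x
        = weak_grad E (\<lambda>x. weak_grad E w x \<bullet> i) x - weak_grad E (\<lambda>x. weak_grad E v x \<bullet> i) x"
      by eventually_elim simp
  qed
  show d: "(\<lambda>x. w x - v x) \<in> H2_space E" using d1(1) d2(1) by (simp add: H2_space_def)
  have sq: "L2_fun (leb E) (weak_partial E u l)" if u: "u \<in> H2_space E" and l: "l \<in> multi_indices" for u l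
  proof -
    note g = H1_space_L2_weak_gradient[OF E]
    have "L2_fun (leb E) u" "L2_fun (leb E) (weak_grad E u)"
      using g[OF H1(1)[OF u]] by (auto simp: L2_weak_gradient_def)
    moreover have "L2_fun (leb E) (weak_grad E (\<lambda>x. weak_grad E u x \<bullet> i))" if "i \<in> Basis" for i
      using g[OF H1(2)[OF u that]] by (auto simp: L2_weak_gradient_def)
    ultimately show ?thesis using l by (auto simp: multi_indices_def intro!: L2_fun_inner_const)
  qed
  then show "l \<in> multi_indices \<Longrightarrow> L2_fun (leb E) (weak_partial E w l)" using w by blast
  assume l: "l \<in> multi_indices"
  have "AE x in leb E. weak_partial E w l x - weak_partial E v l x = weak_partial E (\<lambda>x. w x - v x) l x"
  proof -
    have "AE x in leb E. weak_grad E (\<lambda>x. weak_grad E w x \<bullet> i) x \<bullet> j - weak_grad E (\<lambda>x. weak_grad E v x \<bullet> i) x \<bullet> j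
        = weak_grad E (\<lambda>x. weak_grad E (\<lambda>x. w x - v x) x \<bullet> i) x \<bullet> j" if "i \<in> Basis" for i j
      using d2(2)[OF that] by eventually_elim (simp add: inner_diff_left)
    then show ?thesis using l ae1 by (auto simp: multi_indices_def)
  qed
  then show "norm2 (leb E) (weak_partial E (\<lambda>x. w x - v x) l)
      = norm2 (leb E) (\<lambda>x. weak_partial E w l x - weak_partial E v l x)"
    by (intro L2_fun_cong_AE(2)[OF EL] L2_fun_diff sq w v l)
qed

text \<open>Mapping a function to its derivatives up to second order embeds \<open>H\<^sup>2\<close> into a finite product of
  copies of \<open>L\<^sup>2\<close>, which makes it separable and reduces the measurability of its norm to that of
  integrals against test functions. These only involve first derivatives of \<open>\<phi> t\<close>, and hence depend
  continuously on \<open>\<phi> t\<close> in \<open>H\<^sup>1\<close>.\<close>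
lemma strongly_measurable_H2:
  fixes U :: "'a::euclidean_space set" and \<phi> :: "real \<Rightarrow> 'a \<Rightarrow> real"
  assumes U: "open U" "U \<in> lmeasurable" and I: "I \<in> sets lebesgue"
    and \<phi>: "strongly_measurable_on I (H1_space U) (norm_H1 U) \<phi>" and H2: "AE t in leb I. \<phi> t \<in> H2_space U"
  shows "strongly_measurable_on I (H2_space U) (norm_H2 U) \<phi>"
    and "(\<lambda>t. (norm_H2 U (\<phi> t))\<^sup>2) \<in> borel_measurable (leb I)"
proof -
  let ?M = "leb U"
  have UL: "U \<in> sets lebesgue" using U by auto
  obtain J where J: "J \<in> sets lebesgue" "J \<subseteq> I" "I - J \<in> null_sets lebesgue" and JH2: "\<And>t. t \<in> J \<Longrightarrow> \<phi> t \<in> H2_space U"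
    using AE_lebesgue_on_good_set[OF I H2] by metis
  have JH1: "\<phi> t \<in> H1_space U" if "t \<in> J" for t using JH2[OF that] by (simp add: H2_space_def)
  have H1sq: "L2_fun ?M u" "L2_fun ?M (\<lambda>x. weak_grad U u x \<bullet> i)" if "u \<in> H1_space U" for u i
    using H1_space_L2_weak_gradient[OF U(1) that] by (auto simp: L2_weak_gradient_def intro: L2_fun_inner_const)
  have m0: "(\<lambda>t. LINT x|?M. \<phi> t x * q x) \<in> borel_measurable (leb J)" if q: "L2_fun ?M q" for q
  proof (rule borel_measurable_functional_of_strongly_measurable[OF \<phi> I J(1,2) JH1])
    fix v w assume vw: "v \<in> H1_space U" "w \<in> H1_space U"
    have "\<bar>(LINT x|?M. v x * q x) - (LINT x|?M. w x * q x)\<bar> = \<bar>LINT x|?M. (v x - w x) * q x\<bar>"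
      unfolding left_diff_distrib
      by (subst Bochner_Integration.integral_diff) (auto intro!: integrable_mult_L2_fun H1sq vw q)
    also have "\<dots> \<le> norm2 ?M (\<lambda>x. v x - w x) * norm2 ?M q"
      by (intro Cauchy_Schwarz_norm2_real L2_fun_diff H1sq vw q)
    also have "\<dots> \<le> norm_H1 U (\<lambda>x. v x - w x) * norm2 ?M q"
      by (intro mult_right_mono norm2_le_norm_H1(2)[OF U(1)] H1_space_diff U vw) simp
    finally show "\<bar>(LINT x|?M. v x * q x) - (LINT x|?M. w x * q x)\<bar> \<le> norm2 ?M q * norm_H1 U (v - w)"
      by (simp add: fun_diff_def mult.commute)
  qed
  have m1: "(\<lambda>t. LINT x|?M. (weak_grad U (\<phi> t) x \<bullet> i) * q x) \<in> borel_measurable (leb J)"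
    if q: "L2_fun ?M q" and i: "i \<in> Basis" for q i
  proof (rule borel_measurable_functional_of_strongly_measurable[OF \<phi> I J(1,2) JH1])
    fix v w assume vw: "v \<in> H1_space U" "w \<in> H1_space U"
    note d = H1_space_diff[OF U(1) vw]
    have sd: "L2_fun ?M (weak_grad U (\<lambda>x. v x - w x))"
      using H1_space_L2_weak_gradient[OF U(1) d(1)] by (simp add: L2_weak_gradient_def)
    have "\<bar>(LINT x|?M. (weak_grad U v x \<bullet> i) * q x) - (LINT x|?M. (weak_grad U w x \<bullet> i) * q x)\<bar>
        = \<bar>LINT x|?M. (weak_grad U v x \<bullet> i - weak_grad U w x \<bullet> i) * q x\<bar>"
      unfolding left_diff_distrib
      by (subst Bochner_Integration.integral_diff) (auto intro!: integrable_mult_L2_fun H1sq vw q)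
    also have "\<dots> \<le> norm2 ?M (\<lambda>x. weak_grad U v x \<bullet> i - weak_grad U w x \<bullet> i) * norm2 ?M q"
      by (intro Cauchy_Schwarz_norm2_real L2_fun_diff H1sq vw q)
    also have "norm2 ?M (\<lambda>x. weak_grad U v x \<bullet> i - weak_grad U w x \<bullet> i) = norm2 ?M (\<lambda>x. weak_grad U (\<lambda>x. v x - w x) x \<bullet> i)"
    proof (rule L2_fun_cong_AE(2)[OF UL L2_fun_inner_const[OF sd]])
      show "AE x in ?M. weak_grad U (\<lambda>x. v x - w x) x \<bullet> i = weak_grad U v x \<bullet> i - weak_grad U w x \<bullet> i"
        using d(2) by eventually_elim (simp add: inner_diff_left)
    qed
    also have "\<dots> * norm2 ?M q \<le> norm_H1 U (\<lambda>x. v x - w x) * norm2 ?M q"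
      using norm2_inner_const_le[OF sd, of i] i norm2_le_norm_H1(3)[OF U(1) d(1)]
      by (intro mult_right_mono) auto
    finally show "\<bar>(LINT x|?M. (weak_grad U v x \<bullet> i) * q x) - (LINT x|?M. (weak_grad U w x \<bullet> i) * q x)\<bar>
        \<le> norm2 ?M q * norm_H1 U (v - w)"
      by (simp add: fun_diff_def mult.commute)
  qed
  \<comment> \<open>Second derivatives are tested by moving one derivative to the test function.\<close>
  have mw: "(\<lambda>t. LINT x|?M. weak_partial U (\<phi> t) l x * \<psi> x) \<in> borel_measurable (leb J)"
    if \<psi>: "\<psi> \<in> test_functions U" and l: "l \<in> multi_indices" for \<psi> l
  proof -
    have \<psi>sq: "L2_fun ?M \<psi>" by (rule L2_fun_test_function[OF \<psi> UL])
    have "(\<lambda>t. LINT x|?M. (weak_grad U (\<lambda>x. weak_grad U (\<phi> t) x \<bullet> i) x \<bullet> j) * \<psi> x) \<in> borel_measurable (leb J)"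
      if i: "i \<in> Basis" for i j
    proof -
      have eq: "(LINT x|?M. (weak_grad U (\<lambda>x. weak_grad U (\<phi> t) x \<bullet> i) x \<bullet> j) * \<psi> x)
          = - (LINT x|?M. (weak_grad U (\<phi> t) x \<bullet> i) * dderiv \<psi> x j)" if t: "t \<in> space (leb J)" for t
      proof -
        have "(\<lambda>x. weak_grad U (\<phi> t) x \<bullet> i) \<in> H1_space U" using JH2[of t] t i by (simp add: H2_space_def)
        from H1_space_L2_weak_gradient[OF U(1) this] show ?thesis using \<psi> by (simp add: L2_weak_gradient_def)
      qed
      have "(\<lambda>t. - (LINT x|?M. (weak_grad U (\<phi> t) x \<bullet> i) * dderiv \<psi> x j)) \<in> borel_measurable (leb J)"
        by (intro borel_measurable_uminus m1 L2_fun_dderiv_test_function[OF \<psi> UL] i)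
      then show ?thesis by (rule borel_measurable_cong_on_space[OF _ eq])
    qed
    then show ?thesis using l m0[OF \<psi>sq] m1[OF \<psi>sq] by (auto simp: multi_indices_def)
  qed
  have nonempty: "test_functions U \<noteq> {}" using zero_test_function by blast
  obtain \<psi> :: "nat \<Rightarrow> 'a \<Rightarrow> real" where \<psi>: "\<And>n. \<psi> n \<in> test_functions U"
      "\<And>w e. w \<in> test_functions U \<Longrightarrow> 0 < e \<Longrightarrow> \<exists>n. \<forall>k\<in>{()}. norm2 ?M (\<lambda>x. w x - \<psi> n x) < e"
    by (rule separable_family[OF U(2) _ nonempty, of "{()}" "\<lambda>v _. v"])
      (use L2_fun_test_function[OF _ UL] in auto)
  have \<psi>sq: "L2_fun ?M (\<psi> n)" for n by (rule L2_fun_test_function[OF \<psi>(1) UL])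
  have \<psi>d: "\<exists>n. norm2 ?M (\<lambda>x. g x - \<psi> n x) < e" if g: "L2_fun ?M g" and e: "0 < e" for g e
  proof -
    obtain w where w: "w \<in> test_functions U" "norm2 ?M (\<lambda>x. g x - w x) < e / 2"
      using test_functions_dense[OF U(1) g, of "e / 2"] e by auto
    obtain n where n: "norm2 ?M (\<lambda>x. w x - \<psi> n x) < e / 2" using \<psi>(2)[OF w(1), of "e / 2"] e by auto
    have "norm2 ?M (\<lambda>x. g x - \<psi> n x) < e"
      using norm2_triangle_diff[OF g L2_fun_test_function[OF w(1) UL] \<psi>sq, of n] w(2) n by linarith
    then show ?thesis by blast
  qed
  have mnorm: "(\<lambda>t. (norm_H2 U (\<lambda>x. \<phi> t x - v x))\<^sup>2) \<in> borel_measurable (leb J)" if v: "v \<in> H2_space U" for v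
  proof -
    have "(\<lambda>t. (norm2 ?M (weak_partial U (\<lambda>x. \<phi> t x - v x) l))\<^sup>2) \<in> borel_measurable (leb J)" if l: "l \<in> multi_indices" for l
    proof -
      have sqt: "L2_fun ?M (weak_partial U (\<phi> t) l)" if "t \<in> J" for t
        by (rule weak_partial_diff(2)[OF U(1) JH2[OF that] v l])
      have sqv: "L2_fun ?M (weak_partial U v l)" by (rule weak_partial_diff(2)[OF U(1) v v l])
      have meas: "(\<lambda>t. (norm2 ?M (\<lambda>x. weak_partial U (\<phi> t) l x - weak_partial U v l x))\<^sup>2) \<in> borel_measurable (leb J)"
      proof (rule borel_measurable_norm2_square[OF \<psi>sq])
        show sd: "L2_fun ?M (\<lambda>x. weak_partial U (\<phi> t) l x - weak_partial U v l x)" if "t \<in> space (leb J)" for t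
          using that by (intro L2_fun_diff sqt sqv) simp
        show "\<exists>n. norm2 ?M (\<lambda>x. (weak_partial U (\<phi> t) l x - weak_partial U v l x) - \<psi> n x) < e"
          if "t \<in> space (leb J)" "0 < e" for t e by (rule \<psi>d[OF sd[OF that(1)] that(2)])
        fix n
        have eq: "(LINT x|?M. (weak_partial U (\<phi> t) l x - weak_partial U v l x) * \<psi> n x)
            = (LINT x|?M. weak_partial U (\<phi> t) l x * \<psi> n x) - (LINT x|?M. weak_partial U v l x * \<psi> n x)"
          if "t \<in> space (leb J)" for t
          unfolding left_diff_distrib using that
          by (intro Bochner_Integration.integral_diff integrable_mult_L2_fun sqt sqv \<psi>sq) simp
        have "(\<lambda>t. (LINT x|?M. weak_partial U (\<phi> t) l x * \<psi> n x) - (LINT x|?M. weak_partial U v l x * \<psi> n x))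
            \<in> borel_measurable (leb J)"
          by (intro borel_measurable_diff mw[OF \<psi>(1) l]) simp
        then show "(\<lambda>t. LINT x|?M. (weak_partial U (\<phi> t) l x - weak_partial U v l x) * \<psi> n x) \<in> borel_measurable (leb J)"
          by (rule borel_measurable_cong_on_space[OF _ eq])
      qed
      have eq: "(norm2 ?M (weak_partial U (\<lambda>x. \<phi> t x - v x) l))\<^sup>2 = (norm2 ?M (\<lambda>x. weak_partial U (\<phi> t) l x - weak_partial U v l x))\<^sup>2"
        if "t \<in> space (leb J)" for t
        using that weak_partial_diff(3)[OF U(1) JH2 v l] by simp
      show ?thesis by (rule borel_measurable_cong_on_space[OF meas eq])
    qed
    then show ?thesis unfolding norm_H2_square by (intro borel_measurable_add borel_measurable_sum) (auto simp: multi_indices_def simp del: weak_partial.simps)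
  qed
  have z1: "L2_weak_gradient U (\<lambda>x. 0) (\<lambda>x. 0)" by (simp add: L2_weak_gradient_def)
  have z: "(\<lambda>x. 0) \<in> H2_space U"
  proof -
    have "AE x in ?M. weak_grad U (\<lambda>x. 0) x \<bullet> i = 0" for i
      using L2_weak_gradient_H1_space(2)[OF U(1) z1] by eventually_elim simp
    then have "AE x in ?M. 0 = weak_grad U (\<lambda>x. 0) x \<bullet> i" for i
      by (rule eventually_mono) simp
    then show ?thesis
      using H1_space_cong_AE(1)[OF U(1) L2_weak_gradient_H1_space(1)[OF U(1) z1]] L2_weak_gradient_H1_space(1)[OF U(1) z1]
      by (simp add: H2_space_def)
  qed
  show "(\<lambda>t. (norm_H2 U (\<phi> t))\<^sup>2) \<in> borel_measurable (leb I)"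
  proof -
    have "(\<lambda>t. indicator J t *\<^sub>R (norm_H2 U (\<phi> t))\<^sup>2) \<in> borel_measurable lebesgue"
      using mnorm[OF z] J(1) by (simp add: borel_measurable_restrict_space_iff)
    then have "(\<lambda>t. indicator J t *\<^sub>R (norm_H2 U (\<phi> t))\<^sup>2) \<in> borel_measurable (leb I)"
      by (rule measurable_restrict_space1)
    moreover have "AE t in leb I. indicator J t *\<^sub>R (norm_H2 U (\<phi> t))\<^sup>2 = (norm_H2 U (\<phi> t))\<^sup>2"
      by (rule AE_lebesgue_on_if_good_set[OF I J(3)]) simp
    ultimately show ?thesis by (rule borel_measurable_lebesgue_on_AE[OF I])
  qed
  obtain v :: "nat \<Rightarrow> 'a \<Rightarrow> real" where v: "\<And>n. v n \<in> H2_space U"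
      "\<And>w e. w \<in> H2_space U \<Longrightarrow> 0 < e \<Longrightarrow> \<exists>n. \<forall>l\<in>multi_indices. norm2 ?M (\<lambda>x. weak_partial U w l x - weak_partial U (v n) l x) < e"
  proof (rule separable_family[OF U(2) finite_multi_indices, of "H2_space U" "weak_partial U"])
    show "H2_space U \<noteq> {}" using z by blast
  qed (use weak_partial_diff(2)[OF U(1)] in blast)+
  show "strongly_measurable_on I (H2_space U) (norm_H2 U) \<phi>"
  proof (rule strongly_measurable_if_separably_valued[OF I J JH2 v(1)])
    show "0 \<le> norm_H2 U w" for w by (simp add: norm_H2_def sum_nonneg)
    have "(\<lambda>t. sqrt ((norm_H2 U (\<lambda>x. \<phi> t x - v n x))\<^sup>2)) \<in> borel_measurable (leb J)" for n
      by (rule measurable_compose[OF mnorm[OF v(1)]]) (intro borel_measurable_continuous_onI continuous_intros)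
    moreover have "0 \<le> norm_H2 U w" for w by (simp add: norm_H2_def sum_nonneg)
    ultimately show "(\<lambda>t. norm_H2 U (\<phi> t - v n)) \<in> borel_measurable (leb J)" for n
      by (simp add: fun_diff_def)
    fix t and e :: real assume t: "t \<in> J" and e: "0 < e"
    define d where "d = real (card (Basis :: 'a set))"
    define \<delta> where "\<delta> = e / (2 * (d + 1))"
    have d: "0 \<le> d" by (simp add: d_def)
    then have \<delta>: "0 < \<delta>" using e by (simp add: \<delta>_def)
    obtain n where n: "\<forall>l\<in>multi_indices. norm2 ?M (\<lambda>x. weak_partial U (\<phi> t) l x - weak_partial U (v n) l x) < \<delta>"
      using v(2)[OF JH2[OF t] \<delta>] by blast
    have le: "(norm2 ?M (weak_partial U (\<lambda>x. \<phi> t x - v n x) l))\<^sup>2 \<le> \<delta>\<^sup>2" if "l \<in> multi_indices" for l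
      using n that weak_partial_diff(3)[OF U(1) JH2[OF t] v(1) that] by (intro power_mono) (auto intro: less_imp_le)
    have "(norm_H2 U (\<lambda>x. \<phi> t x - v n x))\<^sup>2 \<le> \<delta>\<^sup>2 + (\<Sum>i\<in>(Basis :: 'a set). \<delta>\<^sup>2 + (\<Sum>j\<in>(Basis :: 'a set). \<delta>\<^sup>2))"
      unfolding norm_H2_square by (intro add_mono sum_mono le) (auto simp: multi_indices_def)
    also have "\<dots> = \<delta>\<^sup>2 * (1 + d * (1 + d))" by (simp add: d_def algebra_simps)
    also have "\<dots> \<le> \<delta>\<^sup>2 * (d + 1)\<^sup>2" using d by (intro mult_left_mono) (auto simp: power2_eq_square algebra_simps)
    also have "\<dots> = (e / 2)\<^sup>2"
    proof -
      have "\<delta> * (d + 1) = e / 2" using d by (simp add: \<delta>_def field_simps)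
      then show ?thesis by (metis power_mult_distrib)
    qed
    finally have "norm_H2 U (\<lambda>x. \<phi> t x - v n x) \<le> e / 2" by (rule power2_le_imp_le) (use e in simp)
    then show "\<exists>n. norm_H2 U (\<phi> t - v n) < e" using e by (intro exI[of _ n]) (simp add: fun_diff_def)
  qed
qed

section \<open>Regularity of weak solutions\<close>

text \<open>Homogeneity forces \<open>A 0 = 0\<close>, so that the origin is a minimum.\<close>
lemma gradient_zero_if_two_homogeneous:
  fixes A :: "'a::euclidean_space \<Rightarrow> real"
  assumes A: "C11 A" and pos: "\<forall>p. p \<noteq> 0 \<longrightarrow> A p > 0" and hom: "\<forall>c>0. \<forall>p. A (c *\<^sub>R p) = c\<^sup>2 * A p"
  shows "gradient A 0 = 0"
proof -
  have "A (2 *\<^sub>R 0) = 2\<^sup>2 * A 0" by (rule hom[rule_format]) simp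
  then have "A 0 = 0" by simp
  then have "\<forall>p\<in>UNIV. A 0 \<le> A p" using pos by (metis less_eq_real_def)
  moreover have "A differentiable (at 0)" using A by (simp add: C11_def)
  ultimately have "(\<lambda>d. gradient A 0 \<bullet> d) = (\<lambda>d. 0)"
    by (intro differential_zero_maxmin[of 0 UNIV A] gradient_has_derivative) auto
  then have "gradient A 0 \<bullet> gradient A 0 = 0" by metis
  then show ?thesis by simp
qed

lemma AE_closed_interval_iff:
  "(AE t in leb {a..b}. P t) \<longleftrightarrow> (AE t in leb {a<..<b}. P t)" for a b :: real
proof -
  have "AE t :: real in lebesgue. t \<noteq> a" "AE t :: real in lebesgue. t \<noteq> b"
    by (rule AE_completion[OF AE_lborel_singleton])+
  then have "AE t in lebesgue. (t \<in> {a..b} \<longrightarrow> P t) \<longleftrightarrow> (t \<in> {a<..<b} \<longrightarrow> P t)"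
    by eventually_elim auto
  then have "(AE t in lebesgue. t \<in> {a..b} \<longrightarrow> P t) \<longleftrightarrow> (AE t in lebesgue. t \<in> {a<..<b} \<longrightarrow> P t)"
    by (rule eventually_subst)
  then show ?thesis by (simp add: AE_restrict_space_iff)
qed

text \<open>The regularity estimate is applied to the coordinate functions and to the components of \<open>a\<close>. The
  last claim follows by comparing the weak equation with the weak derivatives of \<open>a (grad u)\<close> on test
  functions.\<close>
proposition neumann_solution_regularity:
  fixes U :: "'a::euclidean_space set"
  assumes U: "bounded_C11_domain U"
    and a: "\<And>p q. norm (a p - a q) \<le> \<Lambda> * norm (p - q)" "a 0 = 0"
      "\<And>p q. a0 * (norm (p - q))\<^sup>2 \<le> (a p - a q) \<bullet> (p - q)" and a0: "0 < a0" and \<Lambda>: "0 \<le> \<Lambda>"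
  obtains C where "0 \<le> C" "\<And>u f. u \<in> H1_space U \<Longrightarrow> neumann_solution a U u (weak_grad U u) f \<Longrightarrow>
    u \<in> H2_space U \<and> (norm_H2 U u)\<^sup>2 \<le> C * ((norm2 (leb U) f)\<^sup>2 + (norm_H1 U u)\<^sup>2) \<and>
    (\<forall>i\<in>Basis. (\<lambda>x. a (weak_grad U u x) \<bullet> i) \<in> H1_space U) \<and>
    (AE x in leb U. weak_div U (\<lambda>x. a (weak_grad U u x)) x = - f x)"
proof -
  let ?M = "leb U"
  have Uo: "open U" using U by (simp add: bounded_C11_domain_def)
  then have UL: "U \<in> sets lebesgue" by auto
  obtain K where K: "0 \<le> K" and reg: "\<And>u G f \<Theta> \<kappa>. neumann_solution a U u G f \<Longrightarrow>
    (\<And>p q. \<bar>\<Theta> p - \<Theta> q\<bar> \<le> \<kappa> * norm (p - q)) \<Longrightarrow> \<Theta> 0 = 0 \<Longrightarrow> 0 \<le> \<kappa> \<Longrightarrow>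
    \<exists>D. L2_weak_gradient U (\<lambda>x. \<Theta> (G x)) D \<and> norm2 ?M D \<le> \<kappa> * (K * (norm2 ?M f + norm2 ?M u + norm2 ?M G))"
    by (rule lipschitz_of_gradient_regularity[OF U a a0 \<Lambda>]) blast
  define n where "n = real (card (Basis :: 'a set))"
  show thesis
  proof (rule that[of "1 + 3 * n * K\<^sup>2"], goal_cases)
    case 1
    show ?case by (simp add: n_def)
  next
    case (2 u f)
    define G where "G = weak_grad U u"
    have sol: "neumann_solution a U u G f" using 2 by (simp add: G_def)
    have u: "L2_weak_gradient U u G" and f: "L2_fun ?M f"
      and eqn: "\<And>\<eta> H. L2_weak_gradient U \<eta> H \<Longrightarrow> (LINT x|?M. a (G x) \<bullet> H x) = (LINT x|?M. f x * \<eta> x)"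
      using sol by (auto simp: neumann_solution_def)
    have G: "L2_fun ?M G" using u by (simp add: L2_weak_gradient_def)
    have N1: "(norm_H1 U u)\<^sup>2 = (norm2 ?M u)\<^sup>2 + (norm2 ?M G)\<^sup>2"
      unfolding G_def by (rule norm2_le_norm_H1(1)[OF Uo 2(1)])
    let ?N = "norm2 ?M f + norm2 ?M u + norm2 ?M G"
    have part: "(\<lambda>x. G x \<bullet> i) \<in> H1_space U \<and> norm2 ?M (weak_grad U (\<lambda>x. G x \<bullet> i)) \<le> K * ?N" if i: "i \<in> Basis" for i
    proof -
      have "\<exists>D. L2_weak_gradient U (\<lambda>x. G x \<bullet> i) D \<and> norm2 ?M D \<le> 1 * (K * ?N)"
      proof (rule reg[OF sol, of "\<lambda>p. p \<bullet> i"])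
        show "\<bar>p \<bullet> i - q \<bullet> i\<bar> \<le> 1 * norm (p - q)" for p q
          using Basis_le_norm[OF i, of "p - q"] by (simp add: inner_diff_left)
      qed simp_all
      then obtain D where D: "L2_weak_gradient U (\<lambda>x. G x \<bullet> i) D" "norm2 ?M D \<le> K * ?N" by auto
      have "AE x in ?M. D x = weak_grad U (\<lambda>x. G x \<bullet> i) x"
        using L2_weak_gradient_H1_space(2)[OF Uo D(1)] by eventually_elim simp
      then have "norm2 ?M (weak_grad U (\<lambda>x. G x \<bullet> i)) = norm2 ?M D"
        using D(1) by (intro L2_fun_cong_AE(2)[OF UL]) (simp_all add: L2_weak_gradient_def)
      then show ?thesis using D(2) L2_weak_gradient_H1_space(1)[OF Uo D(1)] by simp
    qed
    have H2: "u \<in> H2_space U" using 2(1) part by (simp add: H2_space_def G_def)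
    have bound: "(norm_H2 U u)\<^sup>2 \<le> (1 + 3 * n * K\<^sup>2) * ((norm2 ?M f)\<^sup>2 + (norm_H1 U u)\<^sup>2)"
    proof -
      have "(norm_H2 U u)\<^sup>2 = (norm2 ?M u)\<^sup>2 + (\<Sum>i\<in>Basis. (norm_H1 U (\<lambda>x. G x \<bullet> i))\<^sup>2)"
        by (simp add: norm_H2_def norm_L2_eq sum_nonneg G_def)
      also have "\<dots> \<le> (norm2 ?M u)\<^sup>2 + (\<Sum>i\<in>Basis. (norm2 ?M (\<lambda>x. G x \<bullet> i))\<^sup>2 + (K * ?N)\<^sup>2)"
        using part by (intro add_left_mono sum_mono) (simp add: norm2_le_norm_H1(1)[OF Uo] power_mono)
      also have "\<dots> = (norm_H1 U u)\<^sup>2 + n * K\<^sup>2 * ?N\<^sup>2"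
        by (simp add: N1 norm2_square_componentwise[OF G] sum.distrib n_def power_mult_distrib)
      also have "n * K\<^sup>2 * ?N\<^sup>2 \<le> n * K\<^sup>2 * (3 * ((norm2 ?M f)\<^sup>2 + (norm_H1 U u)\<^sup>2))"
      proof (rule mult_left_mono)
        have "(x + y + z)\<^sup>2 \<le> 3 * (x\<^sup>2 + (y\<^sup>2 + z\<^sup>2))" for x y z :: real
        proof -
          have "0 \<le> (x - y)\<^sup>2 + (y - z)\<^sup>2 + (x - z)\<^sup>2" by simp
          then show ?thesis by (simp add: power2_eq_square algebra_simps)
        qed
        then show "?N\<^sup>2 \<le> 3 * ((norm2 ?M f)\<^sup>2 + (norm_H1 U u)\<^sup>2)" unfolding N1 .
        show "0 \<le> n * K\<^sup>2" by (simp add: n_def)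
      qed
      finally have "(norm_H2 U u)\<^sup>2 \<le> (norm_H1 U u)\<^sup>2 + n * K\<^sup>2 * (3 * ((norm2 ?M f)\<^sup>2 + (norm_H1 U u)\<^sup>2))" by simp
      also have "\<dots> \<le> (1 + 3 * n * K\<^sup>2) * ((norm2 ?M f)\<^sup>2 + (norm_H1 U u)\<^sup>2)"
        by (simp add: algebra_simps)
      finally show ?thesis .
    qed
    have flux: "\<exists>D. L2_weak_gradient U (\<lambda>x. a (G x) \<bullet> i) D" if i: "i \<in> Basis" for i
    proof -
      have "\<exists>D. L2_weak_gradient U (\<lambda>x. a (G x) \<bullet> i) D \<and> norm2 ?M D \<le> \<Lambda> * (K * ?N)"
      proof (rule reg[OF sol, of "\<lambda>p. a p \<bullet> i"])
        show "\<bar>a p \<bullet> i - a q \<bullet> i\<bar> \<le> \<Lambda> * norm (p - q)" for p q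
          using Basis_le_norm[OF i, of "a p - a q"] a(1)[of p q] by (simp add: inner_diff_left)
      qed (use a(2) \<Lambda> in simp_all)
      then show ?thesis by blast
    qed
    then have fluxH1: "(\<lambda>x. a (G x) \<bullet> i) \<in> H1_space U" if "i \<in> Basis" for i
      using L2_weak_gradient_H1_space(1)[OF Uo] that by blast
    have fg: "L2_weak_gradient U (\<lambda>x. a (G x) \<bullet> i) (weak_grad U (\<lambda>x. a (G x) \<bullet> i))" if "i \<in> Basis" for i
      by (rule H1_space_L2_weak_gradient[OF Uo fluxH1[OF that]])
    have fsq: "L2_fun ?M (\<lambda>x. a (G x) \<bullet> i)" "L2_fun ?M (\<lambda>x. weak_grad U (\<lambda>x. a (G x) \<bullet> i) x \<bullet> i)"
      if "i \<in> Basis" for i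
      using fg[OF that] by (auto simp: L2_weak_gradient_def intro: L2_fun_inner_const)
    have div: "AE x in ?M. weak_div U (\<lambda>x. a (G x)) x = - f x"
    proof (rule AE_eq_if_test_integrals_eq[OF Uo])
      have "L2_fun ?M (weak_div U (\<lambda>x. a (G x)))"
        unfolding weak_div_def by (intro L2_fun_sum fsq(2)) auto
      then show "locally_integrable U (weak_div U (\<lambda>x. a (G x)))" using UL by (rule L2_fun_imp_locally_integrable)
      show "locally_integrable U (\<lambda>x. - f x)"
        using L2_fun_mult[OF f, of "-1"] by (intro L2_fun_imp_locally_integrable[OF _ UL]) simp
      fix \<psi> assume \<psi>: "\<psi> \<in> test_functions U"
      have sm: "smooth \<psi>" by (rule test_functions_smooth[OF \<psi>])
      have \<psi>sq: "L2_fun ?M \<psi>" "\<And>d. L2_fun ?M (\<lambda>x. dderiv \<psi> x d)"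
        using L2_fun_test_function[OF \<psi> UL] L2_fun_dderiv_test_function[OF \<psi> UL] by auto
      have "(LINT x|?M. weak_div U (\<lambda>x. a (G x)) x * \<psi> x) = (\<Sum>i\<in>Basis. LINT x|?M. (weak_grad U (\<lambda>x. a (G x) \<bullet> i) x \<bullet> i) * \<psi> x)"
        unfolding weak_div_def sum_distrib_right
        by (intro Bochner_Integration.integral_sum integrable_mult_L2_fun fsq \<psi>sq)
      also have "\<dots> = (\<Sum>i\<in>Basis. - (LINT x|?M. (a (G x) \<bullet> i) * dderiv \<psi> x i))"
        using fg \<psi> by (intro sum.cong) (simp_all add: L2_weak_gradient_def)
      also have "\<dots> = - (LINT x|?M. (\<Sum>i\<in>Basis. (a (G x) \<bullet> i) * dderiv \<psi> x i))"
        unfolding sum_negf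
        by (subst Bochner_Integration.integral_sum) (auto intro: integrable_mult_L2_fun fsq \<psi>sq)
      also have "\<dots> = - (LINT x|?M. a (G x) \<bullet> gradient \<psi> x)"
        by (subst euclidean_inner) (simp add: dderiv_eq_gradient[OF smooth_differentiable[OF sm]])
      also have "\<dots> = - (LINT x|?M. f x * \<psi> x)"
        using eqn[OF L2_weak_gradient_test_function[OF \<psi> Uo]] by simp
      finally show "(LINT x|?M. weak_div U (\<lambda>x. a (G x)) x * \<psi> x) = (LINT x|?M. - f x * \<psi> x)" by simp
    qed
    show ?case using H2 bound fluxH1 div by (simp add: G_def)
  qed
qed

text \<open>For the logarithmic potential the derivative agrees almost everywhere with the value of an
  elementary Borel function; completeness of the Lebesgue measure does the rest.\<close>
lemma deriv_potential_space_time_measurable: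
  fixes E :: "'a::euclidean_space set"
  assumes E: "open E" and \<phi>: "space_time_measurable T E \<phi>"
    and F: "continuous_on UNIV (deriv F) \<or>
      F = log_potential \<theta> \<theta>c \<and> (AE (t, x) in leb (space_time T E). \<bar>\<phi> t x\<bar> < 1)"
  shows "space_time_measurable T E (\<lambda>t x. deriv F (\<phi> t x))"
  using F
proof
  assume "continuous_on UNIV (deriv F)"
  then have "deriv F \<in> borel_measurable borel" by (rule borel_measurable_continuous_onI)
  from measurable_compose[OF \<phi>[unfolded space_time_measurable_def] this]
  show ?thesis by (simp add: space_time_measurable_def case_prod_beta')
next
  assume F: "F = log_potential \<theta> \<theta>c \<and> (AE (t, x) in leb (space_time T E). \<bar>\<phi> t x\<bar> < 1)"
  define g where "g s = \<theta> / 2 * (ln (1 + s) - ln (1 - s)) - \<theta>c * s" for s :: real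
  have g: "deriv F s = g s" if "\<bar>s\<bar> < 1" for s
  proof (rule DERIV_imp_deriv)
    have "((\<lambda>s. \<theta> / 2 * ((1 + s) * ln (1 + s) + (1 - s) * ln (1 - s)) + \<theta>c / 2 * (1 - s\<^sup>2)) has_real_derivative g s) (at s)"
    proof -
      have 1: "((\<lambda>s. (1 + s) * ln (1 + s)) has_real_derivative ln (1 + s) + 1) (at s)"
        using that by (auto intro!: derivative_eq_intros simp: abs_less_iff)
      have 2: "((\<lambda>s. (1 - s) * ln (1 - s)) has_real_derivative - ln (1 - s) - 1) (at s)"
        using that by (auto intro!: derivative_eq_intros simp: abs_less_iff)
      have 3: "((\<lambda>s. \<theta>c / 2 * (1 - s\<^sup>2)) has_real_derivative - \<theta>c * s) (at s)"
        by (auto intro!: derivative_eq_intros)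
      show ?thesis
        using DERIV_add[OF DERIV_cmult[OF DERIV_add[OF 1 2], of "\<theta> / 2"] 3] by (simp add: g_def algebra_simps)
    qed
    then show "(F has_real_derivative g s) (at s)" using F by (simp add: log_potential_def[abs_def])
  qed
  have gm: "g \<in> borel_measurable borel" unfolding g_def by measurable
  have "open (space_time T E)" by (rule open_Times[OF open_greaterThanLessThan E])
  then have ST: "space_time T E \<in> sets lebesgue" by (intro sets_completionI_sets) simp
  have "(\<lambda>z. g ((\<lambda>(t, x). \<phi> t x) z)) \<in> borel_measurable (leb (space_time T E))"
    by (rule measurable_compose[OF \<phi>[unfolded space_time_measurable_def] gm])
  moreover have "AE z in leb (space_time T E). g ((\<lambda>(t, x). \<phi> t x) z) = (\<lambda>(t, x). deriv F (\<phi> t x)) z"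
    using conjunct2[OF F] by eventually_elim (auto simp: g)
  ultimately show ?thesis unfolding space_time_measurable_def by (rule borel_measurable_lebesgue_on_AE[OF ST])
qed

theorem theorem2p8:
  fixes \<Omega> :: "(real ^ 'n) set" and T :: real
    and A :: "real ^ 'n \<Rightarrow> real" and a0 :: real
    and M :: "real ^ 'n \<Rightarrow> real \<Rightarrow> real" and M0 M1 :: real
    and F :: "real \<Rightarrow> real" and kind :: potential_kind
    and \<phi>0 :: "real ^ 'n \<Rightarrow> real"
    and \<phi> \<mu> :: "real \<Rightarrow> real ^ 'n \<Rightarrow> real"
  assumes dim: "CARD('n) = 2 \<or> CARD('n) = 3"
    and domain: "bounded_C11_domain \<Omega>"
    and T_pos: "T > 0"
    and A_C11: "C11 A"
    and A_pos: "\<forall>p. p \<noteq> 0 \<longrightarrow> A p > 0"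
    and A_hom: "\<forall>c>0. \<forall>p. A (c *\<^sub>R p) = c\<^sup>2 * A p"
    and a0_pos: "a0 > 0"
    and A_mono: "\<forall>p q. (gradient A p - gradient A q) \<bullet> (p - q) \<ge> a0 * (norm (p - q))\<^sup>2"
    and M_cont: "continuous_on UNIV (\<lambda>(p, s). M p s)"
    and M0_pos: "0 < M0"
    and M_bounds: "\<forall>p s. M0 \<le> M p s \<and> M p s \<le> M1"
    and init: "\<phi>0 \<in> H1_space \<Omega>"
    and potential:
      "(kind = Regular \<and> regular_potential F) \<or>
       (kind = Logarithmic \<and> (\<exists>\<theta>>0. \<exists>\<theta>c>0. F = log_potential \<theta> \<theta>c) \<and>
        (AE x in lebesgue_on \<Omega>. \<bar>\<phi>0 x\<bar> \<le> 1) \<and> \<bar>mean \<Omega> \<phi>0\<bar> < 1)"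
    and solution: "weak_solution kind T \<Omega> A M F \<phi>0 \<phi> \<mu>"
  shows "\<phi> \<in> L2_H2 T \<Omega> \<and>
    (AE t in lebesgue_on {0..T}. \<forall>i\<in>Basis.
       (\<lambda>x. gradient A (weak_grad \<Omega> (\<phi> t) x) \<bullet> i) \<in> H1_space \<Omega>) \<and>
    (\<exists>D. space_time_representative T \<Omega>
            (\<lambda>t. weak_div \<Omega> (\<lambda>x. gradient A (weak_grad \<Omega> (\<phi> t) x))) D \<and>
         (AE (t, x) in lebesgue_on (space_time T \<Omega>). \<mu> t x = - D t x + deriv F (\<phi> t x)))"
proof -
  let ?I = "{0<..<T}" and ?M = "leb \<Omega>" and ?a = "gradient A"
  define f where "f t x = \<mu> t x - deriv F (\<phi> t x)" for t x
  have \<Omega>: "open \<Omega>" "\<Omega> \<in> lmeasurable" and \<Omega>L: "\<Omega> \<in> sets lebesgue"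
    using domain by (auto simp: bounded_C11_domain_def intro: lmeasurable_open)
  have I: "?I \<in> sets lebesgue" by simp
  obtain \<Lambda> where \<Lambda>: "\<Lambda>-lipschitz_on UNIV ?a" using A_C11 by (auto simp: C11_def)
  have \<Lambda>0: "0 \<le> \<Lambda>" by (rule lipschitz_on_nonneg[OF \<Lambda>])
  have lip: "norm (?a p - ?a q) \<le> \<Lambda> * norm (p - q)" for p q
    using lipschitz_onD[OF \<Lambda>, of p q] by (simp add: dist_norm)
  have a_zero: "?a 0 = 0" by (rule gradient_zero_if_two_homogeneous[OF A_C11 A_pos A_hom])
  obtain C where C: "0 \<le> C" and reg: "\<And>u f. u \<in> H1_space \<Omega> \<Longrightarrow> neumann_solution ?a \<Omega> u (weak_grad \<Omega> u) f \<Longrightarrow>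
    u \<in> H2_space \<Omega> \<and> (norm_H2 \<Omega> u)\<^sup>2 \<le> C * ((norm2 ?M f)\<^sup>2 + (norm_H1 \<Omega> u)\<^sup>2) \<and>
    (\<forall>i\<in>Basis. (\<lambda>x. ?a (weak_grad \<Omega> u x) \<bullet> i) \<in> H1_space \<Omega>) \<and>
    (AE x in ?M. weak_div \<Omega> (\<lambda>x. ?a (weak_grad \<Omega> u x)) x = - f x)"
    by (rule neumann_solution_regularity[OF domain lip a_zero A_mono[rule_format] a0_pos \<Lambda>0]) blast
  have stm: "space_time_measurable T \<Omega> \<phi>" "space_time_measurable T \<Omega> \<mu>"
    and \<phi>: "\<phi> \<in> Linf_H1 T \<Omega>" and \<mu>: "\<mu> \<in> L2_H1 T \<Omega>" and F': "(\<lambda>t x. deriv F (\<phi> t x)) \<in> L2_L2 T \<Omega>"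
    using solution by (simp_all add: weak_solution_def)
  have sm\<phi>: "strongly_measurable_on ?I (H1_space \<Omega>) (norm_H1 \<Omega>) \<phi>" using \<phi> by (simp add: Linf_bochner_def)
  obtain B where B: "AE t in leb ?I. norm_H1 \<Omega> (\<phi> t) \<le> B" using \<phi> by (auto simp: Linf_bochner_def)
  have ae: "AE t in leb ?I. \<phi> t \<in> H1_space \<Omega>" "AE t in leb ?I. \<mu> t \<in> H1_space \<Omega>"
      "AE t in leb ?I. (\<lambda>x. deriv F (\<phi> t x)) \<in> L2_space \<Omega>"
    using \<phi> \<mu> F' by (auto simp: Linf_bochner_def L2_bochner_def strongly_measurable_on_def)
  have "AE t in leb {0..T}. \<forall>\<eta>\<in>H1_space \<Omega>. (LINT x|?M. \<mu> t x * \<eta> x)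
      = (LINT x|?M. ?a (weak_grad \<Omega> (\<phi> t) x) \<bullet> weak_grad \<Omega> \<eta> x + deriv F (\<phi> t x) * \<eta> x)"
  proof -
    obtain dt where "AE t in leb {0..T}. \<forall>\<zeta>\<in>H1_space \<Omega>. \<forall>\<eta>\<in>H1_space \<Omega>.
          dt t \<zeta> = - (LINT x|?M. M (weak_grad \<Omega> (\<phi> t) x) (\<phi> t x) * (weak_grad \<Omega> (\<mu> t) x \<bullet> weak_grad \<Omega> \<zeta> x)) \<and>
          (LINT x|?M. \<mu> t x * \<eta> x)
            = (LINT x|?M. ?a (weak_grad \<Omega> (\<phi> t) x) \<bullet> weak_grad \<Omega> \<eta> x + deriv F (\<phi> t x) * \<eta> x)"
      using solution unfolding weak_solution_def by blast
    then show ?thesis by eventually_elim blast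
  qed
  then have weak: "AE t in leb ?I. \<forall>\<eta>\<in>H1_space \<Omega>. (LINT x|?M. \<mu> t x * \<eta> x)
      = (LINT x|?M. ?a (weak_grad \<Omega> (\<phi> t) x) \<bullet> weak_grad \<Omega> \<eta> x + deriv F (\<phi> t x) * \<eta> x)"
    by (simp only: AE_closed_interval_iff)
  \<comment> \<open>At almost every time the slice solves the Neumann problem with right-hand side \<open>f t\<close>.\<close>
  have sol: "AE t in leb ?I. \<phi> t \<in> H1_space \<Omega> \<and> neumann_solution ?a \<Omega> (\<phi> t) (weak_grad \<Omega> (\<phi> t)) (f t) \<and>
      (norm2 ?M (f t))\<^sup>2 \<le> 2 * ((norm_H1 \<Omega> (\<mu> t))\<^sup>2 + (norm_L2 \<Omega> (\<lambda>x. deriv F (\<phi> t x)))\<^sup>2)"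
    using ae weak
  proof eventually_elim
    case (elim t)
    have u: "L2_weak_gradient \<Omega> (\<phi> t) (weak_grad \<Omega> (\<phi> t))" by (rule H1_space_L2_weak_gradient[OF \<Omega>(1) elim(1)])
    then have G: "L2_fun ?M (weak_grad \<Omega> (\<phi> t))" by (simp add: L2_weak_gradient_def)
    have mu: "L2_fun ?M (\<mu> t)"
      using H1_space_L2_weak_gradient[OF \<Omega>(1) elim(2)] by (simp add: L2_weak_gradient_def)
    have F: "L2_fun ?M (\<lambda>x. deriv F (\<phi> t x))" using elim(3) by (simp add: L2_space_iff)
    have f: "L2_fun ?M (f t)" unfolding f_def by (rule L2_fun_diff[OF mu F])
    have aG: "L2_fun ?M (\<lambda>x. ?a (weak_grad \<Omega> (\<phi> t) x))"
    proof (rule L2_fun_mono[OF G])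
      have "?a \<in> borel_measurable borel"
        by (rule borel_measurable_continuous_onI[OF lipschitz_on_continuous_on[OF \<Lambda>]])
      then show "(\<lambda>x. ?a (weak_grad \<Omega> (\<phi> t) x)) \<in> borel_measurable ?M"
        by (rule measurable_compose[OF L2_fun_measurable[OF G]])
      show "AE x in ?M. norm (?a (weak_grad \<Omega> (\<phi> t) x)) \<le> \<Lambda> * norm (weak_grad \<Omega> (\<phi> t) x)"
        using lip[of _ 0] by (simp add: a_zero)
    qed
    have "neumann_solution ?a \<Omega> (\<phi> t) (weak_grad \<Omega> (\<phi> t)) (f t)"
      unfolding neumann_solution_def
    proof (intro conjI u f allI impI)
      fix \<eta> H assume \<eta>: "L2_weak_gradient \<Omega> \<eta> H"
      have \<eta>1: "\<eta> \<in> H1_space \<Omega>" and H: "AE x in ?M. weak_grad \<Omega> \<eta> x = H x"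
        using L2_weak_gradient_H1_space[OF \<Omega>(1) \<eta>] by auto
      have sq: "L2_fun ?M \<eta>" "L2_fun ?M (weak_grad \<Omega> \<eta>)" "L2_fun ?M H"
        using \<eta> H1_space_L2_weak_gradient[OF \<Omega>(1) \<eta>1] by (auto simp: L2_weak_gradient_def)
      have "(LINT x|?M. ?a (weak_grad \<Omega> (\<phi> t) x) \<bullet> H x) = (LINT x|?M. ?a (weak_grad \<Omega> (\<phi> t) x) \<bullet> weak_grad \<Omega> \<eta> x)"
      proof (rule integral_cong_AE)
        show "AE x in ?M. ?a (weak_grad \<Omega> (\<phi> t) x) \<bullet> H x = ?a (weak_grad \<Omega> (\<phi> t) x) \<bullet> weak_grad \<Omega> \<eta> x"
          using H by eventually_elim simp
      qed (intro borel_measurable_integrable integrable_inner_L2_fun aG sq)+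
      also have "\<dots> = (LINT x|?M. \<mu> t x * \<eta> x) - (LINT x|?M. deriv F (\<phi> t x) * \<eta> x)"
        unfolding bspec[OF elim(4) \<eta>1]
        by (subst Bochner_Integration.integral_add) (auto intro: integrable_inner_L2_fun integrable_mult_L2_fun aG sq F)
      also have "\<dots> = (LINT x|?M. f t x * \<eta> x)"
        unfolding f_def left_diff_distrib
        by (rule Bochner_Integration.integral_diff[symmetric]) (auto intro: integrable_mult_L2_fun mu sq F)
      finally show "(LINT x|?M. ?a (weak_grad \<Omega> (\<phi> t) x) \<bullet> H x) = (LINT x|?M. f t x * \<eta> x)" .
    qed
    moreover have "(norm2 ?M (f t))\<^sup>2 \<le> 2 * ((norm_H1 \<Omega> (\<mu> t))\<^sup>2 + (norm_L2 \<Omega> (\<lambda>x. deriv F (\<phi> t x)))\<^sup>2)"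
    proof -
      have "norm2 ?M (f t) \<le> norm2 ?M (\<mu> t) + norm2 ?M (\<lambda>x. deriv F (\<phi> t x))"
        using norm2_triangle_diff[OF mu L2_fun_zero F] by (simp add: f_def[abs_def])
      also have "\<dots> \<le> norm_H1 \<Omega> (\<mu> t) + norm_L2 \<Omega> (\<lambda>x. deriv F (\<phi> t x))"
        using norm2_le_norm_H1(2)[OF \<Omega>(1) elim(2)] by (simp add: norm_L2_eq)
      finally have "(norm2 ?M (f t))\<^sup>2 \<le> (norm_H1 \<Omega> (\<mu> t) + norm_L2 \<Omega> (\<lambda>x. deriv F (\<phi> t x)))\<^sup>2"
        by (intro power_mono) auto
      also have "\<dots> \<le> 2 * ((norm_H1 \<Omega> (\<mu> t))\<^sup>2 + (norm_L2 \<Omega> (\<lambda>x. deriv F (\<phi> t x)))\<^sup>2)"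
        using zero_le_power2[of "norm_H1 \<Omega> (\<mu> t) - norm_L2 \<Omega> (\<lambda>x. deriv F (\<phi> t x))"]
        by (simp add: power2_eq_square algebra_simps)
      finally show ?thesis .
    qed
    ultimately show ?case using elim(1) by blast
  qed
  have slices: "AE t in leb ?I. \<phi> t \<in> H2_space \<Omega> \<and>
      (\<forall>i\<in>Basis. (\<lambda>x. ?a (weak_grad \<Omega> (\<phi> t) x) \<bullet> i) \<in> H1_space \<Omega>) \<and>
      (AE x in ?M. weak_div \<Omega> (\<lambda>x. ?a (weak_grad \<Omega> (\<phi> t) x)) x = - f t x)"
    using sol by eventually_elim (use reg in blast)
  have H2: "AE t in leb ?I. \<phi> t \<in> H2_space \<Omega>" using slices by eventually_elim blast
  note smH2 = strongly_measurable_H2[OF \<Omega> I sm\<phi> H2]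
  have L2H2: "\<phi> \<in> L2_H2 T \<Omega>"
  proof -
    have "integrable (leb ?I) (\<lambda>t. (norm_H2 \<Omega> (\<phi> t))\<^sup>2)"
    proof (rule Bochner_Integration.integrable_bound[OF _ smH2(2)])
      have "integrable (leb ?I) (\<lambda>t. (norm_H1 \<Omega> (\<mu> t))\<^sup>2)"
          "integrable (leb ?I) (\<lambda>t. (norm_L2 \<Omega> (\<lambda>x. deriv F (\<phi> t x)))\<^sup>2)"
        using \<mu> F' by (auto simp: L2_bochner_def)
      moreover have "integrable (leb ?I) (\<lambda>t. B\<^sup>2)"
        by (intro finite_measure.integrable_const finite_measure_lebesgue_on) simp
      ultimately show "integrable (leb ?I) (\<lambda>t. C * (2 * ((norm_H1 \<Omega> (\<mu> t))\<^sup>2 + (norm_L2 \<Omega> (\<lambda>x. deriv F (\<phi> t x)))\<^sup>2) + B\<^sup>2))"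
        by simp
      show "AE t in leb ?I. norm ((norm_H2 \<Omega> (\<phi> t))\<^sup>2)
          \<le> norm (C * (2 * ((norm_H1 \<Omega> (\<mu> t))\<^sup>2 + (norm_L2 \<Omega> (\<lambda>x. deriv F (\<phi> t x)))\<^sup>2) + B\<^sup>2))"
        using sol B
      proof eventually_elim
        case (elim t)
        have "0 \<le> norm_H1 \<Omega> (\<phi> t)" by (simp add: norm_H1_def sum_nonneg)
        then have "(norm_H1 \<Omega> (\<phi> t))\<^sup>2 \<le> B\<^sup>2" using elim(2) by (intro power_mono)
        moreover have "(norm_H2 \<Omega> (\<phi> t))\<^sup>2 \<le> C * ((norm2 ?M (f t))\<^sup>2 + (norm_H1 \<Omega> (\<phi> t))\<^sup>2)"
          using reg elim(1) by blast
        moreover have "C * ((norm2 ?M (f t))\<^sup>2 + (norm_H1 \<Omega> (\<phi> t))\<^sup>2)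
            \<le> C * (2 * ((norm_H1 \<Omega> (\<mu> t))\<^sup>2 + (norm_L2 \<Omega> (\<lambda>x. deriv F (\<phi> t x)))\<^sup>2) + B\<^sup>2)"
          using elim(1) calculation(1) by (intro mult_left_mono C add_mono) auto
        ultimately have "(norm_H2 \<Omega> (\<phi> t))\<^sup>2 \<le> C * (2 * ((norm_H1 \<Omega> (\<mu> t))\<^sup>2 + (norm_L2 \<Omega> (\<lambda>x. deriv F (\<phi> t x)))\<^sup>2) + B\<^sup>2)"
          by linarith
        then show ?case by simp
      qed
    qed
    then show ?thesis using smH2(1) by (simp add: L2_bochner_def)
  qed
  have flux: "AE t in leb {0..T}. \<forall>i\<in>Basis. (\<lambda>x. ?a (weak_grad \<Omega> (\<phi> t) x) \<bullet> i) \<in> H1_space \<Omega>"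
    unfolding AE_closed_interval_iff using slices by eventually_elim blast
  have "continuous_on UNIV (deriv F) \<or> (\<exists>\<theta> \<theta>c. F = log_potential \<theta> \<theta>c \<and>
      (AE (t, x) in leb (space_time T \<Omega>). \<bar>\<phi> t x\<bar> < 1))"
    using potential solution by (auto simp: regular_potential_def weak_solution_def)
  then have F'm: "space_time_measurable T \<Omega> (\<lambda>t x. deriv F (\<phi> t x))"
    using deriv_potential_space_time_measurable[OF \<Omega>(1) stm(1)] by blast
  have "space_time_measurable T \<Omega> (\<lambda>t x. - f t x)"
    using borel_measurable_diff[OF F'm[unfolded space_time_measurable_def] stm(2)[unfolded space_time_measurable_def]]
    by (simp add: space_time_measurable_def f_def case_prod_beta')
  moreover have "AE t in leb ?I. AE x in ?M. - f t x = weak_div \<Omega> (\<lambda>x. ?a (weak_grad \<Omega> (\<phi> t) x)) x"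
    using slices
  proof eventually_elim
    case (elim t)
    from elim have "AE x in ?M. weak_div \<Omega> (\<lambda>x. ?a (weak_grad \<Omega> (\<phi> t) x)) x = - f t x" by blast
    then show ?case by eventually_elim simp
  qed
  ultimately have "space_time_representative T \<Omega> (\<lambda>t. weak_div \<Omega> (\<lambda>x. ?a (weak_grad \<Omega> (\<phi> t) x))) (\<lambda>t x. - f t x)"
    by (simp add: space_time_representative_def)
  moreover have "AE (t, x) in leb (space_time T \<Omega>). \<mu> t x = - (- f t x) + deriv F (\<phi> t x)"
    by (simp add: f_def)
  ultimately show ?thesis using L2H2 flux by blast
qed

end
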